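(* Let $R$ be a unital commutative ring, $a\in R$ and $n\ge 1$. There are $R$-module isomorphisms $$\mathrm{Tor}_i^{\mathrm{TL}_{2n}(R,a)}(R,R)\cong\begin{cases}R & i=0\\ 0 & 0<i<2n-1\\ H_{i-2n+1}(L(2n;R,a)) & 2n-1\le i.\end{cases}$$
   Context: Temperley--Lieb diagrams. For $m,k\ge 0$ with $m+k$ even, a Temperley--Lieb $(m,k)$-diagram consists of two vertical bars with $m$ nodes on the left bar and $k$ nodes on the right bar (numbered from bottom to top), together with $(m+k)/2$ pairwise disjoint arcs lying between the two bars and connecting the $m+k$ nodes in pairs, up to isotopy relative to end points. $\mathrm{TL}(m,k)$ is the free $R$-module on these diagrams ($0$ if $m+k$ is odd); $\mathrm{TL}(0,0)=R\{\emptyset\}$ with $\emptyset$ the empty diagram. Composition $\mathrm{TL}(l,m)\otimes_R\mathrm{TL}(m,k)\to\mathrm{TL}(l,k)$ is $D\otimes D'\mapsto D\cdot D'=a^j[D\circ D']$, where $[D\circ D']$ is obtained by gluing the right bar of $D$ to the left bar of $D'$, joining arcs, and discarding the $j$ closed loops so created. The Temperley--Lieb algebra is $\mathrm{TL}_k=\mathrm{TL}_k(R,a)=\mathrm{TL}(k,k)$. The trivial (left or right) $\mathrm{TL}_{k}$-module $R$ is the $R$-module $R$ on which the identity diagram acts as $1$ and every other diagram acts as $0$; both copies of $R$ in $\mathrm{Tor}$ are trivial modules. The dga of planar loops $L(2n)=L(2n;R,a)$. $L(2n)_0=\mathrm{TL}(0,0)=R\{\emptyset\}$ and, for $q\ge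 1$, $L(2n)_q=\mathrm{TL}(0,2n)\otimes_R\mathrm{TL}_{2n}^{\otimes (q-1)}\otimes_R\mathrm{TL}(2n,0)$, with elements written $(D_0|\cdots|D_q)$; the differential is $d(D_0|\cdots|D_q)=\sum_{i=0}^{q-1}(-1)^i(D_0|\cdots|D_iD_{i+1}|\cdots|D_q)$; the product is $(D_0|\cdots|D_p)\cdot(E_0|\cdots|E_q)=(D_0|\cdots|D_pE_0|\cdots|E_q)$ for $p,q\ge 1$, with unit $\emptyset$. *)

theory Defs
  imports "HOL-Algebra.Module" "HOL-Algebra.AbelCoset" "HOL-Library.Disjoint_Sets"
begin

section \<open>Modules over a ring that need not be commutative\<close>

text \<open>The locale \<^locale>\<open>module\<close> of HOL-Algebra requires a commutative ring of scalars.  Its record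
  type is reused here; the fields \<^const>\<open>mult\<close> and \<^const>\<open>one\<close> of a module carry no meaning.\<close>

locale left_module = A?: ring A + M?: abelian_group M 
  for A :: "('a, 'k) ring_scheme" (structure) and M :: "('a, 'b) module" (structure) +
  assumes smult_closed:
      "\<lbrakk>a \<in> carrier A; x \<in> carrier M\<rbrakk> \<Longrightarrow> a \<odot>\<^bsub>M\<^esub> x \<in> carrier M"
    and smult_l_distr:
      "\<lbrakk>a \<in> carrier A; b \<in> carrier A; x \<in> carrier M\<rbrakk> \<Longrightarrow>
        (a \<oplus>\<^bsub>A\<^esub> b) \<odot>\<^bsub>M\<^esub> x = a \<odot>\<^bsub>M\<^esub> x \<oplus>\<^bsub>M\<^esub> b \<odot>\<^bsub>M\<^esub> x"
    and smult_r_distr: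
      "\<lbrakk>a \<in> carrier A; x \<in> carrier M; y \<in> carrier M\<rbrakk> \<Longrightarrow>
        a \<odot>\<^bsub>M\<^esub> (x \<oplus>\<^bsub>M\<^esub> y) = a \<odot>\<^bsub>M\<^esub> x \<oplus>\<^bsub>M\<^esub> a \<odot>\<^bsub>M\<^esub> y"
    and smult_assoc:
      "\<lbrakk>a \<in> carrier A; b \<in> carrier A; x \<in> carrier M\<rbrakk> \<Longrightarrow>
        (a \<otimes>\<^bsub>A\<^esub> b) \<odot>\<^bsub>M\<^esub> x = a \<odot>\<^bsub>M\<^esub> (b \<odot>\<^bsub>M\<^esub> x)"
    and smult_one:
      "x \<in> carrier M \<Longrightarrow> \<one>\<^bsub>A\<^esub> \<odot>\<^bsub>M\<^esub> x = x"

text \<open>A right \<open>A\<close>-module is a left module over the opposite ring: for a right module \<open>P\<close>,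
  \<open>a \<odot>\<^bsub>P\<^esub> p\<close> stands for \<open>p \<cdot> a\<close>.\<close>

definition opposite :: "('a, 'm) ring_scheme \<Rightarrow> ('a, 'm) ring_scheme" where
  "opposite A = A\<lparr>mult := (\<lambda>x y. y \<otimes>\<^bsub>A\<^esub> x)\<rparr>"

definition module_hom ::
    "('a, 'k) ring_scheme \<Rightarrow> ('a, 'b) module \<Rightarrow> ('a, 'c) module \<Rightarrow> ('b \<Rightarrow> 'c) set" where
  "module_hom A M N = {h. h \<in> carrier M \<rightarrow> carrier N \<and>
     (\<forall>x\<in>carrier M. \<forall>y\<in>carrier M. h (x \<oplus>\<^bsub>M\<^esub> y) = h x \<oplus>\<^bsub>N\<^esub> h y) \<and>
     (\<forall>a\<in>carrier A. \<forall>x\<in>carrier M. h (a \<odot>\<^bsub>M\<^esub> x) = a \<odot>\<^bsub>N\<^esub> h x)}"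

definition module_isomorphic ::
    "('a, 'k) ring_scheme \<Rightarrow> ('a, 'b) module \<Rightarrow> ('a, 'c) module \<Rightarrow> bool" where
  "module_isomorphic A M N \<longleftrightarrow> (\<exists>h\<in>module_hom A M N. bij_betw h (carrier M) (carrier N))"

definition regular_module :: "('a, 'k) ring_scheme \<Rightarrow> ('a, 'a) module" where
  "regular_module A = \<lparr>carrier = carrier A, mult = mult A, one = \<one>\<^bsub>A\<^esub>, zero = \<zero>\<^bsub>A\<^esub>,
     add = add A, smult = mult A\<rparr>"

text \<open>The free left module with basis \<open>S\<close>: finitely supported functions on \<open>S\<close>, extended by zero.\<close>

definition free_module :: "('a, 'k) ring_scheme \<Rightarrow> 's set \<Rightarrow> ('a, 's \<Rightarrow> 'a) module" where
  "free_module A S =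
     \<lparr>carrier = {f. range f \<subseteq> carrier A \<and> finite {x. f x \<noteq> \<zero>\<^bsub>A\<^esub>} \<and> {x. f x \<noteq> \<zero>\<^bsub>A\<^esub>} \<subseteq> S},
      mult = undefined, one = undefined,
      zero = (\<lambda>_. \<zero>\<^bsub>A\<^esub>),
      add = (\<lambda>f g x. f x \<oplus>\<^bsub>A\<^esub> g x),
      smult = (\<lambda>a f x. a \<otimes>\<^bsub>A\<^esub> f x)\<rparr>"

definition basis_elt :: "('a, 'k) ring_scheme \<Rightarrow> 's \<Rightarrow> 's \<Rightarrow> 'a" where
  "basis_elt A s = (\<lambda>x. if x = s then \<one>\<^bsub>A\<^esub> else \<zero>\<^bsub>A\<^esub>)"

definition linear_extension ::
    "('a, 'k) ring_scheme \<Rightarrow> ('a, 'b) module \<Rightarrow> ('s \<Rightarrow> 'b) \<Rightarrow> ('s \<Rightarrow> 'a) \<Rightarrow> 'b" where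
  "linear_extension A M \<phi> f = (\<Oplus>\<^bsub>M\<^esub>x\<in>{x. f x \<noteq> \<zero>\<^bsub>A\<^esub>}. f x \<odot>\<^bsub>M\<^esub> \<phi> x)"

definition submodule_generated ::
    "('a, 'k) ring_scheme \<Rightarrow> ('a, 'b) module \<Rightarrow> 'b set \<Rightarrow> 'b set" where
  "submodule_generated A M X = \<Inter>{H. submodule H A M \<and> X \<subseteq> H}"

definition quotient_module :: "('a, 'b) module \<Rightarrow> 'b set \<Rightarrow> ('a, 'b set) module" where
  "quotient_module M H =
     \<lparr>carrier = a_rcosets\<^bsub>M\<^esub> H, mult = undefined, one = undefined,
      zero = H, add = set_add M,
      smult = (\<lambda>a C. \<Union>x\<in>C. H +>\<^bsub>M\<^esub> (a \<odot>\<^bsub>M\<^esub> x))\<rparr>"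


section \<open>Homology of a nonnegatively graded chain complex\<close>

text \<open>Here \<open>d q\<close> is the differential from degree \<open>q + 1\<close> to degree \<open>q\<close>; the complex is zero in
  negative degrees.\<close>

fun cycles :: "(nat \<Rightarrow> ('a, 'b) module) \<Rightarrow> (nat \<Rightarrow> 'b \<Rightarrow> 'b) \<Rightarrow> nat \<Rightarrow> 'b set" where
  "cycles C d 0 = carrier (C 0)"
| "cycles C d (Suc q) = {x \<in> carrier (C (Suc q)). d q x = \<zero>\<^bsub>C q\<^esub>}"

definition boundaries :: "(nat \<Rightarrow> ('a, 'b) module) \<Rightarrow> (nat \<Rightarrow> 'b \<Rightarrow> 'b) \<Rightarrow> nat \<Rightarrow> 'b set" where
  "boundaries C d q = d q ` carrier (C (Suc q))"

definition homology ::
    "(nat \<Rightarrow> ('a, 'b) module) \<Rightarrow> (nat \<Rightarrow> 'b \<Rightarrow> 'b) \<Rightarrow> nat \<Rightarrow> ('a, 'b set) module" where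
  "homology C d q = quotient_module ((C q)\<lparr>carrier := cycles C d q\<rparr>) (boundaries C d q)"


section \<open>Projective resolutions and Tor\<close>

text \<open>A module is projective if it is a direct summand (a retract) of a free module.  The basis
  may be taken in the type of the elements of the module, since every projective module \<open>P\<close> is a
  summand of the free module on its own underlying set.\<close>

definition projective_module :: "('a, 'k) ring_scheme \<Rightarrow> ('a, 'p) module \<Rightarrow> bool" where
  "projective_module A P \<longleftrightarrow> left_module A P \<and>
     (\<exists>(S :: 'p set) s r. s \<in> module_hom A P (free_module A S) \<and>
        r \<in> module_hom A (free_module A S) P \<and> (\<forall>p\<in>carrier P. r (s p) = p))"

text \<open>Exactness of \<open>\<dots> \<rightarrow> P 2 \<rightarrow> P 1 \<rightarrow> P 0 \<rightarrow> M \<rightarrow> 0\<close>, with \<open>d i : P (i + 1) \<rightarrow> P i\<close> and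
  augmentation \<open>e : P 0 \<rightarrow> M\<close>.\<close>

definition projective_resolution ::
    "('a, 'k) ring_scheme \<Rightarrow> ('a, 'b) module \<Rightarrow> (nat \<Rightarrow> ('a, 'p) module) \<Rightarrow>
     (nat \<Rightarrow> 'p \<Rightarrow> 'p) \<Rightarrow> ('p \<Rightarrow> 'b) \<Rightarrow> bool" where
  "projective_resolution A M P d e \<longleftrightarrow>
     (\<forall>i. projective_module A (P i)) \<and>
     (\<forall>i. d i \<in> module_hom A (P (Suc i)) (P i)) \<and>
     e \<in> module_hom A (P 0) M \<and>
     e ` carrier (P 0) = carrier M \<and>
     d 0 ` carrier (P 1) = {x \<in> carrier (P 0). e x = \<zero>\<^bsub>M\<^esub>} \<and>
     (\<forall>i. d (Suc i) ` carrier (P (Suc (Suc i))) = {x \<in> carrier (P (Suc i)). d i x = \<zero>\<^bsub>P i\<^esub>})"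

text \<open>The tensor product \<open>P \<otimes>\<^bsub>A\<^esub> N\<close> of a right module \<open>P\<close> and a left module \<open>N\<close> over an
  \<open>R\<close>-algebra \<open>A\<close>, as an \<open>R\<close>-module.  The algebra \<open>A\<close> is a record of type \<^type>\<open>module\<close>, and its
  structure map \<open>R \<rightarrow> A\<close> sends \<open>r\<close> to \<open>r \<odot>\<^bsub>A\<^esub> \<one>\<^bsub>A\<^esub>\<close>; \<open>R\<close> acts through it on \<open>P\<close>.\<close>

definition tensor_relations ::
    "('r, 'k) ring_scheme \<Rightarrow> ('r, 'a) module \<Rightarrow> ('a, 'p) module \<Rightarrow> ('a, 'b) module \<Rightarrow>
     ('p \<times> 'b \<Rightarrow> 'r) set" where
  "tensor_relations R A P N =
    (let F = free_module R (carrier P \<times> carrier N); t = (\<lambda>p x. basis_elt R (p, x)) in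
       submodule_generated R F
       ({t (p \<oplus>\<^bsub>P\<^esub> p') x \<ominus>\<^bsub>F\<^esub> (t p x \<oplus>\<^bsub>F\<^esub> t p' x) | p p' x.
            p \<in> carrier P \<and> p' \<in> carrier P \<and> x \<in> carrier N} \<union>
        {t p (x \<oplus>\<^bsub>N\<^esub> x') \<ominus>\<^bsub>F\<^esub> (t p x \<oplus>\<^bsub>F\<^esub> t p x') | p x x'.
            p \<in> carrier P \<and> x \<in> carrier N \<and> x' \<in> carrier N} \<union>
        {t (a \<odot>\<^bsub>P\<^esub> p) x \<ominus>\<^bsub>F\<^esub> t p (a \<odot>\<^bsub>N\<^esub> x) | a p x.
            a \<in> carrier A \<and> p \<in> carrier P \<and> x \<in> carrier N} \<union>
        {t ((r \<odot>\<^bsub>A\<^esub> \<one>\<^bsub>A\<^esub>) \<odot>\<^bsub>P\<^esub> p) x \<ominus>\<^bsub>F\<^esub> (r \<odot>\<^bsub>F\<^esub> t p x) | r p x.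
            r \<in> carrier R \<and> p \<in> carrier P \<and> x \<in> carrier N}))"

definition tensor_module ::
    "('r, 'k) ring_scheme \<Rightarrow> ('r, 'a) module \<Rightarrow> ('a, 'p) module \<Rightarrow> ('a, 'b) module \<Rightarrow>
     ('r, ('p \<times> 'b \<Rightarrow> 'r) set) module" where
  "tensor_module R A P N =
     quotient_module (free_module R (carrier P \<times> carrier N)) (tensor_relations R A P N)"

text \<open>The map \<open>g \<otimes> id : P \<otimes>\<^bsub>A\<^esub> N \<rightarrow> P' \<otimes>\<^bsub>A\<^esub> N\<close> induced by \<open>g : P \<rightarrow> P'\<close>.  The union over the
  representatives of a class \<open>C\<close> is a single class whenever \<open>g\<close> is \<open>A\<close>-linear.\<close>

definition tensor_map ::
    "('r, 'k) ring_scheme \<Rightarrow> ('r, 'a) module \<Rightarrow> ('a, 'p) module \<Rightarrow> ('a, 'b) module \<Rightarrow>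
     ('p \<Rightarrow> 'p) \<Rightarrow> ('p \<times> 'b \<Rightarrow> 'r) set \<Rightarrow> ('p \<times> 'b \<Rightarrow> 'r) set" where
  "tensor_map R A P' N g C =
    (let F' = free_module R (carrier P' \<times> carrier N) in
       \<Union>u\<in>C. tensor_relations R A P' N +>\<^bsub>F'\<^esub>
         linear_extension R F' (\<lambda>(p, x). basis_elt R (g p, x)) u)"

text \<open>\<open>Tor\<^sub>i\<^sup>A(M, N)\<close> computed from a projective resolution \<open>(P, d)\<close> of the right module \<open>M\<close>, that is,
  the homology of \<open>P \<otimes>\<^bsub>A\<^esub> N\<close> as an \<open>R\<close>-module.
  The module \<open>M\<close> enters only through \<open>(P, d)\<close>, cf. \<^const>\<open>projective_resolution\<close>
  (over \<open>opposite A\<close>).\<close>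

definition Tor ::
    "('r, 'k) ring_scheme \<Rightarrow> ('r, 'a) module \<Rightarrow> (nat \<Rightarrow> ('a, 'p) module) \<Rightarrow> (nat \<Rightarrow> 'p \<Rightarrow> 'p) \<Rightarrow>
     ('a, 'b) module \<Rightarrow> nat \<Rightarrow> ('r, ('p \<times> 'b \<Rightarrow> 'r) set set) module" where
  "Tor R A P d N =
     homology (\<lambda>i. tensor_module R A (P i) N) (\<lambda>i. tensor_map R A (P i) N (d i))"


section \<open>Temperley--Lieb diagrams\<close>

text \<open>\<open>Inl i\<close> and \<open>Inr j\<close> are the nodes of the left and of the right bar, numbered from bottom to
  top starting at 0.  A system of disjoint arcs between the bars is determined up to isotopy by the
  pairs of nodes it connects, and a perfect matching of the nodes arises in this way iff it is
  noncrossing for the cyclic order of the nodes on the boundary of the region between the bars: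
  up the left bar, then down the right bar.\<close>

type_synonym diagram = "(nat + nat) set set"

definition nodes :: "nat \<Rightarrow> nat \<Rightarrow> (nat + nat) set" where
  "nodes m k = Inl ` {..<m} \<union> Inr ` {..<k}"

fun position :: "nat \<Rightarrow> nat \<Rightarrow> nat + nat \<Rightarrow> nat" where
  "position m k (Inl i) = i"
| "position m k (Inr j) = m + (k - Suc j)"

definition diagrams :: "nat \<Rightarrow> nat \<Rightarrow> diagram set" where
  "diagrams m k = {D. partition_on (nodes m k) D \<and> (\<forall>c\<in>D. card c = 2) \<and>
     \<not> (\<exists>x y z w. {x, y} \<in> D \<and> {z, w} \<in> D \<and>
          position m k x < position m k z \<and> position m k z < position m k y \<and>
          position m k y < position m k w)}"

definition identity_diagram :: "nat \<Rightarrow> diagram" where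
  "identity_diagram k = {{Inl i, Inr i} | i. i < k}"

text \<open>Gluing \<open>D\<close> to \<open>D'\<close>: the right bar of \<open>D\<close> and the left bar of \<open>D'\<close> become the middle column.\<close>

datatype glued_node = GLeft nat | GMid nat | GRight nat

definition glued_arcs :: "diagram \<Rightarrow> diagram \<Rightarrow> glued_node set set" where
  "glued_arcs D D' = (\<lambda>c. case_sum GLeft GMid ` c) ` D \<union> (\<lambda>c. case_sum GMid GRight ` c) ` D'"

definition connected_glued :: "diagram \<Rightarrow> diagram \<Rightarrow> (glued_node \<times> glued_node) set" where
  "connected_glued D D' = {(x, y). {x, y} \<in> glued_arcs D D'}\<^sup>*"

definition outer_node :: "nat + nat \<Rightarrow> glued_node" where
  "outer_node = case_sum GLeft GRight"

definition compose_diagrams :: "diagram \<Rightarrow> diagram \<Rightarrow> diagram" where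
  "compose_diagrams D D' =
     {{x, y} | x y. x \<noteq> y \<and> (outer_node x, outer_node y) \<in> connected_glued D D'}"

text \<open>The closed loops are the connected components of the glued picture that contain middle nodes
  only.\<close>

definition closed_loops :: "diagram \<Rightarrow> diagram \<Rightarrow> nat" where
  "closed_loops D D' =
     card {C. (\<exists>x\<in>\<Union>(glued_arcs D D'). C = connected_glued D D' `` {x}) \<and> C \<subseteq> range GMid}"

text \<open>The product \<open>D \<cdot> D' = a\<^sup>j [D \<circ> D']\<close>, extended bilinearly to \<open>TL(l, m) \<times> TL(m, k) \<rightarrow> TL(l, k)\<close>.\<close>

definition TL_module :: "('r, 'x) ring_scheme \<Rightarrow> nat \<Rightarrow> nat \<Rightarrow> ('r, diagram \<Rightarrow> 'r) module" where
  "TL_module R m k = free_module R (diagrams m k)"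

definition TL_compose ::
    "('r, 'x) ring_scheme \<Rightarrow> 'r \<Rightarrow> nat \<Rightarrow> nat \<Rightarrow> (diagram \<Rightarrow> 'r) \<Rightarrow> (diagram \<Rightarrow> 'r) \<Rightarrow> (diagram \<Rightarrow> 'r)" where
  "TL_compose R a l k f g =
     linear_extension R (TL_module R l k) (\<lambda>D.
       linear_extension R (TL_module R l k) (\<lambda>D'.
         (a [^]\<^bsub>R\<^esub> closed_loops D D') \<odot>\<^bsub>TL_module R l k\<^esub> basis_elt R (compose_diagrams D D')) g) f"

definition TL_algebra :: "('r, 'x) ring_scheme \<Rightarrow> 'r \<Rightarrow> nat \<Rightarrow> ('r, diagram \<Rightarrow> 'r) module" where
  "TL_algebra R a k = (TL_module R k k)
     \<lparr>mult := TL_compose R a k k, one := basis_elt R (identity_diagram k)\<rparr>"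

text \<open>The trivial module: an element of the algebra acts as its coefficient at the identity diagram.
  The same record is the trivial right module, i.e. a left module over the opposite algebra.\<close>

definition trivial_module :: "('r, 'x) ring_scheme \<Rightarrow> nat \<Rightarrow> (diagram \<Rightarrow> 'r, 'r) module" where
  "trivial_module R k = \<lparr>carrier = carrier R, mult = mult R, one = \<one>\<^bsub>R\<^esub>, zero = \<zero>\<^bsub>R\<^esub>,
     add = add R, smult = (\<lambda>f r. f (identity_diagram k) \<otimes>\<^bsub>R\<^esub> r)\<rparr>"


section \<open>The complex of planar loops\<close>

text \<open>\<open>L(m)\<^sub>q\<close> is a tensor product over \<open>R\<close> of free modules with bases of diagrams, hence the free
  module on the tuples \<open>(D\<^sub>0|\<dots>|D\<^sub>q)\<close>.  The bars between consecutive entries have \<open>m\<close> nodes and the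
  two outermost bars have none; for \<open>q = 0\<close> this gives \<open>TL(0, 0)\<close>.\<close>

definition loop_tuples :: "nat \<Rightarrow> nat \<Rightarrow> diagram list set" where
  "loop_tuples m q = {Ds. length Ds = Suc q \<and>
     (\<forall>i\<le>q. Ds ! i \<in> diagrams (if i = 0 then 0 else m) (if i = q then 0 else m))}"

definition planar_loops ::
    "('r, 'x) ring_scheme \<Rightarrow> nat \<Rightarrow> nat \<Rightarrow> ('r, diagram list \<Rightarrow> 'r) module" where
  "planar_loops R m q = free_module R (loop_tuples m q)"

text \<open>The differential from degree \<open>q + 1\<close> to degree \<open>q\<close>.\<close>

definition planar_loops_diff ::
    "('r, 'x) ring_scheme \<Rightarrow> 'r \<Rightarrow> nat \<Rightarrow> nat \<Rightarrow> (diagram list \<Rightarrow> 'r) \<Rightarrow> (diagram list \<Rightarrow> 'r)" where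
  "planar_loops_diff R a m q = linear_extension R (planar_loops R m q) (\<lambda>Ds.
     \<Oplus>\<^bsub>planar_loops R m q\<^esub>i\<in>{..q}.
       ((\<ominus>\<^bsub>R\<^esub> \<one>\<^bsub>R\<^esub>) [^]\<^bsub>R\<^esub> i \<otimes>\<^bsub>R\<^esub> a [^]\<^bsub>R\<^esub> closed_loops (Ds ! i) (Ds ! Suc i)) \<odot>\<^bsub>planar_loops R m q\<^esub>
       basis_elt R (take i Ds @ [compose_diagrams (Ds ! i) (Ds ! Suc i)] @ drop (i + 2) Ds))"

definition planar_loops_homology ::
    "('r, 'x) ring_scheme \<Rightarrow> 'r \<Rightarrow> nat \<Rightarrow> nat \<Rightarrow> ('r, (diagram list \<Rightarrow> 'r) set) module" where
  "planar_loops_homology R a m =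
     homology (planar_loops R m) (planar_loops_diff R a m)"

end

theory Submission
  imports Defs
begin

section \<open>Linear maps\<close>

lemma module_ab: "module R V ==> abelian_group V"
 by (rule module.axioms)

lemma module_homD:
 assumes "h \<in> module_hom R V W"
 shows module_hom_closed: "x \<in> carrier V ==> h x \<in> carrier W"
  and module_hom_add: "x \<in> carrier V ==> y \<in> carrier V ==> h (x \<oplus>\<^bsub>V\<^esub> y) = h x \<oplus>\<^bsub>W\<^esub> h y"
  and module_hom_smult: "r \<in> carrier R ==> x \<in> carrier V ==> h (r \<odot>\<^bsub>V\<^esub> x) = r \<odot>\<^bsub>W\<^esub> h x"
 using assms by (auto simp: module_hom_def)

lemma module_homI:
 assumes "!!x. x \<in> carrier V ==> h x \<in> carrier W"
  and "!!x y. x \<in> carrier V ==> y \<in> carrier V ==> h (x \<oplus>\<^bsub>V\<^esub> y) = h x \<oplus>\<^bsub>W\<^esub> h y"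
  and "!!r x. r \<in> carrier R ==> x \<in> carrier V ==> h (r \<odot>\<^bsub>V\<^esub> x) = r \<odot>\<^bsub>W\<^esub> h x"
 shows "h \<in> module_hom R V W"
 using assms by (auto simp: module_hom_def)

lemma module_hom_comp:
 "h \<in> module_hom R X Y ==> k \<in> module_hom R Y Z ==> (%x. k (h x)) \<in> module_hom R X Z"
 by (auto simp: module_hom_def Pi_def)

context
 fixes K :: "('a, 'k) ring_scheme" and V :: "('a, 'v) module" and W :: "('a, 'w) module" and h
 assumes V: "abelian_group V" and W: "abelian_group W" and h: "h \<in> module_hom K V W"
begin

interpretation V: abelian_group V by (rule V)
interpretation W: abelian_group W by (rule W)

lemma module_hom_zero: "h \<zero>\<^bsub>V\<^esub> = \<zero>\<^bsub>W\<^esub>"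
proof -
 have "h \<zero>\<^bsub>V\<^esub> \<oplus>\<^bsub>W\<^esub> h \<zero>\<^bsub>V\<^esub> = h \<zero>\<^bsub>V\<^esub>"
  using module_hom_add[OF h, of "\<zero>\<^bsub>V\<^esub>" "\<zero>\<^bsub>V\<^esub>"] by simp
 then show ?thesis
  using module_hom_closed[OF h V.zero_closed] W.add.r_cancel_one by blast
qed

lemma module_hom_inv: "x \<in> carrier V ==> h (\<ominus>\<^bsub>V\<^esub> x) = \<ominus>\<^bsub>W\<^esub> h x"
proof -
 assume x: "x \<in> carrier V"
 have "h (\<ominus>\<^bsub>V\<^esub> x) \<oplus>\<^bsub>W\<^esub> h x = \<zero>\<^bsub>W\<^esub>"
  using module_hom_add[OF h, of "\<ominus>\<^bsub>V\<^esub> x" x] x module_hom_zero by (simp add: V.l_neg)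
 then show ?thesis
  using W.minus_equality module_hom_closed[OF h] x by (metis V.a_inv_closed)
qed

lemma module_hom_diff:
 "x \<in> carrier V ==> y \<in> carrier V ==> h (x \<ominus>\<^bsub>V\<^esub> y) = h x \<ominus>\<^bsub>W\<^esub> h y"
 by (simp add: a_minus_def module_hom_add[OF h] module_hom_inv)

lemma module_hom_finsum:
 "finite A ==> (!!i. i \<in> A ==> F i \<in> carrier V) ==>
  h (finsum V F A) = finsum W (%i. h (F i)) A"
proof (induction A rule: finite_induct)
 case empty
 then show ?case by (simp add: module_hom_zero)
next
 case (insert a A)
 then have "finsum V F (insert a A) = F a \<oplus>\<^bsub>V\<^esub> finsum V F A"
  by (intro V.finsum_insert) auto
 moreover have "finsum W (%i. h (F i)) (insert a A) = h (F a) \<oplus>\<^bsub>W\<^esub> finsum W (%i. h (F i)) A"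
  using insert by (intro W.finsum_insert) (auto intro: module_hom_closed[OF h])
 moreover have "finsum V F A \<in> carrier V"
  using insert by (intro V.finsum_closed) auto
 ultimately show ?case
  using insert by (simp add: module_hom_add[OF h])
qed

end

lemma (in abelian_monoid) finsum_swap:
 assumes "finite A" "finite B" "!!i j. i \<in> A ==> j \<in> B ==> F i j \<in> carrier G"
 shows "(\<Oplus>i\<in>A. \<Oplus>j\<in>B. F i j) = (\<Oplus>j\<in>B. \<Oplus>i\<in>A. F i j)"
 using assms(1,3)
proof (induction A rule: finite_induct)
 case empty
 then show ?case by (simp add: add.finprod_one)
next
 case (insert a A)
 have "(\<Oplus>i\<in>insert a A. \<Oplus>j\<in>B. F i j) = (\<Oplus>j\<in>B. F a j) \<oplus> (\<Oplus>i\<in>A. \<Oplus>j\<in>B. F i j)"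
  using insert by (intro finsum_insert) (auto intro!: finsum_closed)
 also have "... = (\<Oplus>j\<in>B. F a j) \<oplus> (\<Oplus>j\<in>B. \<Oplus>i\<in>A. F i j)"
  using insert by simp
 also have "... = (\<Oplus>j\<in>B. F a j \<oplus> (\<Oplus>i\<in>A. F i j))"
  using insert by (intro finsum_addf[symmetric]) (auto intro!: finsum_closed)
 also have "... = (\<Oplus>j\<in>B. \<Oplus>i\<in>insert a A. F i j)"
  using insert by (intro finsum_cong' finsum_insert[symmetric]) (auto intro!: finsum_closed)
 finally show ?case .
qed

lemma (in abelian_monoid) finsum_zero': "(!!i. i \<in> A ==> F i = \<zero>) ==> finsum G F A = \<zero>"
 by (rule add.finprod_one_eqI)

lemma (in abelian_monoid) finsum_single:
 assumes "finite A" "a \<in> A" "F a \<in> carrier G" "!!i. i \<in> A ==> i ~= a ==> F i = \<zero>"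
 shows "finsum G F A = F a"
proof -
 have "finsum G F A = (\<Oplus>i\<in>A. if a = i then F i else \<zero>)"
  using assms by (intro finsum_cong') auto
 also have "... = F a"
  using assms by (intro finsum_singleton) (auto simp: Pi_def, metis zero_closed)
 finally show ?thesis .
qed

lemma (in abelian_monoid) finsum_mono_neutral:
 assumes "finite B" "A \<subseteq> B" "!!i. i \<in> A ==> F i \<in> carrier G" "!!i. i \<in> B - A ==> F i = \<zero>"
 shows "finsum G F A = finsum G F B"
 using assms by (intro add.finprod_mono_neutral_cong_left) (auto simp: Pi_def, metis DiffI zero_closed)

section \<open>Modules of functions\<close>

definition funs :: "('a, 'b) module => ('a, 's => 'b) module" where
 "funs V = \<lparr>carrier = {f. \<forall>s. f s \<in> carrier V}, mult = undefined, one = undefined,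
   zero = (%_. \<zero>\<^bsub>V\<^esub>), add = (%f g s. f s \<oplus>\<^bsub>V\<^esub> g s), smult = (%r f s. r \<odot>\<^bsub>V\<^esub> f s)\<rparr>"

lemma funs_simps [simp]:
 "f \<in> carrier (funs V) \<longleftrightarrow> (\<forall>s. f s \<in> carrier V)"
 "\<zero>\<^bsub>funs V\<^esub> = (%_. \<zero>\<^bsub>V\<^esub>)"
 "f \<oplus>\<^bsub>funs V\<^esub> g = (%s. f s \<oplus>\<^bsub>V\<^esub> g s)"
 "r \<odot>\<^bsub>funs V\<^esub> f = (%s. r \<odot>\<^bsub>V\<^esub> f s)"
 by (simp_all add: funs_def)

lemma funs_is_module:
 assumes "module R V"
 shows "module R (funs V :: ('a, 's => 'b) module)"
proof -
 interpret module R V by fact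
 show ?thesis
 proof (intro moduleI abelian_groupI)
  fix f :: "'s => 'b"
  assume "f \<in> carrier (funs V)"
  then show "\<exists>g\<in>carrier (funs V). g \<oplus>\<^bsub>funs V\<^esub> f = \<zero>\<^bsub>funs V\<^esub>"
   by (intro bexI[of _ "%s. \<ominus>\<^bsub>V\<^esub> f s"]) (auto simp: M.l_neg)
 qed (auto simp: is_cring M.a_ac smult_l_distr smult_r_distr smult_assoc1)
qed

lemma eval_module_hom: "(%f. f s) \<in> module_hom R (funs V) V"
 by (auto simp: module_hom_def)

lemma funs_inv:
 assumes "module R V" "!!s. f s \<in> carrier V"
 shows "(\<ominus>\<^bsub>funs V\<^esub> f) s = \<ominus>\<^bsub>V\<^esub> f s"
 using module_hom_inv[OF module_ab module_ab eval_module_hom,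
   OF funs_is_module[OF assms(1)] assms(1), of f] assms(2) by simp

lemma funs_diff:
 assumes "module R V" "!!s. f s \<in> carrier V" "!!s. g s \<in> carrier V"
 shows "(f \<ominus>\<^bsub>funs V\<^esub> g) s = f s \<ominus>\<^bsub>V\<^esub> g s"
 using assms by (simp add: a_minus_def funs_inv)

lemma funs_finsum:
 assumes "module R V" "finite A" "!!i s. i \<in> A ==> F i s \<in> carrier V"
 shows "finsum (funs V) F A s = finsum V (%i. F i s) A"
 using module_hom_finsum[OF module_ab module_ab eval_module_hom,
   OF funs_is_module[OF assms(1)] assms(1), of A F] assms(2,3) by simp

lemma postcompose_module_hom:
 "h \<in> module_hom R V W ==> (%f s. h (f s)) \<in> module_hom R (funs V) (funs W)"
 by (auto simp: module_hom_def Pi_def)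

lemma regular_module_simps [simp]:
 "carrier (regular_module K) = carrier K" "\<zero>\<^bsub>regular_module K\<^esub> = \<zero>\<^bsub>K\<^esub>"
 "x \<oplus>\<^bsub>regular_module K\<^esub> y = x \<oplus>\<^bsub>K\<^esub> y" "r \<odot>\<^bsub>regular_module K\<^esub> x = r \<otimes>\<^bsub>K\<^esub> x"
 by (simp_all add: regular_module_def)

lemma regular_module_is_module:
 assumes "cring R" shows "module R (regular_module R)"
proof -
 interpret cring R by fact
 show ?thesis
 proof (intro moduleI abelian_groupI)
  fix x assume "x \<in> carrier (regular_module R)"
  then show "\<exists>y\<in>carrier (regular_module R). y \<oplus>\<^bsub>regular_module R\<^esub> x = \<zero>\<^bsub>regular_module R\<^esub>"
   by (intro bexI[of _ "\<ominus>\<^bsub>R\<^esub> x"]) (auto simp: l_neg)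
 qed (auto simp: is_cring a_ac l_distr r_distr m_assoc)
qed

lemma finsum_regular_module [simp]: "finsum (regular_module R) F A = finsum R F A"
 by (simp add: finsum_def finprod_def regular_module_def)

lemma a_inv_regular_module [simp]: "\<ominus>\<^bsub>regular_module R\<^esub> x = \<ominus>\<^bsub>R\<^esub> x"
 by (simp add: a_inv_def m_inv_def regular_module_def)

lemma a_minus_regular_module [simp]: "x \<ominus>\<^bsub>regular_module R\<^esub> y = x \<ominus>\<^bsub>R\<^esub> y"
 by (simp add: a_minus_def)


section \<open>Free modules\<close>

lemma free_module_simps [simp]:
 "\<zero>\<^bsub>free_module K S\<^esub> = (%_. \<zero>\<^bsub>K\<^esub>)"
 "f \<oplus>\<^bsub>free_module K S\<^esub> g = (%s. f s \<oplus>\<^bsub>K\<^esub> g s)"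
 "r \<odot>\<^bsub>free_module K S\<^esub> f = (%s. r \<otimes>\<^bsub>K\<^esub> f s)"
 by (simp_all add: free_module_def)

lemma free_module_carrier:
 "f \<in> carrier (free_module K S) \<longleftrightarrow>
  (\<forall>x. f x \<in> carrier K) & finite {x. f x ~= \<zero>\<^bsub>K\<^esub>} & (\<forall>x. x \<notin> S --> f x = \<zero>\<^bsub>K\<^esub>)"
 by (auto simp: free_module_def)

lemma free_module_left_module:
 assumes "ring K"
 shows "left_module K (free_module K S)"
proof -
 interpret ring K by fact
 have fin: "finite {x. f x \<oplus>\<^bsub>K\<^esub> g x ~= \<zero>\<^bsub>K\<^esub>}"
  if "f \<in> carrier (free_module K S)" "g \<in> carrier (free_module K S)" for f g
  by (rule finite_subset[of _ "{x. f x ~= \<zero>\<^bsub>K\<^esub>} \<union> {x. g x ~= \<zero>\<^bsub>K\<^esub>}"])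
   (use that in \<open>auto simp: free_module_carrier\<close>)
 have fin2: "finite {x. h (f x) ~= \<zero>\<^bsub>K\<^esub>}"
  if "f \<in> carrier (free_module K S)" "h \<zero>\<^bsub>K\<^esub> = \<zero>\<^bsub>K\<^esub>" for f h
  by (rule finite_subset[of _ "{x. f x ~= \<zero>\<^bsub>K\<^esub>}"]) (use that in \<open>auto simp: free_module_carrier\<close>)
 have "abelian_group (free_module K S)"
 proof (rule abelian_groupI)
  fix f assume f: "f \<in> carrier (free_module K S)"
  show "\<exists>g\<in>carrier (free_module K S). g \<oplus>\<^bsub>free_module K S\<^esub> f = \<zero>\<^bsub>free_module K S\<^esub>"
   using f fin2[OF f, of "a_inv K"]
   by (intro bexI[of _ "%s. \<ominus>\<^bsub>K\<^esub> f s"]) (auto simp: free_module_carrier l_neg)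
 qed (auto simp: free_module_carrier a_ac fin)
 moreover have "left_module_axioms K (free_module K S)"
  by unfold_locales
   (auto simp: free_module_carrier l_distr r_distr m_assoc fin2[of _ "%y. _ \<otimes>\<^bsub>K\<^esub> y"])
 ultimately show ?thesis
  by (intro left_module.intro) (auto intro: assms)
qed

lemma free_module_is_module:
 assumes "cring R"
 shows "module R (free_module R S)"
proof -
 interpret cring R by fact
 interpret left_module R "free_module R S" by (rule free_module_left_module) (rule ring_axioms)
 show ?thesis
  by (intro moduleI) (use smult_closed smult_l_distr smult_r_distr smult_assoc smult_one in
    \<open>auto simp del: free_module_simps simp: is_cring M.abelian_group_axioms\<close>)
qed

lemma eval_free_module_hom: "(%f. f s) \<in> module_hom R (free_module R S) (regular_module R)"
 by (auto simp: module_hom_def free_module_carrier)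

lemma free_module_finsum:
 assumes "cring R" "finite A" "!!i. i \<in> A ==> F i \<in> carrier (free_module R S)"
 shows "finsum (free_module R S) F A s = finsum R (%i. F i s) A"
 using module_hom_finsum[OF module_ab module_ab eval_free_module_hom,
   OF free_module_is_module[OF assms(1)] regular_module_is_module[OF assms(1)], of A F] assms(2,3)
 by simp

lemma basis_elt_closed:
 assumes "ring K" "s \<in> S"
 shows "basis_elt K s \<in> carrier (free_module K S)"
proof -
 interpret ring K by fact
 have "finite {x. basis_elt K s x ~= \<zero>\<^bsub>K\<^esub>}"
  by (rule finite_subset[of _ "{s}"]) (auto simp: basis_elt_def)
 then show ?thesis
  using assms(2) by (auto simp: free_module_carrier basis_elt_def)
qed

text \<open>The support of \<open>f\<close> may be enlarged to any finite set, in particular to the basis if that is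
  finite.\<close>

lemma linear_extension_superset:
 assumes "module R M" "f \<in> carrier (free_module R S)" "finite T" "T \<subseteq> S"
  "{x. f x ~= \<zero>\<^bsub>R\<^esub>} \<subseteq> T" "!!x. x \<in> S ==> \<phi> x \<in> carrier M"
 shows "linear_extension R M \<phi> f = (\<Oplus>\<^bsub>M\<^esub>x\<in>T. f x \<odot>\<^bsub>M\<^esub> \<phi> x)"
proof -
 interpret module R M by fact
 show ?thesis
  unfolding linear_extension_def using assms
  by (intro M.finsum_mono_neutral) (auto simp: free_module_carrier)
qed

lemma linear_extension_hom:
 assumes "module R M" "!!x. x \<in> S ==> \<phi> x \<in> carrier M"
 shows "linear_extension R M \<phi> \<in> module_hom R (free_module R S) M"
proof (rule module_homI)
 interpret module R M by fact
 fix f assume f: "f \<in> carrier (free_module R S)"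
 let ?T = "%f. {x. f x ~= \<zero>\<^bsub>R\<^esub>}"
 show "linear_extension R M \<phi> f \<in> carrier M"
  unfolding linear_extension_def using f assms(2)
  by (intro M.finsum_closed) (auto simp: free_module_carrier intro!: smult_closed)
 { fix g assume g: "g \<in> carrier (free_module R S)"
  let ?U = "?T f \<union> ?T g"
  have U: "finite ?U" "?U \<subseteq> S" using f g by (auto simp: free_module_carrier)
  have closed: "!!x. f x \<in> carrier R" "!!x. g x \<in> carrier R" "!!x. x \<in> ?U ==> \<phi> x \<in> carrier M"
   using f g U assms(2) by (auto simp: free_module_carrier)
  have fg: "f \<oplus>\<^bsub>free_module R S\<^esub> g \<in> carrier (free_module R S)"
   by (rule abelian_monoid.a_closed[OF abelian_group.axioms(1)[OF module_ab]])
    (rule free_module_is_module[OF is_cring] f g)+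
  have "linear_extension R M \<phi> (f \<oplus>\<^bsub>free_module R S\<^esub> g) =
    (\<Oplus>\<^bsub>M\<^esub>x\<in>?U. (f \<oplus>\<^bsub>free_module R S\<^esub> g) x \<odot>\<^bsub>M\<^esub> \<phi> x)"
   by (rule linear_extension_superset[OF assms(1) fg U _ assms(2)]) auto
  also have "... = (\<Oplus>\<^bsub>M\<^esub>x\<in>?U. f x \<odot>\<^bsub>M\<^esub> \<phi> x \<oplus>\<^bsub>M\<^esub> g x \<odot>\<^bsub>M\<^esub> \<phi> x)"
   by (rule M.finsum_cong') (use closed in \<open>simp_all add: Pi_def smult_l_distr\<close>)
  also have "... = (\<Oplus>\<^bsub>M\<^esub>x\<in>?U. f x \<odot>\<^bsub>M\<^esub> \<phi> x) \<oplus>\<^bsub>M\<^esub> (\<Oplus>\<^bsub>M\<^esub>x\<in>?U. g x \<odot>\<^bsub>M\<^esub> \<phi> x)"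
   by (rule M.finsum_addf) (use closed in \<open>simp_all add: Pi_def\<close>)
  also have "... = linear_extension R M \<phi> f \<oplus>\<^bsub>M\<^esub> linear_extension R M \<phi> g"
   using linear_extension_superset[OF assms(1) f U _ assms(2)]
    linear_extension_superset[OF assms(1) g U _ assms(2)] by auto
  finally show "linear_extension R M \<phi> (f \<oplus>\<^bsub>free_module R S\<^esub> g) =
   linear_extension R M \<phi> f \<oplus>\<^bsub>M\<^esub> linear_extension R M \<phi> g" . }
 fix r assume r: "r \<in> carrier R"
 have T: "finite (?T f)" "?T f \<subseteq> S" using f by (auto simp: free_module_carrier)
 have closed: "!!x. f x \<in> carrier R" "!!x. x \<in> ?T f ==> \<phi> x \<in> carrier M"
  using f T assms(2) by (auto simp: free_module_carrier)
 have rf: "r \<odot>\<^bsub>free_module R S\<^esub> f \<in> carrier (free_module R S)"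
  using f r module.smult_closed[OF free_module_is_module[OF is_cring]] by blast
 have "linear_extension R M \<phi> (r \<odot>\<^bsub>free_module R S\<^esub> f) =
   (\<Oplus>\<^bsub>M\<^esub>x\<in>?T f. (r \<odot>\<^bsub>free_module R S\<^esub> f) x \<odot>\<^bsub>M\<^esub> \<phi> x)"
  by (rule linear_extension_superset[OF assms(1) rf T _ assms(2)]) (use r in auto)
 also have "... = (\<Oplus>\<^bsub>M\<^esub>x\<in>?T f. r \<odot>\<^bsub>M\<^esub> (f x \<odot>\<^bsub>M\<^esub> \<phi> x))"
  by (rule M.finsum_cong') (use closed r in \<open>simp_all add: Pi_def smult_assoc1\<close>)
 also have "... = r \<odot>\<^bsub>M\<^esub> linear_extension R M \<phi> f"
  unfolding linear_extension_def
  by (rule finsum_smult_ldistr[symmetric]) (use closed r T in \<open>simp_all add: Pi_def\<close>)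
 finally show "linear_extension R M \<phi> (r \<odot>\<^bsub>free_module R S\<^esub> f) =
   r \<odot>\<^bsub>M\<^esub> linear_extension R M \<phi> f" .
qed

lemma linear_extension_basis:
 assumes "module R M" "s \<in> S" "!!x. x \<in> S ==> \<phi> x \<in> carrier M"
 shows "linear_extension R M \<phi> (basis_elt R s) = \<phi> s"
proof -
 interpret module R M by fact
 have "linear_extension R M \<phi> (basis_elt R s) = (\<Oplus>\<^bsub>M\<^esub>x\<in>{s}. basis_elt R s x \<odot>\<^bsub>M\<^esub> \<phi> x)"
  by (rule linear_extension_superset[OF assms(1) basis_elt_closed[OF R.ring_axioms assms(2)]])
   (use assms in \<open>auto simp: basis_elt_def\<close>)
 also have "... = \<phi> s"
  using assms by (subst M.finsum_insert) (auto simp: basis_elt_def)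
 finally show ?thesis .
qed

text \<open>A finitely supported function is the sum of its values times basis elements; linear maps are
  therefore determined by their values on the basis.\<close>

lemma free_module_expand:
 assumes "cring R" "f \<in> carrier (free_module R S)"
 shows "f = linear_extension R (free_module R S) (basis_elt R) f"
proof
 fix s
 interpret R: cring R by fact
 interpret module R "free_module R S" by (rule free_module_is_module) fact
 let ?T = "{x. f x ~= \<zero>\<^bsub>R\<^esub>}"
 have f: "finite ?T" "?T \<subseteq> S" "!!x. f x \<in> carrier R" using assms(2) by (auto simp: free_module_carrier)
 have "linear_extension R (free_module R S) (basis_elt R) f s
   = finsum R (%x. (f x \<odot>\<^bsub>free_module R S\<^esub> basis_elt R x) s) ?T"
  unfolding linear_extension_def using f
  by (intro free_module_finsum)
   (auto intro!: smult_closed basis_elt_closed R.ring_axioms simp: R.is_cring simp del: free_module_simps)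
 also have "... = f s"
 proof (cases "s \<in> ?T")
  case True
  have "finsum R (%x. f x \<otimes>\<^bsub>R\<^esub> basis_elt R x s) ?T = (%x. f x \<otimes>\<^bsub>R\<^esub> basis_elt R x s) s"
   using f True by (intro R.finsum_single) (auto simp: basis_elt_def)
  then show ?thesis using f by (simp add: basis_elt_def)
 next
  case False
  then show ?thesis using f by (auto simp: basis_elt_def intro!: R.finsum_zero')
 qed
 finally show "f s = linear_extension R (free_module R S) (basis_elt R) f s" by simp
qed

lemma free_module_hom_eqI:
 assumes "cring R" "module R M" "g \<in> module_hom R (free_module R S) M"
  "h \<in> module_hom R (free_module R S) M" "!!s. s \<in> S ==> g (basis_elt R s) = h (basis_elt R s)"
  "f \<in> carrier (free_module R S)"
 shows "g f = h f"
proof -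
 interpret F: module R "free_module R S" by (rule free_module_is_module) fact
 interpret M: module R M by fact
 let ?T = "{x. f x ~= \<zero>\<^bsub>R\<^esub>}"
 have f: "finite ?T" "?T \<subseteq> S" "!!x. f x \<in> carrier R" using assms(6) by (auto simp: free_module_carrier)
 have b: "!!x. x \<in> ?T ==> basis_elt R x \<in> carrier (free_module R S)"
  using f by (auto intro!: basis_elt_closed F.R.ring_axioms)
 have *: "k f = (\<Oplus>\<^bsub>M\<^esub>x\<in>?T. f x \<odot>\<^bsub>M\<^esub> k (basis_elt R x))"
  if k: "k \<in> module_hom R (free_module R S) M" for k
 proof -
  have "k f = k (linear_extension R (free_module R S) (basis_elt R) f)"
   using free_module_expand[OF assms(1,6)] by simp
  also have "... = (\<Oplus>\<^bsub>M\<^esub>x\<in>?T. k (f x \<odot>\<^bsub>free_module R S\<^esub> basis_elt R x))"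
   unfolding linear_extension_def using f b
   by (intro module_hom_finsum[OF F.M.abelian_group_axioms M.M.abelian_group_axioms k])
    (auto simp del: free_module_simps)
  also have "... = (\<Oplus>\<^bsub>M\<^esub>x\<in>?T. f x \<odot>\<^bsub>M\<^esub> k (basis_elt R x))"
   using f b module_hom_closed[OF k]
   by (intro M.finsum_cong') (auto simp: module_hom_smult[OF k] simp del: free_module_simps)
  finally show ?thesis .
 qed
 have "g f = (\<Oplus>\<^bsub>M\<^esub>x\<in>?T. f x \<odot>\<^bsub>M\<^esub> g (basis_elt R x))" by (rule *) fact
 also have "... = (\<Oplus>\<^bsub>M\<^esub>x\<in>?T. f x \<odot>\<^bsub>M\<^esub> h (basis_elt R x))"
  using f b assms(5) module_hom_closed[OF assms(4)] by (intro M.finsum_cong') auto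
 also have "... = h f" by (rule *[symmetric]) fact
 finally show ?thesis .
qed

section \<open>Quotient modules and isomorphic subquotients\<close>

context module
begin

lemma submodule_abelian_subgroup:
 assumes "submodule H R M" shows "abelian_subgroup H M"
 by (rule abelian_subgroupI3)
  (use assms in \<open>auto simp: submodule_def M.abelian_group_axioms intro: additive_subgroup.intro\<close>)

lemma submodule_coset_eq_iff:
 assumes H: "submodule H R M" and "x \<in> carrier M" "y \<in> carrier M"
 shows "H +>\<^bsub>M\<^esub> x = H +>\<^bsub>M\<^esub> y \<longleftrightarrow> x \<ominus>\<^bsub>M\<^esub> y \<in> H"
proof -
 interpret H: abelian_subgroup H M by (rule submodule_abelian_subgroup) fact
 show ?thesis
  using assms H.a_rcos_module[folded a_minus_def] H.a_repr_independence'
   H.a_rcos_self[of x] by metis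
qed

lemma submodule_coset_smult:
 assumes H: "submodule H R M" and r: "r \<in> carrier R" and x: "x \<in> carrier M"
 shows "(\<Union>y\<in>H +>\<^bsub>M\<^esub> x. H +>\<^bsub>M\<^esub> (r \<odot>\<^bsub>M\<^esub> y)) = H +>\<^bsub>M\<^esub> (r \<odot>\<^bsub>M\<^esub> x)"
proof -
 interpret H: abelian_subgroup H M by (rule submodule_abelian_subgroup) fact
 have "H +>\<^bsub>M\<^esub> (r \<odot>\<^bsub>M\<^esub> y) = H +>\<^bsub>M\<^esub> (r \<odot>\<^bsub>M\<^esub> x)" if "y \<in> H +>\<^bsub>M\<^esub> x" for y
 proof -
  have y: "y \<in> carrier M" using that x H.a_elemrcos_carrier by blast
  have "y \<ominus>\<^bsub>M\<^esub> x \<in> H"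
   using that x y H.a_rcos_module[folded a_minus_def] by blast
  then have "r \<odot>\<^bsub>M\<^esub> (y \<ominus>\<^bsub>M\<^esub> x) \<in> H" using submoduleE(4)[OF H] r by blast
  moreover have "r \<odot>\<^bsub>M\<^esub> (y \<ominus>\<^bsub>M\<^esub> x) = r \<odot>\<^bsub>M\<^esub> y \<ominus>\<^bsub>M\<^esub> r \<odot>\<^bsub>M\<^esub> x"
   using r x y by (simp add: a_minus_def smult_r_distr smult_r_minus)
  ultimately show ?thesis
   using submodule_coset_eq_iff[OF H] r x y by simp
 qed
 then show ?thesis using H.a_rcos_self[OF x] by blast
qed

end

context
 fixes R :: "('a, 'k) ring_scheme" and M :: "('a, 'b) module" and H
 assumes M: "module R M" and H: "submodule H R M"
begin

interpretation module R M by (rule M)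

lemma quotient_module_simps:
 shows "carrier (quotient_module M H) = (%x. H +>\<^bsub>M\<^esub> x) ` carrier M"
  and "\<zero>\<^bsub>quotient_module M H\<^esub> = H +>\<^bsub>M\<^esub> \<zero>\<^bsub>M\<^esub>"
  and "[|x \<in> carrier M; y \<in> carrier M|] ==>
   (H +>\<^bsub>M\<^esub> x) \<oplus>\<^bsub>quotient_module M H\<^esub> (H +>\<^bsub>M\<^esub> y) = H +>\<^bsub>M\<^esub> (x \<oplus>\<^bsub>M\<^esub> y)"
  and "[|r \<in> carrier R; x \<in> carrier M|] ==>
   r \<odot>\<^bsub>quotient_module M H\<^esub> (H +>\<^bsub>M\<^esub> x) = H +>\<^bsub>M\<^esub> (r \<odot>\<^bsub>M\<^esub> x)"
proof -
 interpret H: abelian_subgroup H M by (rule submodule_abelian_subgroup[OF H])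
 show "carrier (quotient_module M H) = (%x. H +>\<^bsub>M\<^esub> x) ` carrier M"
  by (auto simp: quotient_module_def A_RCOSETS_def')
 show "\<zero>\<^bsub>quotient_module M H\<^esub> = H +>\<^bsub>M\<^esub> \<zero>\<^bsub>M\<^esub>"
  using H.a_subset by (simp add: quotient_module_def)
 show "[|x \<in> carrier M; y \<in> carrier M|] ==>
   (H +>\<^bsub>M\<^esub> x) \<oplus>\<^bsub>quotient_module M H\<^esub> (H +>\<^bsub>M\<^esub> y) = H +>\<^bsub>M\<^esub> (x \<oplus>\<^bsub>M\<^esub> y)"
  by (simp add: quotient_module_def H.a_rcos_sum)
 show "[|r \<in> carrier R; x \<in> carrier M|] ==>
   r \<odot>\<^bsub>quotient_module M H\<^esub> (H +>\<^bsub>M\<^esub> x) = H +>\<^bsub>M\<^esub> (r \<odot>\<^bsub>M\<^esub> x)"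
  using submodule_coset_smult[OF H] by (simp add: quotient_module_def)
qed

lemma quotient_module_is_module:
 shows "module R (quotient_module M H)"
proof (intro moduleI abelian_groupI)
 note q = quotient_module_simps
 fix X assume "X \<in> carrier (quotient_module M H)"
 then obtain x where x: "x \<in> carrier M" "X = H +>\<^bsub>M\<^esub> x" by (auto simp: q)
 show "\<exists>Y\<in>carrier (quotient_module M H). Y \<oplus>\<^bsub>quotient_module M H\<^esub> X = \<zero>\<^bsub>quotient_module M H\<^esub>"
  by (rule bexI[of _ "H +>\<^bsub>M\<^esub> \<ominus>\<^bsub>M\<^esub> x"])
   (use x in \<open>simp_all add: q(2,3) M.l_neg\<close>, simp add: q(1))
qed (auto simp: quotient_module_simps is_cring M.a_ac smult_l_distr smult_r_distr smult_assoc1)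

end

lemma submodule_image:
 assumes V: "module R V" and W: "module R W" and h: "h \<in> module_hom R V W" and H: "submodule H R V"
 shows "submodule (h ` H) R W"
proof -
 interpret V: module R V by fact
 interpret W: module R W by fact
 note E = V.submoduleE[OF H] and ag = V.M.abelian_group_axioms W.M.abelian_group_axioms
 have Hc: "x \<in> H ==> x \<in> carrier V" for x using E(1) by blast
 have H0: "\<zero>\<^bsub>V\<^esub> \<in> H" using H by (auto simp: submodule_def dest: subgroup.one_closed)
 show ?thesis
 proof (rule W.submoduleI)
  show "h ` H \<subseteq> carrier W" using module_hom_closed[OF h] Hc by blast
  show "\<zero>\<^bsub>W\<^esub> \<in> h ` H" using module_hom_zero[OF ag h] H0 by (metis imageI)
  show "\<ominus>\<^bsub>W\<^esub> y \<in> h ` H" if "y \<in> h ` H" for y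
  proof -
   obtain x where x: "x \<in> H" "y = h x" using \<open>y \<in> h ` H\<close> by blast
   then show ?thesis using module_hom_inv[OF ag h Hc[OF x(1)]] E(3)[OF x(1)] by (simp add: image_iff) metis
  qed
  show "y \<oplus>\<^bsub>W\<^esub> y' \<in> h ` H" if y: "y \<in> h ` H" "y' \<in> h ` H" for y y'
  proof -
   obtain x x' where x: "x \<in> H" "y = h x" "x' \<in> H" "y' = h x'" using y by blast
   then have "y \<oplus>\<^bsub>W\<^esub> y' = h (x \<oplus>\<^bsub>V\<^esub> x')" using module_hom_add[OF h] Hc by simp
   then show ?thesis using E(5)[OF x(1,3)] by simp
  qed
  show "r \<odot>\<^bsub>W\<^esub> y \<in> h ` H" if r: "r \<in> carrier R" and y: "y \<in> h ` H" for r y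
  proof -
   obtain x where x: "x \<in> H" "y = h x" using y by blast
   then have "r \<odot>\<^bsub>W\<^esub> y = h (r \<odot>\<^bsub>V\<^esub> x)" using module_hom_smult[OF h r] Hc by simp
   then show ?thesis using E(4)[OF r x(1)] by simp
  qed
 qed
qed

lemma submodule_preimage:
 assumes V: "module R V" and W: "module R W" and h: "h \<in> module_hom R V W" and H: "submodule H R W"
 shows "submodule {x \<in> carrier V. h x \<in> H} R V"
proof -
 interpret V: module R V by fact
 interpret W: module R W by fact
 note E = W.submoduleE[OF H] and ag = V.M.abelian_group_axioms W.M.abelian_group_axioms
 have H0: "\<zero>\<^bsub>W\<^esub> \<in> H" using H by (auto simp: submodule_def dest: subgroup.one_closed)
 show ?thesis
  by (rule V.submoduleI)
   (use E H0 in \<open>auto simp: module_hom_zero[OF ag h] module_hom_inv[OF ag h] module_hom_add[OF h] module_hom_smult[OF h]\<close>)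
qed

text \<open>Two subquotients \<open>Z/B\<close> of \<open>V\<close> and \<open>Z'/B'\<close> of \<open>W\<close> are compared through linear
  correspondences instead of maps: a connecting homomorphism, which is a map only after passing to
  classes, is an honest correspondence between cycles, and correspondences can be composed without
  choosing representatives.\<close>

definition subquot_iso ::
  "('a, 'k) ring_scheme => ('a, 'v) module => 'v set => 'v set =>
   ('a, 'w) module => 'w set => 'w set => bool" where
 "subquot_iso R V Z B W Z' B' \<longleftrightarrow> (\<exists>\<rho>. Domain \<rho> = Z & Range \<rho> = Z' &
   (\<forall>(x, y)\<in>\<rho>. \<forall>(x', y')\<in>\<rho>. (x \<oplus>\<^bsub>V\<^esub> x', y \<oplus>\<^bsub>W\<^esub> y') \<in> \<rho>) &
   (\<forall>r\<in>carrier R. \<forall>(x, y)\<in>\<rho>. (r \<odot>\<^bsub>V\<^esub> x, r \<odot>\<^bsub>W\<^esub> y) \<in> \<rho>) &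
   (\<forall>(x, y)\<in>\<rho>. x \<in> B \<longleftrightarrow> y \<in> B'))"

lemma subquot_isoI:
 assumes "Domain \<rho> = Z" "Range \<rho> = Z'"
  "!!x y x' y'. (x, y) \<in> \<rho> ==> (x', y') \<in> \<rho> ==> (x \<oplus>\<^bsub>V\<^esub> x', y \<oplus>\<^bsub>W\<^esub> y') \<in> \<rho>"
  "!!r x y. r \<in> carrier R ==> (x, y) \<in> \<rho> ==> (r \<odot>\<^bsub>V\<^esub> x, r \<odot>\<^bsub>W\<^esub> y) \<in> \<rho>"
  "!!x y. (x, y) \<in> \<rho> ==> x \<in> B \<longleftrightarrow> y \<in> B'"
 shows "subquot_iso R V Z B W Z' B'"
 unfolding subquot_iso_def
proof (intro exI conjI)
 show "\<forall>(x, y)\<in>\<rho>. \<forall>(x', y')\<in>\<rho>. (x \<oplus>\<^bsub>V\<^esub> x', y \<oplus>\<^bsub>W\<^esub> y') \<in> \<rho>" using assms(3) by blast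
 show "\<forall>r\<in>carrier R. \<forall>(x, y)\<in>\<rho>. (r \<odot>\<^bsub>V\<^esub> x, r \<odot>\<^bsub>W\<^esub> y) \<in> \<rho>" using assms(4) by blast
 show "\<forall>(x, y)\<in>\<rho>. x \<in> B \<longleftrightarrow> y \<in> B'" using assms(5) by blast
qed (use assms(1,2) in auto)

lemma subquot_isoE:
 assumes "subquot_iso R V Z B W Z' B'"
 obtains \<rho> where "Domain \<rho> = Z" "Range \<rho> = Z'"
  "!!x y x' y'. (x, y) \<in> \<rho> ==> (x', y') \<in> \<rho> ==> (x \<oplus>\<^bsub>V\<^esub> x', y \<oplus>\<^bsub>W\<^esub> y') \<in> \<rho>"
  "!!r x y. r \<in> carrier R ==> (x, y) \<in> \<rho> ==> (r \<odot>\<^bsub>V\<^esub> x, r \<odot>\<^bsub>W\<^esub> y) \<in> \<rho>"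
  "!!x y. (x, y) \<in> \<rho> ==> x \<in> B \<longleftrightarrow> y \<in> B'"
proof -
 from assms obtain \<rho> where \<rho>: "Domain \<rho> = Z" "Range \<rho> = Z'"
   "\<forall>(x, y)\<in>\<rho>. \<forall>(x', y')\<in>\<rho>. (x \<oplus>\<^bsub>V\<^esub> x', y \<oplus>\<^bsub>W\<^esub> y') \<in> \<rho>"
   "\<forall>r\<in>carrier R. \<forall>(x, y)\<in>\<rho>. (r \<odot>\<^bsub>V\<^esub> x, r \<odot>\<^bsub>W\<^esub> y) \<in> \<rho>"
   "\<forall>(x, y)\<in>\<rho>. x \<in> B \<longleftrightarrow> y \<in> B'"
  unfolding subquot_iso_def by blast
 show thesis by (rule that[of \<rho>]) (use \<rho> in blast)+
qed

lemma subquot_iso_sym: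
 assumes "subquot_iso R V Z B W Z' B'"
 shows "subquot_iso R W Z' B' V Z B"
proof -
 from assms obtain \<rho> where \<rho>: "Domain \<rho> = Z" "Range \<rho> = Z'"
  "!!x y x' y'. (x, y) \<in> \<rho> ==> (x', y') \<in> \<rho> ==> (x \<oplus>\<^bsub>V\<^esub> x', y \<oplus>\<^bsub>W\<^esub> y') \<in> \<rho>"
  "!!r x y. r \<in> carrier R ==> (x, y) \<in> \<rho> ==> (r \<odot>\<^bsub>V\<^esub> x, r \<odot>\<^bsub>W\<^esub> y) \<in> \<rho>"
  "!!x y. (x, y) \<in> \<rho> ==> x \<in> B \<longleftrightarrow> y \<in> B'"
  by (rule subquot_isoE) blast
 show ?thesis
  by (rule subquot_isoI[of "\<rho>\<inverse>"]) (use \<rho> in \<open>auto simp: Domain_converse Range_converse\<close>)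
qed

lemma subquot_iso_trans:
 assumes "subquot_iso R V Z B W Z' B'" "subquot_iso R W Z' B' U Z'' B''"
 shows "subquot_iso R V Z B U Z'' B''"
proof -
 from assms(1) obtain \<rho> where \<rho>: "Domain \<rho> = Z" "Range \<rho> = Z'"
  "!!x y x' y'. (x, y) \<in> \<rho> ==> (x', y') \<in> \<rho> ==> (x \<oplus>\<^bsub>V\<^esub> x', y \<oplus>\<^bsub>W\<^esub> y') \<in> \<rho>"
  "!!r x y. r \<in> carrier R ==> (x, y) \<in> \<rho> ==> (r \<odot>\<^bsub>V\<^esub> x, r \<odot>\<^bsub>W\<^esub> y) \<in> \<rho>"
  "!!x y. (x, y) \<in> \<rho> ==> x \<in> B \<longleftrightarrow> y \<in> B'"
  by (rule subquot_isoE) blast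
 from assms(2) obtain \<sigma> where \<sigma>: "Domain \<sigma> = Z'" "Range \<sigma> = Z''"
  "!!x y x' y'. (x, y) \<in> \<sigma> ==> (x', y') \<in> \<sigma> ==> (x \<oplus>\<^bsub>W\<^esub> x', y \<oplus>\<^bsub>U\<^esub> y') \<in> \<sigma>"
  "!!r x y. r \<in> carrier R ==> (x, y) \<in> \<sigma> ==> (r \<odot>\<^bsub>W\<^esub> x, r \<odot>\<^bsub>U\<^esub> y) \<in> \<sigma>"
  "!!x y. (x, y) \<in> \<sigma> ==> x \<in> B' \<longleftrightarrow> y \<in> B''"
  by (rule subquot_isoE) blast
 have D: "Domain (\<rho> O \<sigma>) = Z" "Range (\<rho> O \<sigma>) = Z''" using \<rho>(1,2) \<sigma>(1,2) by blast+
 show ?thesis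
 proof (rule subquot_isoI[OF D])
  fix x z x' z' assume "(x, z) \<in> \<rho> O \<sigma>" "(x', z') \<in> \<rho> O \<sigma>"
  then obtain y y' where "(x, y) \<in> \<rho>" "(y, z) \<in> \<sigma>" "(x', y') \<in> \<rho>" "(y', z') \<in> \<sigma>" by auto
  then show "(x \<oplus>\<^bsub>V\<^esub> x', z \<oplus>\<^bsub>U\<^esub> z') \<in> \<rho> O \<sigma>" using \<rho>(3) \<sigma>(3) by blast
 next
  fix r x z assume "r \<in> carrier R" "(x, z) \<in> \<rho> O \<sigma>"
  then show "(r \<odot>\<^bsub>V\<^esub> x, r \<odot>\<^bsub>U\<^esub> z) \<in> \<rho> O \<sigma>" using \<rho>(4) \<sigma>(4) by blast
 next
  fix x z assume "(x, z) \<in> \<rho> O \<sigma>"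
  then show "x \<in> B \<longleftrightarrow> z \<in> B''" using \<rho>(5) \<sigma>(5) by blast
 qed
qed

text \<open>The correspondence given by the graph of a map.\<close>

lemma subquot_iso_map:
 assumes "f ` Z = Z'"
  "!!x y. x \<in> Z ==> y \<in> Z ==> x \<oplus>\<^bsub>V\<^esub> y \<in> Z & f (x \<oplus>\<^bsub>V\<^esub> y) = f x \<oplus>\<^bsub>W\<^esub> f y"
  "!!r x. r \<in> carrier R ==> x \<in> Z ==> r \<odot>\<^bsub>V\<^esub> x \<in> Z & f (r \<odot>\<^bsub>V\<^esub> x) = r \<odot>\<^bsub>W\<^esub> f x"
  "!!x. x \<in> Z ==> x \<in> B \<longleftrightarrow> f x \<in> B'"
 shows "subquot_iso R V Z B W Z' B'"
 by (rule subquot_isoI[of "{(x, f x) | x. x \<in> Z}"]) (use assms in auto)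

lemma subquot_iso_zero:
 assumes "subquot_iso R V Z B W Z' B'" "Z \<subseteq> B"
 shows "Z' \<subseteq> B'"
 using assms unfolding subquot_iso_def by blast

lemma subquot_iso_quotient:
 assumes M: "module R M" and N: "module R N"
  and B: "submodule B R M" and B': "submodule B' R N"
  and iso: "subquot_iso R M (carrier M) B N (carrier N) B'"
 shows "module_isomorphic R (quotient_module M B) (quotient_module N B')"
proof -
 interpret M: module R M by fact
 interpret N: module R N by fact
 interpret B: abelian_subgroup B M by (rule M.submodule_abelian_subgroup) fact
 interpret B': abelian_subgroup B' N by (rule N.submodule_abelian_subgroup) fact
 from iso obtain \<rho> where \<rho>: "Domain \<rho> = carrier M" "Range \<rho> = carrier N"
  "!!x y x' y'. (x, y) \<in> \<rho> ==> (x', y') \<in> \<rho> ==> (x \<oplus>\<^bsub>M\<^esub> x', y \<oplus>\<^bsub>N\<^esub> y') \<in> \<rho>"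
  "!!r x y. r \<in> carrier R ==> (x, y) \<in> \<rho> ==> (r \<odot>\<^bsub>M\<^esub> x, r \<odot>\<^bsub>N\<^esub> y) \<in> \<rho>"
  "!!x y. (x, y) \<in> \<rho> ==> x \<in> B \<longleftrightarrow> y \<in> B'"
  by (rule subquot_isoE) blast
 note qM = quotient_module_simps[OF M B] and qN = quotient_module_simps[OF N B']
 have cl: "x \<in> carrier M" "y \<in> carrier N" if "(x, y) \<in> \<rho>" for x y
  using that \<rho>(1,2) by blast+
 have coset_iff: "B +>\<^bsub>M\<^esub> x = B +>\<^bsub>M\<^esub> x' \<longleftrightarrow> B' +>\<^bsub>N\<^esub> y = B' +>\<^bsub>N\<^esub> y'"
  if xy: "(x, y) \<in> \<rho>" "(x', y') \<in> \<rho>" for x y x' y'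
 proof -
  have "(\<ominus>\<^bsub>R\<^esub> \<one>\<^bsub>R\<^esub> \<odot>\<^bsub>M\<^esub> x', \<ominus>\<^bsub>R\<^esub> \<one>\<^bsub>R\<^esub> \<odot>\<^bsub>N\<^esub> y') \<in> \<rho>" using \<rho>(4) xy by simp
  then have "(\<ominus>\<^bsub>M\<^esub> x', \<ominus>\<^bsub>N\<^esub> y') \<in> \<rho>"
   using cl[OF xy(2)] by (simp add: M.smult_l_minus N.smult_l_minus)
  then have "(x \<ominus>\<^bsub>M\<^esub> x', y \<ominus>\<^bsub>N\<^esub> y') \<in> \<rho>" using \<rho>(3) xy by (simp add: a_minus_def)
  then show ?thesis
   using \<rho>(5) M.submodule_coset_eq_iff[OF B] N.submodule_coset_eq_iff[OF B'] cl xy by metis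
 qed
 define h where "h C = B' +>\<^bsub>N\<^esub> (SOME y. \<exists>x. (x, y) \<in> \<rho> & B +>\<^bsub>M\<^esub> x = C)" for C
 have h: "h (B +>\<^bsub>M\<^esub> x) = B' +>\<^bsub>N\<^esub> y" if xy: "(x, y) \<in> \<rho>" for x y
 proof -
  define y0 where "y0 = (SOME y. \<exists>x'. (x', y) \<in> \<rho> & B +>\<^bsub>M\<^esub> x' = B +>\<^bsub>M\<^esub> x)"
  have "\<exists>x'. (x', y0) \<in> \<rho> & B +>\<^bsub>M\<^esub> x' = B +>\<^bsub>M\<^esub> x"
   unfolding y0_def
   by (rule someI[of "%y. \<exists>x'. (x', y) \<in> \<rho> & B +>\<^bsub>M\<^esub> x' = B +>\<^bsub>M\<^esub> x" y]) (use xy in blast)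
  then obtain x' where x': "(x', y0) \<in> \<rho>" "B +>\<^bsub>M\<^esub> x' = B +>\<^bsub>M\<^esub> x" by blast
  have "B' +>\<^bsub>N\<^esub> y0 = B' +>\<^bsub>N\<^esub> y" using coset_iff[OF x'(1) xy] x'(2) by blast
  then show ?thesis unfolding h_def y0_def .
 qed
 have rep: "\<exists>x y. (x, y) \<in> \<rho> & C = B +>\<^bsub>M\<^esub> x" if "C \<in> carrier (quotient_module M B)" for C
  using that \<rho>(1) unfolding qM(1) by blast
 have "h \<in> module_hom R (quotient_module M B) (quotient_module N B')"
 proof (rule module_homI)
  fix C assume "C \<in> carrier (quotient_module M B)"
  then obtain x y where xy: "(x, y) \<in> \<rho>" "C = B +>\<^bsub>M\<^esub> x" using rep by blast
  then show "h C \<in> carrier (quotient_module N B')" using h cl(2) unfolding qN(1) by blast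
  { fix r assume r: "r \<in> carrier R"
   show "h (r \<odot>\<^bsub>quotient_module M B\<^esub> C) = r \<odot>\<^bsub>quotient_module N B'\<^esub> h C"
    using xy r h[OF \<rho>(4)[OF r xy(1)]] h[OF xy(1)] cl[OF xy(1)] by (simp add: qM qN) }
  fix D assume "D \<in> carrier (quotient_module M B)"
  then obtain x' y' where xy': "(x', y') \<in> \<rho>" "D = B +>\<^bsub>M\<^esub> x'" using rep by blast
  show "h (C \<oplus>\<^bsub>quotient_module M B\<^esub> D) = h C \<oplus>\<^bsub>quotient_module N B'\<^esub> h D"
   using xy xy' h[OF \<rho>(3)[OF xy(1) xy'(1)]] h[OF xy(1)] h[OF xy'(1)] cl[OF xy(1)] cl[OF xy'(1)]
   by (simp add: qM qN)
 qed
 moreover have "bij_betw h (carrier (quotient_module M B)) (carrier (quotient_module N B'))"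
 proof (rule bij_betw_imageI)
  show "inj_on h (carrier (quotient_module M B))"
  proof (rule inj_onI)
   fix C D assume CD: "C \<in> carrier (quotient_module M B)" "D \<in> carrier (quotient_module M B)" "h C = h D"
   obtain x y x' y' where "(x, y) \<in> \<rho>" "C = B +>\<^bsub>M\<^esub> x" "(x', y') \<in> \<rho>" "D = B +>\<^bsub>M\<^esub> x'"
    using rep[OF CD(1)] rep[OF CD(2)] by blast
   then show "C = D" using CD(3) h coset_iff by simp
  qed
  show "h ` carrier (quotient_module M B) = carrier (quotient_module N B')"
  proof
   show "h ` carrier (quotient_module M B) \<subseteq> carrier (quotient_module N B')"
    using rep h cl(2) unfolding qN(1) by blast
   show "carrier (quotient_module N B') \<subseteq> h ` carrier (quotient_module M B)"
   proof
    fix D assume "D \<in> carrier (quotient_module N B')"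
    then obtain x y where "(x, y) \<in> \<rho>" "D = B' +>\<^bsub>N\<^esub> y" using \<rho>(2) unfolding qN(1) by blast
    then show "D \<in> h ` carrier (quotient_module M B)"
     using h[of x y] cl(1)[of x y] unfolding qM(1) by blast
   qed
  qed
 qed
 ultimately show ?thesis unfolding module_isomorphic_def by blast
qed

section \<open>Homology\<close>

locale chain_complex =
 fixes R :: "('a, 'k) ring_scheme" and C :: "nat => ('a, 'b) module" and d :: "nat => 'b => 'b"
 assumes chain_module: "module R (C q)"
  and diff_hom: "d q \<in> module_hom R (C (Suc q)) (C q)"
  and diff_diff: "x \<in> carrier (C (Suc (Suc q))) ==> d q (d (Suc q) x) = \<zero>\<^bsub>C q\<^esub>"
begin

lemma cycles_submodule: "submodule (cycles C d q) R (C q)"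
proof (cases q)
 case 0
 then show ?thesis using module.carrier_is_submodule[OF chain_module] by simp
next
 case (Suc p)
 interpret C: module R "C (Suc p)" by (rule chain_module)
 interpret C': module R "C p" by (rule chain_module)
 note d = module_hom_zero[OF C.M.abelian_group_axioms C'.M.abelian_group_axioms diff_hom]
  module_hom_inv[OF C.M.abelian_group_axioms C'.M.abelian_group_axioms diff_hom]
  module_hom_add[OF diff_hom] module_hom_smult[OF diff_hom]
 show ?thesis unfolding Suc by (rule C.submoduleI) (auto simp: d)
qed

lemma cycles_subset: "cycles C d q \<subseteq> carrier (C q)"
 using module.submoduleE(1)[OF chain_module cycles_submodule] .

lemma boundaries_subset: "boundaries C d q \<subseteq> cycles C d q"
 using diff_hom diff_diff by (cases q) (auto simp: boundaries_def module_hom_closed[OF diff_hom])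

lemma cycles_module: "module R ((C q)\<lparr>carrier := cycles C d q\<rparr>)"
 by (rule submodule.submodule_is_module[OF cycles_submodule chain_module])

lemma boundaries_submodule: "submodule (boundaries C d q) R (C q)"
 unfolding boundaries_def
 by (rule submodule_image[OF chain_module chain_module diff_hom module.carrier_is_submodule[OF chain_module]])

lemma boundaries_submodule': "submodule (boundaries C d q) R ((C q)\<lparr>carrier := cycles C d q\<rparr>)"
proof -
 interpret Z: module R "(C q)\<lparr>carrier := cycles C d q\<rparr>" by (rule cycles_module)
 interpret C: module R "C q" by (rule chain_module)
 note b = C.submoduleE[OF boundaries_submodule]
 show ?thesis
 proof (rule Z.module_incl_imp_submodule)
  have "module R ((C q)\<lparr>carrier := boundaries C d q\<rparr>)"
   by (rule submodule.submodule_is_module[OF boundaries_submodule chain_module])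
  then show "module R ((C q)\<lparr>carrier := cycles C d q, carrier := boundaries C d q\<rparr>)" by simp
 qed (simp add: boundaries_subset)
qed

end

lemma homology_isomorphic:
 assumes "chain_complex R C d" "chain_complex R D d'"
  "subquot_iso R (C q) (cycles C d q) (boundaries C d q)
   (D p) (cycles D d' p) (boundaries D d' p)"
 shows "module_isomorphic R (homology C d q) (homology D d' p)"
proof -
 interpret C: chain_complex R C d by fact
 interpret D: chain_complex R D d' by fact
 show ?thesis
  unfolding homology_def
  by (rule subquot_iso_quotient)
   (use assms(3) in \<open>auto simp: C.cycles_module D.cycles_module C.boundaries_submodule'
    D.boundaries_submodule' subquot_iso_def\<close>)
qed

lemma homology_trivial:
 assumes "chain_complex R C d" "cycles C d q \<subseteq> boundaries C d q"
 shows "carrier (homology C d q) = {\<zero>\<^bsub>homology C d q\<^esub>}"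
proof -
 interpret C: chain_complex R C d by fact
 interpret Z: module R "(C q)\<lparr>carrier := cycles C d q\<rparr>" by (rule C.cycles_module)
 note B = C.boundaries_submodule'
 note Zq = quotient_module_simps[OF C.cycles_module B]
 let ?Z = "(C q)\<lparr>carrier := cycles C d q\<rparr>"
 have *: "boundaries C d q +>\<^bsub>?Z\<^esub> x = boundaries C d q +>\<^bsub>?Z\<^esub> \<zero>\<^bsub>?Z\<^esub>" if x: "x \<in> carrier ?Z" for x
 proof -
  have "x \<ominus>\<^bsub>?Z\<^esub> \<zero>\<^bsub>?Z\<^esub> \<in> carrier ?Z" by (rule Z.M.minus_closed[OF x Z.M.zero_closed])
  then have "x \<ominus>\<^bsub>?Z\<^esub> \<zero>\<^bsub>?Z\<^esub> \<in> boundaries C d q" using assms(2) by auto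
  then show ?thesis using Z.submodule_coset_eq_iff[OF B x Z.M.zero_closed] by blast
 qed
 show ?thesis
  unfolding homology_def Zq(1,2) using * Z.M.zero_closed by blast
qed

text \<open>A module \<open>N\<close> is the subquotient \<open>N/0\<close>.\<close>

lemma homology_isomorphic_module:
 assumes "chain_complex R C d" "module R N"
  "subquot_iso R (C q) (cycles C d q) (boundaries C d q) N (carrier N) {\<zero>\<^bsub>N\<^esub>}"
 shows "module_isomorphic R (homology C d q) N"
proof -
 interpret C: chain_complex R C d by fact
 interpret N: module R N by fact
 have zero: "submodule {\<zero>\<^bsub>N\<^esub>} R N" by (rule N.submoduleI) auto
 have iso: "module_isomorphic R (homology C d q) (quotient_module N {\<zero>\<^bsub>N\<^esub>})"
  unfolding homology_def
  by (rule subquot_iso_quotient)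
   (use assms(3) in \<open>auto simp: C.cycles_module zero assms(2) C.boundaries_submodule'
    subquot_iso_def\<close>)
 then obtain h where h: "h \<in> module_hom R (homology C d q) (quotient_module N {\<zero>\<^bsub>N\<^esub>})"
   "bij_betw h (carrier (homology C d q)) (carrier (quotient_module N {\<zero>\<^bsub>N\<^esub>}))"
  unfolding module_isomorphic_def by blast
 have coset: "{\<zero>\<^bsub>N\<^esub>} +>\<^bsub>N\<^esub> x = {x}" if "x \<in> carrier N" for x
  using that by (auto simp: a_r_coset_def')
 have qc: "carrier (quotient_module N {\<zero>\<^bsub>N\<^esub>}) = (%x. {x}) ` carrier N"
  using coset by (auto simp: quotient_module_simps[OF assms(2) zero])
 have "the_elem \<in> module_hom R (quotient_module N {\<zero>\<^bsub>N\<^esub>}) N"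
  using quotient_module_simps(3,4)[OF assms(2) zero]
  by (intro module_homI) (auto simp: qc coset)
 moreover have "bij_betw the_elem (carrier (quotient_module N {\<zero>\<^bsub>N\<^esub>})) (carrier N)"
  by (rule bij_betw_byWitness[of _ "%x. {x}"]) (auto simp: qc)
 ultimately show ?thesis
  unfolding module_isomorphic_def using h
  by (intro bexI[of _ "the_elem \<circ> h"])
   (auto intro!: bij_betw_trans module_homI simp: module_hom_def Pi_def)
qed

section \<open>Dimension shifting\<close>

lemma (in abelian_group) minus_zero_right: "x \<in> carrier G ==> x \<ominus> \<zero> = x"
 by (simp add: a_minus_def)

lemma (in abelian_group) a_inv_eq_zero_iff: "x \<in> carrier G ==> \<ominus> x = \<zero> \<longleftrightarrow> x = \<zero>"
proof
 assume "x \<in> carrier G" "\<ominus> x = \<zero>"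
 then have "\<ominus> (\<ominus> x) = \<zero>" by simp
 then show "x = \<zero>" using \<open>x \<in> carrier G\<close> by simp
qed simp

lemma (in abelian_group) minus_eq_zero_iff:
 assumes "x \<in> carrier G" "y \<in> carrier G"
 shows "x \<ominus> y = \<zero> \<longleftrightarrow> x = y"
proof
 assume "x \<ominus> y = \<zero>"
 then have "x \<oplus> (\<ominus> y \<oplus> y) = \<zero> \<oplus> y" using assms by (simp add: a_minus_def flip: a_assoc)
 then show "x = y" using assms by (simp add: l_neg)
qed (use assms in \<open>simp add: a_minus_def r_neg\<close>)

definition same_homology ::
  "('a, 'k) ring_scheme => ('a, 'v) module => (nat => 'v set) => ('v => 'v) => nat =>
   ('a, 'w) module => (nat => 'w set) => ('w => 'w) => nat => bool" where
 "same_homology R V C d q W C' d' q' \<longleftrightarrow>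
   subquot_iso R V {x \<in> C q. d x = \<zero>\<^bsub>V\<^esub>} (d ` C (Suc q))
    W {x \<in> C' q'. d' x = \<zero>\<^bsub>W\<^esub>} (d' ` C' (Suc q'))"

definition exact_at :: "('a, 'v) module => (nat => 'v set) => ('v => 'v) => nat => bool" where
 "exact_at V C d q \<longleftrightarrow> {x \<in> C q. d x = \<zero>\<^bsub>V\<^esub>} \<subseteq> d ` C (Suc q)"

lemma same_homology_sym:
 "same_homology R V C d q W C' d' q' ==> same_homology R W C' d' q' V C d q"
 unfolding same_homology_def by (rule subquot_iso_sym)

lemma same_homology_trans:
 "same_homology R V C d q W C' d' q' ==> same_homology R W C' d' q' U C'' d'' q'' ==>
  same_homology R V C d q U C'' d'' q''"
 unfolding same_homology_def by (rule subquot_iso_trans)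

lemma same_homology_exact:
 "same_homology R V C d q W C' d' q' ==> exact_at V C d q ==> exact_at W C' d' q'"
 unfolding same_homology_def exact_at_def by (rule subquot_iso_zero)

text \<open>An injective chain map that is onto in the relevant degrees; it need only commute with the
  differentials up to sign.\<close>

lemma same_homology_injective:
 assumes V: "module R V" and W: "module R W"
  and sub: "submodule (C q) R V" "submodule (C (Suc q)) R V"
  and d: "d \<in> module_hom R V V" and d': "d' \<in> module_hom R W W" and f: "f \<in> module_hom R V W"
  and onto: "f ` C q = C' q'" "f ` C (Suc q) = C' (Suc q')"
  and comm: "!!x. x \<in> C q \<union> C (Suc q) ==> d' (f x) = f (d x) \<or> d' (f x) = \<ominus>\<^bsub>W\<^esub> f (d x)"
  and dC: "!!x. x \<in> C (Suc q) ==> d x \<in> C q"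
  and inj: "!!x. x \<in> C q \<or> x \<in> d ` C q ==> f x = \<zero>\<^bsub>W\<^esub> ==> x = \<zero>\<^bsub>V\<^esub>"
 shows "same_homology R V C d q W C' d' q'"
proof -
 interpret V: module R V by fact
 interpret W: module R W by fact
 note ag = V.M.abelian_group_axioms W.M.abelian_group_axioms
 note C0 = V.submoduleE[OF sub(1)] and C1 = V.submoduleE[OF sub(2)]
 have cl: "x \<in> C q ==> x \<in> carrier V" "x \<in> C (Suc q) ==> x \<in> carrier V" for x
  using C0(1) C1(1) by blast+
 note fc = module_hom_closed[OF f] and dc = module_hom_closed[OF d]
 have neg: "\<ominus>\<^bsub>W\<^esub> y = \<zero>\<^bsub>W\<^esub> \<longleftrightarrow> y = \<zero>\<^bsub>W\<^esub>" if "y \<in> carrier W" for y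
  using that by (rule W.M.a_inv_eq_zero_iff)
 have cyc: "d' (f x) = \<zero>\<^bsub>W\<^esub> \<longleftrightarrow> d x = \<zero>\<^bsub>V\<^esub>" if x: "x \<in> C q" for x
 proof -
  have "d' (f x) = \<zero>\<^bsub>W\<^esub> \<longleftrightarrow> f (d x) = \<zero>\<^bsub>W\<^esub>"
   using comm[of x] x neg[OF fc[OF dc[OF cl(1)[OF x]]]] by auto
  also have "... \<longleftrightarrow> d x = \<zero>\<^bsub>V\<^esub>"
   using inj[of "d x"] x module_hom_zero[OF ag f] by auto
  finally show ?thesis .
 qed
 show ?thesis
  unfolding same_homology_def
 proof (rule subquot_iso_map[of f])
  show "f ` {x \<in> C q. d x = \<zero>\<^bsub>V\<^esub>} = {x \<in> C' q'. d' x = \<zero>\<^bsub>W\<^esub>}"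
   using cyc by (auto simp flip: onto(1))
  show "x \<oplus>\<^bsub>V\<^esub> y \<in> {x \<in> C q. d x = \<zero>\<^bsub>V\<^esub>} & f (x \<oplus>\<^bsub>V\<^esub> y) = f x \<oplus>\<^bsub>W\<^esub> f y"
   if "x \<in> {x \<in> C q. d x = \<zero>\<^bsub>V\<^esub>}" "y \<in> {x \<in> C q. d x = \<zero>\<^bsub>V\<^esub>}" for x y
   using that C0(5)[of x y] cl(1)[of x] cl(1)[of y]
   by (simp add: module_hom_add[OF d] module_hom_add[OF f])
  show "r \<odot>\<^bsub>V\<^esub> x \<in> {x \<in> C q. d x = \<zero>\<^bsub>V\<^esub>} & f (r \<odot>\<^bsub>V\<^esub> x) = r \<odot>\<^bsub>W\<^esub> f x"
   if "r \<in> carrier R" "x \<in> {x \<in> C q. d x = \<zero>\<^bsub>V\<^esub>}" for r x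
   using that C0(4)[of r x] cl(1)[of x] by (simp add: module_hom_smult[OF d] module_hom_smult[OF f])
  show "x \<in> d ` C (Suc q) \<longleftrightarrow> f x \<in> d' ` C' (Suc q')" if "x \<in> {x \<in> C q. d x = \<zero>\<^bsub>V\<^esub>}" for x
  proof
   assume "x \<in> d ` C (Suc q)"
   then obtain g where g: "g \<in> C (Suc q)" "x = d g" by blast
   have "d' (f (\<ominus>\<^bsub>V\<^esub> g)) = \<ominus>\<^bsub>W\<^esub> d' (f g)"
    using cl(2)[OF g(1)] fc
    by (simp add: module_hom_inv[OF ag f] module_hom_inv[OF ag(2,2) d'])
   then have "f x = d' (f g) \<or> f x = d' (f (\<ominus>\<^bsub>V\<^esub> g))"
    using comm[of g] g fc dc cl(2)[OF g(1)] by auto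
   then show "f x \<in> d' ` C' (Suc q')"
    using g(1) C1(3)[OF g(1)] by (auto simp flip: onto(2))
  next
   assume "f x \<in> d' ` C' (Suc q')"
   then obtain g where g: "g \<in> C (Suc q)" "f x = d' (f g)" by (auto simp flip: onto(2))
   have "f (d (\<ominus>\<^bsub>V\<^esub> g)) = \<ominus>\<^bsub>W\<^esub> f (d g)"
    using cl(2)[OF g(1)] dc by (simp add: module_hom_inv[OF ag f] module_hom_inv[OF ag(1,1) d])
   then obtain g' where g': "g' \<in> C (Suc q)" "f x = f (d g')"
   proof (cases "d' (f g) = f (d g)")
    case True
    then show ?thesis using that[of g] g by simp
   next
    case False
    then have "f x = f (d (\<ominus>\<^bsub>V\<^esub> g))"
     using comm[of g] g \<open>f (d (\<ominus>\<^bsub>V\<^esub> g)) = \<ominus>\<^bsub>W\<^esub> f (d g)\<close> by simp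
    then show ?thesis using that C1(3)[OF g(1)] by blast
   qed
   have "x \<ominus>\<^bsub>V\<^esub> d g' \<in> C q"
    using that dC[OF g'(1)] C0(3,5) by (simp add: a_minus_def)
   moreover have "f (x \<ominus>\<^bsub>V\<^esub> d g') = \<zero>\<^bsub>W\<^esub>"
    using that cl g'(1) dc fc module_hom_diff[OF ag f, of x "d g'"] g'(2)
    by (simp add: W.M.r_neg a_minus_def[of W])
   ultimately have "x \<ominus>\<^bsub>V\<^esub> d g' = \<zero>\<^bsub>V\<^esub>" using inj by blast
   then have "x = d g'"
    using that cl g'(1) dc V.M.minus_eq_zero_iff by simp
   then show "x \<in> d ` C (Suc q)" using g'(1) by blast
  qed
 qed
qed

locale chain_surjection =
 V: module R V + W: module R W
 for R :: "('a, 'k) ring_scheme" and V :: "('a, 'v) module" and W :: "('a, 'w) module" +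
 fixes C :: "nat => 'v set" and d :: "'v => 'v" and C' :: "nat => 'w set" and d' :: "'w => 'w"
  and p :: "'v => 'w"
 assumes sub: "submodule (C q) R V"
  and d_hom: "d \<in> module_hom R V V" and d'_hom: "d' \<in> module_hom R W W"
  and p_hom: "p \<in> module_hom R V W"
  and dC: "x \<in> C (Suc q) ==> d x \<in> C q"
  and dd: "x \<in> carrier V ==> d (d x) = \<zero>\<^bsub>V\<^esub>"
  and pd: "x \<in> carrier V ==> p (d x) = d' (p x)"
  and pC: "p ` C q = C' q"
begin

definition K where "K q = {x \<in> C q. p x = \<zero>\<^bsub>W\<^esub>}"

lemma in_carrier: "x \<in> C q ==> x \<in> carrier V"
 using V.submoduleE(1)[OF sub] by blast

lemma C_closed:
 "x \<in> C q ==> y \<in> C q ==> x \<oplus>\<^bsub>V\<^esub> y \<in> C q"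
 "x \<in> C q ==> y \<in> C q ==> x \<ominus>\<^bsub>V\<^esub> y \<in> C q"
 "r \<in> carrier R ==> x \<in> C q ==> r \<odot>\<^bsub>V\<^esub> x \<in> C q"
 using V.submoduleE[OF sub] by (auto simp: a_minus_def)

lemmas hom_simps =
 module_hom_add[OF d_hom] module_hom_add[OF d'_hom] module_hom_add[OF p_hom]
 module_hom_smult[OF d_hom] module_hom_smult[OF d'_hom] module_hom_smult[OF p_hom]
 module_hom_closed[OF d_hom] module_hom_closed[OF d'_hom] module_hom_closed[OF p_hom]

lemmas d_diff = module_hom_diff[OF V.abelian_group_axioms V.abelian_group_axioms d_hom]
lemmas p_diff = module_hom_diff[OF V.abelian_group_axioms W.abelian_group_axioms p_hom]

text \<open>The connecting homomorphism of \<open>0 \<rightarrow> K \<rightarrow> C \<rightarrow> C' \<rightarrow> 0\<close> as a correspondence: the cycle \<open>p x\<close> is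
  related to the cycle \<open>d x\<close>, for every chain \<open>x\<close> whose image \<open>p x\<close> is a cycle.\<close>

lemma connecting_correspondence:
 assumes ex: "exact_at V C d (Suc q)"
 shows "subquot_iso R W {y \<in> C' (Suc q). d' y = \<zero>\<^bsub>W\<^esub>} (d' ` C' (Suc (Suc q)))
  V (K q \<inter> d ` C (Suc q)) (d ` K (Suc q))"
proof (rule subquot_isoI[of "{(p x, d x) | x. x \<in> C (Suc q) & d' (p x) = \<zero>\<^bsub>W\<^esub>}"])
 let ?\<rho> = "{(p x, d x) | x. x \<in> C (Suc q) & d' (p x) = \<zero>\<^bsub>W\<^esub>}"
 show "Domain ?\<rho> = {y \<in> C' (Suc q). d' y = \<zero>\<^bsub>W\<^esub>}"
  using pC[of "Suc q"] by (auto simp: Domain_unfold)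
 show "Range ?\<rho> = K q \<inter> d ` C (Suc q)"
 proof -
  have [simp]: "p (d x) = d' (p x)" "d x \<in> C q" if "x \<in> C (Suc q)" for x
   using pd[OF in_carrier[OF that]] dC[OF that] by blast+
  show ?thesis by (auto simp: K_def Range_iff)
 qed
 show "(x \<oplus>\<^bsub>W\<^esub> x', y \<oplus>\<^bsub>V\<^esub> y') \<in> ?\<rho>" if "(x, y) \<in> ?\<rho>" "(x', y') \<in> ?\<rho>" for x y x' y'
 proof -
  from that obtain u v where uv: "x = p u" "y = d u" "x' = p v" "y' = d v"
   "u \<in> C (Suc q)" "v \<in> C (Suc q)" "d' (p u) = \<zero>\<^bsub>W\<^esub>" "d' (p v) = \<zero>\<^bsub>W\<^esub>" by blast
  have "u \<oplus>\<^bsub>V\<^esub> v \<in> C (Suc q)" using uv C_closed by blast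
  then show ?thesis
   using uv in_carrier[OF uv(5)] in_carrier[OF uv(6)]
   by (intro CollectI exI[of _ "u \<oplus>\<^bsub>V\<^esub> v"]) (simp add: hom_simps)
 qed
 show "(r \<odot>\<^bsub>W\<^esub> x, r \<odot>\<^bsub>V\<^esub> y) \<in> ?\<rho>" if "r \<in> carrier R" "(x, y) \<in> ?\<rho>" for r x y
 proof -
  from that obtain u where u: "x = p u" "y = d u" "u \<in> C (Suc q)" "d' (p u) = \<zero>\<^bsub>W\<^esub>" by blast
  have "r \<odot>\<^bsub>V\<^esub> u \<in> C (Suc q)" using u C_closed that by blast
  then show ?thesis
   using u in_carrier[OF u(3)] that
   by (intro CollectI exI[of _ "r \<odot>\<^bsub>V\<^esub> u"]) (simp add: hom_simps)
 qed
 show "x \<in> d' ` C' (Suc (Suc q)) \<longleftrightarrow> y \<in> d ` K (Suc q)" if "(x, y) \<in> ?\<rho>" for x y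
 proof -
  from that obtain u where u: "x = p u" "y = d u" "u \<in> C (Suc q)" "d' (p u) = \<zero>\<^bsub>W\<^esub>" by blast
  note uc = in_carrier[OF u(3)]
  show ?thesis
  proof
   assume "x \<in> d' ` C' (Suc (Suc q))"
   then obtain w where w: "w \<in> C (Suc (Suc q))" "x = d' (p w)"
    by (auto simp flip: pC)
   note wc = in_carrier[OF w(1)] and dw = dC[OF w(1)]
   have "p (d w) = p u"
    by (rule trans[OF pd[OF wc]]) (rule trans[OF w(2)[symmetric] u(1)])
   then have "p (u \<ominus>\<^bsub>V\<^esub> d w) = p u \<ominus>\<^bsub>W\<^esub> p u"
    using p_diff[OF uc in_carrier[OF dw]] by metis
   then have "u \<ominus>\<^bsub>V\<^esub> d w \<in> K (Suc q)"
    using C_closed(2)[OF u(3) dw] module_hom_closed[OF p_hom uc]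
    by (simp add: K_def W.r_neg a_minus_def)
   moreover have "d (u \<ominus>\<^bsub>V\<^esub> d w) = d u \<ominus>\<^bsub>V\<^esub> \<zero>\<^bsub>V\<^esub>"
    using d_diff[OF uc in_carrier[OF dw]] dd[OF wc] by metis
   then have "d (u \<ominus>\<^bsub>V\<^esub> d w) = y"
    using u(2) module_hom_closed[OF d_hom uc] by (simp add: V.minus_zero_right)
   ultimately show "y \<in> d ` K (Suc q)" by blast
  next
   assume "y \<in> d ` K (Suc q)"
   then obtain k where k: "k \<in> C (Suc q)" "p k = \<zero>\<^bsub>W\<^esub>" "d u = d k" using u(2) by (auto simp: K_def)
   note kc = in_carrier[OF k(1)]
   have "u \<ominus>\<^bsub>V\<^esub> k \<in> C (Suc q)" "d (u \<ominus>\<^bsub>V\<^esub> k) = \<zero>\<^bsub>V\<^esub>"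
    using C_closed(2)[OF u(3) k(1)] d_diff[OF uc kc] k(3) module_hom_closed[OF d_hom kc]
    by (simp_all add: V.r_neg a_minus_def[of V])
   then obtain w where w: "w \<in> C (Suc (Suc q))" "u \<ominus>\<^bsub>V\<^esub> k = d w"
    using ex unfolding exact_at_def by blast
   have "p u = p (u \<ominus>\<^bsub>V\<^esub> k)"
    using k(2) module_hom_closed[OF p_hom uc] by (simp add: p_diff[OF uc kc] W.minus_zero_right)
   also have "... = d' (p w)" using w in_carrier by (simp add: pd)
   finally show "x \<in> d' ` C' (Suc (Suc q))" using w pC[of "Suc (Suc q)"] u by blast
  qed
 qed
qed

lemma dimension_shift:
 assumes "exact_at V C d q" "exact_at V C d (Suc q)"
 shows "same_homology R W C' d' (Suc q) V K d q"
proof -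
 have "K q \<inter> d ` C (Suc q) = {x \<in> K q. d x = \<zero>\<^bsub>V\<^esub>}"
  using assms(1) dd in_carrier by (auto simp: exact_at_def K_def)
 then show ?thesis
  using connecting_correspondence[OF assms(2)] by (simp add: same_homology_def)
qed

lemma exact_at_bottom:
 assumes "exact_at V C d 0" "!!x. x \<in> C 0 ==> d x = \<zero>\<^bsub>V\<^esub>"
 shows "exact_at W C' d' 0"
proof -
 have "y \<in> d' ` C' (Suc 0)" if "y \<in> C' 0" for y
 proof -
  from that obtain x where x: "x \<in> C 0" "y = p x" using pC[of 0] by blast
  then obtain w where w: "w \<in> C (Suc 0)" "x = d w" using assms by (auto simp: exact_at_def)
  then have "y = d' (p w)" using x in_carrier by (simp add: pd)
  then show ?thesis using w pC[of "Suc 0"] by blast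
 qed
 then show ?thesis by (auto simp: exact_at_def)
qed

end

section \<open>The bar differential\<close>

lemma (in abelian_monoid) finsum_swap_inner:
 assumes "finite A" "finite B" "finite C"
  "!!i j k. i \<in> A ==> j \<in> B ==> k \<in> C ==> F i j k \<in> carrier G"
 shows "(\<Oplus>i\<in>A. \<Oplus>j\<in>B. \<Oplus>k\<in>C. F i j k) = (\<Oplus>i\<in>A. \<Oplus>k\<in>C. \<Oplus>j\<in>B. F i j k)"
proof (rule finsum_cong'[OF refl Pi_I])
 fix i assume "i \<in> A"
 then show "(\<Oplus>j\<in>B. \<Oplus>k\<in>C. F i j k) = (\<Oplus>k\<in>C. \<Oplus>j\<in>B. F i j k)"
  using assms by (intro finsum_swap) auto
 show "(\<Oplus>k\<in>C. \<Oplus>j\<in>B. F i j k) \<in> carrier G"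
  using assms \<open>i \<in> A\<close> by (intro finsum_closed Pi_I) auto
qed

lemma finsum_smult_rdistr:
 assumes "module R V" "finite A" "!!i. i \<in> A ==> f i \<in> carrier R" "x \<in> carrier V"
 shows "finsum R f A \<odot>\<^bsub>V\<^esub> x = (\<Oplus>\<^bsub>V\<^esub>i\<in>A. f i \<odot>\<^bsub>V\<^esub> x)"
proof -
 interpret V: module R V by fact
 show ?thesis
  using assms(2,3)
 proof (induction A rule: finite_induct)
  case (insert a A)
  then have "finsum R f A \<in> carrier R" by (intro V.R.finsum_closed) auto
  then show ?case
   using insert assms(4) by (simp add: V.R.finsum_insert V.M.finsum_insert Pi_def V.smult_l_distr)
 qed (use assms(4) in simp)
qed

locale structure_constants = R: cring R for R :: "('r, 'k) ring_scheme" (structure) +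
 fixes \<D> :: "'d set" and \<mu> :: "'d => 'd => 'd => 'r"
 assumes finite_basis: "finite \<D>"
  and mu_closed: "!!x y z. x \<in> \<D> ==> y \<in> \<D> ==> \<mu> x y z \<in> carrier R"
  and mu_support: "!!x y z. x \<in> \<D> ==> y \<in> \<D> ==> z \<notin> \<D> ==> \<mu> x y z = \<zero>"
  and mu_assoc: "!!u v y z. u \<in> \<D> ==> v \<in> \<D> ==> y \<in> \<D> ==>
   (\<Oplus>w\<in>\<D>. \<mu> u v w \<otimes> \<mu> w y z) = (\<Oplus>w\<in>\<D>. \<mu> v y w \<otimes> \<mu> u w z)"
begin

fun merge :: "('r, 'v) module => ('d list => 'v) => 'd list => 'v" where
 "merge V f [] = \<zero>\<^bsub>V\<^esub>"
| "merge V f (z # zs) =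
  (\<Oplus>\<^bsub>V\<^esub>x\<in>\<D>. \<Oplus>\<^bsub>V\<^esub>y\<in>\<D>. \<mu> x y z \<odot>\<^bsub>V\<^esub> f (x # y # zs)) \<ominus>\<^bsub>V\<^esub> merge V (%ws. f (z # ws)) zs"

context
 fixes V :: "('r, 'v) module"
 assumes V: "module R V"
begin

interpretation V: module R V by (rule V)

lemma sum2_closed:
 "(!!x y. x \<in> \<D> ==> y \<in> \<D> ==> g x y \<in> carrier V) ==> (\<Oplus>\<^bsub>V\<^esub>x\<in>\<D>. \<Oplus>\<^bsub>V\<^esub>y\<in>\<D>. g x y) \<in> carrier V"
 by (intro V.finsum_closed Pi_I) auto

lemma sum2_cong:
 "(!!x y. x \<in> \<D> ==> y \<in> \<D> ==> g x y = h x y) ==>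
  (!!x y. x \<in> \<D> ==> y \<in> \<D> ==> h x y \<in> carrier V) ==>
  (\<Oplus>\<^bsub>V\<^esub>x\<in>\<D>. \<Oplus>\<^bsub>V\<^esub>y\<in>\<D>. g x y) = (\<Oplus>\<^bsub>V\<^esub>x\<in>\<D>. \<Oplus>\<^bsub>V\<^esub>y\<in>\<D>. h x y)"
 by (intro V.finsum_cong' V.finsum_closed Pi_I refl) auto

lemma sum2_add:
 assumes "!!x y. x \<in> \<D> ==> y \<in> \<D> ==> g x y \<in> carrier V" "!!x y. x \<in> \<D> ==> y \<in> \<D> ==> h x y \<in> carrier V"
 shows "(\<Oplus>\<^bsub>V\<^esub>x\<in>\<D>. \<Oplus>\<^bsub>V\<^esub>y\<in>\<D>. g x y \<oplus>\<^bsub>V\<^esub> h x y) =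
  (\<Oplus>\<^bsub>V\<^esub>x\<in>\<D>. \<Oplus>\<^bsub>V\<^esub>y\<in>\<D>. g x y) \<oplus>\<^bsub>V\<^esub> (\<Oplus>\<^bsub>V\<^esub>x\<in>\<D>. \<Oplus>\<^bsub>V\<^esub>y\<in>\<D>. h x y)"
proof -
 have "(\<Oplus>\<^bsub>V\<^esub>x\<in>\<D>. \<Oplus>\<^bsub>V\<^esub>y\<in>\<D>. g x y \<oplus>\<^bsub>V\<^esub> h x y) =
   (\<Oplus>\<^bsub>V\<^esub>x\<in>\<D>. (\<Oplus>\<^bsub>V\<^esub>y\<in>\<D>. g x y) \<oplus>\<^bsub>V\<^esub> (\<Oplus>\<^bsub>V\<^esub>y\<in>\<D>. h x y))"
  using assms by (intro V.finsum_cong' V.finsum_addf Pi_I refl) (auto intro!: V.finsum_closed)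
 also have "... = (\<Oplus>\<^bsub>V\<^esub>x\<in>\<D>. \<Oplus>\<^bsub>V\<^esub>y\<in>\<D>. g x y) \<oplus>\<^bsub>V\<^esub> (\<Oplus>\<^bsub>V\<^esub>x\<in>\<D>. \<Oplus>\<^bsub>V\<^esub>y\<in>\<D>. h x y)"
  using assms by (intro V.finsum_addf Pi_I) (auto intro!: V.finsum_closed)
 finally show ?thesis .
qed

lemma merge_closed: "(!!xs. f xs \<in> carrier V) ==> merge V f ys \<in> carrier V"
 by (induction ys arbitrary: f) (auto intro!: V.M.minus_closed sum2_closed V.smult_closed mu_closed)

lemma merge_add:
 assumes "!!xs. f xs \<in> carrier V" "!!xs. g xs \<in> carrier V"
 shows "merge V (%xs. f xs \<oplus>\<^bsub>V\<^esub> g xs) ys = merge V f ys \<oplus>\<^bsub>V\<^esub> merge V g ys"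
 using assms
proof (induction ys arbitrary: f g)
 case Nil
 then show ?case by simp
next
 case (Cons z zs)
 let ?S = "%f. \<Oplus>\<^bsub>V\<^esub>x\<in>\<D>. \<Oplus>\<^bsub>V\<^esub>y\<in>\<D>. \<mu> x y z \<odot>\<^bsub>V\<^esub> f (x # y # zs)"
 have c: "?S f \<in> carrier V" "?S g \<in> carrier V" "merge V (%ws. f (z # ws)) zs \<in> carrier V"
  "merge V (%ws. g (z # ws)) zs \<in> carrier V"
  using Cons.prems by (auto intro!: sum2_closed merge_closed V.smult_closed mu_closed)
 have "?S (%xs. f xs \<oplus>\<^bsub>V\<^esub> g xs) =
   (\<Oplus>\<^bsub>V\<^esub>x\<in>\<D>. \<Oplus>\<^bsub>V\<^esub>y\<in>\<D>. \<mu> x y z \<odot>\<^bsub>V\<^esub> f (x # y # zs) \<oplus>\<^bsub>V\<^esub> \<mu> x y z \<odot>\<^bsub>V\<^esub> g (x # y # zs))"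
  using Cons.prems by (intro sum2_cong) (auto intro!: V.smult_r_distr V.smult_closed mu_closed)
 also have "... = ?S f \<oplus>\<^bsub>V\<^esub> ?S g"
  using Cons.prems by (intro sum2_add) (auto intro!: V.smult_closed mu_closed)
 finally have "merge V (%xs. f xs \<oplus>\<^bsub>V\<^esub> g xs) (z # zs) = (?S f \<oplus>\<^bsub>V\<^esub> ?S g) \<ominus>\<^bsub>V\<^esub>
   (merge V (%ws. f (z # ws)) zs \<oplus>\<^bsub>V\<^esub> merge V (%ws. g (z # ws)) zs)"
  using Cons.IH[of "%ws. f (z # ws)" "%ws. g (z # ws)"] Cons.prems by simp
 also have "... = (?S f \<ominus>\<^bsub>V\<^esub> merge V (%ws. f (z # ws)) zs) \<oplus>\<^bsub>V\<^esub>
   (?S g \<ominus>\<^bsub>V\<^esub> merge V (%ws. g (z # ws)) zs)"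
  using c by (simp add: a_minus_def V.M.minus_add V.M.a_ac)
 finally show ?case by simp
qed

end

text \<open>The differential commutes with every linear map applied to the coefficients.\<close>

lemma merge_module_hom:
 assumes V: "module R V" and W: "module R W" and h: "h \<in> module_hom R V W" and f: "!!xs. f xs \<in> carrier V"
 shows "h (merge V f ys) = merge W (%xs. h (f xs)) ys"
 using f
proof (induction ys arbitrary: f)
 interpret V: module R V by fact
 interpret W: module R W by fact
 note ag = V.M.abelian_group_axioms W.M.abelian_group_axioms
 case Nil
 show ?case by (simp add: module_hom_zero[OF ag h])
next
 interpret V: module R V by fact
 interpret W: module R W by fact
 note ag = V.M.abelian_group_axioms W.M.abelian_group_axioms
 note hc = module_hom_closed[OF h]
 case (Cons z zs)
 let ?S = "\<Oplus>\<^bsub>V\<^esub>x\<in>\<D>. \<Oplus>\<^bsub>V\<^esub>y\<in>\<D>. \<mu> x y z \<odot>\<^bsub>V\<^esub> f (x # y # zs)"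
 have t: "\<mu> x y z \<odot>\<^bsub>V\<^esub> f (x # y # zs) \<in> carrier V" if "x \<in> \<D>" "y \<in> \<D>" for x y
  using that Cons.prems mu_closed by auto
 have "h ?S = (\<Oplus>\<^bsub>W\<^esub>x\<in>\<D>. h (\<Oplus>\<^bsub>V\<^esub>y\<in>\<D>. \<mu> x y z \<odot>\<^bsub>V\<^esub> f (x # y # zs)))"
  using t by (intro module_hom_finsum[OF ag h] finite_basis V.M.finsum_closed Pi_I)
 also have "... = (\<Oplus>\<^bsub>W\<^esub>x\<in>\<D>. \<Oplus>\<^bsub>W\<^esub>y\<in>\<D>. h (\<mu> x y z \<odot>\<^bsub>V\<^esub> f (x # y # zs)))"
  using t hc
  by (intro W.M.finsum_cong' module_hom_finsum[OF ag h] finite_basis W.M.finsum_closed Pi_I refl) auto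
 also have "... = (\<Oplus>\<^bsub>W\<^esub>x\<in>\<D>. \<Oplus>\<^bsub>W\<^esub>y\<in>\<D>. \<mu> x y z \<odot>\<^bsub>W\<^esub> h (f (x # y # zs)))"
  using Cons.prems mu_closed hc
  by (intro sum2_cong[OF W]) (auto simp: module_hom_smult[OF h])
 finally have "h ?S = (\<Oplus>\<^bsub>W\<^esub>x\<in>\<D>. \<Oplus>\<^bsub>W\<^esub>y\<in>\<D>. \<mu> x y z \<odot>\<^bsub>W\<^esub> h (f (x # y # zs)))" .
 moreover have "?S \<in> carrier V" using t by (intro sum2_closed[OF V])
 ultimately show ?case
  using Cons.IH[of "%ws. f (z # ws)"] Cons.prems
  by (simp add: module_hom_diff[OF ag h] merge_closed[OF V])
qed

lemma smult_module_hom: "module R V ==> r \<in> carrier R ==> (%x. r \<odot>\<^bsub>V\<^esub> x) \<in> module_hom R V V"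
proof -
 assume "module R V" and r: "r \<in> carrier R"
 then interpret V: module R V by blast
 show ?thesis
  by (rule module_homI) (use r in \<open>auto simp: V.smult_r_distr R.m_comm simp flip: V.smult_assoc1\<close>)
qed

lemma merge_hom:
 assumes "module R V"
 shows "merge V \<in> module_hom R (funs V) (funs V)"
 using merge_closed[OF assms] merge_add[OF assms]
  merge_module_hom[OF assms assms smult_module_hom[OF assms]]
 by (intro module_homI) (auto simp: fun_eq_iff)

lemma merge_zero: "module R V ==> merge V (%_. \<zero>\<^bsub>V\<^esub>) = (%_. \<zero>\<^bsub>V\<^esub>)"
 using module_hom_zero[OF module_ab module_ab merge_hom,
   OF funs_is_module funs_is_module] by auto

lemma merge_diff:
 assumes "module R V" "!!xs. f xs \<in> carrier V" "!!xs. g xs \<in> carrier V"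
 shows "merge V (%xs. f xs \<ominus>\<^bsub>V\<^esub> g xs) ys = merge V f ys \<ominus>\<^bsub>V\<^esub> merge V g ys"
proof -
 note F = funs_is_module[OF assms(1), where 's = "'d list"]
 have "(%xs. f xs \<ominus>\<^bsub>V\<^esub> g xs) = f \<ominus>\<^bsub>funs V\<^esub> g"
  using funs_diff[OF assms(1), of f g] assms by auto
 then show ?thesis
  using module_hom_diff[OF module_ab[OF F] module_ab[OF F] merge_hom[OF assms(1)], of f g]
   funs_diff[OF assms(1), of "merge V f" "merge V g" ys] merge_closed[OF assms(1)] assms
  by simp
qed

lemma merge_finsum:
 assumes "module R V" "finite I" "!!i xs. i \<in> I ==> F i xs \<in> carrier V"
 shows "merge V (%xs. \<Oplus>\<^bsub>V\<^esub>i\<in>I. F i xs) ys = (\<Oplus>\<^bsub>V\<^esub>i\<in>I. merge V (F i) ys)"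
proof -
 note F = funs_is_module[OF assms(1), where 's = "'d list"]
 have "(%xs. \<Oplus>\<^bsub>V\<^esub>i\<in>I. F i xs) = finsum (funs V) F I"
  using funs_finsum[OF assms(1,2), of F] assms by auto
 then show ?thesis
  using module_hom_finsum[OF module_ab[OF F] module_ab[OF F] merge_hom[OF assms(1)] assms(2), of F]
   funs_finsum[OF assms(1,2), of "%i. merge V (F i)" ys] merge_closed[OF assms(1)] assms
  by simp
qed

end

section \<open>Chains on lists with prescribed ends\<close>

context structure_constants
begin

definition tensor_lists :: "'d set => 'd set => nat => 'd list set" where
 "tensor_lists X Y q = {xs. set xs \<subseteq> \<D> & length xs = Suc q & hd xs \<in> X & last xs \<in> Y}"

definition right_stable :: "'d set => bool" where
 "right_stable X \<longleftrightarrow> X \<subseteq> \<D> & (\<forall>x\<in>X. \<forall>y\<in>\<D>. \<forall>z. \<mu> x y z ~= \<zero> --> z \<in> X)"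

definition left_stable :: "'d set => bool" where
 "left_stable Y \<longleftrightarrow> Y \<subseteq> \<D> & (\<forall>x\<in>\<D>. \<forall>y\<in>Y. \<forall>z. \<mu> x y z ~= \<zero> --> z \<in> Y)"

lemma right_stableD: "right_stable X ==> x \<in> X ==> y \<in> \<D> ==> \<mu> x y z ~= \<zero> ==> z \<in> X"
 unfolding right_stable_def by blast

lemma left_stableD: "left_stable Y ==> x \<in> \<D> ==> y \<in> Y ==> \<mu> x y z ~= \<zero> ==> z \<in> Y"
 unfolding left_stable_def by blast

definition chains :: "('r, 'v) module => 'd list set => ('d list => 'v) set" where
 "chains V L = {f. (\<forall>xs. f xs \<in> carrier V) & (\<forall>xs. xs \<notin> L --> f xs = \<zero>\<^bsub>V\<^esub>)}"

lemma chains_submodule: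
 assumes "module R V"
 shows "submodule (chains V L) R (funs V)"
proof -
 interpret V: module R V by fact
 show ?thesis
  by (rule module.submoduleI[OF funs_is_module[OF assms]])
   (auto simp: chains_def funs_inv[OF assms])
qed

lemma right_stable_basis: "right_stable \<D>"
 using mu_support by (auto simp: right_stable_def)

lemma merge_vanish:
 assumes V: "module R V" and "!!xs. f xs \<in> carrier V" "!!xs. length xs ~= Suc q ==> f xs = \<zero>\<^bsub>V\<^esub>"
  "length ys ~= q"
 shows "merge V f ys = \<zero>\<^bsub>V\<^esub>"
 using assms(2-4)
proof (induction ys arbitrary: f q)
 interpret V: module R V by fact
 case (Cons z zs)
 have "merge V (%ws. f (z # ws)) zs = \<zero>\<^bsub>V\<^esub>"
 proof (cases q)
  case 0
  then have "(%ws. f (z # ws)) = (%ws. if ws = [] then f [z] else \<zero>\<^bsub>V\<^esub>)"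
   using Cons.prems(2) by (auto simp: fun_eq_iff)
  moreover have "merge V (%ws. if ws = [] then a else \<zero>\<^bsub>V\<^esub>) us = \<zero>\<^bsub>V\<^esub>" for a us
   by (cases us) (simp_all add: merge_zero[OF V] V.M.finsum_zero' mu_closed a_minus_def)
  ultimately show ?thesis by simp
 next
  case (Suc p)
  then show ?thesis using Cons.prems by (intro Cons.IH[of _ p]) auto
 qed
 moreover have "f (x # y # zs) = \<zero>\<^bsub>V\<^esub>" for x y using Cons.prems by simp
 ultimately show ?case by (simp add: V.M.finsum_zero' mu_closed a_minus_def)
qed simp

lemma merge_chains_vanish:
 assumes V: "module R V" and Y: "left_stable Y" and X: "right_stable X"
  and f: "f \<in> chains V (tensor_lists X Y (Suc q))" and ys: "ys \<notin> tensor_lists X Y q"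
 shows "merge V f ys = \<zero>\<^bsub>V\<^esub>"
 using X f ys
proof (induction ys arbitrary: f q X)
 interpret V: module R V by fact
 case (Cons z zs)
 note cl = Cons.prems(2)[unfolded chains_def, simplified]
 have first: "\<mu> x y z \<odot>\<^bsub>V\<^esub> f (x # y # zs) = \<zero>\<^bsub>V\<^esub>" if xy: "x \<in> \<D>" "y \<in> \<D>" for x y
 proof (rule ccontr)
  assume *: "\<mu> x y z \<odot>\<^bsub>V\<^esub> f (x # y # zs) ~= \<zero>\<^bsub>V\<^esub>"
  then have "f (x # y # zs) ~= \<zero>\<^bsub>V\<^esub>" using xy mu_closed by auto
  then have m: "x # y # zs \<in> tensor_lists X Y (Suc q)" using cl by blast
  have mu: "\<mu> x y z ~= \<zero>" using * cl by auto
  then have z: "z \<in> \<D>" using mu_support xy by blast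
  have "z \<in> X" using right_stableD[OF Cons.prems(1) _ xy(2) mu] m by (simp add: tensor_lists_def)
  moreover have "z \<in> Y" if "zs = []"
   using left_stableD[OF Y xy(1) _ mu] m that by (simp add: tensor_lists_def)
  ultimately have "z # zs \<in> tensor_lists X Y q"
   using m z by (auto simp: tensor_lists_def)
  then show False using Cons.prems(3) by blast
 qed
 have "merge V (%ws. f (z # ws)) zs = \<zero>\<^bsub>V\<^esub>"
 proof (cases "z \<in> X")
  case False
  then have "(%ws. f (z # ws)) = (%_. \<zero>\<^bsub>V\<^esub>)" using cl by (auto simp: tensor_lists_def fun_eq_iff)
  then show ?thesis by (simp add: merge_zero[OF V])
 next
  case True
  have "ws \<in> tensor_lists \<D> Y q" if "f (z # ws) ~= \<zero>\<^bsub>V\<^esub>" for ws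
  proof -
   have "z # ws \<in> tensor_lists X Y (Suc q)" using cl that by blast
   moreover from this have "ws ~= []" by (auto simp: tensor_lists_def)
   ultimately show ?thesis using hd_in_set[of ws] by (auto simp: tensor_lists_def)
  qed
  then have fz: "(%ws. f (z # ws)) \<in> chains V (tensor_lists \<D> Y q)"
   using cl by (auto simp: chains_def)
  show ?thesis
  proof (cases q)
   case 0
   then show ?thesis
    using fz by (cases "zs = []") (auto intro!: merge_vanish[OF V, of _ 0] simp: chains_def tensor_lists_def)
  next
   case (Suc p)
   then show ?thesis
   proof (cases "zs \<in> tensor_lists \<D> Y p")
    case zs: True
    then have "z # zs \<in> tensor_lists X Y q"
     using True Cons.prems(1) Suc by (auto simp: tensor_lists_def right_stable_def)
    then show ?thesis using Cons.prems(3) by blast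
   next
    case False
    then show ?thesis using Cons.IH[OF right_stable_basis] fz Suc by blast
   qed
  qed
 qed
 then show ?case by (simp add: V.M.finsum_zero' first a_minus_def)
qed simp

lemma merge_chains:
 assumes "module R V" "left_stable Y" "right_stable X" "f \<in> chains V (tensor_lists X Y (Suc q))"
 shows "merge V f \<in> chains V (tensor_lists X Y q)"
 using merge_chains_vanish[OF assms] merge_closed[OF assms(1)] assms(4) by (auto simp: chains_def)

lemma merge_chains_bottom:
 assumes "module R V" "f \<in> chains V (tensor_lists X Y 0)"
 shows "merge V f = (%_. \<zero>\<^bsub>V\<^esub>)"
proof
 fix ys
 show "merge V f ys = \<zero>\<^bsub>V\<^esub>"
  using assms by (cases "ys = []") (auto intro!: merge_vanish[OF assms(1), of f 0] simp: chains_def tensor_lists_def)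
qed

text \<open>Prepending a tensor factor, chosen linearly in the coefficient, is the contracting homotopy of
  every bar complex below.\<close>

fun prepend :: "('r, 'v) module => ('d => 'v => 'v) => ('d list => 'v) => 'd list => 'v" where
 "prepend V \<sigma> f [] = \<zero>\<^bsub>V\<^esub>"
| "prepend V \<sigma> f (x # xs) = \<sigma> x (f xs)"

lemma merge_prepend:
 assumes "module R V" "\<sigma> z \<in> module_hom R V V" "!!xs. f xs \<in> carrier V"
 shows "merge V (prepend V \<sigma> f) (z # zs) =
  (\<Oplus>\<^bsub>V\<^esub>x\<in>\<D>. \<Oplus>\<^bsub>V\<^esub>y\<in>\<D>. \<mu> x y z \<odot>\<^bsub>V\<^esub> \<sigma> x (f (y # zs))) \<ominus>\<^bsub>V\<^esub> \<sigma> z (merge V f zs)"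
 using merge_module_hom[OF assms(1,1,2), of f zs] assms(3) by simp

end

section \<open>Sums with signs\<close>

lemma (in abelian_group) finsum_antisymmetric:
 assumes "finite B" "!!s t. s \<in> B ==> t \<in> B ==> g s t \<in> carrier G"
  "!!s t. s \<in> B ==> t \<in> B ==> g t s = \<ominus> g s t" "!!s. s \<in> B ==> g s s = \<zero>"
 shows "(\<Oplus>s\<in>B. \<Oplus>t\<in>B. g s t) = \<zero>"
 using assms
proof (induction B rule: finite_induct)
 case empty
 show ?case by (simp add: finsum_empty)
next
 case (insert b B)
 note g = insert.prems(1) and diag = insert.prems(3)
 have inner: "(\<Oplus>t\<in>insert b B. g s t) = g s b \<oplus> (\<Oplus>t\<in>B. g s t)" if "s \<in> insert b B" for s
  using insert.hyps that g by (intro finsum_insert) auto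
 have c: "(\<Oplus>t\<in>B. g s t) \<in> carrier G" if "s \<in> insert b B" for s
  using that g by (intro finsum_closed Pi_I) auto
 have IH: "(\<Oplus>s\<in>B. \<Oplus>t\<in>B. g s t) = \<zero>"
  by (rule insert.IH; (rule insert.prems(1) | rule insert.prems(2) | rule insert.prems(3)); simp)
 have neg: "(\<Oplus>s\<in>B. g s b) \<oplus> (\<Oplus>t\<in>B. g b t) = \<zero>"
 proof -
  have "(\<Oplus>s\<in>B. g s b) \<oplus> (\<Oplus>t\<in>B. g b t) = (\<Oplus>s\<in>B. g s b \<oplus> g b s)"
   using g by (intro finsum_addf[symmetric]) auto
  also have "... = \<zero>"
  proof (rule finsum_zero')
   fix s assume "s \<in> B"
   then have "g b s = \<ominus> g s b" "g s b \<in> carrier G" using insert.prems(2)[of s b] g[of s b] by auto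
   then show "g s b \<oplus> g b s = \<zero>" by (simp add: r_neg)
  qed
  finally show ?thesis .
 qed
 have "(\<Oplus>s\<in>insert b B. \<Oplus>t\<in>insert b B. g s t) =
   (\<Oplus>t\<in>insert b B. g b t) \<oplus> (\<Oplus>s\<in>B. \<Oplus>t\<in>insert b B. g s t)"
  using insert.hyps g by (intro finsum_insert) (auto intro!: finsum_closed)
 also have "(\<Oplus>t\<in>insert b B. g b t) = (\<Oplus>t\<in>B. g b t)"
  using inner[of b] c[of b] diag[of b] by simp
 also have "(\<Oplus>s\<in>B. \<Oplus>t\<in>insert b B. g s t) = (\<Oplus>s\<in>B. g s b \<oplus> (\<Oplus>t\<in>B. g s t))"
  using inner c g by (intro finsum_cong') auto
 also have "... = (\<Oplus>s\<in>B. g s b) \<oplus> (\<Oplus>s\<in>B. \<Oplus>t\<in>B. g s t)"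
  using c g by (intro finsum_addf) auto
 finally show ?case
  using IH neg c g by (simp add: a_comm Pi_def)
qed

definition sign_in :: "('r, 'k) ring_scheme => nat => nat set => 'r" where
 "sign_in R s S = (\<ominus>\<^bsub>R\<^esub> \<one>\<^bsub>R\<^esub>) [^]\<^bsub>R\<^esub> card {t \<in> S. t < s}"

context cring
begin

lemma sign_in_closed [simp]: "sign_in R s S \<in> carrier R"
 by (simp add: sign_in_def)

lemma sign_in_insert:
 assumes "finite S" "t \<notin> S" "s ~= t"
 shows "sign_in R s (insert t S) = (if t < s then \<ominus> sign_in R s S else sign_in R s S)"
proof (cases "t < s")
 case True
 then have "{u \<in> insert t S. u < s} = insert t {u \<in> S. u < s}" by auto
 then have "card {u \<in> insert t S. u < s} = Suc (card {u \<in> S. u < s})" using assms by simp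
 then show ?thesis using True by (simp add: sign_in_def l_minus r_minus)
next
 case False
 then have "{u \<in> insert t S. u < s} = {u \<in> S. u < s}" using assms(3) by auto
 then show ?thesis using False by (simp add: sign_in_def)
qed

lemma sign_in_swap:
 assumes "finite S" "t \<notin> S" "s \<notin> S" "s ~= t"
 shows "sign_in R t S \<otimes> sign_in R s (insert t S) = \<ominus> (sign_in R s S \<otimes> sign_in R t (insert s S))"
 using assms by (cases "t < s") (auto simp: sign_in_insert l_minus r_minus m_comm)

end

text \<open>The simplicial boundary on functions of finite sets of vertices from \<open>{..<N}\<close>.\<close>

definition simplicial :: "('r, 'k) ring_scheme => nat => (nat set => 'r) => nat set => 'r" where
 "simplicial R N v S = (\<Oplus>\<^bsub>R\<^esub>s\<in>{..<N} - S. sign_in R s S \<otimes>\<^bsub>R\<^esub> v (insert s S))"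

context cring
begin

lemma simplicial_closed: "(!!S. v S \<in> carrier R) ==> simplicial R N v S \<in> carrier R"
 unfolding simplicial_def by (intro finsum_closed) auto

lemma simplicial_hom:
 "simplicial R N \<in> module_hom R (funs (regular_module R)) (funs (regular_module R))"
proof (rule module_homI)
 fix v assume v: "v \<in> carrier (funs (regular_module R) :: ('a, nat set => 'a) module)"
 then show "simplicial R N v \<in> carrier (funs (regular_module R))"
  by (simp add: simplicial_closed)
 { fix w assume w: "w \<in> carrier (funs (regular_module R) :: ('a, nat set => 'a) module)"
  show "simplicial R N (v \<oplus>\<^bsub>funs (regular_module R)\<^esub> w) =
    simplicial R N v \<oplus>\<^bsub>funs (regular_module R)\<^esub> simplicial R N w"
  proof
   fix S
   have "simplicial R N (v \<oplus>\<^bsub>funs (regular_module R)\<^esub> w) S =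
    (\<Oplus>s\<in>{..<N} - S. sign_in R s S \<otimes> v (insert s S) \<oplus> sign_in R s S \<otimes> w (insert s S))"
    unfolding simplicial_def using v w by (intro finsum_cong') (auto simp: r_distr)
   also have "... = simplicial R N v S \<oplus> simplicial R N w S"
    unfolding simplicial_def using v w by (intro finsum_addf) auto
   finally show "simplicial R N (v \<oplus>\<^bsub>funs (regular_module R)\<^esub> w) S =
    (simplicial R N v \<oplus>\<^bsub>funs (regular_module R)\<^esub> simplicial R N w) S" by simp
  qed }
 fix r assume r: "r \<in> carrier R"
 show "simplicial R N (r \<odot>\<^bsub>funs (regular_module R)\<^esub> v) =
   r \<odot>\<^bsub>funs (regular_module R)\<^esub> simplicial R N v"
 proof
  fix S
  have "simplicial R N (r \<odot>\<^bsub>funs (regular_module R)\<^esub> v) S =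
   (\<Oplus>s\<in>{..<N} - S. r \<otimes> (sign_in R s S \<otimes> v (insert s S)))"
   unfolding simplicial_def using v r by (intro finsum_cong') (auto simp: m_lcomm)
  also have "... = r \<otimes> simplicial R N v S"
   unfolding simplicial_def using v r by (intro finsum_rdistr[symmetric]) auto
  finally show "simplicial R N (r \<odot>\<^bsub>funs (regular_module R)\<^esub> v) S =
    (r \<odot>\<^bsub>funs (regular_module R)\<^esub> simplicial R N v) S" by simp
 qed
qed

lemma simplicial_simplicial:
 assumes v: "!!S. v S \<in> carrier R" and S: "finite S"
 shows "simplicial R N (simplicial R N v) S = \<zero>"
proof -
 let ?B = "{..<N} - S"
 let ?g = "%s t. if s = t then \<zero> else (sign_in R s S \<otimes> sign_in R t (insert s S)) \<otimes> v (insert t (insert s S))"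
 have "simplicial R N (simplicial R N v) S = (\<Oplus>s\<in>?B. \<Oplus>t\<in>?B. ?g s t)"
  unfolding simplicial_def[of R N "simplicial R N v"]
 proof (rule finsum_cong'[OF refl Pi_I])
  fix s assume s: "s \<in> ?B"
  show "(\<Oplus>t\<in>?B. ?g s t) \<in> carrier R" using v by (intro finsum_closed) auto
  have "sign_in R s S \<otimes> simplicial R N v (insert s S) =
    (\<Oplus>t\<in>{..<N} - insert s S. sign_in R s S \<otimes> (sign_in R t (insert s S) \<otimes> v (insert t (insert s S))))"
   unfolding simplicial_def using v by (intro finsum_rdistr) auto
  also have "... = (\<Oplus>t\<in>{..<N} - insert s S. ?g s t)"
   using v by (intro finsum_cong') (auto simp: m_assoc)
  also have "... = (\<Oplus>t\<in>?B. ?g s t)"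
   using v by (intro finsum_mono_neutral) auto
  finally show "sign_in R s S \<otimes> simplicial R N v (insert s S) = (\<Oplus>t\<in>?B. ?g s t)" .
 qed
 also have "... = \<zero>"
 proof (rule finsum_antisymmetric)
  fix s t assume "s \<in> ?B" "t \<in> ?B"
  then show "?g t s = \<ominus> ?g s t"
   using v sign_in_swap[OF S, of t s]
   by (auto simp: l_minus insert_commute)
 qed (use v in auto)
 finally show ?thesis .
qed

end

section \<open>Bar complexes of right modules\<close>

lemma (in abelian_group) finsum_neg:
 assumes "finite A" "!!i. i \<in> A ==> F i \<in> carrier G"
 shows "(\<Oplus>i\<in>A. \<ominus> F i) = \<ominus> (\<Oplus>i\<in>A. F i)"
 using assms
proof (induction A rule: finite_induct)
 case (insert a A)
 have "(\<Oplus>i\<in>A. F i) \<in> carrier G" using insert.prems by (intro finsum_closed) auto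
 then show ?case using insert by (simp add: finsum_insert Pi_def minus_add)
next
 case empty
 have "\<ominus> \<zero> = \<zero>" using a_inv_eq_zero_iff[OF zero_closed] by blast
 then show ?case unfolding finsum_empty by (rule sym)
qed

context structure_constants
begin

text \<open>A right module over the algebra with structure constants \<open>\<mu>\<close>, given by the action of the basis.\<close>

definition right_rep :: "('r, 'v) module => ('v => 'd => 'v) => bool" where
 "right_rep V act \<longleftrightarrow> module R V & (\<forall>x\<in>\<D>. (%v. act v x) \<in> module_hom R V V) &
   (\<forall>v\<in>carrier V. \<forall>x\<in>\<D>. \<forall>y\<in>\<D>. act (act v x) y = (\<Oplus>\<^bsub>V\<^esub>z\<in>\<D>. \<mu> x y z \<odot>\<^bsub>V\<^esub> act v z))"

definition equivariant ::
  "('r, 'v) module => ('v => 'd => 'v) => ('r, 'w) module => ('w => 'd => 'w) => ('v => 'w) => bool" where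
 "equivariant V act W act' p \<longleftrightarrow> p \<in> module_hom R V W &
   (\<forall>v\<in>carrier V. \<forall>x\<in>\<D>. p (act v x) = act' (p v) x)"

definition bar :: "('r, 'v) module => ('v => 'd => 'v) => ('d list => 'v) => 'd list => 'v" where
 "bar V act f ys = (\<Oplus>\<^bsub>V\<^esub>x\<in>\<D>. act (f (x # ys)) x) \<ominus>\<^bsub>V\<^esub> merge V f ys"

definition bar_lists :: "'d set => nat => 'd list set" where
 "bar_lists Y q = {xs. set xs \<subseteq> \<D> & length xs = q & (xs ~= [] --> last xs \<in> Y)}"

lemma bar_lists_Suc: "Y \<subseteq> \<D> ==> bar_lists Y (Suc q) = tensor_lists \<D> Y q"
 by (auto simp: bar_lists_def tensor_lists_def length_Suc_conv)

lemma equivariant_hom: "equivariant V act W act' p ==> p \<in> module_hom R V W"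
 by (simp add: equivariant_def)

lemma equivariant_act:
 "equivariant V act W act' p ==> v \<in> carrier V ==> x \<in> \<D> ==> p (act v x) = act' (p v) x"
 by (simp add: equivariant_def)

context
 fixes V :: "('r, 'v) module" and act
 assumes rep: "right_rep V act"
begin

lemma rep_module: "module R V"
 using rep by (simp add: right_rep_def)

interpretation V: module R V by (rule rep_module)

lemma act_hom: "x \<in> \<D> ==> (%v. act v x) \<in> module_hom R V V"
 using rep by (simp add: right_rep_def)

lemma act_closed: "x \<in> \<D> ==> v \<in> carrier V ==> act v x \<in> carrier V"
 using module_hom_closed[OF act_hom] .

lemma act_act: "v \<in> carrier V ==> x \<in> \<D> ==> y \<in> \<D> ==>
  act (act v x) y = (\<Oplus>\<^bsub>V\<^esub>z\<in>\<D>. \<mu> x y z \<odot>\<^bsub>V\<^esub> act v z)"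
 using rep unfolding right_rep_def by blast

abbreviation (input) act_sum where
 "act_sum f ys \<equiv> (\<Oplus>\<^bsub>V\<^esub>x\<in>\<D>. act (f (x # ys)) x)"

lemma act_sum_closed: "(!!xs. f xs \<in> carrier V) ==> act_sum f ys \<in> carrier V"
 by (intro V.M.finsum_closed Pi_I act_closed)

lemma bar_closed: "(!!xs. f xs \<in> carrier V) ==> bar V act f ys \<in> carrier V"
 unfolding bar_def by (intro V.M.minus_closed act_sum_closed merge_closed[OF rep_module])

text \<open>Compatibility with linear maps holds for the whole differential when the map is equivariant.\<close>

lemma bar_equivariant:
 assumes rep': "right_rep W act'" and p: "equivariant V act W act' p" and f: "!!xs. f xs \<in> carrier V"
 shows "p (bar V act f ys) = bar W act' (%xs. p (f xs)) ys"
proof -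
 have W: "module R W" using rep' by (simp add: right_rep_def)
 interpret W: module R W by (rule W)
 note ag = V.M.abelian_group_axioms W.M.abelian_group_axioms
 note ph = equivariant_hom[OF p]
 have "p (act_sum f ys) = (\<Oplus>\<^bsub>W\<^esub>x\<in>\<D>. p (act (f (x # ys)) x))"
  using f by (intro module_hom_finsum[OF ag ph] finite_basis act_closed)
 also have "... = (\<Oplus>\<^bsub>W\<^esub>x\<in>\<D>. act' (p (f (x # ys))) x)"
 proof (rule W.M.finsum_cong'[OF refl Pi_I])
  fix x assume x: "x \<in> \<D>"
  then show *: "p (act (f (x # ys)) x) = act' (p (f (x # ys))) x" using equivariant_act[OF p] f by blast
  show "act' (p (f (x # ys))) x \<in> carrier W"
   unfolding *[symmetric] using module_hom_closed[OF ph act_closed[OF x f]] .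
 qed
 finally have first: "p (act_sum f ys) = (\<Oplus>\<^bsub>W\<^esub>x\<in>\<D>. act' (p (f (x # ys))) x)" .
 have "p (bar V act f ys) = p (act_sum f ys) \<ominus>\<^bsub>W\<^esub> p (merge V f ys)"
  unfolding bar_def
  using f by (intro module_hom_diff[OF ag ph] act_sum_closed merge_closed[OF rep_module])
 also have "p (merge V f ys) = merge W (%xs. p (f xs)) ys"
  by (rule merge_module_hom[OF rep_module W ph f])
 finally show ?thesis unfolding first bar_def .
qed

lemma bar_add:
 assumes f: "!!xs. f xs \<in> carrier V" and g: "!!xs. g xs \<in> carrier V"
 shows "bar V act (%xs. f xs \<oplus>\<^bsub>V\<^esub> g xs) ys = bar V act f ys \<oplus>\<^bsub>V\<^esub> bar V act g ys"
proof -
 have "act_sum (%xs. f xs \<oplus>\<^bsub>V\<^esub> g xs) ys = (\<Oplus>\<^bsub>V\<^esub>x\<in>\<D>. act (f (x # ys)) x \<oplus>\<^bsub>V\<^esub> act (g (x # ys)) x)"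
  using f g by (intro V.M.finsum_cong' refl) (auto simp: module_hom_add[OF act_hom] act_closed)
 also have "... = act_sum f ys \<oplus>\<^bsub>V\<^esub> act_sum g ys"
  using f g by (intro V.M.finsum_addf) (auto simp: act_closed)
 finally have "bar V act (%xs. f xs \<oplus>\<^bsub>V\<^esub> g xs) ys =
   (act_sum f ys \<oplus>\<^bsub>V\<^esub> act_sum g ys) \<ominus>\<^bsub>V\<^esub> (merge V f ys \<oplus>\<^bsub>V\<^esub> merge V g ys)"
  unfolding bar_def using merge_add[OF rep_module, of f g ys] f g by simp
 then show ?thesis
  unfolding bar_def a_minus_def
  using act_sum_closed[of f ys] act_sum_closed[of g ys] f g
   merge_closed[OF rep_module, of f ys] merge_closed[OF rep_module, of g ys]
  by (simp add: V.M.minus_add V.M.a_ac)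
qed

lemma bar_smult:
 assumes f: "!!xs. f xs \<in> carrier V" and r: "r \<in> carrier R"
 shows "bar V act (%xs. r \<odot>\<^bsub>V\<^esub> f xs) ys = r \<odot>\<^bsub>V\<^esub> bar V act f ys"
proof -
 have "equivariant V act V act (%v. r \<odot>\<^bsub>V\<^esub> v)"
  using smult_module_hom[OF rep_module r] r
  by (auto simp: equivariant_def module_hom_smult[OF act_hom])
 from bar_equivariant[OF rep this f] show ?thesis by simp
qed

lemma bar_hom: "bar V act \<in> module_hom R (funs V) (funs V)"
 using bar_closed bar_add bar_smult by (intro module_homI) (auto simp: fun_eq_iff)

lemma bar_bar_merge:
 assumes f: "!!xs. f xs \<in> carrier V" and mm: "merge V (merge V f) ys = \<zero>\<^bsub>V\<^esub>"
 shows "bar V act (bar V act f) ys = \<zero>\<^bsub>V\<^esub>"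
proof -
 let ?a = "act_sum f" and ?m = "merge V f"
 note mc = merge_closed[OF rep_module]
 have c: "?a xs \<in> carrier V" "?m xs \<in> carrier V" "bar V act f xs \<in> carrier V" for xs
  using f by (auto intro: act_sum_closed mc bar_closed)
 have barf: "bar V act f = (%xs. ?a xs \<ominus>\<^bsub>V\<^esub> ?m xs)" by (simp add: bar_def fun_eq_iff)
 have act_diff: "act (u \<ominus>\<^bsub>V\<^esub> v) x = act u x \<ominus>\<^bsub>V\<^esub> act v x"
  if "u \<in> carrier V" "v \<in> carrier V" "x \<in> \<D>" for u v x
  using module_hom_diff[OF V.M.abelian_group_axioms V.M.abelian_group_axioms act_hom[OF that(3)] that(1,2)] .
 let ?AA = "\<Oplus>\<^bsub>V\<^esub>y\<in>\<D>. act (?a (y # ys)) y"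
 let ?S = "%z. \<Oplus>\<^bsub>V\<^esub>x\<in>\<D>. \<Oplus>\<^bsub>V\<^esub>y\<in>\<D>. \<mu> x y z \<odot>\<^bsub>V\<^esub> f (x # y # ys)"
 let ?Mz = "%z. merge V (%ws. f (z # ws)) ys"
 have Sc: "?S z \<in> carrier V" for z
  using f mu_closed by (intro sum2_closed[OF rep_module] V.smult_closed) auto
 have Mc: "?Mz z \<in> carrier V" for z using f by (intro mc)
 have AA: "?AA = (\<Oplus>\<^bsub>V\<^esub>z\<in>\<D>. act (?S z) z)"
 proof -
  have "?AA = (\<Oplus>\<^bsub>V\<^esub>y\<in>\<D>. \<Oplus>\<^bsub>V\<^esub>x\<in>\<D>. act (act (f (x # y # ys)) x) y)"
   using f by (intro V.M.finsum_cong'[OF refl Pi_I]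
     module_hom_finsum[OF V.M.abelian_group_axioms V.M.abelian_group_axioms act_hom] finite_basis
     V.M.finsum_closed act_closed Pi_I)
  also have "... = (\<Oplus>\<^bsub>V\<^esub>y\<in>\<D>. \<Oplus>\<^bsub>V\<^esub>x\<in>\<D>. \<Oplus>\<^bsub>V\<^esub>z\<in>\<D>. \<mu> x y z \<odot>\<^bsub>V\<^esub> act (f (x # y # ys)) z)"
   using f mu_closed
   by (intro sum2_cong[OF rep_module] act_act V.M.finsum_closed) (auto simp: act_closed)
  also have "... = (\<Oplus>\<^bsub>V\<^esub>y\<in>\<D>. \<Oplus>\<^bsub>V\<^esub>z\<in>\<D>. \<Oplus>\<^bsub>V\<^esub>x\<in>\<D>. \<mu> x y z \<odot>\<^bsub>V\<^esub> act (f (x # y # ys)) z)"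
   using f mu_closed by (intro V.M.finsum_swap_inner finite_basis) (auto simp: act_closed)
  also have "... = (\<Oplus>\<^bsub>V\<^esub>z\<in>\<D>. \<Oplus>\<^bsub>V\<^esub>y\<in>\<D>. \<Oplus>\<^bsub>V\<^esub>x\<in>\<D>. \<mu> x y z \<odot>\<^bsub>V\<^esub> act (f (x # y # ys)) z)"
   using f mu_closed by (intro V.M.finsum_swap finite_basis V.M.finsum_closed) (auto simp: act_closed)
  also have "... = (\<Oplus>\<^bsub>V\<^esub>z\<in>\<D>. \<Oplus>\<^bsub>V\<^esub>x\<in>\<D>. \<Oplus>\<^bsub>V\<^esub>y\<in>\<D>. \<mu> x y z \<odot>\<^bsub>V\<^esub> act (f (x # y # ys)) z)"
   using f mu_closed by (intro V.M.finsum_swap_inner finite_basis) (auto simp: act_closed)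
  also have "... = (\<Oplus>\<^bsub>V\<^esub>z\<in>\<D>. act (?S z) z)"
  proof (rule V.M.finsum_cong'[OF refl Pi_I])
   fix z assume z: "z \<in> \<D>"
   show "act (?S z) z \<in> carrier V" using act_closed[OF z Sc] .
   have "act (?S z) z = (\<Oplus>\<^bsub>V\<^esub>x\<in>\<D>. act (\<Oplus>\<^bsub>V\<^esub>y\<in>\<D>. \<mu> x y z \<odot>\<^bsub>V\<^esub> f (x # y # ys)) z)"
    using f mu_closed z
    by (intro module_hom_finsum[OF V.M.abelian_group_axioms V.M.abelian_group_axioms act_hom] finite_basis
     V.M.finsum_closed) auto
   also have "... = (\<Oplus>\<^bsub>V\<^esub>x\<in>\<D>. \<Oplus>\<^bsub>V\<^esub>y\<in>\<D>. act (\<mu> x y z \<odot>\<^bsub>V\<^esub> f (x # y # ys)) z)"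
    using f mu_closed z
    by (intro V.M.finsum_cong'[OF refl Pi_I]
      module_hom_finsum[OF V.M.abelian_group_axioms V.M.abelian_group_axioms act_hom] finite_basis
     V.M.finsum_closed Pi_I act_closed) auto
   also have "... = (\<Oplus>\<^bsub>V\<^esub>x\<in>\<D>. \<Oplus>\<^bsub>V\<^esub>y\<in>\<D>. \<mu> x y z \<odot>\<^bsub>V\<^esub> act (f (x # y # ys)) z)"
    using f mu_closed z
    by (intro sum2_cong[OF rep_module]) (auto simp: module_hom_smult[OF act_hom] act_closed)
   finally show "(\<Oplus>\<^bsub>V\<^esub>x\<in>\<D>. \<Oplus>\<^bsub>V\<^esub>y\<in>\<D>. \<mu> x y z \<odot>\<^bsub>V\<^esub> act (f (x # y # ys)) z) = act (?S z) z" by simp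
  qed
  finally show ?thesis .
 qed
 have MA: "merge V ?a ys = (\<Oplus>\<^bsub>V\<^esub>z\<in>\<D>. act (?Mz z) z)"
 proof -
  have "merge V ?a ys = (\<Oplus>\<^bsub>V\<^esub>z\<in>\<D>. merge V (%ws. act (f (z # ws)) z) ys)"
   using f by (intro merge_finsum[OF rep_module finite_basis] act_closed)
  also have "... = (\<Oplus>\<^bsub>V\<^esub>z\<in>\<D>. act (?Mz z) z)"
   using f by (intro V.M.finsum_cong'[OF refl Pi_I] act_closed Mc
     merge_module_hom[OF rep_module rep_module act_hom, symmetric])
  finally show ?thesis .
 qed
 have AM: "(\<Oplus>\<^bsub>V\<^esub>z\<in>\<D>. act (?m (z # ys)) z) \<oplus>\<^bsub>V\<^esub> merge V ?a ys = ?AA"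
 proof -
  have "(\<Oplus>\<^bsub>V\<^esub>z\<in>\<D>. act (?m (z # ys)) z) \<oplus>\<^bsub>V\<^esub> (\<Oplus>\<^bsub>V\<^esub>z\<in>\<D>. act (?Mz z) z) =
    (\<Oplus>\<^bsub>V\<^esub>z\<in>\<D>. act (?m (z # ys)) z \<oplus>\<^bsub>V\<^esub> act (?Mz z) z)"
   by (intro V.M.finsum_addf[symmetric] Pi_I act_closed Mc c)
  also have "... = (\<Oplus>\<^bsub>V\<^esub>z\<in>\<D>. act (?S z) z)"
  proof (rule V.M.finsum_cong'[OF refl Pi_I])
   fix z assume z: "z \<in> \<D>"
   show "act (?S z) z \<in> carrier V" using act_closed[OF z Sc] .
   have "?m (z # ys) = ?S z \<ominus>\<^bsub>V\<^esub> ?Mz z" by simp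
   then have "act (?m (z # ys)) z = act (?S z) z \<ominus>\<^bsub>V\<^esub> act (?Mz z) z"
    using act_diff[OF Sc Mc z] by simp
   then show "act (?m (z # ys)) z \<oplus>\<^bsub>V\<^esub> act (?Mz z) z = act (?S z) z"
    using act_closed[OF z Sc[of z]] act_closed[OF z Mc[of z]]
    by (simp add: a_minus_def V.M.a_assoc V.M.l_neg)
  qed
  finally show ?thesis unfolding AA MA .
 qed
 have "bar V act (bar V act f) ys =
   (\<Oplus>\<^bsub>V\<^esub>y\<in>\<D>. act (?a (y # ys) \<ominus>\<^bsub>V\<^esub> ?m (y # ys)) y) \<ominus>\<^bsub>V\<^esub> merge V (%xs. ?a xs \<ominus>\<^bsub>V\<^esub> ?m xs) ys"
  unfolding bar_def[of V act "bar V act f"] by (simp only: barf)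
 also have "merge V (%xs. ?a xs \<ominus>\<^bsub>V\<^esub> ?m xs) ys = merge V ?a ys \<ominus>\<^bsub>V\<^esub> \<zero>\<^bsub>V\<^esub>"
  using merge_diff[OF rep_module, of ?a ?m ys] mm c(1,2) f by simp
 also have "(\<Oplus>\<^bsub>V\<^esub>y\<in>\<D>. act (?a (y # ys) \<ominus>\<^bsub>V\<^esub> ?m (y # ys)) y) =
   (\<Oplus>\<^bsub>V\<^esub>y\<in>\<D>. act (?a (y # ys)) y \<oplus>\<^bsub>V\<^esub> (%y. \<ominus>\<^bsub>V\<^esub> act (?m (y # ys)) y) y)"
 proof (rule V.M.finsum_cong'[OF refl Pi_I])
  fix y assume y: "y \<in> \<D>"
  show "act (?a (y # ys) \<ominus>\<^bsub>V\<^esub> ?m (y # ys)) y =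
    act (?a (y # ys)) y \<oplus>\<^bsub>V\<^esub> (%y. \<ominus>\<^bsub>V\<^esub> act (?m (y # ys)) y) y"
   using act_diff[OF c(1,2) y] unfolding a_minus_def .
  show "act (?a (y # ys)) y \<oplus>\<^bsub>V\<^esub> (%y. \<ominus>\<^bsub>V\<^esub> act (?m (y # ys)) y) y \<in> carrier V"
   by (intro V.M.a_closed V.M.a_inv_closed act_closed y c)
 qed
 also have "... = ?AA \<oplus>\<^bsub>V\<^esub> (\<Oplus>\<^bsub>V\<^esub>y\<in>\<D>. \<ominus>\<^bsub>V\<^esub> act (?m (y # ys)) y)"
  by (intro V.M.finsum_addf Pi_I V.M.a_inv_closed act_closed c)
 also have "(\<Oplus>\<^bsub>V\<^esub>y\<in>\<D>. \<ominus>\<^bsub>V\<^esub> act (?m (y # ys)) y) = \<ominus>\<^bsub>V\<^esub> (\<Oplus>\<^bsub>V\<^esub>y\<in>\<D>. act (?m (y # ys)) y)"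
  using c by (intro V.M.finsum_neg finite_basis act_closed)
 finally have fin: "bar V act (bar V act f) ys =
   (?AA \<oplus>\<^bsub>V\<^esub> \<ominus>\<^bsub>V\<^esub> (\<Oplus>\<^bsub>V\<^esub>y\<in>\<D>. act (?m (y # ys)) y)) \<ominus>\<^bsub>V\<^esub> (merge V ?a ys \<ominus>\<^bsub>V\<^esub> \<zero>\<^bsub>V\<^esub>)" .
 have cc: "?AA \<in> carrier V" "(\<Oplus>\<^bsub>V\<^esub>y\<in>\<D>. act (?m (y # ys)) y) \<in> carrier V" "merge V ?a ys \<in> carrier V"
  by (intro V.M.finsum_closed Pi_I act_closed c f, assumption?)+ (rule mc, rule c)
 show ?thesis
  unfolding fin AM[symmetric] using cc
  by (simp add: V.M.minus_zero_right a_minus_def V.M.minus_add V.M.a_ac V.M.r_neg V.M.r_neg1 V.M.r_neg2)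
qed

lemma bar_chains:
 assumes Y: "left_stable Y" and f: "f \<in> chains V (bar_lists Y (Suc q))"
 shows "bar V act f \<in> chains V (bar_lists Y q)"
proof -
 have fc: "f xs \<in> carrier V" for xs using f by (auto simp: chains_def)
 have YD: "Y \<subseteq> \<D>" using Y by (simp add: left_stable_def)
 have "bar V act f ys = \<zero>\<^bsub>V\<^esub>" if ys: "ys \<notin> bar_lists Y q" for ys
 proof -
  have "f (x # ys) = \<zero>\<^bsub>V\<^esub>" if x: "x \<in> \<D>" for x
  proof -
   have "x # ys \<notin> bar_lists Y (Suc q)" using ys by (auto simp: bar_lists_def split: if_splits)
   then show ?thesis using f by (auto simp: chains_def)
  qed
  then have "act (f (x # ys)) x = \<zero>\<^bsub>V\<^esub>" if "x \<in> \<D>" for x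
   using that module_hom_zero[OF V.M.abelian_group_axioms V.M.abelian_group_axioms act_hom] by simp
  then have "act_sum f ys = \<zero>\<^bsub>V\<^esub>" by (intro V.M.finsum_zero')
  moreover have "merge V f ys = \<zero>\<^bsub>V\<^esub>"
  proof (cases q)
   case 0
   then have "merge V f = (%_. \<zero>\<^bsub>V\<^esub>)"
    using merge_chains_bottom[OF rep_module, of f \<D> Y] f bar_lists_Suc[OF YD] by simp
   then show ?thesis by simp
  next
   case (Suc p)
   then show ?thesis
    using merge_chains_vanish[OF rep_module Y right_stable_basis, of f p ys] f ys bar_lists_Suc[OF YD] by simp
  qed
  ultimately show ?thesis by (simp add: bar_def a_minus_def)
 qed
 then show ?thesis using bar_closed[OF fc] by (auto simp: chains_def)
qed

lemma bar_chains_bottom: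
 assumes f: "f \<in> chains V (bar_lists Y 0)"
 shows "bar V act f ys = \<zero>\<^bsub>V\<^esub>"
proof -
 have f0: "f xs = \<zero>\<^bsub>V\<^esub>" if "xs ~= []" for xs using f that by (auto simp: chains_def bar_lists_def)
 have "act (f (x # ys)) x = \<zero>\<^bsub>V\<^esub>" if "x \<in> \<D>" for x
  using that f0 module_hom_zero[OF V.M.abelian_group_axioms V.M.abelian_group_axioms act_hom] by simp
 then have "act_sum f ys = \<zero>\<^bsub>V\<^esub>" by (intro V.M.finsum_zero')
 moreover have "merge V f ys = \<zero>\<^bsub>V\<^esub>"
 proof (cases ys)
  case (Cons z zs)
  have "merge V (%ws. f (z # ws)) = merge V (%_. \<zero>\<^bsub>V\<^esub>)" using f0 by (intro arg_cong[of _ _ "merge V"]) auto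
  then show ?thesis using Cons f0 by (simp add: merge_zero[OF rep_module] V.M.finsum_zero' mu_closed a_minus_def)
 qed simp
 ultimately show ?thesis by (simp add: bar_def a_minus_def)
qed

text \<open>A section \<open>v \<mapsto> \<Sum>\<^sub>x \<sigma> x v \<otimes> x\<close> of the action \<open>V \<otimes> A \<rightarrow> V\<close> that is a map of right modules exists for
  projective \<open>V\<close>, and contracts the bar complex.\<close>

lemma bar_exact:
 assumes \<sigma>: "!!x. \<sigma> x \<in> module_hom R V V" and \<sigma>0: "!!x v. x \<notin> \<D> ==> \<sigma> x v = \<zero>\<^bsub>V\<^esub>"
  and retract: "!!v. v \<in> carrier V ==> (\<Oplus>\<^bsub>V\<^esub>x\<in>\<D>. act (\<sigma> x v) x) = v"
  and equi: "!!v y z. v \<in> carrier V ==> y \<in> \<D> ==> z \<in> \<D> ==> \<sigma> z (act v y) = (\<Oplus>\<^bsub>V\<^esub>x\<in>\<D>. \<mu> x y z \<odot>\<^bsub>V\<^esub> \<sigma> x v)"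
 shows "exact_at (funs V) (%q. chains V (bar_lists Y q)) (bar V act) (Suc q)"
 unfolding exact_at_def
proof (rule subsetI)
 fix f assume "f \<in> {f \<in> chains V (bar_lists Y (Suc q)). bar V act f = \<zero>\<^bsub>funs V\<^esub>}"
 then have f: "f \<in> chains V (bar_lists Y (Suc q))" and bf: "!!ys. bar V act f ys = \<zero>\<^bsub>V\<^esub>" by (auto simp: fun_eq_iff)
 have fc: "f xs \<in> carrier V" for xs using f by (auto simp: chains_def)
 note ag = V.M.abelian_group_axioms V.M.abelian_group_axioms
 note \<sigma>c = module_hom_closed[OF \<sigma>]
 define h where "h = prepend V \<sigma> f"
 have hc: "h xs \<in> carrier V" for xs using fc \<sigma>c by (cases xs) (auto simp: h_def)
 have h: "h \<in> chains V (bar_lists Y (Suc (Suc q)))"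
 proof -
  have "xs \<in> bar_lists Y (Suc (Suc q))" if nz: "h xs ~= \<zero>\<^bsub>V\<^esub>" for xs
  proof -
   obtain x ws where xs: "xs = x # ws" using nz by (cases xs) (auto simp: h_def)
   have "x \<in> \<D>" using nz \<sigma>0 xs by (auto simp: h_def)
   moreover have "f ws ~= \<zero>\<^bsub>V\<^esub>" using nz xs module_hom_zero[OF ag \<sigma>] by (auto simp: h_def)
   then have "ws \<in> bar_lists Y (Suc q)" using f by (auto simp: chains_def)
   ultimately show ?thesis by (auto simp: xs bar_lists_def)
  qed
  then show ?thesis using hc by (auto simp: chains_def)
 qed
 have "bar V act h ys = f ys" for ys
 proof -
  have "merge V h ys = \<zero>\<^bsub>V\<^esub>"
  proof (cases ys)
   case (Cons z zs)
   have "merge V h (z # zs) =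
     (\<Oplus>\<^bsub>V\<^esub>x\<in>\<D>. \<Oplus>\<^bsub>V\<^esub>y\<in>\<D>. \<mu> x y z \<odot>\<^bsub>V\<^esub> \<sigma> x (f (y # zs))) \<ominus>\<^bsub>V\<^esub> \<sigma> z (merge V f zs)"
    unfolding h_def by (rule merge_prepend[OF rep_module \<sigma> fc])
   also have "(\<Oplus>\<^bsub>V\<^esub>x\<in>\<D>. \<Oplus>\<^bsub>V\<^esub>y\<in>\<D>. \<mu> x y z \<odot>\<^bsub>V\<^esub> \<sigma> x (f (y # zs))) = \<sigma> z (act_sum f zs)"
   proof (cases "z \<in> \<D>")
    case False
    then show ?thesis using \<sigma>0 mu_support \<sigma>c fc by (simp add: V.M.finsum_zero')
   next
    case True
    have "(\<Oplus>\<^bsub>V\<^esub>x\<in>\<D>. \<Oplus>\<^bsub>V\<^esub>y\<in>\<D>. \<mu> x y z \<odot>\<^bsub>V\<^esub> \<sigma> x (f (y # zs))) =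
      (\<Oplus>\<^bsub>V\<^esub>y\<in>\<D>. \<Oplus>\<^bsub>V\<^esub>x\<in>\<D>. \<mu> x y z \<odot>\<^bsub>V\<^esub> \<sigma> x (f (y # zs)))"
     using fc \<sigma>c mu_closed by (intro V.M.finsum_swap finite_basis) auto
    also have "... = (\<Oplus>\<^bsub>V\<^esub>y\<in>\<D>. \<sigma> z (act (f (y # zs)) y))"
     by (rule V.M.finsum_cong'[OF refl Pi_I])
      (use fc \<sigma>c act_closed in blast, use fc True in \<open>simp add: equi\<close>)
    also have "... = \<sigma> z (act_sum f zs)"
     using fc by (intro module_hom_finsum[OF ag \<sigma>, symmetric] finite_basis act_closed)
    finally show ?thesis .
   qed
   also have "\<sigma> z (act_sum f zs) \<ominus>\<^bsub>V\<^esub> \<sigma> z (merge V f zs) = \<sigma> z (bar V act f zs)"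
    unfolding bar_def using fc
    by (intro module_hom_diff[OF ag \<sigma>, symmetric] act_sum_closed merge_closed[OF rep_module])
   finally show ?thesis using Cons bf module_hom_zero[OF ag \<sigma>] by simp
  qed simp
  then show ?thesis
   using retract[OF fc] fc by (simp add: bar_def h_def V.M.minus_zero_right)
 qed
 then have "bar V act h = f" by auto
 then show "f \<in> bar V act ` chains V (bar_lists Y (Suc (Suc q)))" using h by blast
qed

end

text \<open>The entries of a chain with values in \<open>V\<close> can be read as a chain with values in the right module of
  functions on the basis, and merging then becomes the bar differential of that module. So merging twice gives
  zero by induction on the length.\<close>

lemma merge_merge:
 fixes V :: "('r, 'v) module"
 assumes V: "module R V" and f: "!!xs. f xs \<in> carrier V"
 shows "merge V (merge V f) ys = \<zero>\<^bsub>V\<^esub>"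
 using f
proof (induction ys arbitrary: f)
 case Nil
 show ?case by simp
next
 interpret V: module R V by fact
 case (Cons z zs)
 let ?W = "funs V :: ('r, 'd => 'v) module"
 define act where "act h x = (%z. \<Oplus>\<^bsub>V\<^esub>u\<in>\<D>. \<mu> u x z \<odot>\<^bsub>V\<^esub> h u)" for h x
 have W: "module R ?W" by (rule funs_is_module[OF V])
 have ac: "act h x y \<in> carrier V" if "x \<in> \<D>" "!!u. h u \<in> carrier V" for h x y
  unfolding act_def using that mu_closed by (intro V.M.finsum_closed) auto
 have double: "(\<Oplus>\<^bsub>V\<^esub>u\<in>\<D>. c u \<odot>\<^bsub>V\<^esub> (\<Oplus>\<^bsub>V\<^esub>w\<in>\<D>. k w u \<odot>\<^bsub>V\<^esub> h w)) = (\<Oplus>\<^bsub>V\<^esub>w\<in>\<D>. (\<Oplus>u\<in>\<D>. k w u \<otimes> c u) \<odot>\<^bsub>V\<^esub> h w)"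
  if c: "!!u. u \<in> \<D> ==> c u \<in> carrier R" and k: "!!w u. w \<in> \<D> ==> u \<in> \<D> ==> k w u \<in> carrier R"
   and h: "!!w. h w \<in> carrier V" for c k h
 proof -
  have "(\<Oplus>\<^bsub>V\<^esub>u\<in>\<D>. c u \<odot>\<^bsub>V\<^esub> (\<Oplus>\<^bsub>V\<^esub>w\<in>\<D>. k w u \<odot>\<^bsub>V\<^esub> h w)) = (\<Oplus>\<^bsub>V\<^esub>u\<in>\<D>. \<Oplus>\<^bsub>V\<^esub>w\<in>\<D>. c u \<odot>\<^bsub>V\<^esub> (k w u \<odot>\<^bsub>V\<^esub> h w))"
   using c k h by (intro V.M.finsum_cong'[OF refl Pi_I] V.finsum_smult_ldistr finite_basis V.M.finsum_closed) auto
  also have "... = (\<Oplus>\<^bsub>V\<^esub>u\<in>\<D>. \<Oplus>\<^bsub>V\<^esub>w\<in>\<D>. (k w u \<otimes> c u) \<odot>\<^bsub>V\<^esub> h w)"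
   using c k h by (intro sum2_cong[OF V]) (auto simp: R.m_comm simp flip: V.smult_assoc1)
  also have "... = (\<Oplus>\<^bsub>V\<^esub>w\<in>\<D>. \<Oplus>\<^bsub>V\<^esub>u\<in>\<D>. (k w u \<otimes> c u) \<odot>\<^bsub>V\<^esub> h w)"
   using c k h by (intro V.M.finsum_swap finite_basis) auto
  also have "... = (\<Oplus>\<^bsub>V\<^esub>w\<in>\<D>. (\<Oplus>u\<in>\<D>. k w u \<otimes> c u) \<odot>\<^bsub>V\<^esub> h w)"
   using c k h by (intro V.M.finsum_cong'[OF refl Pi_I] finsum_smult_rdistr[OF V, symmetric] finite_basis
    V.smult_closed R.finsum_closed) auto
  finally show ?thesis .
 qed
 have rep: "right_rep ?W act"
  unfolding right_rep_def
 proof (intro conjI ballI)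
  show "(%h. act h x) \<in> module_hom R ?W ?W" if x: "x \<in> \<D>" for x
  proof (rule module_homI)
   fix h assume h: "h \<in> carrier ?W"
   show "act h x \<in> carrier ?W" using ac[OF x] h by simp
   show "act (h \<oplus>\<^bsub>?W\<^esub> g) x = act h x \<oplus>\<^bsub>?W\<^esub> act g x" if "g \<in> carrier ?W" for g
   proof
    fix y
    have "(\<Oplus>\<^bsub>V\<^esub>u\<in>\<D>. \<mu> u x y \<odot>\<^bsub>V\<^esub> h u) \<oplus>\<^bsub>V\<^esub> (\<Oplus>\<^bsub>V\<^esub>u\<in>\<D>. \<mu> u x y \<odot>\<^bsub>V\<^esub> g u) =
     (\<Oplus>\<^bsub>V\<^esub>u\<in>\<D>. \<mu> u x y \<odot>\<^bsub>V\<^esub> h u \<oplus>\<^bsub>V\<^esub> \<mu> u x y \<odot>\<^bsub>V\<^esub> g u)"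
     using x h that mu_closed by (intro V.M.finsum_addf[symmetric]) auto
    also have "... = act (h \<oplus>\<^bsub>?W\<^esub> g) x y"
     unfolding act_def using x h that mu_closed
     by (intro V.M.finsum_cong'[OF refl Pi_I]) (auto simp: V.smult_r_distr)
    finally show "act (h \<oplus>\<^bsub>?W\<^esub> g) x y = (act h x \<oplus>\<^bsub>?W\<^esub> act g x) y" by (simp add: act_def)
   qed
   show "act (r \<odot>\<^bsub>?W\<^esub> h) x = r \<odot>\<^bsub>?W\<^esub> act h x" if r: "r \<in> carrier R" for r
   proof
    fix y
    have "r \<odot>\<^bsub>V\<^esub> act h x y = (\<Oplus>\<^bsub>V\<^esub>u\<in>\<D>. r \<odot>\<^bsub>V\<^esub> (\<mu> u x y \<odot>\<^bsub>V\<^esub> h u))"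
     unfolding act_def using x h r mu_closed by (intro V.finsum_smult_ldistr finite_basis) auto
    also have "... = act (r \<odot>\<^bsub>?W\<^esub> h) x y"
     unfolding act_def using x h r mu_closed
     by (intro V.M.finsum_cong'[OF refl Pi_I]) (auto simp: R.m_comm simp flip: V.smult_assoc1)
    finally show "act (r \<odot>\<^bsub>?W\<^esub> h) x y = (r \<odot>\<^bsub>?W\<^esub> act h x) y" by simp
   qed
  qed
  fix h x y assume "h \<in> carrier ?W" and x: "x \<in> \<D>" and y: "y \<in> \<D>"
  then have h: "h u \<in> carrier V" for u by simp
  show "act (act h x) y = (\<Oplus>\<^bsub>?W\<^esub>v\<in>\<D>. \<mu> x y v \<odot>\<^bsub>?W\<^esub> act h v)"
  proof
   fix w
   have "act (act h x) y w = (\<Oplus>\<^bsub>V\<^esub>u\<in>\<D>. (\<Oplus>v\<in>\<D>. \<mu> u x v \<otimes> \<mu> v y w) \<odot>\<^bsub>V\<^esub> h u)"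
    unfolding act_def using mu_closed x y h by (intro double) auto
   also have "... = (\<Oplus>\<^bsub>V\<^esub>u\<in>\<D>. (\<Oplus>v\<in>\<D>. \<mu> u v w \<otimes> \<mu> x y v) \<odot>\<^bsub>V\<^esub> h u)"
   proof (rule V.M.finsum_cong'[OF refl Pi_I])
    fix u assume u: "u \<in> \<D>"
    have "(\<Oplus>v\<in>\<D>. \<mu> u v w \<otimes> \<mu> x y v) = (\<Oplus>v\<in>\<D>. \<mu> x y v \<otimes> \<mu> u v w)"
     using mu_closed x y u by (intro R.finsum_cong'[OF refl Pi_I]) (auto simp: R.m_comm)
    then show "(\<Oplus>v\<in>\<D>. \<mu> u x v \<otimes> \<mu> v y w) \<odot>\<^bsub>V\<^esub> h u = (\<Oplus>v\<in>\<D>. \<mu> u v w \<otimes> \<mu> x y v) \<odot>\<^bsub>V\<^esub> h u"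
     using mu_assoc[OF u x y, of w] by simp
    show "(\<Oplus>v\<in>\<D>. \<mu> u v w \<otimes> \<mu> x y v) \<odot>\<^bsub>V\<^esub> h u \<in> carrier V"
     using mu_closed x y u h by (intro V.smult_closed R.finsum_closed) auto
   qed
   also have "... = (\<Oplus>\<^bsub>V\<^esub>v\<in>\<D>. \<mu> x y v \<odot>\<^bsub>V\<^esub> act h v w)"
    unfolding act_def using mu_closed x y h by (intro double[symmetric]) auto
   also have "... = (\<Oplus>\<^bsub>?W\<^esub>v\<in>\<D>. \<mu> x y v \<odot>\<^bsub>?W\<^esub> act h v) w"
    using mu_closed x y h ac by (subst funs_finsum[OF V finite_basis]) auto
   finally show "act (act h x) y w = (\<Oplus>\<^bsub>?W\<^esub>v\<in>\<D>. \<mu> x y v \<odot>\<^bsub>?W\<^esub> act h v) w" .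
  qed
 qed (rule W)
 have mW: "merge ?W g ws y = merge V (%xs. g xs y) ws" if "!!xs. g xs \<in> carrier ?W" for g ws y
  by (rule merge_module_hom[OF W V eval_module_hom that])
 have key: "merge V g (y # ws) = bar ?W act (%ws y. g (y # ws)) ws y" if g: "!!xs. g xs \<in> carrier V" for g ws y
 proof -
  have gW: "(%y. g (y # ws)) \<in> carrier ?W" for ws using g by simp
  have s: "(\<Oplus>\<^bsub>?W\<^esub>x\<in>\<D>. act (%y. g (y # x # ws)) x) \<in> carrier ?W"
   by (rule act_sum_closed[OF rep, of "%ws y. g (y # ws)" ws]) (rule gW)
  have m: "merge ?W (%ws y. g (y # ws)) ws \<in> carrier ?W" by (rule merge_closed[OF W gW])
  have "(\<Oplus>\<^bsub>?W\<^esub>x\<in>\<D>. act (%y. g (y # x # ws)) x) y = (\<Oplus>\<^bsub>V\<^esub>x\<in>\<D>. \<Oplus>\<^bsub>V\<^esub>u\<in>\<D>. \<mu> u x y \<odot>\<^bsub>V\<^esub> g (u # x # ws))"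
   using ac g by (subst funs_finsum[OF V finite_basis]) (auto simp: act_def)
  also have "... = (\<Oplus>\<^bsub>V\<^esub>u\<in>\<D>. \<Oplus>\<^bsub>V\<^esub>x\<in>\<D>. \<mu> u x y \<odot>\<^bsub>V\<^esub> g (u # x # ws))"
   using g mu_closed by (intro V.M.finsum_swap finite_basis) auto
  finally show ?thesis using s m mW[of "%ws y. g (y # ws)" ws y, OF gW] by (simp add: bar_def funs_diff[OF V])
 qed
 let ?F = "%ws y. f (y # ws)"
 have F: "?F ws \<in> carrier ?W" for ws using Cons.prems by simp
 have mF: "merge ?W ?F = (%ws y. merge V (%xs. f (y # xs)) ws)" using mW[of ?F, OF F] by (intro ext) simp
 have "merge V (merge V f) (z # zs) = bar ?W act (%ws y. merge V f (y # ws)) zs z"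
  by (rule key) (rule merge_closed[OF V Cons.prems])
 also have "(%ws y. merge V f (y # ws)) = bar ?W act ?F" using key[OF Cons.prems] by (intro ext) simp
 also have "bar ?W act (bar ?W act ?F) zs = \<zero>\<^bsub>?W\<^esub>"
 proof (rule bar_bar_merge[OF rep F])
  have "merge ?W (merge ?W ?F) zs y = \<zero>\<^bsub>V\<^esub>" for y
   using mW[of "merge ?W ?F" zs y, OF merge_closed[OF W F]] Cons.IH[of "%xs. f (y # xs)"] Cons.prems by (simp add: mF)
  then show "merge ?W (merge ?W ?F) zs = \<zero>\<^bsub>?W\<^esub>" by (simp add: fun_eq_iff)
 qed
 finally show ?case by simp
qed

lemma bar_bar:
 assumes rep: "right_rep V act" and f: "!!xs. f xs \<in> carrier V"
 shows "bar V act (bar V act f) ys = \<zero>\<^bsub>V\<^esub>"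
 by (rule bar_bar_merge[OF rep f merge_merge[OF rep_module[OF rep] f]])

definition bar_chains_in :: "('r, 'v) module => 'v set => 'd set => nat => ('d list => 'v) set" where
 "bar_chains_in V U Y q = {f \<in> chains V (bar_lists Y q). \<forall>xs. f xs \<in> U}"

definition product_with :: "('r, 'v) module => ('v => 'd => 'v) => 'd set => 'v set" where
 "product_with V act Y = {bar V act g [] | g. g \<in> chains V (bar_lists Y (Suc 0))}"

lemma product_with_submodule:
 assumes rep: "right_rep V act"
 shows "submodule (product_with V act Y) R V"
proof -
 note V = rep_module[OF rep]
 have "(%g. bar V act g []) \<in> module_hom R (funs V) V"
  by (rule module_hom_comp[OF bar_hom[OF rep] eval_module_hom])
 from submodule_image[OF funs_is_module[OF V] V this chains_submodule[OF V]]
 have "submodule ((%g. bar V act g []) ` chains V (bar_lists Y (Suc 0))) R V" .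
 moreover have "product_with V act Y = (%g. bar V act g []) ` chains V (bar_lists Y (Suc 0))"
  unfolding product_with_def by blast
 ultimately show ?thesis by simp
qed

lemma lift_chain:
 assumes "module R V" "module R W" "p \<in> module_hom R V W" "g \<in> bar_chains_in W (p ` carrier V) Y q"
 obtains h where "h \<in> chains V (bar_lists Y q)" "!!xs. p (h xs) = g xs"
proof -
 interpret V: module R V by fact
 define h where "h xs = (if g xs = \<zero>\<^bsub>W\<^esub> then \<zero>\<^bsub>V\<^esub> else SOME v. v \<in> carrier V & p v = g xs)" for xs
 have *: "h xs \<in> carrier V & p (h xs) = g xs" for xs
 proof (cases "g xs = \<zero>\<^bsub>W\<^esub>")
  case True
  then show ?thesis
   using module_hom_zero[OF module_ab module_ab, OF assms(1-3)] by (simp add: h_def)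
 next
  case False
  have "g xs \<in> p ` carrier V" using assms(4) by (simp add: bar_chains_in_def)
  then have "\<exists>v. v \<in> carrier V & p v = g xs" by auto
  from someI_ex[OF this] show ?thesis using False by (simp add: h_def)
 qed
 show ?thesis
 proof (rule that)
  have "h xs = \<zero>\<^bsub>V\<^esub>" if "xs \<notin> bar_lists Y q" for xs
   using assms(4) that by (simp add: h_def bar_chains_in_def chains_def)
  then show "h \<in> chains V (bar_lists Y q)" using * by (auto simp: chains_def)
  show "p (h xs) = g xs" for xs using * by blast
 qed
qed

context
 fixes V :: "('r, 'v) module" and act and W :: "('r, 'w) module" and act' and p and Y
 assumes V: "right_rep V act" and W: "right_rep W act'" and p: "equivariant V act W act' p"
  and Y: "left_stable Y"
begin

interpretation V: module R V by (rule rep_module[OF V])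
interpretation W: module R W by (rule rep_module[OF W])

lemma bar_chain_surjection:
 "chain_surjection R (funs V) (funs W) (%q. chains V (bar_lists Y q)) (bar V act)
  (bar_chains_in W (p ` carrier V) Y) (bar W act') (%f xs. p (f xs))"
proof -
 note F = funs_is_module[OF rep_module[OF V], where 's = "'d list"]
 note F' = funs_is_module[OF rep_module[OF W], where 's = "'d list"]
 note ph = equivariant_hom[OF p]
 show ?thesis
 proof (intro chain_surjection.intro[OF F F'] chain_surjection_axioms.intro)
  show "submodule (chains V (bar_lists Y q)) R (funs V)" for q
   by (rule chains_submodule[OF rep_module[OF V]])
  show "bar V act \<in> module_hom R (funs V) (funs V)" by (rule bar_hom[OF V])
  show "bar W act' \<in> module_hom R (funs W) (funs W)" by (rule bar_hom[OF W])
  show "(%f xs. p (f xs)) \<in> module_hom R (funs V) (funs W)"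
   by (rule postcompose_module_hom[OF ph])
  show "bar V act x \<in> chains V (bar_lists Y q)" if "x \<in> chains V (bar_lists Y (Suc q))" for x q
   by (rule bar_chains[OF V Y that])
  show "bar V act (bar V act x) = \<zero>\<^bsub>funs V\<^esub>" if "x \<in> carrier (funs V)" for x
   using bar_bar[OF V, of x] that by (simp add: fun_eq_iff)
  show "(%xs. p (bar V act x xs)) = bar W act' (%xs. p (x xs))" if "x \<in> carrier (funs V)" for x
   using bar_equivariant[OF V W p, of x] that by (simp add: fun_eq_iff)
  show "(%f xs. p (f xs)) ` chains V (bar_lists Y q) = bar_chains_in W (p ` carrier V) Y q" for q
  proof
   show "(%f xs. p (f xs)) ` chains V (bar_lists Y q) \<subseteq> bar_chains_in W (p ` carrier V) Y q"
    using module_hom_closed[OF ph] module_hom_zero[OF V.M.abelian_group_axioms W.M.abelian_group_axioms ph]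
    by (auto simp: bar_chains_in_def chains_def)
   show "bar_chains_in W (p ` carrier V) Y q \<subseteq> (%f xs. p (f xs)) ` chains V (bar_lists Y q)"
   proof
    fix g assume "g \<in> bar_chains_in W (p ` carrier V) Y q"
    then obtain h where h: "h \<in> chains V (bar_lists Y q)" "!!xs. p (h xs) = g xs"
     by (rule lift_chain[OF rep_module[OF V] rep_module[OF W] ph]) blast
    then show "g \<in> (%f xs. p (f xs)) ` chains V (bar_lists Y q)" by (intro rev_image_eqI[of h]) auto
   qed
  qed
 qed
qed

lemma bar_kernel:
 "chain_surjection.K (funs W) (%q. chains V (bar_lists Y q)) (%f xs. p (f xs)) =
  bar_chains_in V {v \<in> carrier V. p v = \<zero>\<^bsub>W\<^esub>} Y"
 unfolding chain_surjection.K_def[OF bar_chain_surjection]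
 by (rule ext) (auto simp: bar_chains_in_def chains_def fun_eq_iff)

lemma bar_shift:
 assumes "!!q. exact_at (funs V) (%q. chains V (bar_lists Y q)) (bar V act) (Suc q)"
 shows "same_homology R (funs W) (bar_chains_in W (p ` carrier V) Y) (bar W act') (Suc (Suc q))
  (funs V) (bar_chains_in V {v \<in> carrier V. p v = \<zero>\<^bsub>W\<^esub>} Y) (bar V act) (Suc q)"
 using chain_surjection.dimension_shift[OF bar_chain_surjection assms assms] unfolding bar_kernel .

lemma bar_first:
 assumes ex: "!!q. exact_at (funs V) (%q. chains V (bar_lists Y q)) (bar V act) (Suc q)"
  and V': "right_rep V' act''" and b: "equivariant V' act'' V act b"
  and im: "b ` carrier V' = {v \<in> carrier V. p v = \<zero>\<^bsub>W\<^esub>}"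
 shows "subquot_iso R V' {z \<in> carrier V'. b z \<in> product_with V act Y}
   {u \<oplus>\<^bsub>V'\<^esub> m | u m. u \<in> carrier V' & b u = \<zero>\<^bsub>V\<^esub> & m \<in> product_with V' act'' Y}
  (funs W) {f \<in> bar_chains_in W (p ` carrier V) Y (Suc 0). bar W act' f = \<zero>\<^bsub>funs W\<^esub>}
   (bar W act' ` bar_chains_in W (p ` carrier V) Y (Suc (Suc 0)))"
proof -
 interpret V': module R V' by (rule rep_module[OF V'])
 note bh = equivariant_hom[OF b]
 note ag = V'.M.abelian_group_axioms V.M.abelian_group_axioms
 let ?Z = "{z \<in> carrier V'. b z \<in> product_with V act Y}"
 let ?B = "{u \<oplus>\<^bsub>V'\<^esub> m | u m. u \<in> carrier V' & b u = \<zero>\<^bsub>V\<^esub> & m \<in> product_with V' act'' Y}"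
 let ?BC = "bar V act ` chains V (bar_lists Y (Suc 0))"
 let ?K = "bar_chains_in V {v \<in> carrier V. p v = \<zero>\<^bsub>W\<^esub>} Y"
 let ?f = "%z xs. if xs = [] then b z else \<zero>\<^bsub>V\<^esub>"
 have conn: "subquot_iso R (funs W)
   {f \<in> bar_chains_in W (p ` carrier V) Y (Suc 0). bar W act' f = \<zero>\<^bsub>funs W\<^esub>}
   (bar W act' ` bar_chains_in W (p ` carrier V) Y (Suc (Suc 0)))
   (funs V) (?K 0 \<inter> ?BC) (bar V act ` ?K (Suc 0))"
  using chain_surjection.connecting_correspondence[OF bar_chain_surjection ex] unfolding bar_kernel .
 have supp: "g = ?f z" if g: "g \<in> chains V (bar_lists Y 0)" "g [] = b z" for g z
 proof
  fix xs show "g xs = ?f z xs" using g by (cases xs) (auto simp: chains_def bar_lists_def)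
 qed
 have fK: "?f z \<in> ?K 0" if "z \<in> carrier V'" for z
 proof -
  have "b z \<in> {v \<in> carrier V. p v = \<zero>\<^bsub>W\<^esub>}" using that im by blast
  moreover have "p \<zero>\<^bsub>V\<^esub> = \<zero>\<^bsub>W\<^esub>"
   by (rule module_hom_zero[OF V.M.abelian_group_axioms W.M.abelian_group_axioms equivariant_hom[OF p]])
  ultimately show ?thesis by (auto simp: bar_chains_in_def chains_def bar_lists_def)
 qed
 have "subquot_iso R V' ?Z
   ?B
   (funs V) (?K 0 \<inter> ?BC) (bar V act ` ?K (Suc 0))"
 proof (rule subquot_iso_map[of ?f])
  show onto: "?f ` ?Z =
    ?K 0 \<inter> ?BC"
  proof
   show "?f ` ?Z \<subseteq>
    ?K 0 \<inter> ?BC"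
   proof (rule image_subsetI)
    fix z assume "z \<in> ?Z"
    then obtain g where z: "z \<in> carrier V'" and g: "g \<in> chains V (bar_lists Y (Suc 0))" "bar V act g [] = b z"
     by (auto simp: product_with_def)
    have "bar V act g = ?f z" by (rule supp[OF bar_chains[OF V Y g(1)] g(2)])
    then show "?f z \<in> ?K 0 \<inter> ?BC"
     by (intro IntI fK[OF z] image_eqI[OF _ g(1)]) (rule sym)
   qed
   show "?K 0 \<inter> ?BC \<subseteq>
    ?f ` ?Z"
   proof
    fix k assume k: "k \<in> ?K 0 \<inter> ?BC"
    then have "k [] \<in> {v \<in> carrier V. p v = \<zero>\<^bsub>W\<^esub>}" by (auto simp: bar_chains_in_def)
    then obtain z where z: "z \<in> carrier V'" "k [] = b z" unfolding im[symmetric] by blast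
    have "k = ?f z" 
     by (rule supp) (use k z(2) in \<open>simp_all add: bar_chains_in_def\<close>)
    moreover obtain g where g: "g \<in> chains V (bar_lists Y (Suc 0))" "k = bar V act g" using k by blast
    have "b z \<in> product_with V act Y"
     unfolding product_with_def using g z(2) by (intro CollectI exI[of _ g]) simp
    ultimately show "k \<in> ?f ` ?Z" using z(1) by blast
   qed
  qed
  note ZE = V'.submoduleE[OF submodule_preimage[OF V'.module_axioms V.module_axioms bh product_with_submodule[OF V]]]
  show "x \<oplus>\<^bsub>V'\<^esub> y \<in> ?Z & ?f (x \<oplus>\<^bsub>V'\<^esub> y) = ?f x \<oplus>\<^bsub>funs V\<^esub> ?f y" if "x \<in> ?Z" "y \<in> ?Z" for x y
   using ZE(5)[OF that] that by (auto simp: module_hom_add[OF bh])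
  show "r \<odot>\<^bsub>V'\<^esub> x \<in> ?Z & ?f (r \<odot>\<^bsub>V'\<^esub> x) = r \<odot>\<^bsub>funs V\<^esub> ?f x" if "r \<in> carrier R" "x \<in> ?Z" for r x
   using ZE(4)[OF that] that by (auto simp: module_hom_smult[OF bh])
  show "z \<in> ?B \<longleftrightarrow>
    ?f z \<in> bar V act ` ?K (Suc 0)"
   if "z \<in> ?Z" for z
  proof
   have z: "z \<in> carrier V'" using that by simp
   { assume "z \<in> ?B"
    then obtain u g where u: "u \<in> carrier V'" "b u = \<zero>\<^bsub>V\<^esub>" and g: "g \<in> chains V' (bar_lists Y (Suc 0))"
     "z = u \<oplus>\<^bsub>V'\<^esub> bar V' act'' g []" by (auto simp: product_with_def)
    have gc: "g xs \<in> carrier V'" for xs using g by (auto simp: chains_def)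
    have bg: "(%xs. b (g xs)) \<in> ?K (Suc 0)"
    proof -
     have "b (g xs) \<in> {v \<in> carrier V. p v = \<zero>\<^bsub>W\<^esub>}" for xs using gc im by blast
     then show ?thesis
      using g(1) module_hom_zero[OF ag bh] by (auto simp: bar_chains_in_def chains_def)
    qed
    have mc: "bar V' act'' g [] \<in> carrier V'" by (rule bar_closed[OF V' gc])
    have "b z = b (bar V' act'' g [])"
     using module_hom_closed[OF bh mc] by (simp add: g(2) module_hom_add[OF bh u(1) mc] u(2))
    then have eq: "bar V act (%xs. b (g xs)) [] = b z"
     using bar_equivariant[OF V' V b, of g "[]"] gc by simp
    have "bar V act (%xs. b (g xs)) \<in> chains V (bar_lists Y 0)"
     using bar_chains[OF V Y] bg by (simp add: bar_chains_in_def)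
    from supp[OF this eq] show "?f z \<in> bar V act ` ?K (Suc 0)" by (intro image_eqI[OF _ bg]) (rule sym) }
   { assume "?f z \<in> bar V act ` ?K (Suc 0)"
    then obtain k where k: "k \<in> ?K (Suc 0)" "?f z = bar V act k" by blast
    from k(1) have "k \<in> bar_chains_in V (b ` carrier V') Y (Suc 0)" unfolding im .
    then obtain g where g: "g \<in> chains V' (bar_lists Y (Suc 0))" "!!xs. b (g xs) = k xs"
     by (rule lift_chain[OF rep_module[OF V'] rep_module[OF V] bh]) blast
    have gc: "g xs \<in> carrier V'" for xs using g by (auto simp: chains_def)
    let ?m = "bar V' act'' g []"
    have mc: "?m \<in> carrier V'" by (rule bar_closed[OF V' gc])
    have "b ?m = bar V act k []" using bar_equivariant[OF V' V b, of g "[]"] gc g(2) by simp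
    also have "... = b z" using fun_cong[OF k(2), of "[]"] by simp
    finally have "b (z \<ominus>\<^bsub>V'\<^esub> ?m) = \<zero>\<^bsub>V\<^esub>"
     using module_hom_closed[OF bh z] by (simp add: module_hom_diff[OF ag bh z mc] V.M.r_neg a_minus_def[of V])
    moreover have "z = (z \<ominus>\<^bsub>V'\<^esub> ?m) \<oplus>\<^bsub>V'\<^esub> ?m"
     using z mc by (simp add: a_minus_def V'.M.a_assoc V'.M.l_neg)
    moreover have "?m \<in> product_with V' act'' Y" using g(1) by (auto simp: product_with_def)
    ultimately show "z \<in> ?B"
     using z mc by blast }
  qed
 qed
 with conn show ?thesis
  by (meson subquot_iso_sym subquot_iso_trans)
qed

end

text \<open>Dimension shifting along a resolution \<open>\<dots> \<rightarrow> V 1 \<rightarrow> V 0 \<rightarrow> W \<rightarrow> 0\<close> whose terms have exact bar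
  complexes.\<close>

theorem resolution_homology:
 fixes V :: "nat => ('r, 'v) module" and W :: "('r, 'w) module"
 assumes V: "!!j. right_rep (V j) (act j)" and W: "right_rep W act'" and Y: "left_stable Y"
  and b: "!!j. equivariant (V (Suc j)) (act (Suc j)) (V j) (act j) (b j)"
  and e: "equivariant (V 0) (act 0) W act' e" and surj: "e ` carrier (V 0) = carrier W"
  and im0: "b 0 ` carrier (V (Suc 0)) = {v \<in> carrier (V 0). e v = \<zero>\<^bsub>W\<^esub>}"
  and im: "!!j. b (Suc j) ` carrier (V (Suc (Suc j))) = {v \<in> carrier (V (Suc j)). b j v = \<zero>\<^bsub>V j\<^esub>}"
  and ex: "!!j q. exact_at (funs (V j)) (%q. chains (V j) (bar_lists Y q)) (bar (V j) (act j)) (Suc q)"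
 shows "subquot_iso R (V (Suc i)) {z \<in> carrier (V (Suc i)). b i z \<in> product_with (V i) (act i) Y}
   {u \<oplus>\<^bsub>V (Suc i)\<^esub> m | u m. u \<in> carrier (V (Suc i)) & b i u = \<zero>\<^bsub>V i\<^esub> & m \<in> product_with (V (Suc i)) (act (Suc i)) Y}
  (funs W) {f \<in> chains W (bar_lists Y (Suc i)). bar W act' f = \<zero>\<^bsub>funs W\<^esub>}
   (bar W act' ` chains W (bar_lists Y (Suc (Suc i))))"
proof -
 define Z where "Z j = b j ` carrier (V (Suc j))" for j
 have WW: "bar_chains_in W (e ` carrier (V 0)) Y q = chains W (bar_lists Y q)" for q
  unfolding surj by (auto simp: bar_chains_in_def chains_def)
 have Z: "subquot_iso R (V (Suc (Suc (j + i))))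
   {z \<in> carrier (V (Suc (Suc (j + i)))). b (Suc (j + i)) z \<in> product_with (V (Suc (j + i))) (act (Suc (j + i))) Y}
   {u \<oplus>\<^bsub>V (Suc (Suc (j + i)))\<^esub> m | u m. u \<in> carrier (V (Suc (Suc (j + i)))) & b (Suc (j + i)) u = \<zero>\<^bsub>V (Suc (j + i))\<^esub> &
     m \<in> product_with (V (Suc (Suc (j + i)))) (act (Suc (Suc (j + i)))) Y}
   (funs (V j)) {f \<in> bar_chains_in (V j) (Z j) Y (Suc i). bar (V j) (act j) f = \<zero>\<^bsub>funs (V j)\<^esub>}
   (bar (V j) (act j) ` bar_chains_in (V j) (Z j) Y (Suc (Suc i)))" for j i
 proof (induction i arbitrary: j)
  case 0
  show ?case
   unfolding Z_def using bar_first[OF V V b Y ex V b im] by simp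
 next
  case (Suc i)
  have "same_homology R (funs (V j)) (bar_chains_in (V j) (Z j) Y) (bar (V j) (act j)) (Suc (Suc i))
    (funs (V (Suc j))) (bar_chains_in (V (Suc j)) (Z (Suc j)) Y) (bar (V (Suc j)) (act (Suc j))) (Suc i)"
   using bar_shift[OF V V b Y ex] unfolding Z_def im .
  from subquot_iso_trans[OF Suc.IH[of "Suc j"] subquot_iso_sym[OF this[unfolded same_homology_def]]]
  show ?case by simp
 qed
 show ?thesis
 proof (cases i)
  case 0
  then show ?thesis using bar_first[OF V W e Y ex V b im0] by (simp add: WW)
 next
  case (Suc k)
  have "same_homology R (funs W) (bar_chains_in W (e ` carrier (V 0)) Y) (bar W act') (Suc (Suc k))
    (funs (V 0)) (bar_chains_in (V 0) (Z 0) Y) (bar (V 0) (act 0)) (Suc k)"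
   using bar_shift[OF V W e Y ex] unfolding Z_def im0 .
  from subquot_iso_trans[OF Z[of 0 k] subquot_iso_sym[OF this[unfolded same_homology_def]]]
  show ?thesis by (simp add: Suc WW)
 qed
qed

end

section \<open>The resolution by cups\<close>

lemma same_homology_refl:
 assumes V: "module R V" and sub: "submodule (C q) R V" and d: "d \<in> module_hom R V V"
 shows "same_homology R V C d q V C d q"
proof -
 interpret V: module R V by fact
 note C = V.submoduleE[OF sub]
 have "x \<in> carrier V" if "x \<in> C q" for x using C(1) that by blast
 then show ?thesis
  unfolding same_homology_def
  by (intro subquot_iso_map[where f = id])
   (auto simp: C module_hom_add[OF d] module_hom_smult[OF d])
qed

locale cup_algebra = structure_constants R \<D> \<mu>
 for R :: "('r, 'k) ring_scheme" (structure) and \<D> :: "'d set" and \<mu> +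
 fixes I :: "'d set" and cups :: "'d => nat set" and N n :: nat and c :: "nat set"
 assumes n_pos: "n \<ge> 1"
  and I_right: "right_stable I"
  and cups_bounded: "!!x. x \<in> I ==> cups x \<subseteq> {..<N}"
  and cups_nonempty: "!!x. x \<in> I ==> cups x ~= {}"
  and cups_mono: "!!x y z. x \<in> I ==> y \<in> \<D> ==> \<mu> x y z ~= \<zero> ==> cups x \<subseteq> cups z"
  and generator: "!!S x. x \<in> I ==> S \<subseteq> cups x ==> S ~= {} ==> card S < n ==>
   \<exists>e. (\<forall>x\<in>\<D>. e x \<in> carrier R & (e x ~= \<zero> --> x \<in> I & S \<subseteq> cups x)) &
    (\<forall>y\<in>I. S \<subseteq> cups y --> (\<forall>z\<in>\<D>. (\<Oplus>x\<in>\<D>. e x \<otimes> \<mu> x y z) = (if z = y then \<one> else \<zero>)))"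
  and card_cups: "!!x S. x \<in> I ==> S \<subseteq> cups x ==> card S \<le> n"
  and card_top: "card c = n"
  and top_unique: "!!x S. x \<in> I ==> S \<subseteq> cups x ==> card S = n ==> S = c"
begin

abbreviation V1 :: "('r, 'r) module" where "V1 \<equiv> regular_module R"
abbreviation V0 :: "('r, nat set => 'r) module" where "V0 \<equiv> funs V1"

lemma V1: "module R V1" by (rule regular_module_is_module) (rule R.is_cring)
lemma V0: "module R V0" by (rule funs_is_module) (rule V1)

definition with_cups :: "nat set => 'd set" where "with_cups S = {x \<in> I. S \<subseteq> cups x}"

lemma with_cups_right: "right_stable (with_cups S)"
 unfolding right_stable_def
proof (intro conjI ballI allI impI)
 show "with_cups S \<subseteq> \<D>" using I_right by (auto simp: with_cups_def right_stable_def)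
 fix x y z assume *: "x \<in> with_cups S" "y \<in> \<D>" "\<mu> x y z ~= \<zero>"
 then have x: "x \<in> I" "S \<subseteq> cups x" by (auto simp: with_cups_def)
 have "z \<in> I" by (rule right_stableD[OF I_right x(1) *(2,3)])
 moreover have "S \<subseteq> cups z" using cups_mono[OF x(1) *(2,3)] x(2) by blast
 ultimately show "z \<in> with_cups S" by (simp add: with_cups_def)
qed

lemma with_cups_empty: "with_cups {} = I"
 by (simp add: with_cups_def)

lemma finite_cups: "x \<in> I ==> finite (cups x)"
 using cups_bounded finite_subset by blast

definition resolution :: "'d set => nat => nat => ('d list => nat set => 'r) set" where
 "resolution Y k q = {f. (\<forall>xs S. f xs S \<in> carrier R) &
   (\<forall>xs S. f xs S ~= \<zero> --> xs \<in> tensor_lists I Y q & S \<subseteq> cups (hd xs) & card S = k)}"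

abbreviation nerve :: "('d list => nat set => 'r) => 'd list => nat set => 'r" where
 "nerve f \<equiv> %xs. simplicial R N (f xs)"

definition nerve_cycles :: "'d set => nat => nat => ('d list => nat set => 'r) set" where
 "nerve_cycles Y k q = {f \<in> resolution Y k q. nerve f = (%xs S. \<zero>)}"

lemma nerve_hom: "nerve \<in> module_hom R (funs V0) (funs V0)"
 by (rule postcompose_module_hom[OF R.simplicial_hom])

lemma resolutionD:
 assumes "f \<in> resolution Y k q"
 shows "f xs S \<in> carrier R"
  "f xs S ~= \<zero> ==> xs \<in> tensor_lists I Y q"
  "f xs S ~= \<zero> ==> hd xs \<in> I"
  "f xs S ~= \<zero> ==> S \<subseteq> cups (hd xs)"
  "f xs S ~= \<zero> ==> card S = k"
  "f xs S ~= \<zero> ==> finite S"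
proof -
 note * = assms[unfolded resolution_def mem_Collect_eq]
 show "f xs S \<in> carrier R" using * by blast
 show "xs \<in> tensor_lists I Y q" "hd xs \<in> I" "S \<subseteq> cups (hd xs)" "card S = k" "finite S" if "f xs S ~= \<zero>"
 proof -
  have **: "xs \<in> tensor_lists I Y q & S \<subseteq> cups (hd xs) & card S = k" using * that by blast
  then show "xs \<in> tensor_lists I Y q" "hd xs \<in> I" "S \<subseteq> cups (hd xs)" "card S = k"
   by (auto simp: tensor_lists_def)
  then show "finite S" using finite_cups finite_subset by blast
 qed
qed

lemma resolutionI:
 assumes "!!xs S. f xs S \<in> carrier R"
  "!!xs S. f xs S ~= \<zero> ==> xs \<in> tensor_lists I Y q & S \<subseteq> cups (hd xs) & card S = k"
 shows "f \<in> resolution Y k q"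
 unfolding resolution_def using assms by blast

lemma resolution_submodule: "submodule (resolution Y k q) R (funs V0)"
proof (rule module.submoduleI[OF funs_is_module[OF V0]])
 show "resolution Y k q \<subseteq> carrier (funs V0)" using resolutionD(1) by auto
 show "\<zero>\<^bsub>funs V0\<^esub> \<in> resolution Y k q" by (auto intro: resolutionI)
 fix f assume f: "f \<in> resolution Y k q"
 have neg: "(\<ominus>\<^bsub>funs V0\<^esub> f) xs S = \<ominus> f xs S" for xs S
  using resolutionD(1)[OF f] by (simp add: funs_inv[OF V0] funs_inv[OF V1])
 show "\<ominus>\<^bsub>funs V0\<^esub> f \<in> resolution Y k q"
 proof (intro resolutionI)
  fix xs S
  show "(\<ominus>\<^bsub>funs V0\<^esub> f) xs S \<in> carrier R" using neg resolutionD(1)[OF f] by simp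
  assume "(\<ominus>\<^bsub>funs V0\<^esub> f) xs S ~= \<zero>"
  then have "f xs S ~= \<zero>" unfolding neg by auto
  from resolutionD(2,4,5)[OF f this] show "xs \<in> tensor_lists I Y q & S \<subseteq> cups (hd xs) & card S = k"
   by blast
 qed
 show "r \<odot>\<^bsub>funs V0\<^esub> f \<in> resolution Y k q" if "r \<in> carrier R" for r
 proof (intro resolutionI)
  fix xs S
  show "(r \<odot>\<^bsub>funs V0\<^esub> f) xs S \<in> carrier R" using that resolutionD(1)[OF f] by simp
  assume "(r \<odot>\<^bsub>funs V0\<^esub> f) xs S ~= \<zero>"
  then have "f xs S ~= \<zero>" using that by auto
  from resolutionD(2,4,5)[OF f this] show "xs \<in> tensor_lists I Y q & S \<subseteq> cups (hd xs) & card S = k"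
   by blast
 qed
 fix g assume g: "g \<in> resolution Y k q"
 show "f \<oplus>\<^bsub>funs V0\<^esub> g \<in> resolution Y k q"
 proof (rule resolutionI)
  fix xs S assume "(f \<oplus>\<^bsub>funs V0\<^esub> g) xs S ~= \<zero>"
  then consider "f xs S ~= \<zero>" | "g xs S ~= \<zero>" by fastforce
  then show "xs \<in> tensor_lists I Y q & S \<subseteq> cups (hd xs) & card S = k"
   by cases (use resolutionD(2,4,5)[OF f, of xs S] resolutionD(2,4,5)[OF g, of xs S] in blast)+
 qed (use resolutionD(1)[OF f] resolutionD(1)[OF g] in auto)
qed

lemma merge_eval:
 assumes "!!xs S. f xs S \<in> carrier R"
 shows "merge V0 f ys S = merge V1 (%xs. f xs S) ys"
 by (rule merge_module_hom[OF V0 V1 eval_module_hom]) (use assms in simp)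

lemma resolution_eval:
 assumes "f \<in> resolution Y k q"
 shows "(%xs. f xs S) \<in> chains V1 (tensor_lists (with_cups S) Y q)"
proof -
 have "xs \<in> tensor_lists (with_cups S) Y q" if "f xs S ~= \<zero>" for xs
  using resolutionD(2-4)[OF assms that] by (simp add: tensor_lists_def with_cups_def)
 then show ?thesis using resolutionD(1)[OF assms] by (auto simp: chains_def)
qed

lemma merge_resolution:
 assumes Y: "left_stable Y" and f: "f \<in> resolution Y k (Suc q)"
 shows "merge V0 f \<in> resolution Y k q"
proof (rule resolutionI)
 note fc = resolutionD(1)[OF f]
 fix ys S
 show "merge V0 f ys S \<in> carrier R"
  using merge_closed[OF V1, of "%xs. f xs S"] fc by (simp add: merge_eval)
 assume "merge V0 f ys S ~= \<zero>"
 then have nz: "merge V1 (%xs. f xs S) ys ~= \<zero>" using fc by (simp add: merge_eval)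
 then have "ys \<in> tensor_lists (with_cups S) Y q"
  using merge_chains_vanish[OF V1 Y with_cups_right resolution_eval[OF f]] by auto
 then have "ys \<in> tensor_lists I Y q & S \<subseteq> cups (hd ys)"
  by (auto simp: tensor_lists_def with_cups_def)
 moreover have "card S = k"
 proof (rule ccontr)
  assume "card S ~= k"
  then have "(%xs. f xs S) = (%xs. \<zero>)" using resolutionD(5)[OF f] by blast
  then show False using nz merge_zero[OF V1] by simp
 qed
 ultimately show "ys \<in> tensor_lists I Y q & S \<subseteq> cups (hd ys) & card S = k" by blast
qed

lemma merge_resolution_bottom:
 assumes "f \<in> resolution Y k 0"
 shows "merge V0 f = (%xs S. \<zero>)"
proof (intro ext)
 fix ys S
 have "merge V1 (%xs. f xs S) = (%_. \<zero>\<^bsub>V1\<^esub>)"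
  by (rule merge_chains_bottom[OF V1 resolution_eval[OF assms]])
 then show "merge V0 f ys S = \<zero>" using resolutionD(1)[OF assms] by (simp add: merge_eval)
qed

lemma nerve_merge:
 assumes "!!xs S. f xs S \<in> carrier R"
 shows "nerve (merge V0 f) = merge V0 (nerve f)"
 by (rule ext, rule merge_module_hom[OF V0 V0 R.simplicial_hom]) (use assms in simp)

lemma nerve_resolution:
 assumes f: "f \<in> resolution Y (Suc k) q"
 shows "nerve f \<in> nerve_cycles Y k q"
proof -
 note fD = resolutionD[OF f]
 have res: "nerve f \<in> resolution Y k q"
 proof (rule resolutionI)
  fix xs S
  show "nerve f xs S \<in> carrier R" using fD(1) by (intro R.simplicial_closed)
  assume "nerve f xs S ~= \<zero>"
  have "\<exists>s\<in>{..<N} - S. sign_in R s S \<otimes> f xs (insert s S) ~= \<zero>"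
  proof (rule ccontr)
   assume "\<not> ?thesis"
   then have "nerve f xs S = \<zero>" unfolding simplicial_def by (intro R.finsum_zero') blast
   then show False using \<open>nerve f xs S ~= \<zero>\<close> by blast
  qed
  then obtain s where s: "s \<in> {..<N} - S" "sign_in R s S \<otimes> f xs (insert s S) ~= \<zero>" by blast
  then have "f xs (insert s S) ~= \<zero>" by auto
  from fD(2-)[OF this] s(1) show "xs \<in> tensor_lists I Y q & S \<subseteq> cups (hd xs) & card S = k" by auto
 qed
 have "simplicial R N (nerve f xs) S = \<zero>" for xs S
 proof (cases "finite S")
  case True
  then show ?thesis using fD(1) by (intro R.simplicial_simplicial)
 next
  case False
  then have "nerve f xs (insert s S) = \<zero>" for s using resolutionD(6)[OF res] by (metis finite_insert)
  then show ?thesis unfolding simplicial_def[of R N "nerve f xs"] by (intro R.finsum_zero') simp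
 qed
 then show ?thesis using res by (simp add: nerve_cycles_def fun_eq_iff)
qed

text \<open>The nonempty subsets of \<open>cups (hd xs)\<close> form a full simplex, which is contracted onto the least
  cup.\<close>

lemma nerve_exact:
 assumes f: "f \<in> nerve_cycles Y k q"
 shows "f \<in> nerve ` resolution Y (Suc k) q"
proof -
 have fr: "f \<in> resolution Y k q" and f0: "!!xs S. simplicial R N (f xs) S = \<zero>"
  using f by (auto simp: nerve_cycles_def fun_eq_iff)
 note fD = resolutionD[OF fr]
 define v where "v xs = Min (cups (hd xs))" for xs
 have v: "v xs \<in> cups (hd xs)" "v xs < N" "!!s. s \<in> cups (hd xs) ==> v xs \<le> s" if "hd xs \<in> I" for xs
 proof -
  show *: "v xs \<in> cups (hd xs)"
   unfolding v_def by (rule Min_in[OF finite_cups[OF that] cups_nonempty[OF that]])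
  then show "v xs < N" using cups_bounded[OF that] by blast
  show "v xs \<le> s" if "s \<in> cups (hd xs)" for s
   using that finite_cups[OF \<open>hd xs \<in> I\<close>] by (simp add: v_def)
 qed
 define g where "g xs S = (if v xs \<in> S then f xs (S - {v xs}) else \<zero>)" for xs S
 have g: "g \<in> resolution Y (Suc k) q"
 proof (rule resolutionI)
  fix xs S
  show "g xs S \<in> carrier R" using fD(1) by (simp add: g_def)
  assume "g xs S ~= \<zero>"
  then have vS: "v xs \<in> S" and nz: "f xs (S - {v xs}) ~= \<zero>" by (auto simp: g_def split: if_splits)
  have "S \<subseteq> cups (hd xs)" using fD(4)[OF nz] v(1)[OF fD(3)[OF nz]] by blast
  moreover have "card S = Suc (card (S - {v xs}))"
   by (rule card.remove) (use vS fD(6)[OF nz] in auto)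
  then have "card S = Suc k" using fD(5)[OF nz] by simp
  ultimately show "xs \<in> tensor_lists I Y q & S \<subseteq> cups (hd xs) & card S = Suc k"
   using fD(2)[OF nz] by blast
 qed
 have "simplicial R N (g xs) S = f xs S" for xs S
 proof (cases "xs \<in> tensor_lists I Y q")
  case False
  then have "f xs T = \<zero>" for T using fD(2) by blast
  then show ?thesis by (auto simp: simplicial_def g_def intro!: R.finsum_zero')
 next
  case True
  then have x: "hd xs \<in> I" by (simp add: tensor_lists_def)
  let ?v = "v xs"
  have sgn: "sign_in R ?v T \<otimes> f xs S = f xs S" if "T \<subseteq> S" for T
  proof (cases "f xs S = \<zero>")
   case False
   then have none: "{t \<in> T. t < ?v} = {}" using that fD(4)[OF False] v(3)[OF x] by fastforce
   show ?thesis using fD(1)[of xs S] unfolding sign_in_def none by simp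
  qed simp
  show ?thesis
  proof (cases "?v \<in> S")
   case False
   have "simplicial R N (g xs) S = sign_in R ?v S \<otimes> g xs (insert ?v S)"
    unfolding simplicial_def
    by (rule R.finsum_single) (use False v[OF x] fD(1) in \<open>auto simp: g_def\<close>)
   also have "... = f xs S" using False sgn[of S] by (simp add: g_def)
   finally show ?thesis .
  next
   case vS: True
   define T where "T = S - {?v}"
   define rest where "rest = (\<Oplus>s\<in>{..<N} - S. sign_in R s T \<otimes> f xs (insert s T))"
   have ST: "S = insert ?v T" "?v \<notin> T" using vS by (auto simp: T_def)
   have rc: "rest \<in> carrier R" unfolding rest_def using fD(1) by (intro R.finsum_closed) auto
   have "{..<N} - T = insert ?v ({..<N} - S)" using v(2)[OF x] vS by (auto simp: T_def)
   then have "simplicial R N (f xs) T = sign_in R ?v T \<otimes> f xs S \<oplus> rest"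
    unfolding simplicial_def rest_def using vS fD(1)
    by (simp add: R.finsum_insert Pi_def ST(1)[symmetric])
   then have zero: "f xs S \<oplus> rest = \<zero>" using sgn[of T] f0[of xs T] T_def by auto
   have "simplicial R N (g xs) S = (\<Oplus>s\<in>{..<N} - S. \<ominus> (sign_in R s T \<otimes> f xs (insert s T)))"
    unfolding simplicial_def
   proof (rule R.finsum_cong'[OF refl Pi_I])
    fix s assume s: "s \<in> {..<N} - S"
    have gs: "g xs (insert s S) = f xs (insert s T)"
     using s vS by (auto simp: g_def T_def insert_Diff_if)
    show "sign_in R s S \<otimes> g xs (insert s S) = \<ominus> (sign_in R s T \<otimes> f xs (insert s T))"
    proof (cases "f xs (insert s T) = \<zero>")
     case False
     then have "s \<in> cups (hd xs)" "finite T" using fD(4,6)[OF False] by auto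
     then have "?v < s" using v(3)[OF x, of s] s vS by (metis DiffD2 le_neq_implies_less)
     then have "sign_in R s S = \<ominus> sign_in R s T"
      using R.sign_in_insert[OF \<open>finite T\<close> ST(2), of s] ST(1) by auto
     then show ?thesis using gs fD(1) by (simp add: R.l_minus)
    qed (simp add: gs)
   qed (use fD(1) in auto)
   also have "... = \<ominus> rest"
   proof -
    have "rest \<oplus> (\<Oplus>s\<in>{..<N} - S. \<ominus> (sign_in R s T \<otimes> f xs (insert s T))) =
     (\<Oplus>s\<in>{..<N} - S. sign_in R s T \<otimes> f xs (insert s T) \<oplus> \<ominus> (sign_in R s T \<otimes> f xs (insert s T)))"
     unfolding rest_def using fD(1) by (intro R.finsum_addf[symmetric]) auto
    also have "... = \<zero>" using fD(1) by (intro R.finsum_zero') (simp add: R.r_neg)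
    finally have *: "rest \<oplus> (\<Oplus>s\<in>{..<N} - S. \<ominus> (sign_in R s T \<otimes> f xs (insert s T))) = \<zero>" .
    have c: "(\<Oplus>s\<in>{..<N} - S. \<ominus> (sign_in R s T \<otimes> f xs (insert s T))) \<in> carrier R"
     using fD(1) by (intro R.finsum_closed) auto
    show ?thesis
     by (rule R.minus_equality[symmetric]) (use * c rc in \<open>simp_all add: R.a_comm\<close>)
   qed
   also have "... = f xs S" using R.minus_equality[OF zero rc fD(1)] by simp
   finally show ?thesis .
  qed
 qed
 then have "nerve g = f" by auto
 then show ?thesis using g by blast
qed

lemma nerve_image: "nerve ` resolution Y (Suc k) q = nerve_cycles Y k q"
 using nerve_resolution nerve_exact by blast

text \<open>The right ideal spanned by the diagrams with cups at \<open>S\<close> is generated by a left unit of its own,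
  which contracts the corresponding columns.\<close>

lemma resolution_exact:
 assumes k: "0 < k" "k < n"
 shows "exact_at (funs V0) (resolution Y k) (merge V0) q"
 unfolding exact_at_def
proof (rule subsetI)
 fix f assume "f \<in> {f \<in> resolution Y k q. merge V0 f = \<zero>\<^bsub>funs V0\<^esub>}"
 then have f: "f \<in> resolution Y k q" and f0: "!!ys. merge V0 f ys = (%S. \<zero>)" by (auto simp: fun_eq_iff)
 note fD = resolutionD[OF f]
 define valid where "valid S \<longleftrightarrow> S ~= {} & card S < n & (\<exists>x\<in>I. S \<subseteq> cups x)" for S
 define gen where "gen S e \<longleftrightarrow> (\<forall>x\<in>\<D>. e x \<in> carrier R & (e x ~= \<zero> --> x \<in> I & S \<subseteq> cups x)) &
  (\<forall>y\<in>I. S \<subseteq> cups y --> (\<forall>z\<in>\<D>. (\<Oplus>x\<in>\<D>. e x \<otimes> \<mu> x y z) = (if z = y then \<one> else \<zero>)))" for S e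
 define e where "e S = (SOME e. gen S e)" for S
 have e: "gen S (e S)" if "valid S" for S
 proof -
  obtain x where "x \<in> I" "S \<subseteq> cups x" "S ~= {}" "card S < n"
   using \<open>valid S\<close> unfolding valid_def by blast
  from generator[OF this, folded gen_def] show ?thesis unfolding e_def by (rule someI_ex)
 qed
 define E where "E S x = (if valid S & x \<in> \<D> then e S x else \<zero>)" for S x
 have Ec: "E S x \<in> carrier R" and Es: "E S x ~= \<zero> ==> x \<in> I & S \<subseteq> cups x" for S x
  using e[of S] by (simp_all add: E_def gen_def split: if_splits)
 have Eunit: "(\<Oplus>x\<in>\<D>. E S x \<otimes> \<mu> x y z) = (if z = y then \<one> else \<zero>)"
  if "valid S" "y \<in> I" "S \<subseteq> cups y" "z \<in> \<D>" for S y z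
 proof -
  have "(\<Oplus>x\<in>\<D>. e S x \<otimes> \<mu> x y z) = (if z = y then \<one> else \<zero>)"
   using e[OF that(1)] that(2-4) unfolding gen_def by blast
  moreover have "(\<Oplus>x\<in>\<D>. E S x \<otimes> \<mu> x y z) = (\<Oplus>x\<in>\<D>. e S x \<otimes> \<mu> x y z)"
  proof (rule R.finsum_cong'[OF refl Pi_I])
   fix x assume x: "x \<in> \<D>"
   have "y \<in> \<D>" using that(2) I_right by (auto simp: right_stable_def)
   then show "e S x \<otimes> \<mu> x y z \<in> carrier R"
    using e[OF that(1)] x mu_closed by (simp add: gen_def)
   show "E S x \<otimes> \<mu> x y z = e S x \<otimes> \<mu> x y z" using x that(1) by (simp add: E_def)
  qed
  ultimately show ?thesis by simp
 qed
 have fvalid: "valid S & y \<in> I & S \<subseteq> cups y" if "f (y # ys) S ~= \<zero>" for y ys S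
  using fD(3-5)[OF that] k by (auto simp: valid_def)
 define \<sigma> :: "'d => (nat set => 'r) => nat set => 'r" where "\<sigma> x v S = E S x \<otimes> v S" for x v S
 have \<sigma>: "\<sigma> x \<in> module_hom R V0 V0" for x
  by (rule module_homI) (auto simp: \<sigma>_def Ec R.r_distr R.m_lcomm fun_eq_iff)
 define h where "h = prepend V0 \<sigma> f"
 have hc: "h xs S \<in> carrier R" for xs S
  using fD(1) Ec by (cases xs) (auto simp: h_def \<sigma>_def)
 have h: "h \<in> resolution Y k (Suc q)"
 proof (rule resolutionI)
  fix xs S assume nz: "h xs S ~= \<zero>"
  then obtain x ws where xs: "xs = x # ws" by (cases xs) (auto simp: h_def)
  have "E S x ~= \<zero>" "f ws S ~= \<zero>" using nz xs Ec fD(1) by (auto simp: h_def \<sigma>_def)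
  note this Es[OF this(1)] fD(2,5)[OF this(2)]
  moreover have "x \<in> \<D>" using Es[OF \<open>E S x ~= \<zero>\<close>] I_right by (auto simp: right_stable_def)
  ultimately show "xs \<in> tensor_lists I Y (Suc q) & S \<subseteq> cups (hd xs) & card S = k"
   by (auto simp: xs tensor_lists_def)
 qed (rule hc)
 have "merge V0 h ys S = f ys S" for ys S
 proof (cases ys)
  case Nil
  have "f [] S = \<zero>" using fD(2)[of "[]" S] by (auto simp: tensor_lists_def)
  then show ?thesis using Nil by simp
 next
  case (Cons z zs)
  have "merge V0 h (z # zs) S = merge V1 (%xs. h xs S) (z # zs)"
   by (rule merge_eval) (rule hc)
  also have "... = (\<Oplus>x\<in>\<D>. \<Oplus>y\<in>\<D>. \<mu> x y z \<otimes> (E S x \<otimes> f (y # zs) S)) \<ominus> merge V1 (%ws. h (z # ws) S) zs"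
   by (simp add: h_def \<sigma>_def)
  also have "merge V1 (%ws. h (z # ws) S) zs = \<zero>"
  proof -
   have "merge V1 (%ws. h (z # ws) S) zs = merge V0 (%ws. \<sigma> z (f ws)) zs S"
    using merge_eval[of "%ws. \<sigma> z (f ws)" zs S] Ec fD(1) by (simp add: h_def \<sigma>_def)
   also have "... = \<sigma> z (merge V0 f zs) S"
    using merge_module_hom[OF V0 V0 \<sigma>, of f z zs] fD(1) by simp
   finally show ?thesis using f0 Ec by (simp add: \<sigma>_def)
  qed
  also have "(\<Oplus>x\<in>\<D>. \<Oplus>y\<in>\<D>. \<mu> x y z \<otimes> (E S x \<otimes> f (y # zs) S)) =
    (\<Oplus>y\<in>\<D>. \<Oplus>x\<in>\<D>. \<mu> x y z \<otimes> (E S x \<otimes> f (y # zs) S))"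
   using mu_closed Ec fD(1) by (intro R.finsum_swap finite_basis) auto
  also have "... = (\<Oplus>y\<in>\<D>. if z = y then f (y # zs) S else \<zero>)"
  proof (rule R.finsum_cong'[OF refl Pi_I])
   fix y assume y: "y \<in> \<D>"
   have "(\<Oplus>x\<in>\<D>. \<mu> x y z \<otimes> (E S x \<otimes> f (y # zs) S)) = (\<Oplus>x\<in>\<D>. (E S x \<otimes> \<mu> x y z) \<otimes> f (y # zs) S)"
    using mu_closed Ec fD(1) y by (intro R.finsum_cong') (auto simp: R.m_ac)
   also have "... = (\<Oplus>x\<in>\<D>. E S x \<otimes> \<mu> x y z) \<otimes> f (y # zs) S"
    using mu_closed Ec fD(1) y by (intro R.finsum_ldistr[symmetric] finite_basis) auto
   also have "... = (if z = y then f (y # zs) S else \<zero>)"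
   proof (cases "f (y # zs) S = \<zero> \<or> z \<notin> \<D>")
    case True
    moreover have "(\<Oplus>x\<in>\<D>. E S x \<otimes> \<mu> x y z) \<in> carrier R"
     using y Ec mu_closed by (intro R.finsum_closed) auto
    moreover have "(\<Oplus>x\<in>\<D>. E S x \<otimes> \<mu> x y z) = \<zero>" if "z \<notin> \<D>"
     using that y mu_support Ec by (intro R.finsum_zero') auto
    ultimately show ?thesis using y fD(1) by auto
   next
    case False
    then show ?thesis using Eunit[of S y z] fvalid[of y zs S] fD(1) by auto
   qed
   finally show "(\<Oplus>x\<in>\<D>. \<mu> x y z \<otimes> (E S x \<otimes> f (y # zs) S)) = (if z = y then f (y # zs) S else \<zero>)" .
  qed (use fD(1) in auto)
  also have "... = f (z # zs) S"
  proof (cases "z \<in> \<D>")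
   case True
   then show ?thesis using fD(1) by (intro R.finsum_singleton finite_basis) auto
  next
   case False
   then have "f (z # zs) S = \<zero>" using fD(2)[of "z # zs" S] by (auto simp: tensor_lists_def)
   then show ?thesis using False by (auto intro!: R.finsum_zero')
  qed
  finally show ?thesis using Cons fD(1) by (simp add: R.minus_zero_right)
 qed
 then have "merge V0 h = f" by auto
 then show "f \<in> merge V0 ` resolution Y k (Suc q)" using h by blast
qed

lemma nerve_chain_surjection:
 assumes "left_stable Y"
 shows "chain_surjection R (funs V0) (funs V0) (resolution Y (Suc k)) (merge V0)
  (nerve_cycles Y k) (merge V0) nerve"
proof -
 note F = funs_is_module[OF V0, where 's = "'d list"]
 show ?thesis
 proof (intro chain_surjection.intro[OF F F] chain_surjection_axioms.intro)
  show "submodule (resolution Y (Suc k) q) R (funs V0)" for q by (rule resolution_submodule)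
  show "merge V0 \<in> module_hom R (funs V0) (funs V0)" by (rule merge_hom[OF V0])
  then show "merge V0 \<in> module_hom R (funs V0) (funs V0)" .
  show "nerve \<in> module_hom R (funs V0) (funs V0)" by (rule nerve_hom)
  show "merge V0 x \<in> resolution Y (Suc k) q" if "x \<in> resolution Y (Suc k) (Suc q)" for x q
   by (rule merge_resolution[OF assms that])
  show "merge V0 (merge V0 x) = \<zero>\<^bsub>funs V0\<^esub>" if "x \<in> carrier (funs V0)" for x
   using merge_merge[OF V0, of x] that by (simp add: fun_eq_iff)
  show "nerve (merge V0 x) = merge V0 (nerve x)" if "x \<in> carrier (funs V0)" for x
   using nerve_merge[of x] that by simp
  show "nerve ` resolution Y (Suc k) q = nerve_cycles Y k q" for q by (rule nerve_image)
 qed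
qed

lemma chain_surjection_kernel:
 assumes "left_stable Y"
 shows "chain_surjection.K (funs V0) (resolution Y (Suc k)) nerve = nerve_cycles Y (Suc k)"
proof -
 interpret chain_surjection R "funs V0" "funs V0" "resolution Y (Suc k)" "merge V0"
  "nerve_cycles Y k" "merge V0" nerve
  by (rule nerve_chain_surjection[OF assms])
 show ?thesis by (auto simp: K_def nerve_cycles_def fun_eq_iff)
qed

lemma nerve_shift:
 assumes Y: "left_stable Y" and "Suc k < n"
 shows "same_homology R (funs V0) (nerve_cycles Y k) (merge V0) (Suc q)
  (funs V0) (nerve_cycles Y (Suc k)) (merge V0) q"
 using chain_surjection.dimension_shift[OF nerve_chain_surjection[OF Y] resolution_exact resolution_exact]
  assms(2) by (simp add: chain_surjection_kernel[OF Y])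

lemma nerve_bottom:
 assumes Y: "left_stable Y" and "Suc k < n"
 shows "exact_at (funs V0) (nerve_cycles Y k) (merge V0) 0"
 using chain_surjection.exact_at_bottom[OF nerve_chain_surjection[OF Y] resolution_exact]
  assms(2) merge_resolution_bottom by simp

lemma nerve_cycles_submodule: "submodule (nerve_cycles Y k q) R (funs V0)"
proof -
 interpret F: module R "funs V0 :: ('r, 'd list => nat set => 'r) module"
  by (rule funs_is_module[OF V0])
 note n = module_hom_zero[OF F.M.abelian_group_axioms F.M.abelian_group_axioms nerve_hom]
  module_hom_inv[OF F.M.abelian_group_axioms F.M.abelian_group_axioms nerve_hom]
  module_hom_add[OF nerve_hom] module_hom_smult[OF nerve_hom]
 note r = F.submoduleE[OF resolution_submodule]
 have cl: "f \<in> carrier (funs V0)" if "f \<in> resolution Y k q" for f using r(1) that by blast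
 have eq: "nerve_cycles Y k q = {f \<in> resolution Y k q. nerve f = \<zero>\<^bsub>funs V0\<^esub>}"
  by (simp add: nerve_cycles_def)
 show ?thesis
  unfolding eq
 proof (rule F.submoduleI; (elim CollectE conjE)?; (intro CollectI conjI)?)
  show "{f \<in> resolution Y k q. nerve f = \<zero>\<^bsub>funs V0\<^esub>} \<subseteq> carrier (funs V0)" using cl by blast
  show "\<zero>\<^bsub>funs V0\<^esub> \<in> resolution Y k q" by (auto intro: resolutionI)
  show "nerve \<zero>\<^bsub>funs V0\<^esub> = \<zero>\<^bsub>funs V0\<^esub>" by (rule n(1))
  fix f assume f: "f \<in> resolution Y k q" "nerve f = \<zero>\<^bsub>funs V0\<^esub>"
  show "\<ominus>\<^bsub>funs V0\<^esub> f \<in> resolution Y k q" by (rule r(3)[OF f(1)])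
  show "nerve (\<ominus>\<^bsub>funs V0\<^esub> f) = \<zero>\<^bsub>funs V0\<^esub>"
   unfolding n(2)[OF cl[OF f(1)]] f(2)
   using F.M.a_inv_eq_zero_iff[OF F.M.zero_closed] by blast
  { fix g assume g: "g \<in> resolution Y k q" "nerve g = \<zero>\<^bsub>funs V0\<^esub>"
   show "f \<oplus>\<^bsub>funs V0\<^esub> g \<in> resolution Y k q" by (rule r(5)[OF f(1) g(1)])
   show "nerve (f \<oplus>\<^bsub>funs V0\<^esub> g) = \<zero>\<^bsub>funs V0\<^esub>"
    unfolding n(3)[OF cl[OF f(1)] cl[OF g(1)]] f(2) g(2) by (rule F.M.l_zero[OF F.M.zero_closed]) }
  fix s assume s: "s \<in> carrier R"
  show "s \<odot>\<^bsub>funs V0\<^esub> f \<in> resolution Y k q" by (rule r(4)[OF s f(1)])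
  show "nerve (s \<odot>\<^bsub>funs V0\<^esub> f) = \<zero>\<^bsub>funs V0\<^esub>"
   unfolding n(4)[OF s cl[OF f(1)]] f(2) by (rule F.smult_r_null[OF s])
 qed
qed

lemma nerve_shifts:
 assumes Y: "left_stable Y" and "k < n"
 shows "same_homology R (funs V0) (nerve_cycles Y 0) (merge V0) (q + k)
  (funs V0) (nerve_cycles Y k) (merge V0) q"
 using assms(2)
proof (induction k arbitrary: q)
 case 0
 show ?case
  using same_homology_refl[where C = "nerve_cycles Y 0" and q = q,
    OF funs_is_module[OF V0] nerve_cycles_submodule merge_hom[OF V0]] by simp
next
 case (Suc k)
 have "same_homology R (funs V0) (nerve_cycles Y 0) (merge V0) (Suc q + k)
   (funs V0) (nerve_cycles Y k) (merge V0) (Suc q)"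
  using Suc by (intro Suc.IH) simp
 from same_homology_trans[OF this nerve_shift[OF Y Suc.prems]] show ?case by simp
qed

text \<open>On the functions concentrated in a single set \<open>S\<close> of cups, evaluation at \<open>S\<close> forgets nothing.\<close>

lemma resolution_single:
 assumes Y: "left_stable Y" and S: "card S = k" "!!x T. x \<in> I ==> T \<subseteq> cups x ==> card T = k ==> T = S"
 shows "same_homology R (funs V0) (resolution Y k) (merge V0) q
  (funs V1) (%q. chains V1 (tensor_lists (with_cups S) Y q)) (merge V1) q"
proof (rule same_homology_injective[where f = "%f xs. f xs S"])
 show "module R (funs V0)" "module R (funs V1)"
  by (rule funs_is_module[OF V0] funs_is_module[OF V1])+
 show "submodule (resolution Y k q) R (funs V0)" "submodule (resolution Y k (Suc q)) R (funs V0)"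
  by (rule resolution_submodule)+
 show "merge V0 \<in> module_hom R (funs V0) (funs V0)"
  "merge V1 \<in> module_hom R (funs V1) (funs V1)"
  by (rule merge_hom[OF V0] merge_hom[OF V1])+
 show "(%f xs. f xs S) \<in> module_hom R (funs V0) (funs V1)"
  by (auto simp: module_hom_def)
 have onto: "(%f xs. f xs S) ` resolution Y k p = chains V1 (tensor_lists (with_cups S) Y p)" for p
 proof
  show "(%f xs. f xs S) ` resolution Y k p \<subseteq> chains V1 (tensor_lists (with_cups S) Y p)"
   using resolution_eval by blast
  show "chains V1 (tensor_lists (with_cups S) Y p) \<subseteq> (%f xs. f xs S) ` resolution Y k p"
  proof
   fix g assume g: "g \<in> chains V1 (tensor_lists (with_cups S) Y p)"
   have "(%xs T. if T = S then g xs else \<zero>) \<in> resolution Y k p"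
   proof (rule resolutionI)
    fix xs T
    show "(if T = S then g xs else \<zero>) \<in> carrier R" using g by (simp add: chains_def)
    assume "(if T = S then g xs else \<zero>) ~= \<zero>"
    then have "T = S" "g xs ~= \<zero>" by (auto split: if_splits)
    then have "xs \<in> tensor_lists (with_cups S) Y p" using g by (auto simp: chains_def)
    then show "xs \<in> tensor_lists I Y p & T \<subseteq> cups (hd xs) & card T = k"
     using S(1) \<open>T = S\<close> by (auto simp: tensor_lists_def with_cups_def)
   qed
   then show "g \<in> (%f xs. f xs S) ` resolution Y k p" by (rule rev_image_eqI) simp
  qed
 qed
 show "(%f xs. f xs S) ` resolution Y k q = chains V1 (tensor_lists (with_cups S) Y q)"
  "(%f xs. f xs S) ` resolution Y k (Suc q) = chains V1 (tensor_lists (with_cups S) Y (Suc q))"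
  by (rule onto)+
 show "merge V1 (%xs. f xs S) = (%xs. merge V0 f xs S) \<or>
   merge V1 (%xs. f xs S) = \<ominus>\<^bsub>funs V1\<^esub> (%xs. merge V0 f xs S)"
  if "f \<in> resolution Y k q \<union> resolution Y k (Suc q)" for f
  using that resolutionD(1) by (auto simp: merge_eval fun_eq_iff)
 show "merge V0 f \<in> resolution Y k q" if "f \<in> resolution Y k (Suc q)" for f
  by (rule merge_resolution[OF Y that])
 show "f = \<zero>\<^bsub>funs V0\<^esub>"
  if f: "f \<in> resolution Y k q \<or> f \<in> merge V0 ` resolution Y k q" and f0: "(%xs. f xs S) = \<zero>\<^bsub>funs V1\<^esub>" for f
 proof -
  have "f xs T = \<zero>" if p: "f \<in> resolution Y k p" for p xs T
  proof (rule ccontr)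
   assume nz: "f xs T ~= \<zero>"
   have "T = S" by (rule S(2)[OF resolutionD(3,4,5)[OF p nz]])
   then show False using nz f0 by (simp add: fun_eq_iff)
  qed
  moreover have "f = (%xs T. \<zero>) \<or> (\<exists>p. f \<in> resolution Y k p)"
   using f merge_resolution_bottom merge_resolution[OF Y] by (cases q) blast+
  ultimately show ?thesis by (auto simp: fun_eq_iff)
 qed
qed

lemma resolution_beyond_top: "f \<in> resolution Y (Suc n) q ==> f = (%xs S. \<zero>)"
proof (intro ext)
 fix xs S assume f: "f \<in> resolution Y (Suc n) q"
 show "f xs S = \<zero>"
 proof (rule ccontr)
  assume nz: "f xs S ~= \<zero>"
  from card_cups[OF resolutionD(3,4)[OF f nz]] resolutionD(5)[OF f nz] show False by simp
 qed
qed

lemma nerve_top: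
 assumes Y: "left_stable Y"
 shows "same_homology R (funs V0) (resolution Y n) (merge V0) q
  (funs V0) (nerve_cycles Y (n - 1)) (merge V0) q"
proof (rule same_homology_injective[where f = nerve])
 show "module R (funs V0)" "module R (funs V0)"
  by (rule funs_is_module[OF V0])+
 show "submodule (resolution Y n q) R (funs V0)" "submodule (resolution Y n (Suc q)) R (funs V0)"
  by (rule resolution_submodule)+
 show "merge V0 \<in> module_hom R (funs V0) (funs V0)"
  "merge V0 \<in> module_hom R (funs V0) (funs V0)" by (rule merge_hom[OF V0])+
 show "nerve \<in> module_hom R (funs V0) (funs V0)" by (rule nerve_hom)
 have "nerve ` resolution Y n p = nerve_cycles Y (n - 1) p" for p
  using nerve_image[of Y "n - 1" p] n_pos by simp
 then show "nerve ` resolution Y n q = nerve_cycles Y (n - 1) q"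
  "nerve ` resolution Y n (Suc q) = nerve_cycles Y (n - 1) (Suc q)" by blast+
 show "merge V0 (nerve f) = nerve (merge V0 f) \<or> merge V0 (nerve f) = \<ominus>\<^bsub>funs V0\<^esub> nerve (merge V0 f)"
  if "f \<in> resolution Y n q \<union> resolution Y n (Suc q)" for f
  using that resolutionD(1) nerve_merge[of f] by auto
 show "merge V0 f \<in> resolution Y n q" if "f \<in> resolution Y n (Suc q)" for f
  by (rule merge_resolution[OF Y that])
 show "f = \<zero>\<^bsub>funs V0\<^esub>"
  if f: "f \<in> resolution Y n q \<or> f \<in> merge V0 ` resolution Y n q" and f0: "nerve f = \<zero>\<^bsub>funs V0\<^esub>" for f
 proof -
  have "f = (%xs S. \<zero>)" if p: "f \<in> resolution Y n p" for p
  proof -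
   have "f \<in> nerve_cycles Y n p" using p f0 by (simp add: nerve_cycles_def)
   then obtain g where g: "g \<in> resolution Y (Suc n) p" "f = nerve g" using nerve_exact by blast
   from resolution_beyond_top[OF g(1)] g(2) show ?thesis
    by (simp add: simplicial_def fun_eq_iff R.finsum_zero')
  qed
  moreover have "f = (%xs T. \<zero>) \<or> (\<exists>p. f \<in> resolution Y n p)"
   using f merge_resolution_bottom merge_resolution[OF Y] by (cases q) blast+
  ultimately show ?thesis by (auto simp: fun_eq_iff)
 qed
qed

lemma nerve_cycles_zero: "nerve_cycles Y 0 = resolution Y 0"
proof (rule ext)
 fix q
 have "nerve f = (%xs S. \<zero>)" if f: "f \<in> resolution Y 0 q" for f
 proof (intro ext)
  fix xs S
  have "f xs (insert s S) = \<zero>" for s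
   using resolutionD(5,6)[OF f, of xs "insert s S"] by (metis card_0_eq insert_not_empty)
  then show "nerve f xs S = \<zero>" by (simp add: simplicial_def R.finsum_zero')
 qed
 then show "nerve_cycles Y 0 q = resolution Y 0 q" by (auto simp: nerve_cycles_def)
qed

lemma ideal_chains:
 assumes "left_stable Y"
 shows "same_homology R (funs V0) (nerve_cycles Y 0) (merge V0) q
  (funs V1) (%q. chains V1 (tensor_lists I Y q)) (merge V1) q"
 unfolding nerve_cycles_zero
 using resolution_single[OF assms, of "{}" 0 q] finite_cups finite_subset
 by (metis card.empty card_0_eq with_cups_empty)

theorem ideal_shift:
 assumes Y: "left_stable Y"
 shows "same_homology R (funs V1) (%q. chains V1 (tensor_lists I Y q)) (merge V1) (q + (n - 1))
  (funs V1) (%q. chains V1 (tensor_lists (with_cups c) Y q)) (merge V1) q"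
proof -
 have "n - 1 < n" using n_pos by simp
 from nerve_shifts[OF Y this] same_homology_sym[OF nerve_top[OF Y]]
 have "same_homology R (funs V0) (nerve_cycles Y 0) (merge V0) (q + (n - 1))
  (funs V0) (resolution Y n) (merge V0) q" by (rule same_homology_trans)
 with same_homology_sym[OF ideal_chains[OF Y]]
 have "same_homology R (funs V1) (%q. chains V1 (tensor_lists I Y q)) (merge V1) (q + (n - 1))
  (funs V0) (resolution Y n) (merge V0) q" by (rule same_homology_trans)
 then show ?thesis
  by (rule same_homology_trans) (rule resolution_single[OF Y card_top top_unique])
qed

theorem ideal_exact:
 assumes Y: "left_stable Y" and q: "q < n - 1"
 shows "exact_at (funs V1) (%q. chains V1 (tensor_lists I Y q)) (merge V1) q"
proof -
 have "same_homology R (funs V0) (nerve_cycles Y 0) (merge V0) (0 + q)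
   (funs V0) (nerve_cycles Y q) (merge V0) 0"
  using q by (intro nerve_shifts[OF Y]) simp
 from same_homology_exact[OF same_homology_sym[OF this] nerve_bottom[OF Y]] q
 have "exact_at (funs V0) (nerve_cycles Y 0) (merge V0) q" by simp
 with ideal_chains[OF Y] show ?thesis by (rule same_homology_exact)
qed

end

abbreviation "glue \<equiv> compose_diagrams"
abbreviation "conn \<equiv> connected_glued"
abbreviation "loops \<equiv> closed_loops"

section \<open>Composition of noncrossing matchings\<close>

lemma diagramsD:
 assumes "D \<in> diagrams m k"
 shows "\<Union>D = nodes m k" "!!c. c \<in> D ==> card c = 2" "!!c c'. c \<in> D ==> c' \<in> D ==> c ~= c' ==> c \<inter> c' = {}"
  "!!x y z w. {x, y} \<in> D ==> {z, w} \<in> D ==> position m k x < position m k z ==>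
   position m k z < position m k y ==> position m k y < position m k w ==> False"
 using assms unfolding diagrams_def partition_on_def disjoint_def by blast+

lemma finite_nodes: "finite (nodes m k)"
 by (simp add: nodes_def)

lemma finite_diagram: "D \<in> diagrams m k ==> finite D"
 using diagramsD(1) finite_nodes by (metis finite_UnionD)

lemma finite_diagrams: "finite (diagrams m k)"
proof (rule finite_subset)
 show "diagrams m k \<subseteq> Pow (Pow (nodes m k))" using diagramsD(1) by fast
qed (simp add: finite_nodes)

lemma diagram_arc:
 assumes "D \<in> diagrams m k" "x \<in> nodes m k"
 obtains y where "{x, y} \<in> D" "x ~= y" "y \<in> nodes m k"
proof -
 obtain c where c: "c \<in> D" "x \<in> c" using diagramsD(1)[OF assms(1)] assms(2) by blast
 then obtain a b where ab: "c = {a, b}" "a ~= b" using diagramsD(2)[OF assms(1)] by (meson card_2_iff)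
 have "c \<subseteq> nodes m k" using c diagramsD(1)[OF assms(1)] by blast
 then show thesis
  using that[of a] that[of b] c ab by (auto simp: insert_commute)
qed

lemma diagram_arc_unique:
 assumes "D \<in> diagrams m k" "{x, y} \<in> D" "{x, z} \<in> D"
 shows "y = z"
 using diagramsD(3)[OF assms] by (auto simp: doubleton_eq_iff)

lemma diagram_arc_nodes:
 assumes "D \<in> diagrams m k" "{x, y} \<in> D"
 shows "x \<in> nodes m k" "y \<in> nodes m k" "x ~= y"
 using diagramsD(1)[OF assms(1)] diagramsD(2)[OF assms] assms(2) by auto

lemma position_inj: "inj_on (position m k) (nodes m k)"
 by (rule inj_onI) (auto simp: nodes_def)

text \<open>The number of pairs of points of \<open>U\<close> and \<open>V\<close> in ascending order.  For the end points of two
  disjoint chords it is even if and only if the chords do not cross, and it is additive in both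
  arguments; noncrossing thus becomes a bilinear condition modulo two.\<close>

definition ascents :: "('a => nat) => 'a set => 'a set => nat" where
 "ascents p U V = (\<Sum>u\<in>U. \<Sum>v\<in>V. if p u < p v then 1 else 0)"

lemma ascents_union:
 assumes "finite A" "finite B" "!!c. c \<in> A \<union> B ==> finite c"
  "!!c c'. c \<in> A ==> c' \<in> A ==> c ~= c' ==> c \<inter> c' = {}"
  "!!c c'. c \<in> B ==> c' \<in> B ==> c ~= c' ==> c \<inter> c' = {}"
 shows "ascents p (\<Union>A) (\<Union>B) = (\<Sum>c\<in>A. \<Sum>c'\<in>B. ascents p c c')"
proof -
 have "ascents p (\<Union>A) (\<Union>B) = (\<Sum>u\<in>\<Union>A. \<Sum>c'\<in>B. \<Sum>v\<in>c'. if p u < p v then 1 else 0)"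
  unfolding ascents_def using assms by (intro sum.cong refl) (subst sum.Union_disjoint, auto)
 also have "... = (\<Sum>c\<in>A. \<Sum>u\<in>c. \<Sum>c'\<in>B. \<Sum>v\<in>c'. if p u < p v then 1 else 0)"
  using assms by (subst sum.Union_disjoint) auto
 also have "... = (\<Sum>c\<in>A. \<Sum>c'\<in>B. ascents p c c')"
  unfolding ascents_def by (intro sum.cong refl sum.swap)
 finally show ?thesis .
qed

lemma noncrossing_ascents_even:
 assumes D: "D \<in> diagrams m k" and c: "c \<in> D" "c' \<in> D" "c ~= c'"
 shows "even (ascents (position m k) c c')"
proof -
 let ?p = "position m k"
 have "\<exists>a b. c = {a, b} & ?p a < ?p b" if "c \<in> D" for c
 proof -
  obtain a b where ab: "c = {a, b}" "a ~= b" using diagramsD(2)[OF D \<open>c \<in> D\<close>] by (meson card_2_iff)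
  have "a \<in> nodes m k" "b \<in> nodes m k" using diagram_arc_nodes[OF D, of a b] ab that by auto
  then have "?p a ~= ?p b" using ab position_inj by (metis inj_onD)
  then show ?thesis using ab by (metis insert_commute linorder_neqE_nat)
 qed
 then obtain x y z w where xy: "c = {x, y}" "?p x < ?p y" and zw: "c' = {z, w}" "?p z < ?p w"
  using c by metis
 have nodes: "{x, y, z, w} \<subseteq> nodes m k" using diagram_arc_nodes[OF D] c xy zw by blast
 have "{x, y} \<inter> {z, w} = {}" using diagramsD(3)[OF D c] xy zw by blast
 then have ne: "?p x ~= ?p z" "?p x ~= ?p w" "?p y ~= ?p z" "?p y ~= ?p w"
  using nodes inj_onD[OF position_inj] by (metis disjoint_iff insert_iff insert_subset)+
 have n1: "\<not> (?p x < ?p z & ?p z < ?p y & ?p y < ?p w)"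
  using diagramsD(4)[OF D, of x y z w] c xy zw by blast
 have n2: "\<not> (?p z < ?p x & ?p x < ?p w & ?p w < ?p y)"
  using diagramsD(4)[OF D, of z w x y] c xy zw by blast
 have "x ~= y" "z ~= w" using xy zw by auto
 then have "ascents ?p c c' = (if ?p x < ?p z then 1 else 0) + (if ?p x < ?p w then 1 else 0) +
   ((if ?p y < ?p z then 1 else 0) + (if ?p y < ?p w then 1 else 0))"
  by (simp add: ascents_def xy zw)
 then show ?thesis using xy(2) zw(2) ne n1 n2 by (auto split: if_splits)
qed

lemma crossing_ascents_odd:
 assumes "p x < p z" "p z < p y" "p y < p w"
 shows "odd (ascents p {x, y} {z, w})"
proof -
 have "x ~= y" "z ~= w" using assms by auto
 then show ?thesis using assms by (simp add: ascents_def)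
qed

lemma ascents_two_bars:
 assumes "A \<subseteq> {..<m}" "A' \<subseteq> {..<m}" "B \<subseteq> {..<k}" "B' \<subseteq> {..<k}"
 shows "ascents (position m k) (Inl ` A \<union> Inr ` B) (Inl ` A' \<union> Inr ` B') =
  ascents id A A' + card A * card B' + ascents id B' B"
proof -
 have fin: "finite A" "finite A'" "finite B" "finite B'" using assms finite_subset by blast+
 let ?p = "position m k"
 have split: "(\<Sum>v\<in>Inl ` C \<union> Inr ` C'. g v) = (\<Sum>v\<in>C. g (Inl v)) + (\<Sum>v\<in>C'. g (Inr v))"
  if "finite C" "finite C'" for C C' and g :: "nat + nat => nat"
  using that by (subst sum.union_disjoint) (auto simp: sum.reindex)
 have rows:
  "u \<in> A ==> (\<Sum>v\<in>B'. if ?p (Inl u) < ?p (Inr v) then 1 else 0) = (\<Sum>v\<in>B'. 1 :: nat)"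
  "u \<in> B ==> (\<Sum>v\<in>A'. if ?p (Inr u) < ?p (Inl v) then 1 else 0) = (\<Sum>v\<in>A'. 0 :: nat)"
  "u \<in> B ==> (\<Sum>v\<in>B'. if ?p (Inr u) < ?p (Inr v) then 1 else 0) = (\<Sum>v\<in>B'. if v < u then 1 else 0 :: nat)" for u
  using assms by (intro sum.cong refl; fastforce)+
 have "ascents ?p (Inl ` A \<union> Inr ` B) (Inl ` A' \<union> Inr ` B') =
   (\<Sum>u\<in>A. (\<Sum>v\<in>A'. if u < v then 1 else 0) + (\<Sum>v\<in>B'. 1)) +
   (\<Sum>u\<in>B. (\<Sum>v\<in>A'. 0) + (\<Sum>v\<in>B'. if v < u then 1 else 0))"
  unfolding ascents_def split[OF fin(1,3)] split[OF fin(2,4)]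
  using rows by (simp del: position.simps(2) sum_constant cong: sum.cong)
 also have "... = ascents id A A' + card A * card B' + ascents id B' B"
  by (simp add: ascents_def sum.distrib sum.swap[of _ B B'])
 finally show ?thesis .
qed

lemma ascents_total:
 assumes "finite A" "finite B" "A \<inter> B = {}"
 shows "ascents id A B + ascents id B A = card A * card (B :: nat set)"
proof -
 have "ascents id A B + ascents id B A = (\<Sum>u\<in>A. \<Sum>v\<in>B. (if u < v then 1 else 0) + (if v < u then 1 else 0))"
  by (simp add: ascents_def sum.distrib sum.swap[of _ B A])
 also have "... = (\<Sum>u\<in>A. \<Sum>v\<in>B. 1)"
 proof (intro sum.cong refl)
  fix u v assume "u \<in> A" "v \<in> B"
  then have "u ~= v" using assms(3) by blast
  then show "(if u < v then 1 else 0) + (if v < u then 1 else 0) = (1 :: nat)" by auto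
 qed
 finally show ?thesis by simp
qed

text \<open>A connected graph has at most one vertex more than it has edges.\<close>

lemma connected_component_edges:
 fixes F :: "'a set set"
 defines "r \<equiv> {(x, y). {x, y} \<in> F}"
 assumes F: "finite F" and C: "C = r\<^sup>* `` {x}" "finite C"
 shows "card C \<le> Suc (card {c \<in> F. c \<subseteq> C})"
proof -
 have "\<exists>T G. T \<subseteq> C & x \<in> T & card T = Suc n & G \<subseteq> F & \<Union>G \<subseteq> T & card G = n" if "Suc n \<le> card C" for n
  using that
 proof (induction n)
  case 0
  show ?case by (intro exI[of _ "{x}"] exI[of _ "{}"]) (auto simp: C)
 next
  case (Suc n)
  then obtain T G where T: "T \<subseteq> C" "x \<in> T" "card T = Suc n" "G \<subseteq> F" "\<Union>G \<subseteq> T" "card G = n" by auto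
  then obtain y where y: "y \<in> C" "y \<notin> T" using Suc.prems by (metis Suc_n_not_le_n subsetI subset_antisym)
  have "(x, y) \<in> r\<^sup>*" using y C by blast
  then have "\<exists>u v. u \<in> T & v \<notin> T & (u, v) \<in> r" using T(2) y(2)
   by (induction rule: rtrancl_induct) blast+
  then obtain u v where uv: "u \<in> T" "v \<notin> T" "(u, v) \<in> r" by blast
  have "v \<in> C" using uv T(1) C(1) by (auto intro: rtrancl_into_rtrancl)
  have fin: "finite T" "finite G" using T(1,4) C(2) F finite_subset by blast+
  have "{u, v} \<notin> G" using T(5) uv(2) by blast
  then show ?case
   using T uv \<open>v \<in> C\<close> fin
   by (intro exI[of _ "insert v T"] exI[of _ "insert {u, v} G"]) (auto simp: r_def)
 qed
 note grow = this
 have "x \<in> C" by (simp add: C)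
 then have "card C ~= 0" using C(2) by auto
 then have "Suc (card C - 1) \<le> card C" by simp
 from grow[OF this] obtain T G where "T \<subseteq> C" "G \<subseteq> F" "\<Union>G \<subseteq> T" and G: "card G = card C - 1"
  by (elim exE conjE)
 then have "G \<subseteq> {c \<in> F. c \<subseteq> C}" by blast
 moreover have "finite {c \<in> F. c \<subseteq> C}" using F by simp
 ultimately have "card C - 1 \<le> card {c \<in> F. c \<subseteq> C}" using G card_mono by metis
 then show ?thesis by simp
qed

lemma card_union_arcs:
 assumes "finite A" "!!c. c \<in> A ==> card c = 2" "!!c c'. c \<in> A ==> c' \<in> A ==> c ~= c' ==> c \<inter> c' = {}"
 shows "card (\<Union>A) = 2 * card A"
proof -
 have "card (\<Union>A) = sum card A"
  using assms by (intro card_Union_disjoint) (auto simp: pairwise_def disjnt_def intro: card_ge_0_finite)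
 then show ?thesis using assms(2) by simp
qed

abbreviation lower :: "nat + nat => glued_node" where "lower \<equiv> case_sum GLeft GMid"
abbreviation upper :: "nat + nat => glued_node" where "upper \<equiv> case_sum GMid GRight"

lemma lower_inj: "inj lower" and upper_inj: "inj upper" and outer_inj: "inj outer_node"
 by (auto simp: inj_def outer_node_def split: sum.splits)

lemma connected_glued_sym: "(x, y) \<in> conn D E ==> (y, x) \<in> conn D E"
proof -
 have "sym {(x, y). {x, y} \<in> glued_arcs D E}" by (auto simp: sym_def insert_commute)
 then show "(x, y) \<in> conn D E ==> (y, x) \<in> conn D E"
  unfolding connected_glued_def using sym_rtrancl symD by metis
qed

lemma connected_glued_refl: "(x, x) \<in> conn D E"
 by (simp add: connected_glued_def)

lemma connected_glued_trans:
 "(x, y) \<in> conn D E ==> (y, z) \<in> conn D E ==> (x, z) \<in> conn D E"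
 unfolding connected_glued_def by (rule rtrancl_trans)

lemma connected_lower: "{x, y} \<in> D ==> (lower x, lower y) \<in> conn D E"
 unfolding connected_glued_def glued_arcs_def by (intro r_into_rtrancl) (auto intro: image_eqI[of _ _ "{x, y}"])

lemma connected_upper: "{x, y} \<in> E ==> (upper x, upper y) \<in> conn D E"
 unfolding connected_glued_def glued_arcs_def by (intro r_into_rtrancl) (auto intro: image_eqI[of _ _ "{x, y}"])

text \<open>A function that is constant along every arc is constant on components.\<close>

lemma connected_glued_invariant:
 assumes "(x, y) \<in> conn D E"
  and "!!u v. {u, v} \<in> D ==> f (lower u) = f (lower v)" "!!u v. {u, v} \<in> E ==> f (upper u) = f (upper v)"
  and "!!c. c \<in> D \<union> E ==> card c = 2"
 shows "f x = f y"
 using assms(1) unfolding connected_glued_def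
proof (induction rule: rtrancl_induct)
 case (step y z)
 then consider c where "c \<in> D" "{y, z} = lower ` c" | c where "c \<in> E" "{y, z} = upper ` c"
  by (auto simp: glued_arcs_def)
 then have "f y = f z"
 proof cases
  case 1
  then obtain u v where "c = {u, v}" using assms(4) by (meson UnCI card_2_iff)
  then show ?thesis using 1 assms(2)[of u v] by (auto simp: doubleton_eq_iff)
 next
  case 2
  then obtain u v where "c = {u, v}" using assms(4) by (meson UnCI card_2_iff)
  then show ?thesis using 2 assms(3)[of u v] by (auto simp: doubleton_eq_iff)
 qed
 then show ?case using step by simp
qed simp

context
 fixes l m k :: nat and D E :: diagram
 assumes D: "D \<in> diagrams l m" and E: "E \<in> diagrams m k"
begin

definition component :: "glued_node => glued_node set" where
 "component x = conn D E `` {x}"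

abbreviation "glued_nodes \<equiv> GLeft ` {..<l} \<union> GMid ` {..<m} \<union> GRight ` {..<k}"

lemma component_eq: "y \<in> component x ==> component y = component x"
 unfolding component_def using connected_glued_sym connected_glued_trans by blast

lemma glued_arcs_nodes: "\<Union>(glued_arcs D E) = glued_nodes"
proof -
 have "\<Union>(glued_arcs D E) = lower ` \<Union>D \<union> upper ` \<Union>E" by (auto simp: glued_arcs_def)
 then show ?thesis using diagramsD(1)[OF D] diagramsD(1)[OF E] by (auto simp: nodes_def image_Un image_image)
qed

lemma component_nodes: "component x \<subseteq> insert x glued_nodes"
proof
 fix y assume "y \<in> component x"
 then have "(x, y) \<in> {(x, y). {x, y} \<in> glued_arcs D E}\<^sup>*" by (simp add: component_def connected_glued_def)
 then show "y \<in> insert x glued_nodes"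
  by (cases rule: rtranclE) (use glued_arcs_nodes in auto)
qed

definition on_left where "on_left x = {i. i < l & GLeft i \<in> component x}"
definition on_mid where "on_mid x = {i. i < m & GMid i \<in> component x}"
definition on_right where "on_right x = {i. i < k & GRight i \<in> component x}"
definition arcs_left where "arcs_left x = {c \<in> D. lower ` c \<subseteq> component x}"
definition arcs_right where "arcs_right x = {c \<in> E. upper ` c \<subseteq> component x}"

lemma union_arcs_left: "\<Union>(arcs_left x) = Inl ` on_left x \<union> Inr ` on_mid x"
proof -
 have "u \<in> \<Union>(arcs_left x) \<longleftrightarrow> u \<in> nodes l m & lower u \<in> component x" for u
 proof
  assume "u \<in> \<Union>(arcs_left x)"
  then show "u \<in> nodes l m & lower u \<in> component x"
   using diagramsD(1)[OF D] by (auto simp: arcs_left_def)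
 next
  assume u: "u \<in> nodes l m & lower u \<in> component x"
  then obtain v where v: "{u, v} \<in> D" using diagram_arc[OF D] by metis
  have "lower v \<in> component x"
   using u connected_lower[OF v, of E] connected_glued_trans by (auto simp: component_def)
  then show "u \<in> \<Union>(arcs_left x)" using u v by (auto simp: arcs_left_def)
 qed
 then show ?thesis
  by (auto simp: nodes_def on_left_def on_mid_def set_eq_iff)
qed

lemma union_arcs_right: "\<Union>(arcs_right x) = Inl ` on_mid x \<union> Inr ` on_right x"
proof -
 have "u \<in> \<Union>(arcs_right x) \<longleftrightarrow> u \<in> nodes m k & upper u \<in> component x" for u
 proof
  assume "u \<in> \<Union>(arcs_right x)"
  then show "u \<in> nodes m k & upper u \<in> component x"
   using diagramsD(1)[OF E] by (auto simp: arcs_right_def)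
 next
  assume u: "u \<in> nodes m k & upper u \<in> component x"
  then obtain v where v: "{u, v} \<in> E" using diagram_arc[OF E] by metis
  have "upper v \<in> component x"
   using u connected_upper[OF v, of D] connected_glued_trans by (auto simp: component_def)
  then show "u \<in> \<Union>(arcs_right x)" using u v by (auto simp: arcs_right_def)
 qed
 then show ?thesis
  by (auto simp: nodes_def on_right_def on_mid_def set_eq_iff)
qed

lemma component_finite: "finite (on_left x)" "finite (on_mid x)" "finite (on_right x)"
  "finite (arcs_left x)" "finite (arcs_right x)"
 using finite_diagram[OF D] finite_diagram[OF E]
 by (auto simp: on_left_def on_mid_def on_right_def arcs_left_def arcs_right_def)

lemma card_arcs_left: "card (on_left x) + card (on_mid x) = 2 * card (arcs_left x)"
proof -
 have "card (\<Union>(arcs_left x)) = 2 * card (arcs_left x)"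
  using diagramsD(2,3)[OF D] component_finite by (intro card_union_arcs) (auto simp: arcs_left_def)
 moreover have "card (Inl ` on_left x \<union> Inr ` on_mid x :: (nat + nat) set) = card (on_left x) + card (on_mid x)"
  using component_finite by (subst card_Un_disjoint) (auto simp: card_image)
 ultimately show ?thesis by (simp add: union_arcs_left)
qed

lemma card_arcs_right: "card (on_mid x) + card (on_right x) = 2 * card (arcs_right x)"
proof -
 have "card (\<Union>(arcs_right x)) = 2 * card (arcs_right x)"
  using diagramsD(2,3)[OF E] component_finite by (intro card_union_arcs) (auto simp: arcs_right_def)
 moreover have "card (Inl ` on_mid x \<union> Inr ` on_right x :: (nat + nat) set) = card (on_mid x) + card (on_right x)"
  using component_finite by (subst card_Un_disjoint) (auto simp: card_image)
 ultimately show ?thesis by (simp add: union_arcs_right)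
qed

lemma outer_nodes_le: 
 assumes "x \<in> glued_nodes"
 shows "card (on_left x) + card (on_right x) \<le> 2"
proof -
 have C: "component x = GLeft ` on_left x \<union> GMid ` on_mid x \<union> GRight ` on_right x"
  using component_nodes[of x] assms by (auto simp: on_left_def on_mid_def on_right_def)
 have cardC: "card (component x) = card (on_left x) + card (on_mid x) + card (on_right x)"
  unfolding C using component_finite[of x]
  by (subst card_Un_disjoint, simp, simp, blast)+ (simp add: card_image inj_on_def)
 have "finite (glued_arcs D E)"
  using finite_diagram[OF D] finite_diagram[OF E] by (simp add: glued_arcs_def)
 then have "card (component x) \<le> Suc (card {c \<in> glued_arcs D E. c \<subseteq> component x})"
  using component_finite[of x]
  by (intro connected_component_edges[of _ _ x]) (auto simp: component_def connected_glued_def C[unfolded component_def connected_glued_def])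
 also have "{c \<in> glued_arcs D E. c \<subseteq> component x} \<subseteq> (`) lower ` arcs_left x \<union> (`) upper ` arcs_right x"
  by (auto simp: glued_arcs_def arcs_left_def arcs_right_def)
 then have "card {c \<in> glued_arcs D E. c \<subseteq> component x} \<le> card (arcs_left x) + card (arcs_right x)"
  using component_finite[of x]
  by (meson card_Un_le card_image_le card_mono finite_UnI finite_imageI le_trans add_mono)
 finally show ?thesis
  using card_arcs_left[of x] card_arcs_right[of x] cardC by linarith
qed

lemma outer_nodes_even: "even (card (on_left x) + card (on_right x))"
 using card_arcs_left[of x] card_arcs_right[of x] by presburger

lemma outer_component:
 assumes "x \<in> nodes l k"
 shows "{y. outer_node y \<in> component (outer_node x)} = Inl ` on_left (outer_node x) \<union> Inr ` on_right (outer_node x)"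
proof -
 have "outer_node x \<in> glued_nodes" using assms by (auto simp: nodes_def outer_node_def)
 then show ?thesis
  using component_nodes[of "outer_node x"]
  by (auto simp: on_left_def on_right_def outer_node_def set_eq_iff split: sum.splits)
qed

lemma card_outer_component:
 assumes "x \<in> nodes l k"
 shows "card {y. outer_node y \<in> component (outer_node x)} = 2"
proof -
 let ?x = "outer_node x"
 have x: "?x \<in> glued_nodes" using assms by (auto simp: nodes_def outer_node_def)
 have card: "card {y. outer_node y \<in> component ?x} = card (on_left ?x) + card (on_right ?x)"
  unfolding outer_component[OF assms] using component_finite[of ?x]
  by (subst card_Un_disjoint) (auto simp: card_image)
 have fin: "finite {y. outer_node y \<in> component ?x}"
  unfolding outer_component[OF assms] using component_finite[of ?x] by simp
 have "x \<in> {y. outer_node y \<in> component ?x}" by (simp add: component_def connected_glued_refl)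
 then have "card {y. outer_node y \<in> component ?x} ~= 0" using fin by auto
 then show ?thesis using card outer_nodes_le[OF x] outer_nodes_even[of ?x] by presburger
qed

lemma compose_arc_iff:
 "{x, y} \<in> glue D E \<longleftrightarrow> x ~= y & (outer_node x, outer_node y) \<in> conn D E"
 unfolding compose_diagrams_def using connected_glued_sym by (auto simp: doubleton_eq_iff)

lemma compose_arc_nodes:
 assumes "(outer_node x, outer_node y) \<in> conn D E" "x ~= y"
 shows "x \<in> nodes l k" "y \<in> nodes l k"
proof -
 have *: "b \<in> nodes l k" if "(outer_node a, outer_node b) \<in> conn D E" "a ~= b" for a b
 proof -
  have "outer_node b \<in> insert (outer_node a) glued_nodes"
   using component_nodes[of "outer_node a"] that(1) by (auto simp: component_def)
  moreover have "outer_node b ~= outer_node a" using that(2) outer_inj by (auto simp: inj_def)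
  ultimately show ?thesis by (cases b) (auto simp: outer_node_def nodes_def)
 qed
 show "x \<in> nodes l k" "y \<in> nodes l k" using *[of x y] *[of y x] connected_glued_sym assms by blast+
qed

lemma compose_block:
 assumes "{x, y} \<in> glue D E"
 shows "{z. outer_node z \<in> component (outer_node x)} = {x, y}"
proof -
 have xy: "x ~= y" "(outer_node x, outer_node y) \<in> conn D E" using assms by (auto simp: compose_arc_iff)
 have x: "x \<in> nodes l k" by (rule compose_arc_nodes[OF xy(2,1)])
 have "{x, y} \<subseteq> {z. outer_node z \<in> component (outer_node x)}"
  using xy by (auto simp: component_def connected_glued_refl)
 moreover have "card {x, y} = 2" using xy by simp
 ultimately show ?thesis
  using card_outer_component[OF x] by (metis card_subset_eq card.infinite zero_neq_numeral)
qed

lemma compose_partition: "partition_on (nodes l k) (glue D E)"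
proof (rule partition_onI)
 show "\<Union>(glue D E) = nodes l k"
 proof
  show "\<Union>(glue D E) \<subseteq> nodes l k"
   unfolding compose_diagrams_def using compose_arc_nodes by auto
  show "nodes l k \<subseteq> \<Union>(glue D E)"
  proof
   fix x assume "x \<in> nodes l k"
   then have "card {y. outer_node y \<in> component (outer_node x)} = 2" by (rule card_outer_component)
   moreover have "x \<in> {y. outer_node y \<in> component (outer_node x)}"
    by (simp add: component_def connected_glued_refl)
   ultimately obtain y where "y ~= x" "outer_node y \<in> component (outer_node x)"
    by (metis (no_types, lifting) card_2_iff' mem_Collect_eq)
   then have "{x, y} \<in> glue D E" by (auto simp: compose_arc_iff component_def)
   then show "x \<in> \<Union>(glue D E)" by blast
  qed
 qed
 show "{} \<notin> glue D E" by (auto simp: compose_diagrams_def)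
 fix c c' assume c: "c \<in> glue D E" "c' \<in> glue D E" "c ~= c'"
 then obtain x y x' y' where *: "c = {x, y}" "c' = {x', y'}" by (auto simp: compose_diagrams_def)
 show "disjnt c c'"
 proof (rule ccontr)
  assume "\<not> disjnt c c'"
  then obtain z where z: "z \<in> c" "z \<in> c'" by (auto simp: disjnt_def)
  have "component (outer_node z) = component (outer_node x)" "component (outer_node z) = component (outer_node x')"
   using z compose_block[of x y] compose_block[of x' y'] c * component_eq by blast+
  then have "{x, y} = {x', y'}" using compose_block[of x y] compose_block[of x' y'] c * by auto
  then show False using c(3) * by simp
 qed
qed

lemma compose_ascents_even:
 assumes x: "x \<in> nodes l k" and z: "z \<in> nodes l k"
  and ne: "component (outer_node x) ~= component (outer_node z)"
 shows "even (ascents (position l k) {y. outer_node y \<in> component (outer_node x)}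
  {y. outer_node y \<in> component (outer_node z)})"
proof -
 let ?x = "outer_node x" and ?z = "outer_node z"
 have disj: "component ?x \<inter> component ?z = {}" using ne component_eq by blast
 have sub: "on_left y \<subseteq> {..<l}" "on_mid y \<subseteq> {..<m}" "on_right y \<subseteq> {..<k}" for y
  by (auto simp: on_left_def on_mid_def on_right_def)
 have "even (\<Sum>c\<in>arcs_left ?x. \<Sum>c'\<in>arcs_left ?z. ascents (position l m) c c')"
 proof (intro dvd_sum)
  fix c c' assume c: "c \<in> arcs_left ?x" "c' \<in> arcs_left ?z"
  then have "c ~= {}" "lower ` c \<subseteq> component ?x" "lower ` c' \<subseteq> component ?z"
   using diagramsD(2)[OF D, of c] by (auto simp: arcs_left_def)
  then have "c ~= c'" using disj by blast
  then show "even (ascents (position l m) c c')"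
   using c by (intro noncrossing_ascents_even[OF D]) (auto simp: arcs_left_def)
 qed
 also have "(\<Sum>c\<in>arcs_left ?x. \<Sum>c'\<in>arcs_left ?z. ascents (position l m) c c') =
   ascents (position l m) (\<Union>(arcs_left ?x)) (\<Union>(arcs_left ?z))"
  using diagramsD(2,3)[OF D] component_finite
  by (intro ascents_union[symmetric]) (auto simp: arcs_left_def intro: card_ge_0_finite)
 finally have left: "even (ascents id (on_left ?x) (on_left ?z) + card (on_left ?x) * card (on_mid ?z) +
   ascents id (on_mid ?z) (on_mid ?x))"
  using ascents_two_bars[OF sub(1,1,2,2)] by (simp add: union_arcs_left)
 have "even (\<Sum>c\<in>arcs_right ?x. \<Sum>c'\<in>arcs_right ?z. ascents (position m k) c c')"
 proof (intro dvd_sum)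
  fix c c' assume c: "c \<in> arcs_right ?x" "c' \<in> arcs_right ?z"
  then have "c ~= {}" "upper ` c \<subseteq> component ?x" "upper ` c' \<subseteq> component ?z"
   using diagramsD(2)[OF E, of c] by (auto simp: arcs_right_def)
  then have "c ~= c'" using disj by blast
  then show "even (ascents (position m k) c c')"
   using c by (intro noncrossing_ascents_even[OF E]) (auto simp: arcs_right_def)
 qed
 also have "(\<Sum>c\<in>arcs_right ?x. \<Sum>c'\<in>arcs_right ?z. ascents (position m k) c c') =
   ascents (position m k) (\<Union>(arcs_right ?x)) (\<Union>(arcs_right ?z))"
  using diagramsD(2,3)[OF E] component_finite
  by (intro ascents_union[symmetric]) (auto simp: arcs_right_def intro: card_ge_0_finite)
 finally have right: "even (ascents id (on_mid ?x) (on_mid ?z) + card (on_mid ?x) * card (on_right ?z) +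
   ascents id (on_right ?z) (on_right ?x))"
  using ascents_two_bars[OF sub(2,2,3,3)] by (simp add: union_arcs_right)
 have mid: "ascents id (on_mid ?x) (on_mid ?z) + ascents id (on_mid ?z) (on_mid ?x) =
   card (on_mid ?x) * card (on_mid ?z)"
  using disj component_finite by (intro ascents_total) (auto simp: on_mid_def)
 have "even ((card (on_left ?x) + card (on_mid ?x)) * (card (on_mid ?z) + card (on_right ?z)))"
  by (simp add: card_arcs_left)
 moreover have "(ascents id (on_left ?x) (on_left ?z) + card (on_left ?x) * card (on_right ?z) +
   ascents id (on_right ?z) (on_right ?x)) +
   (card (on_left ?x) + card (on_mid ?x)) * (card (on_mid ?z) + card (on_right ?z)) =
  (ascents id (on_left ?x) (on_left ?z) + card (on_left ?x) * card (on_mid ?z) +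
   ascents id (on_mid ?z) (on_mid ?x)) +
  (ascents id (on_mid ?x) (on_mid ?z) + card (on_mid ?x) * card (on_right ?z) +
   ascents id (on_right ?z) (on_right ?x)) + 2 * (card (on_left ?x) * card (on_right ?z))"
  using mid by (simp add: algebra_simps)
 moreover have "even g" if "g + p = a + b + 2 * c" "even p" "even a" "even b" for g p a b c :: nat
  using that by presburger
 ultimately have "even (ascents id (on_left ?x) (on_left ?z) + card (on_left ?x) * card (on_right ?z) +
   ascents id (on_right ?z) (on_right ?x))"
  using left right by blast
 then show ?thesis
  unfolding outer_component[OF x] outer_component[OF z] ascents_two_bars[OF sub(1,1,3,3)] .
qed

theorem compose_closed: "glue D E \<in> diagrams l k"
 unfolding diagrams_def mem_Collect_eq
proof (intro conjI ballI notI)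
 show "partition_on (nodes l k) (glue D E)" by (rule compose_partition)
 show "card c = 2" if "c \<in> glue D E" for c using that by (auto simp: compose_diagrams_def)
 assume "\<exists>x y z w. {x, y} \<in> glue D E & {z, w} \<in> glue D E &
  position l k x < position l k z & position l k z < position l k y & position l k y < position l k w"
 then obtain x y z w where arcs: "{x, y} \<in> glue D E" "{z, w} \<in> glue D E"
  and lt: "position l k x < position l k z" "position l k z < position l k y" "position l k y < position l k w"
  by blast
 have nodes: "x \<in> nodes l k" "z \<in> nodes l k"
  using arcs compose_arc_nodes by (auto simp: compose_arc_iff)
 have "component (outer_node x) ~= component (outer_node z)"
 proof
  assume "component (outer_node x) = component (outer_node z)"
  then have "{x, y} = {z, w}" using compose_block[OF arcs(1)] compose_block[OF arcs(2)] by simp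
  then show False using lt by (auto simp: doubleton_eq_iff)
 qed
 from compose_ascents_even[OF nodes this]
 have "even (ascents (position l k) {x, y} {z, w})"
  unfolding compose_block[OF arcs(1)] compose_block[OF arcs(2)] .
 then show False using crossing_ascents_odd[of "position l k", OF lt] by blast
qed

end

section \<open>Reflection\<close>

definition flip_node :: "nat + nat => nat + nat" where "flip_node = case_sum Inr Inl"
definition flip :: "diagram => diagram" where "flip D = (`) flip_node ` D"

lemma flip_node_simps [simp]: "flip_node (Inl i) = Inr i" "flip_node (Inr i) = Inl i"
 by (simp_all add: flip_node_def)

lemma flip_node_flip_node [simp]: "flip_node (flip_node x) = x"
 by (cases x) simp_all

lemma flip_node_inj: "inj flip_node"
 by (metis flip_node_flip_node injI)

lemma flip_flip [simp]: "flip (flip D) = D"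
 by (simp add: flip_def image_image)

lemma flip_arc_iff: "{x, y} \<in> flip D \<longleftrightarrow> {flip_node x, flip_node y} \<in> D"
proof
 assume "{x, y} \<in> flip D"
 then obtain c where "c \<in> D" "{x, y} = flip_node ` c" by (auto simp: flip_def)
 then have "c = flip_node ` {x, y}" by (simp add: image_image)
 then show "{flip_node x, flip_node y} \<in> D" using \<open>c \<in> D\<close> by simp
next
 assume "{flip_node x, flip_node y} \<in> D"
 then show "{x, y} \<in> flip D" unfolding flip_def by (rule rev_image_eqI) simp
qed

lemma flip_nodes: "flip_node ` nodes m k = nodes k m"
 by (auto simp: nodes_def image_Un image_image)

lemma position_flip: "x \<in> nodes k m ==> position m k (flip_node x) = m + k - 1 - position k m x"
 by (auto simp: nodes_def)

lemma flip_diagrams: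
 assumes D: "D \<in> diagrams m k"
 shows "flip D \<in> diagrams k m"
 unfolding diagrams_def mem_Collect_eq
proof (intro conjI ballI notI)
 show "partition_on (nodes k m) (flip D)"
 proof (rule partition_onI)
  show "\<Union>(flip D) = nodes k m"
   unfolding flip_nodes[of m k, symmetric] using diagramsD(1)[OF D] by (auto simp: flip_def)
  show "disjnt c c'" if "c \<in> flip D" "c' \<in> flip D" "c ~= c'" for c c'
  proof -
   obtain a b where ab: "c = flip_node ` a" "c' = flip_node ` b" "a \<in> D" "b \<in> D"
    using \<open>c \<in> flip D\<close> \<open>c' \<in> flip D\<close> by (auto simp: flip_def)
   then have "a \<inter> b = {}" using diagramsD(3)[OF D, of a b] that(3) by blast
   then have "flip_node ` (a \<inter> b) = {}" by simp
   then show ?thesis unfolding disjnt_def ab(1,2) image_Int[OF flip_node_inj] .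
  qed
  show "{} \<notin> flip D" using diagramsD(2)[OF D] by (force simp: flip_def)
 qed
 show "card c = 2" if "c \<in> flip D" for c
  using that diagramsD(2)[OF D] card_image[OF inj_on_subset[OF flip_node_inj subset_UNIV]]
  by (auto simp: flip_def)
 assume "\<exists>x y z w. {x, y} \<in> flip D & {z, w} \<in> flip D & position k m x < position k m z &
  position k m z < position k m y & position k m y < position k m w"
 then obtain x y z w where *: "{flip_node x, flip_node y} \<in> D" "{flip_node z, flip_node w} \<in> D"
  "position k m x < position k m z" "position k m z < position k m y" "position k m y < position k m w"
  by (auto simp: flip_arc_iff)
 have n: "x \<in> nodes k m" "y \<in> nodes k m" "z \<in> nodes k m" "w \<in> nodes k m"
  using diagram_arc_nodes[OF D *(1)] diagram_arc_nodes[OF D *(2)] flip_nodes[of m k]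
  by (metis flip_node_flip_node imageI)+
 have "position m k (flip_node v) < position m k (flip_node u)"
  if "u \<in> nodes k m" "v \<in> nodes k m" "position k m u < position k m v" for u v
 proof -
  have "position k m v < m + k" using that(2) by (auto simp: nodes_def)
  then show ?thesis
   using that(3) unfolding position_flip[OF that(1)] position_flip[OF that(2)] by linarith
 qed
 then have "position m k (flip_node w) < position m k (flip_node y)"
  "position m k (flip_node y) < position m k (flip_node z)"
  "position m k (flip_node z) < position m k (flip_node x)"
  using *(3-5) n by auto
 moreover have "{flip_node w, flip_node z} \<in> D" "{flip_node y, flip_node x} \<in> D"
  using *(1,2) by (simp_all add: insert_commute)
 ultimately show False
  using diagramsD(4)[OF D, of "flip_node w" "flip_node z" "flip_node y" "flip_node x"] by blast
qed

lemma flip_bij: "bij_betw flip (diagrams m k) (diagrams k m)"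
 by (rule bij_betw_byWitness[of _ flip]) (auto intro: flip_diagrams)

lemma flip_identity: "flip (identity_diagram k) = identity_diagram k"
 by (simp add: flip_def identity_diagram_def setcompr_eq_image image_image insert_commute)

fun flip_glued :: "glued_node => glued_node" where
 "flip_glued (GLeft i) = GRight i" | "flip_glued (GMid i) = GMid i" | "flip_glued (GRight i) = GLeft i"

lemma flip_glued_flip_glued [simp]: "flip_glued (flip_glued x) = x"
 by (cases x) simp_all

lemma flip_glued_inj: "inj flip_glued"
 by (metis flip_glued_flip_glued injI)

lemma flip_glued_simps: "lower (flip_node x) = flip_glued (upper x)" "upper (flip_node x) = flip_glued (lower x)"
 "outer_node (flip_node x) = flip_glued (outer_node x)"
 by (cases x; simp add: outer_node_def)+

lemma glued_arcs_flip: "glued_arcs (flip E) (flip D) = (`) flip_glued ` glued_arcs D E"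
 by (simp add: glued_arcs_def flip_def image_Un image_image flip_glued_simps Un_commute)

lemma connected_flip_imp:
 "(x, y) \<in> conn D E ==> (flip_glued x, flip_glued y) \<in> conn (flip E) (flip D)"
 unfolding connected_glued_def
proof (induction rule: rtrancl_induct)
 case (step y z)
 then have "flip_glued ` {y, z} \<in> glued_arcs (flip E) (flip D)" unfolding glued_arcs_flip by blast
 then show ?case using step by (auto intro: rtrancl_into_rtrancl)
qed simp

lemma connected_flip:
 "(flip_glued x, flip_glued y) \<in> conn (flip E) (flip D) \<longleftrightarrow> (x, y) \<in> conn D E"
 using connected_flip_imp[of x y D E] connected_flip_imp[of "flip_glued x" "flip_glued y" "flip E" "flip D"]
 by auto

lemma compose_flip: "glue (flip E) (flip D) = flip (glue D E)"
proof -
 have *: "{x, y} \<in> glue D E \<longleftrightarrow> x ~= y & (outer_node x, outer_node y) \<in> conn D E"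
  for x y D E
  unfolding compose_diagrams_def using connected_glued_sym by (auto simp: doubleton_eq_iff)
 have "{x, y} \<in> glue (flip E) (flip D) \<longleftrightarrow> {x, y} \<in> flip (glue D E)" for x y
  unfolding flip_arc_iff *
  using connected_flip[of "outer_node (flip_node x)" "outer_node (flip_node y)" E D]
  by (auto simp flip: flip_glued_simps) (metis flip_node_flip_node)
 moreover have "\<exists>x y. c = {x, y}" if "c \<in> glue (flip E) (flip D) \<union> flip (glue D E)" for c
  using that by (auto simp: compose_diagrams_def flip_def)
 ultimately show ?thesis by blast
qed

lemma closed_loops_flip: "loops (flip E) (flip D) = loops D E"
proof -
 have comp: "conn (flip E) (flip D) `` {flip_glued x} = flip_glued ` (conn D E `` {x})" for D E x
 proof (rule Set.set_eqI)
  fix y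
  have "y \<in> flip_glued ` (conn D E `` {x}) \<longleftrightarrow> flip_glued y \<in> conn D E `` {x}"
   by (metis flip_glued_flip_glued image_iff)
  then show "y \<in> conn (flip E) (flip D) `` {flip_glued x} \<longleftrightarrow>
    y \<in> flip_glued ` (conn D E `` {x})"
   using connected_flip[of x "flip_glued y" E D] by simp
 qed
 have mid: "flip_glued ` C \<subseteq> range GMid \<longleftrightarrow> C \<subseteq> range GMid" for C
 proof -
  have "flip_glued y \<in> range GMid \<longleftrightarrow> y \<in> range GMid" for y by (cases y) auto
  then show ?thesis by blast
 qed
 have "{C. (\<exists>x\<in>\<Union>(glued_arcs (flip E) (flip D)). C = conn (flip E) (flip D) `` {x}) & C \<subseteq> range GMid} =
  (`) flip_glued ` {C. (\<exists>x\<in>\<Union>(glued_arcs D E). C = conn D E `` {x}) & C \<subseteq> range GMid}"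
  unfolding glued_arcs_flip by (auto simp: comp mid image_iff) (metis mid)+
 then show ?thesis
  unfolding closed_loops_def
  using card_image[of "(`) flip_glued"] by (simp add: inj_on_def inj_image_eq_iff[OF flip_glued_inj])
qed


section \<open>Cups\<close>

lemma compose_mem_iff:
 "{x, y} \<in> glue D E \<longleftrightarrow> x ~= y & (outer_node x, outer_node y) \<in> conn D E"
 unfolding compose_diagrams_def using connected_glued_sym by (auto simp: doubleton_eq_iff)

definition left_cups :: "diagram => nat set" where
 "left_cups D = {s. {Inl s, Inl (Suc s)} \<in> D}"

lemma left_cups_bounded: "D \<in> diagrams m k ==> s \<in> left_cups D ==> Suc s < m"
 using diagram_arc_nodes(2)[of D m k "Inl s" "Inl (Suc s)"] by (auto simp: left_cups_def nodes_def)

lemma left_cups_nonadjacent: "D \<in> diagrams m k ==> s \<in> left_cups D ==> Suc s \<notin> left_cups D"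
 using diagram_arc_unique[of D m k "Inl (Suc s)" "Inl s" "Inl (Suc (Suc s))"]
 by (auto simp: left_cups_def insert_commute)

lemma left_arc_compose: "{Inl i, Inl j} \<in> D ==> i ~= j ==> {Inl i, Inl j} \<in> glue D E"
 using connected_lower[of "Inl i" "Inl j" D E]
 by (simp add: compose_mem_iff outer_node_def)

lemma left_cups_compose: "left_cups D \<subseteq> left_cups (glue D E)"
 using left_arc_compose by (auto simp: left_cups_def)

text \<open>A shortest arc joining two nodes of the left bar is a cup, since an arc starting below it has to
  stay below it.  Without such arcs all nodes of the left bar are joined to the right bar, and they are
  so in ascending order.\<close>

lemma identity_if_no_left_cups:
 assumes D: "D \<in> diagrams k k" and none: "left_cups D = {}"
 shows "D = identity_diagram k"
proof -
 have no_arc: "{Inl i, Inl j} \<notin> D" if "i < j" for i j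
  using that
 proof (induction "j - i" arbitrary: i j rule: less_induct)
  case less
  show ?case
  proof
   assume arc: "{Inl i, Inl j} \<in> D"
   have jk: "j < k" using diagram_arc_nodes(2)[OF D arc] by (auto simp: nodes_def)
   have "j ~= Suc i" using arc none by (auto simp: left_cups_def)
   then have ij: "Suc i < j" using less.prems by simp
   then have "Inl (Suc i) \<in> nodes k k" using jk by (auto simp: nodes_def)
   then obtain y where y: "{Inl (Suc i), y} \<in> D" "Inl (Suc i) ~= y" "y \<in> nodes k k" by (rule diagram_arc[OF D])
   have "y ~= Inl i" using diagram_arc_unique[OF D arc, of "Inl (Suc i)"] y(1) ij by (auto simp: insert_commute)
   have "y ~= Inl j" using diagram_arc_unique[OF D, of "Inl j" "Inl i" "Inl (Suc i)"] arc y(1) by (auto simp: insert_commute)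
   have "\<not> position k k y < i"
    using diagramsD(4)[OF D, of y "Inl (Suc i)" "Inl i" "Inl j"] arc y(1) ij by (auto simp: insert_commute)
   moreover have "\<not> j < position k k y"
    using diagramsD(4)[OF D arc y(1)] ij by auto
   ultimately obtain u where u: "y = Inl u" "i < u" "u < j"
    using \<open>y ~= Inl i\<close> \<open>y ~= Inl j\<close> jk by (cases y) auto
   then have "u ~= Suc i" using y(2) by auto
   then have "Suc i < u" using u by simp
   then show False using less.hyps[of u "Suc i"] u y(1) ij by auto
  qed
 qed
 have through: "\<exists>j<k. {Inl i, Inr j} \<in> D" if "i < k" for i
 proof -
  have "Inl i \<in> nodes k k" using that by (auto simp: nodes_def)
  then obtain y where y: "{Inl i, y} \<in> D" "Inl i ~= y" "y \<in> nodes k k" by (rule diagram_arc[OF D])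
  show ?thesis
  proof (cases y)
   case (Inl j)
   then have "i < j \<or> j < i" using y(2) by auto
   then show ?thesis using no_arc[of i j] no_arc[of j i] y(1) Inl by (auto simp: insert_commute)
  next
   case (Inr j)
   then show ?thesis using y by (auto simp: nodes_def)
  qed
 qed
 then obtain \<pi> where \<pi>: "!!i. i < k ==> \<pi> i < k" "!!i. i < k ==> {Inl i, Inr (\<pi> i)} \<in> D" by metis
 have mono: "\<pi> i < \<pi> j" if "i < j" "j < k" for i j
 proof -
  have "\<pi> i ~= \<pi> j"
   using diagram_arc_unique[OF D, of "Inr (\<pi> i)" "Inl i" "Inl j"] \<pi>(2)[of i] \<pi>(2)[of j] that
   by (auto simp: insert_commute)
  moreover have "\<not> \<pi> j < \<pi> i"
  proof
   assume "\<pi> j < \<pi> i"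
   then have l3: "position k k (Inr (\<pi> i)) < position k k (Inr (\<pi> j))" using \<pi>(1)[of i] that by simp
   have l1: "position k k (Inl i) < position k k (Inl j)" using that by simp
   have l2: "position k k (Inl j) < position k k (Inr (\<pi> i))" using that by simp
   have "i < k" using that by simp
   from diagramsD(4)[OF D \<pi>(2)[OF this] \<pi>(2)[OF that(2)] l1 l2 l3] show False .
  qed
  ultimately show ?thesis by simp
 qed
 have ge: "i \<le> \<pi> i" if "i < k" for i
  using that
 proof (induction i)
  case (Suc i)
  then show ?case using mono[of i "Suc i"] by simp
 qed simp
 have le: "\<pi> (k - Suc i) \<le> k - Suc i" if "i < k" for i
  using that
 proof (induction i)
  case 0
  then show ?case using \<pi>(1)[of "k - 1"] by simp
 next
  case (Suc i)
  have "k - Suc (Suc i) < k - Suc i" "k - Suc i < k" using Suc.prems by auto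
  from mono[OF this] show ?case using Suc by simp
 qed
 have fixed: "\<pi> i = i" if "i < k" for i
  using ge[OF that] le[of "k - Suc i"] that by simp
 have id: "{Inl i, Inr i} \<in> D" if "i < k" for i using \<pi>(2)[OF that] fixed[OF that] by simp
 show ?thesis
 proof
  show "identity_diagram k \<subseteq> D" using id by (auto simp: identity_diagram_def)
  show "D \<subseteq> identity_diagram k"
  proof
   fix c assume c: "c \<in> D"
   then have "c \<subseteq> nodes k k" "card c = 2" using diagramsD(1,2)[OF D] by auto
   then have "c \<subseteq> nodes k k" "c ~= {}" by auto
   then obtain i where i: "i < k" "Inl i \<in> c \<or> Inr i \<in> c" by (auto simp: nodes_def)
   then have "c \<inter> {Inl i, Inr i} ~= {}" by auto
   then have "c = {Inl i, Inr i}" using diagramsD(3)[OF D c id[OF i(1)]] by blast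
   then show "c \<in> identity_diagram k" using i by (auto simp: identity_diagram_def)
  qed
 qed
qed

lemma left_cups_identity: "left_cups (identity_diagram k) = {}"
 by (auto simp: left_cups_def identity_diagram_def doubleton_eq_iff)

text \<open>The generator \<open>U\<^sub>t\<close> of the Temperley--Lieb algebra.\<close>

definition cup_cap :: "nat => nat => diagram" where
 "cup_cap N t = {{Inl t, Inl (Suc t)}, {Inr t, Inr (Suc t)}} \<union> {{Inl i, Inr i} | i. i < N & i ~= t & i ~= Suc t}"

lemma cup_cap_diagram:
 assumes "Suc t < N"
 shows "cup_cap N t \<in> diagrams N N"
 unfolding diagrams_def mem_Collect_eq
proof (intro conjI ballI notI)
 show "partition_on (nodes N N) (cup_cap N t)"
 proof (rule partition_onI)
  show "\<Union>(cup_cap N t) = nodes N N" using assms by (auto simp: cup_cap_def nodes_def)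
 qed (auto simp: cup_cap_def disjnt_def)
 show "card c = 2" if "c \<in> cup_cap N t" for c using that by (auto simp: cup_cap_def)
 have arcs: "position N N x + position N N y = 2 * N - 1 \<or> position N N y = Suc (position N N x) \<or>
   position N N x = Suc (position N N y)" if "{x, y} \<in> cup_cap N t" for x y
  using that assms by (auto simp: cup_cap_def doubleton_eq_iff)
 assume "\<exists>x y z w. {x, y} \<in> cup_cap N t & {z, w} \<in> cup_cap N t &
     position N N x < position N N z & position N N z < position N N y & position N N y < position N N w"
 then obtain x y z w where "{x, y} \<in> cup_cap N t" "{z, w} \<in> cup_cap N t"
   "position N N x < position N N z" "position N N z < position N N y" "position N N y < position N N w" by blast
 then show False using arcs[of x y] arcs[of z w] by linarith
qed

lemma cup_cap_arcs:
 "{Inl t, Inl (Suc t)} \<in> cup_cap N t" "{Inr t, Inr (Suc t)} \<in> cup_cap N t"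
 "i < N ==> i ~= t ==> i ~= Suc t ==> {Inl i, Inr i} \<in> cup_cap N t"
 by (auto simp: cup_cap_def)

lemma left_cups_cup_cap_compose:
 assumes "Suc t < N" "E \<in> diagrams N N" "u \<in> left_cups E" "u ~= t" "u ~= Suc t" "Suc u ~= t"
 shows "u \<in> left_cups (glue (cup_cap N t) E)"
proof -
 have u: "Suc u < N" using left_cups_bounded assms(2,3) .
 let ?c = "conn (cup_cap N t) E"
 have "(GLeft u, GMid u) \<in> ?c" "(GLeft (Suc u), GMid (Suc u)) \<in> ?c"
  using connected_lower[OF cup_cap_arcs(3)[of u N t], of E] connected_lower[OF cup_cap_arcs(3)[of "Suc u" N t], of E] u assms
  by simp_all
 moreover have "(GMid u, GMid (Suc u)) \<in> ?c"
  using connected_upper[of "Inl u" "Inl (Suc u)" E] assms(3) by (simp add: left_cups_def)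
 ultimately have "(GLeft u, GLeft (Suc u)) \<in> ?c" using connected_glued_sym connected_glued_trans by blast
 then show ?thesis
  by (simp add: left_cups_def compose_mem_iff outer_node_def)
qed

text \<open>Multiplication by \<open>U\<^sub>t\<close> reconnects the arcs at the nodes \<open>t\<close> and \<open>t + 1\<close> of the left bar.\<close>

context
 fixes N t :: nat and D :: diagram and p q
 assumes t: "Suc t < N" and D: "D \<in> diagrams N N"
  and p: "{Inl t, p} \<in> D" and q: "{Inl (Suc t), q} \<in> D" and pq: "p ~= Inl (Suc t)"
begin

definition "reconnected = D - {{Inl t, p}, {Inl (Suc t), q}} \<union> {{Inl t, Inl (Suc t)}, {p, q}}"

lemma pq_distinct: "p ~= q" "p ~= Inl t" "q ~= Inl t" "q ~= Inl (Suc t)"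
proof -
 show "p ~= q" using diagram_arc_unique[OF D, of p "Inl t" "Inl (Suc t)"] p q by (auto simp: insert_commute)
 show "p ~= Inl t" "q ~= Inl (Suc t)" using diagram_arc_nodes(3)[OF D] p q by auto
 show "q ~= Inl t" using diagram_arc_unique[OF D, of "Inl t" "Inl (Suc t)" p] q p pq by (auto simp: insert_commute)
qed

definition block :: "nat + nat => (nat + nat) set" where
 "block x = (if x = Inl t \<or> x = Inl (Suc t) then {Inl t, Inl (Suc t)}
  else if x = p \<or> x = q then {p, q} else (THE c. c \<in> D & x \<in> c))"

definition label :: "glued_node => (nat + nat) set" where
 "label x = (case x of GLeft i => block (Inl i) | GRight i => block (Inr i)
  | GMid i => if i = t \<or> i = Suc t then {p, q} else block (Inl i))"

lemma block_arc:
 assumes "{u, v} \<in> D" "u \<notin> {Inl t, Inl (Suc t), p, q}" "v \<notin> {Inl t, Inl (Suc t), p, q}"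
 shows "block u = {u, v}"
proof -
 have "(THE c. c \<in> D & u \<in> c) = {u, v}"
  by (rule the_equality) (use assms(1) diagramsD(3)[OF D assms(1)] in auto)
 then show ?thesis using assms by (auto simp: block_def)
qed

lemma other_arc:
 assumes "{u, v} \<in> D"
 shows "{u, v} = {Inl t, p} \<or> {u, v} = {Inl (Suc t), q} \<or>
  u \<notin> {Inl t, Inl (Suc t), p, q} & v \<notin> {Inl t, Inl (Suc t), p, q}"
 using diagramsD(3)[OF D assms p] diagramsD(3)[OF D assms q] by blast

lemma label_connected:
 assumes "(x, y) \<in> conn (cup_cap N t) D"
 shows "label x = label y"
proof (rule connected_glued_invariant[OF assms])
 show "card c = 2" if "c \<in> cup_cap N t \<union> D" for c
  using that diagramsD(2)[OF D] diagramsD(2)[OF cup_cap_diagram[OF t]] by blast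
 show "label (lower u) = label (lower v)" if "{u, v} \<in> cup_cap N t" for u v
  using that by (auto simp: cup_cap_def doubleton_eq_iff label_def block_def)
 have up: "label (upper w) = block w" if "w ~= Inl t" "w ~= Inl (Suc t)" for w
  using that by (cases w) (auto simp: label_def)
 show "label (upper u) = label (upper v)" if uv: "{u, v} \<in> D" for u v
  using other_arc[OF uv]
 proof (elim disjE conjE)
  have "label (upper p) = {p, q}" "label (upper q) = {p, q}" "label (upper (Inl t)) = {p, q}"
   "label (upper (Inl (Suc t))) = {p, q}"
   using pq_distinct pq by (auto simp: up block_def) (simp_all add: label_def)
  then show "label (upper u) = label (upper v)" if "{u, v} = {Inl t, p}"
   using that by (auto simp: doubleton_eq_iff)
  show "label (upper u) = label (upper v)" if "{u, v} = {Inl (Suc t), q}"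
   using that \<open>label (upper q) = {p, q}\<close> \<open>label (upper (Inl (Suc t))) = {p, q}\<close>
   by (auto simp: doubleton_eq_iff)
  assume "u \<notin> {Inl t, Inl (Suc t), p, q}" "v \<notin> {Inl t, Inl (Suc t), p, q}"
  then show "label (upper u) = label (upper v)"
   using block_arc[of u v] block_arc[of v u] uv by (simp add: up insert_commute)
 qed
qed

lemma outer_upper:
 assumes "x \<in> nodes N N" "x ~= Inl t" "x ~= Inl (Suc t)"
 shows "(outer_node x, upper x) \<in> conn (cup_cap N t) D"
proof (cases x)
 case (Inl i)
 then show ?thesis
  using assms connected_lower[OF cup_cap_arcs(3)[of i N t], of D] by (auto simp: outer_node_def nodes_def)
next
 case (Inr i)
 then show ?thesis by (simp add: outer_node_def connected_glued_refl)
qed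

lemma compose_cup_cap: "glue (cup_cap N t) D = reconnected"
proof -
 let ?c = "conn (cup_cap N t) D"
 note U = cup_cap_diagram[OF t]
 have lab: "label (outer_node x) = block x" for x by (cases x) (simp_all add: label_def outer_node_def)
 have blk: "{x, y} \<in> reconnected" if xy: "x \<in> nodes N N" "x ~= y" "block x = block y" "y \<in> nodes N N" for x y
 proof -
  consider "x \<in> {Inl t, Inl (Suc t)}" | "x \<in> {p, q}" | v where "{x, v} \<in> D" "x \<notin> {Inl t, Inl (Suc t), p, q}"
   "v \<notin> {Inl t, Inl (Suc t), p, q}"
   using diagram_arc[OF D xy(1)] other_arc by (metis doubleton_eq_iff insert_iff)
  moreover have "y \<in> {Inl t, Inl (Suc t)} & block y = {Inl t, Inl (Suc t)} \<or> y \<in> {p, q} & block y = {p, q} \<or>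
   (\<exists>w. {y, w} \<in> D & block y = {y, w} & y \<notin> {Inl t, Inl (Suc t), p, q} & w \<notin> {Inl t, Inl (Suc t), p, q})"
  proof -
   obtain w where w: "{y, w} \<in> D" by (rule diagram_arc[OF D xy(4)])
   show ?thesis
    using other_arc[OF w] block_arc[OF w] w pq pq_distinct by (auto simp: block_def doubleton_eq_iff)
  qed
  ultimately show ?thesis
  proof cases
   case 1
   then have "block x = {Inl t, Inl (Suc t)}" by (auto simp: block_def)
   then have "y \<in> {Inl t, Inl (Suc t)}"
    using xy(3) \<open>y \<in> {Inl t, Inl (Suc t)} & _ \<or> _\<close> pq pq_distinct by (auto simp: doubleton_eq_iff)
   then show ?thesis using 1 xy(2) by (auto simp: reconnected_def insert_commute)
  next
   case 2
   then have "block x = {p, q}" using pq pq_distinct by (auto simp: block_def)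
   then have "y \<in> {p, q}"
    using xy(3) \<open>y \<in> {Inl t, Inl (Suc t)} & _ \<or> _\<close> pq pq_distinct by (auto simp: doubleton_eq_iff)
   then show ?thesis using 2 xy(2) by (auto simp: reconnected_def insert_commute)
  next
   case 3
   then have "block x = {x, v}" by (intro block_arc)
   then have "y = v"
    using xy(2,3) \<open>y \<in> {Inl t, Inl (Suc t)} & _ \<or> _\<close> 3 by (auto simp: doubleton_eq_iff)
   then show ?thesis using 3 by (auto simp: reconnected_def doubleton_eq_iff)
  qed
 qed
 have con: "(outer_node x, outer_node y) \<in> ?c" "x ~= y" if xy: "{x, y} \<in> reconnected" for x y
 proof -
  have tt: "(GLeft t, GLeft (Suc t)) \<in> ?c" using connected_lower[OF cup_cap_arcs(1)[of t N], of D] by simp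
  have mm: "(GMid t, GMid (Suc t)) \<in> ?c" using connected_lower[OF cup_cap_arcs(2)[of t N], of D] by simp
  have "(upper p, GMid t) \<in> ?c" "(upper q, GMid (Suc t)) \<in> ?c"
   using connected_upper[OF p] connected_upper[OF q] connected_glued_sym by auto
  moreover have "p \<in> nodes N N" "q \<in> nodes N N" using diagram_arc_nodes[OF D] p q by auto
  ultimately have pqc: "(outer_node p, outer_node q) \<in> ?c"
   using outer_upper[of p] outer_upper[of q] pq pq_distinct mm
   by (metis connected_glued_sym connected_glued_trans)
  from xy consider "{x, y} = {Inl t, Inl (Suc t)}" | "{x, y} = {p, q}" |
   "{x, y} \<in> D" "{x, y} ~= {Inl t, p}" "{x, y} ~= {Inl (Suc t), q}" by (auto simp: reconnected_def)
  then have "(outer_node x, outer_node y) \<in> ?c & x ~= y"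
  proof cases
   case 1
   then show ?thesis using tt connected_glued_sym by (auto simp: doubleton_eq_iff outer_node_def)
  next
   case 2
   then show ?thesis using pqc connected_glued_sym pq_distinct(1) by (auto simp: doubleton_eq_iff)
  next
   case 3
   then have "x \<notin> {Inl t, Inl (Suc t)}" "y \<notin> {Inl t, Inl (Suc t)}" using other_arc[OF 3(1)] by auto
   moreover have "x \<in> nodes N N" "y \<in> nodes N N" "x ~= y" using diagram_arc_nodes[OF D 3(1)] by auto
   ultimately show ?thesis
    using outer_upper[of x] outer_upper[of y] connected_upper[OF 3(1), of "cup_cap N t"]
     connected_glued_sym connected_glued_trans by (metis insert_iff)
  qed
  then show "(outer_node x, outer_node y) \<in> ?c" "x ~= y" by auto
 qed
 have "{x, y} \<in> glue (cup_cap N t) D \<longleftrightarrow> {x, y} \<in> reconnected" for x y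
 proof
  assume "{x, y} \<in> glue (cup_cap N t) D"
  then have c: "x ~= y" "(outer_node x, outer_node y) \<in> ?c" by (auto simp: compose_arc_iff[OF U D])
  then show "{x, y} \<in> reconnected"
   using blk[of x y] compose_arc_nodes[OF U D c(2,1)] label_connected[OF c(2)] by (simp add: lab)
 next
  assume "{x, y} \<in> reconnected"
  from con[OF this] show "{x, y} \<in> glue (cup_cap N t) D" by (simp add: compose_arc_iff[OF U D])
 qed
 note arcs = this
 have pair: "\<exists>x y. c = {x, y}" if "c \<in> glue (cup_cap N t) D \<union> reconnected" for c
 proof -
  have "card c = 2 \<or> (\<exists>x y. c = {x, y})"
   using that diagramsD(2)[OF D, of c] by (auto simp: compose_diagrams_def reconnected_def)
  then show ?thesis by (auto simp: card_2_iff)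
 qed
 show ?thesis
 proof (rule Set.set_eqI)
  fix c
  show "c \<in> glue (cup_cap N t) D \<longleftrightarrow> c \<in> reconnected"
   using pair[of c] arcs by (cases "\<exists>x y. c = {x, y}") auto
 qed
qed

lemma loops_cup_cap: "loops (cup_cap N t) D = 0"
proof -
 let ?c = "conn (cup_cap N t) D"
 have "\<exists>y. (GMid i, y) \<in> ?c & y \<notin> range GMid" if i: "i < N" for i
 proof (cases "i = t \<or> i = Suc t")
  case False
  then have "(GLeft i, GMid i) \<in> ?c" using connected_lower[OF cup_cap_arcs(3)[of i N t], of D] i by simp
  then show ?thesis using connected_glued_sym by blast
 next
  case True
  have out: "(upper r, outer_node r) \<in> ?c" if "r = p \<or> r = q" for r
  proof -
   have "r \<in> nodes N N" using diagram_arc_nodes(2)[OF D] p q that by blast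
   then show ?thesis using outer_upper[of r] that pq pq_distinct connected_glued_sym by blast
  qed
  have "(GMid t, upper p) \<in> ?c" "(GMid (Suc t), upper q) \<in> ?c" using connected_upper[OF p] connected_upper[OF q] by auto
  then have "(GMid i, outer_node p) \<in> ?c \<or> (GMid i, outer_node q) \<in> ?c"
   using True out connected_glued_trans by metis
  moreover have "outer_node r \<notin> range GMid" for r by (cases r) (auto simp: outer_node_def)
  ultimately show ?thesis by blast
 qed
 moreover have "i < N" if "GMid i \<in> \<Union>(glued_arcs (cup_cap N t) D)" for i
  using that by (auto simp: glued_arcs_nodes[OF cup_cap_diagram[OF t] D])
 ultimately have "{C. (\<exists>x\<in>\<Union>(glued_arcs (cup_cap N t) D). C = ?c `` {x}) & C \<subseteq> range GMid} = {}"
 proof -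
  assume mid: "!!i. i < N ==> \<exists>y. (GMid i, y) \<in> ?c & y \<notin> range GMid"
   and bound: "!!i. GMid i \<in> \<Union>(glued_arcs (cup_cap N t) D) ==> i < N"
  have "\<not> ?c `` {x} \<subseteq> range GMid" if "x \<in> \<Union>(glued_arcs (cup_cap N t) D)" for x
  proof
   assume sub: "?c `` {x} \<subseteq> range GMid"
   then obtain i where i: "x = GMid i" using connected_glued_refl[of x] by blast
   then show False using mid[of i] bound[of i] sub that by blast
  qed
  then show ?thesis by blast
 qed
 then show ?thesis by (simp only: closed_loops_def card.empty)
qed

end

text \<open>\<open>U\<^sub>s U\<^sub>t D = D\<close> for neighbours \<open>s\<close>, \<open>t\<close> if \<open>D\<close> has a cup at \<open>s\<close>; meanwhile, that cup is moved
  to \<open>t\<close> and the other cups stay.\<close>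

lemma move_cup:
 assumes D: "D \<in> diagrams N N" and s: "s \<in> left_cups D" and t: "Suc t < N" and st: "s = Suc t \<or> t = Suc s"
 shows "loops (cup_cap N t) D = 0"
  and "loops (cup_cap N s) (glue (cup_cap N t) D) = 0"
  and "glue (cup_cap N s) (glue (cup_cap N t) D) = D"
  and "t \<in> left_cups (glue (cup_cap N t) D)"
  and "u \<in> left_cups D ==> u ~= s ==> Suc u ~= t ==> u ~= Suc t ==>
   u \<in> left_cups (glue (cup_cap N t) D)"
proof -
 have sN: "Suc s < N" using left_cups_bounded[OF D s] .
 have cup: "{Inl s, Inl (Suc s)} \<in> D" using s by (simp add: left_cups_def)
 let ?D = "glue (cup_cap N t) D"
 have D1: "?D \<in> diagrams N N" by (rule compose_closed[OF cup_cap_diagram[OF t] D])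
 have "Inl t \<in> nodes N N" "Inl (Suc t) \<in> nodes N N" using t by (auto simp: nodes_def)
 then obtain p q where p: "{Inl t, p} \<in> D" and q: "{Inl (Suc t), q} \<in> D" using diagram_arc[OF D] by metis
 have ends: "s = Suc t ==> q = Inl (Suc (Suc t))" "t = Suc s ==> p = Inl s"
  using diagram_arc_unique[OF D, of "Inl (Suc t)" q "Inl (Suc (Suc t))"] diagram_arc_unique[OF D, of "Inl t" p "Inl s"]
   cup p q by (auto simp: insert_commute)
 have pq: "p ~= Inl (Suc t)"
  using st
 proof
  assume "s = Suc t"
  then show ?thesis
   using diagram_arc_unique[OF D, of "Inl (Suc t)" "Inl t" "Inl (Suc (Suc t))"] p cup by (auto simp: insert_commute)
 qed (use ends in auto)
 note ctx = t D p q pq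
 note dist = pq_distinct[OF ctx]
 have eq: "?D = D - {{Inl t, p}, {Inl (Suc t), q}} \<union> {{Inl t, Inl (Suc t)}, {p, q}}"
  using compose_cup_cap[OF ctx] reconnected_def[OF ctx] by simp
 show "loops (cup_cap N t) D = 0" by (rule loops_cup_cap[OF ctx])
 show "t \<in> left_cups ?D" unfolding eq by (simp add: left_cups_def)
 show "u \<in> left_cups ?D" if "u \<in> left_cups D" "u ~= s" "Suc u ~= t" "u ~= Suc t" for u
 proof -
  have "u ~= t" using that(1) p pq diagram_arc_unique[OF D p, of "Inl (Suc t)"] by (auto simp: left_cups_def)
  then show ?thesis using that unfolding eq by (auto simp: left_cups_def doubleton_eq_iff)
 qed
 obtain p' q' where p': "{Inl s, p'} \<in> ?D" and q': "{Inl (Suc s), q'} \<in> ?D" and pq': "p' ~= Inl (Suc s)"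
  and undo: "?D - {{Inl s, p'}, {Inl (Suc s), q'}} \<union> {{Inl s, Inl (Suc s)}, {p', q'}} = D"
  using st
 proof
  assume s: "s = Suc t"
  note q2 = ends(1)[OF s]
  have "{p, q} \<notin> D" "{Inl t, Inl (Suc t)} \<notin> D"
   using diagram_arc_unique[OF D, of p q "Inl t"] diagram_arc_unique[OF D p, of "Inl (Suc t)"] p pq dist by (auto simp: insert_commute)
  then have "?D - {{Inl s, Inl t}, {Inl (Suc s), p}} \<union> {{Inl s, Inl (Suc s)}, {Inl t, p}} = D"
   unfolding eq using p q s q2 by (auto simp: insert_commute)
  moreover have "{Inl s, Inl t} \<in> ?D" "{Inl (Suc s), p} \<in> ?D"
   unfolding eq using s q2 by (auto simp: insert_commute)
  ultimately show thesis by (intro that[of "Inl t" p]) (use s in simp_all)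
 next
  assume s: "t = Suc s"
  note p2 = ends(2)[OF s]
  have "{p, q} \<notin> D" "{Inl t, Inl (Suc t)} \<notin> D"
   using diagram_arc_unique[OF D, of p q "Inl t"] diagram_arc_unique[OF D p, of "Inl (Suc t)"] p pq dist by (auto simp: insert_commute)
  then have "?D - {{Inl s, q}, {Inl (Suc s), Inl (Suc t)}} \<union> {{Inl s, Inl (Suc s)}, {q, Inl (Suc t)}} = D"
   unfolding eq using p q s p2 by (auto simp: insert_commute)
  moreover have "{Inl s, q} \<in> ?D" "{Inl (Suc s), Inl (Suc t)} \<in> ?D"
   unfolding eq using s p2 by (auto simp: insert_commute)
  moreover have "q ~= Inl (Suc s)" using dist s by simp
  ultimately show thesis by (intro that[of q "Inl (Suc t)"])
 qed
 note ctx' = sN D1 p' q' pq'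
 show "loops (cup_cap N s) ?D = 0" by (rule loops_cup_cap[OF ctx'])
 show "glue (cup_cap N s) ?D = D"
  using compose_cup_cap[OF ctx'] reconnected_def[OF ctx'] undo by simp
qed

section \<open>Closing the left bar by cups\<close>

definition nested_caps :: "nat => diagram" where
 "nested_caps n = {{Inl (2 * i), Inl (Suc (2 * i))} | i. i < n}"

definition add_caps :: "nat => diagram => diagram" where
 "add_caps n D = nested_caps n \<union> D"

lemma cap_arc_iff:
 "{x, y} \<in> nested_caps n \<longleftrightarrow> (\<exists>i<n. x = Inl (2 * i) & y = Inl (Suc (2 * i)) \<or> x = Inl (Suc (2 * i)) & y = Inl (2 * i))"
 by (auto simp: nested_caps_def doubleton_eq_iff)

lemma union_caps: "\<Union>(nested_caps n) = Inl ` {..<2 * n}"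
proof
 show "\<Union>(nested_caps n) \<subseteq> Inl ` {..<2 * n}" by (auto simp: nested_caps_def)
 show "Inl ` {..<2 * n} \<subseteq> \<Union>(nested_caps n)"
 proof
  fix x :: "nat + nat" assume "x \<in> Inl ` {..<2 * n}"
  then obtain j where j: "x = Inl j" "j < 2 * n" by auto
  then have "j = 2 * (j div 2) \<or> j = Suc (2 * (j div 2))" by presburger
  moreover have "j div 2 < n" using j by simp
  ultimately show "x \<in> \<Union>(nested_caps n)" using j by (auto simp: nested_caps_def)
 qed
qed

lemma caps_disjoint: "c \<in> nested_caps n ==> c' \<in> nested_caps n ==> c ~= c' ==> c \<inter> c' = {}"
 by (auto simp: nested_caps_def) presburger+

lemma cap_unique: "{x, y} \<in> nested_caps n ==> {x, z} \<in> nested_caps n ==> y = z"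
 using caps_disjoint[of "{x, y}" n "{x, z}"] by (auto simp: doubleton_eq_iff)

lemma card_cap: "c \<in> nested_caps n ==> card c = 2"
 by (auto simp: nested_caps_def)

lemma nodes_zero: "nodes 0 m = Inr ` {..<m}"
 by (auto simp: nodes_def)

lemma position_shift: "position l m (Inr j) = l + position 0 m (Inr j)"
 by simp

lemma add_caps_closed:
 assumes D: "D \<in> diagrams 0 m"
 shows "add_caps n D \<in> diagrams (2 * n) m"
 unfolding diagrams_def mem_Collect_eq
proof (intro conjI ballI notI)
 note UD = diagramsD(1)[OF D]
 show "partition_on (nodes (2 * n) m) (add_caps n D)"
 proof (rule partition_onI)
  show "\<Union>(add_caps n D) = nodes (2 * n) m"
   unfolding add_caps_def Union_Un_distrib union_caps UD by (auto simp: nodes_def)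
  have cross: "c \<inter> c' = {}" if "c \<in> nested_caps n" "c' \<in> D" for c c'
  proof -
   have "c \<subseteq> Inl ` {..<2 * n}" "c' \<subseteq> Inr ` {..<m}"
    using that UD union_caps[of n] nodes_zero[of m] by blast+
   then show ?thesis by blast
  qed
  show "disjnt c c'" if "c \<in> add_caps n D" "c' \<in> add_caps n D" "c ~= c'" for c c'
   using that caps_disjoint[of c n c'] diagramsD(3)[OF D, of c c'] cross[of c c'] cross[of c' c]
   by (auto simp: add_caps_def disjnt_def)
  show "{} \<notin> add_caps n D" using card_cap diagramsD(2)[OF D] by (force simp: add_caps_def)
 qed
 show "card c = 2" if "c \<in> add_caps n D" for c
  using that card_cap diagramsD(2)[OF D] by (auto simp: add_caps_def)
 have arc: "position (2 * n) m y = Suc (position (2 * n) m x) & position (2 * n) m y < 2 * n \<or>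
   position (2 * n) m x = Suc (position (2 * n) m y) & position (2 * n) m x < 2 * n \<or>
   {x, y} \<in> D & position (2 * n) m x = 2 * n + position 0 m x & position (2 * n) m y = 2 * n + position 0 m y"
  if "{x, y} \<in> add_caps n D" for x y
 proof (cases "{x, y} \<in> nested_caps n")
  case True
  then show ?thesis by (auto simp: cap_arc_iff)
 next
  case False
  then have "{x, y} \<in> D" using that by (simp add: add_caps_def)
  moreover from this obtain i j where "x = Inr i" "y = Inr j"
   using diagram_arc_nodes(1,2)[OF D, of x y] unfolding nodes_zero by blast
  ultimately show ?thesis by simp
 qed
 assume "\<exists>x y z w. {x, y} \<in> add_caps n D & {z, w} \<in> add_caps n D &
  position (2 * n) m x < position (2 * n) m z & position (2 * n) m z < position (2 * n) m y &
  position (2 * n) m y < position (2 * n) m w"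
 then obtain x y z w where *: "{x, y} \<in> add_caps n D" "{z, w} \<in> add_caps n D"
  "position (2 * n) m x < position (2 * n) m z" "position (2 * n) m z < position (2 * n) m y"
  "position (2 * n) m y < position (2 * n) m w" by blast
 then have "{x, y} \<in> D & {z, w} \<in> D & position 0 m x < position 0 m z & position 0 m z < position 0 m y &
   position 0 m y < position 0 m w"
  using arc[OF *(1)] arc[OF *(2)] by linarith
 then show False using diagramsD(4)[OF D, of x y z w] by blast
qed

lemma remove_caps_closed:
 assumes D: "D \<in> diagrams (2 * n) m" and caps: "nested_caps n \<subseteq> D"
 shows "D - nested_caps n \<in> diagrams 0 m" "add_caps n (D - nested_caps n) = D"
proof -
 show "add_caps n (D - nested_caps n) = D" using caps by (auto simp: add_caps_def)
 have U: "\<Union>(D - nested_caps n) = nodes 0 m"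
 proof -
  have "\<Union>(D - nested_caps n) = \<Union>D - \<Union>(nested_caps n)"
  proof -
   have "c \<inter> c' = {}" if "c \<in> D - nested_caps n" "c' \<in> nested_caps n" for c c'
    using that caps diagramsD(3)[OF D, of c c'] by blast
   then show ?thesis by blast
  qed
  then show ?thesis using diagramsD(1)[OF D] by (auto simp: union_caps nodes_def)
 qed
 show "D - nested_caps n \<in> diagrams 0 m"
  unfolding diagrams_def mem_Collect_eq
 proof (intro conjI ballI notI)
  show "partition_on (nodes 0 m) (D - nested_caps n)"
   by (rule partition_onI) (use U diagramsD(3)[OF D] diagramsD(2)[OF D] in \<open>force simp: disjnt_def\<close>)+
  show "card c = 2" if "c \<in> D - nested_caps n" for c using that diagramsD(2)[OF D] by blast
  have pos: "position (2 * n) m x = 2 * n + position 0 m x" if "{x, y} \<in> D - nested_caps n" for x y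
  proof -
   have "x \<in> nodes 0 m" using U that by blast
   then show ?thesis by (auto simp: nodes_zero)
  qed
  assume "\<exists>x y z w. {x, y} \<in> D - nested_caps n & {z, w} \<in> D - nested_caps n &
   position 0 m x < position 0 m z & position 0 m z < position 0 m y & position 0 m y < position 0 m w"
  then obtain x y z w where *: "{x, y} \<in> D - nested_caps n" "{z, w} \<in> D - nested_caps n"
   "position 0 m x < position 0 m z" "position 0 m z < position 0 m y" "position 0 m y < position 0 m w" by blast
  have "position (2 * n) m x < position (2 * n) m z" "position (2 * n) m z < position (2 * n) m y"
   "position (2 * n) m y < position (2 * n) m w"
   using *(3-5) pos[OF *(1)] pos[of y x] pos[OF *(2)] pos[of w z] *(1,2) by (simp_all add: insert_commute)
  then show False using diagramsD(4)[OF D, of x y z w] *(1,2) by blast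
 qed
qed

context
 fixes n m k :: nat and D E :: diagram
 assumes D: "D \<in> diagrams 0 m" and E: "E \<in> diagrams m k"
begin

lemma isolated_left: "(x, GLeft i) \<in> conn D E ==> x = GLeft i"
 unfolding connected_glued_def
proof (erule rtranclE)
 fix y assume "(y, GLeft i) \<in> {(x, y). {x, y} \<in> glued_arcs D E}"
 then have "GLeft i \<in> \<Union>(glued_arcs D E)" by auto
 then show "x = GLeft i" unfolding glued_arcs_nodes[OF D E] by auto
qed

lemma connected_add_caps:
 "conn (add_caps n D) E =
  conn D E \<union> {(GLeft i, GLeft j) | i j. {Inl i, Inl j} \<in> nested_caps n}"
proof
 have "(x, y) \<in> conn D E \<union> {(GLeft i, GLeft j) | i j. {Inl i, Inl j} \<in> nested_caps n}"
  if "(x, y) \<in> conn (add_caps n D) E" for x y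
  using that unfolding connected_glued_def[of "add_caps n D"]
 proof (induction rule: rtrancl_induct)
  case base
  then show ?case by (simp add: connected_glued_refl)
 next
  case (step y z)
  then consider "{y, z} \<in> (`) lower ` nested_caps n" | "{y, z} \<in> glued_arcs D E"
   by (auto simp: glued_arcs_def add_caps_def)
  then show ?case
  proof cases
   case 1
   then obtain i where i: "i < n" "{y, z} = {GLeft (2 * i), GLeft (Suc (2 * i))}" by (auto simp: nested_caps_def)
   then obtain a b where ab: "y = GLeft a" "z = GLeft b" "{Inl a, Inl b} \<in> nested_caps n"
    by (auto simp: doubleton_eq_iff cap_arc_iff)
   from step.IH show ?thesis
   proof
    assume "(x, y) \<in> conn D E"
    then have "x = GLeft a" using isolated_left ab by simp
    then show ?thesis using ab by blast
   next
    assume "(x, y) \<in> {(GLeft i, GLeft j) | i j. {Inl i, Inl j} \<in> nested_caps n}"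
    then obtain j where j: "x = GLeft j" "{Inl j, Inl a} \<in> nested_caps n" using ab by auto
    then have "j = b" using cap_unique[of "Inl a" "Inl j" n "Inl b"] ab by (simp add: insert_commute)
    then show ?thesis using j ab by (simp add: connected_glued_refl)
   qed
  next
   case 2
   then have "y \<notin> range GLeft" using glued_arcs_nodes[OF D E] by auto
   then have "(x, y) \<in> conn D E" using step.IH by auto
   then show ?thesis using 2 unfolding connected_glued_def by (auto intro: rtrancl_into_rtrancl)
  qed
 qed
 then show "conn (add_caps n D) E \<subseteq>
  conn D E \<union> {(GLeft i, GLeft j) | i j. {Inl i, Inl j} \<in> nested_caps n}" by (rule subrelI)
 have "conn D E \<subseteq> conn (add_caps n D) E"
  unfolding connected_glued_def by (rule rtrancl_mono) (auto simp: glued_arcs_def add_caps_def)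
 moreover have "(GLeft i, GLeft j) \<in> conn (add_caps n D) E" if "{Inl i, Inl j} \<in> nested_caps n" for i j
  using connected_lower[of "Inl i" "Inl j" "add_caps n D" E] that by (simp add: add_caps_def)
 ultimately show "conn D E \<union> {(GLeft i, GLeft j) | i j. {Inl i, Inl j} \<in> nested_caps n} \<subseteq>
  conn (add_caps n D) E" by blast
qed

lemma compose_add_caps: "glue (add_caps n D) E = add_caps n (glue D E)"
proof (rule Set.set_eqI)
 fix c
 have outer: "outer_node x = GLeft i \<longleftrightarrow> x = Inl i" for x i by (cases x) (auto simp: outer_node_def)
 have "{x, y} \<in> glue (add_caps n D) E \<longleftrightarrow> {x, y} \<in> add_caps n (glue D E)" for x y
  unfolding compose_mem_iff connected_add_caps
  by (auto simp: add_caps_def outer compose_mem_iff cap_arc_iff)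
 moreover have "\<exists>x y. c = {x, y}" if "c \<in> glue (add_caps n D) E \<union> add_caps n (glue D E)"
  using that by (auto simp: compose_diagrams_def add_caps_def nested_caps_def)
 ultimately show "c \<in> glue (add_caps n D) E \<longleftrightarrow> c \<in> add_caps n (glue D E)"
  by (cases "\<exists>x y. c = {x, y}") auto
qed

lemma loops_add_caps: "loops (add_caps n D) E = loops D E"
proof -
 have "(\<exists>x\<in>\<Union>(glued_arcs (add_caps n D) E). C = conn (add_caps n D) E `` {x}) & C \<subseteq> range GMid \<longleftrightarrow>
  (\<exists>x\<in>\<Union>(glued_arcs D E). C = conn D E `` {x}) & C \<subseteq> range GMid" for C
 proof -
  have comp: "conn (add_caps n D) E `` {GMid i} = conn D E `` {GMid i}" for i
   by (auto simp: connected_add_caps)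
  have arcs: "GMid i \<in> \<Union>(glued_arcs (add_caps n D) E) \<longleftrightarrow> GMid i \<in> \<Union>(glued_arcs D E)" for i
   by (auto simp: glued_arcs_nodes[OF add_caps_closed[OF D] E] glued_arcs_nodes[OF D E])
  have mid: "\<exists>i. x = GMid i" if "C = conn D' E `` {x}" "C \<subseteq> range GMid" for x D'
   using that connected_glued_refl[of x] by blast
  show ?thesis using comp arcs mid by metis
 qed
 then show ?thesis unfolding closed_loops_def by simp
qed

end

section \<open>The Temperley--Lieb algebra\<close>

definition tl_coefficient :: "('r, 'x) ring_scheme => 'r => diagram => diagram => diagram => 'r" where
 "tl_coefficient R a x y z = (if z = glue x y then a [^]\<^bsub>R\<^esub> loops x y else \<zero>\<^bsub>R\<^esub>)"

lemma identity_diagram_closed: "identity_diagram k \<in> diagrams k k"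
 unfolding diagrams_def mem_Collect_eq
proof (intro conjI ballI notI)
 show "partition_on (nodes k k) (identity_diagram k)"
 proof (rule partition_onI)
  show "\<Union>(identity_diagram k) = nodes k k" by (auto simp: identity_diagram_def nodes_def)
 qed (auto simp: identity_diagram_def disjnt_def)
 show "card c = 2" if "c \<in> identity_diagram k" for c using that by (auto simp: identity_diagram_def)
 have arcs: "position k k x + position k k y = 2 * k - 1" if "{x, y} \<in> identity_diagram k" for x y
  using that by (auto simp: identity_diagram_def doubleton_eq_iff)
 assume "\<exists>x y z w. {x, y} \<in> identity_diagram k & {z, w} \<in> identity_diagram k &
     position k k x < position k k z & position k k z < position k k y & position k k y < position k k w"
 then obtain x y z w where "{x, y} \<in> identity_diagram k" "{z, w} \<in> identity_diagram k"
   "position k k x < position k k z" "position k k z < position k k y" "position k k y < position k k w" by blast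
 then show False using arcs[of x y] arcs[of z w] by linarith
qed

locale temperley_lieb = R: cring R for R :: "('r, 'x) ring_scheme" (structure) +
 fixes a :: 'r and n :: nat
 assumes a_closed: "a \<in> carrier R" and n_pos: "n \<ge> 1"
  and opposite_ring: "ring (opposite (TL_algebra R a (2 * n)))"
begin

abbreviation N :: nat where "N \<equiv> 2 * n"
abbreviation A :: "('r, diagram => 'r) module" where "A \<equiv> TL_algebra R a N"
abbreviation Ds :: "diagram set" where "Ds \<equiv> diagrams N N"
abbreviation \<mu> :: "diagram => diagram => diagram => 'r" where "\<mu> \<equiv> tl_coefficient R a"
abbreviation B :: "diagram => diagram => 'r" where "B \<equiv> basis_elt R"

lemma A_simps [simp]:
 "carrier A = carrier (free_module R Ds)" "\<zero>\<^bsub>A\<^esub> = (%_. \<zero>)" "f \<oplus>\<^bsub>A\<^esub> g = (%x. f x \<oplus> g x)"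
 "r \<odot>\<^bsub>A\<^esub> f = (%x. r \<otimes> f x)" "\<one>\<^bsub>A\<^esub> = B (identity_diagram N)"
 by (simp_all add: TL_algebra_def TL_module_def free_module_def)

lemma A_carrier: "f \<in> carrier (free_module R Ds) \<longleftrightarrow> (\<forall>x. f x \<in> carrier R) & (\<forall>x. x \<notin> Ds --> f x = \<zero>)"
proof -
 have "finite {x. f x ~= \<zero>}" if "\<forall>x. x \<notin> Ds --> f x = \<zero>"
  by (rule finite_subset[OF _ finite_diagrams[of N N]]) (use that in auto)
 then show ?thesis by (auto simp: free_module_carrier)
qed

lemma A_ring: "ring A"
proof -
 interpret op: ring "opposite A" by (rule opposite_ring)
 show ?thesis
 proof (rule ringI)
  show "abelian_group A"
  proof -
   have "abelian_group (opposite A)" by (rule op.is_abelian_group)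
   then show ?thesis
    by (simp add: opposite_def abelian_group_def abelian_monoid_def abelian_group_axioms_def)
  qed
  show "monoid A"
   using op.m_assoc op.l_one op.r_one op.m_closed op.one_closed
   by (intro monoidI) (simp_all add: opposite_def del: A_simps)
 qed (use op.l_distr op.r_distr in \<open>simp_all add: opposite_def del: A_simps\<close>)
qed

sublocale A: ring A by (rule A_ring)

lemma Ds_compose: "x \<in> Ds ==> y \<in> Ds ==> glue x y \<in> Ds"
 by (rule compose_closed)

lemma mu_in_R: "\<mu> x y z \<in> carrier R"
 by (simp add: tl_coefficient_def a_closed)

lemma A_mult:
 assumes f: "f \<in> carrier (free_module R Ds)" and g: "g \<in> carrier (free_module R Ds)"
 shows "(f \<otimes>\<^bsub>A\<^esub> g) z = (\<Oplus>x\<in>Ds. \<Oplus>y\<in>Ds. f x \<otimes> g y \<otimes> \<mu> x y z)"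
proof -
 let ?M = "free_module R Ds"
 let ?c = "%x y. (a [^] loops x y) \<odot>\<^bsub>?M\<^esub> B (glue x y)"
 let ?row = "%x. linear_extension R ?M (?c x) g"
 interpret M: module R ?M by (rule free_module_is_module) (rule R.is_cring)
 have sub: "{x. h x ~= \<zero>} \<subseteq> Ds" if "h \<in> carrier ?M" for h using that by (auto simp: A_carrier)
 have c: "?c x y \<in> carrier ?M" if "x \<in> Ds" "y \<in> Ds" for x y
  by (rule M.smult_closed) (auto simp: a_closed intro!: basis_elt_closed[OF R.ring_axioms] compose_closed[OF that])
 have inner: "?row x
  = (\<Oplus>\<^bsub>?M\<^esub>y\<in>Ds. g y \<odot>\<^bsub>?M\<^esub> ?c x y)" if "x \<in> Ds" for x
  by (rule linear_extension_superset[OF M.module_axioms g finite_diagrams subset_refl sub[OF g] c[OF that]])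
 have gc: "g y \<in> carrier R" and fc: "f y \<in> carrier R" for y using f g by (auto simp: A_carrier)
 have ic: "g y \<odot>\<^bsub>?M\<^esub> ?c x y \<in> carrier ?M"
  if "x \<in> Ds" "y \<in> Ds" for x y by (rule M.smult_closed[OF gc c[OF that]])
 have inner_closed: "(\<Oplus>\<^bsub>?M\<^esub>y\<in>Ds. g y \<odot>\<^bsub>?M\<^esub> ?c x y) \<in> carrier ?M"
  if "x \<in> Ds" for x by (rule M.M.finsum_closed) (use ic[OF that] in \<open>auto simp: Pi_def\<close>)
 have lc: "?row x \<in> carrier ?M"
  if "x \<in> Ds" for x unfolding inner[OF that] by (rule inner_closed[OF that])
 have "f \<otimes>\<^bsub>A\<^esub> g = linear_extension R ?M (%x. ?row x) f"
  by (simp add: TL_algebra_def TL_compose_def TL_module_def)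
 also have "... = (\<Oplus>\<^bsub>?M\<^esub>x\<in>Ds. f x \<odot>\<^bsub>?M\<^esub> ?row x)"
  by (rule linear_extension_superset[OF M.module_axioms f finite_diagrams subset_refl sub[OF f] lc])
 finally have "(f \<otimes>\<^bsub>A\<^esub> g) z = ... z" by simp
 also have "... = (\<Oplus>x\<in>Ds. (f x \<odot>\<^bsub>?M\<^esub> ?row x) z)"
  by (rule free_module_finsum[OF R.is_cring finite_diagrams]) (rule M.smult_closed[OF fc lc])
 also have "... = (\<Oplus>x\<in>Ds. f x \<otimes> (\<Oplus>y\<in>Ds. g y \<otimes> \<mu> x y z))"
 proof (rule R.finsum_cong'[OF refl Pi_I])
  fix x assume x: "x \<in> Ds"
  have "(\<Oplus>\<^bsub>?M\<^esub>y\<in>Ds. g y \<odot>\<^bsub>?M\<^esub> ?c x y) z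
   = (\<Oplus>y\<in>Ds. (g y \<odot>\<^bsub>?M\<^esub> ?c x y) z)"
   by (rule free_module_finsum[OF R.is_cring finite_diagrams ic[OF x]])
  also have "... = (\<Oplus>y\<in>Ds. g y \<otimes> \<mu> x y z)"
   by (rule R.finsum_cong'[OF refl Pi_I]) (auto simp: gc mu_in_R, auto simp: tl_coefficient_def basis_elt_def a_closed)
  finally have "?row x z =
   (\<Oplus>y\<in>Ds. g y \<otimes> \<mu> x y z)" unfolding inner[OF x] .
  then show "(f x \<odot>\<^bsub>?M\<^esub> ?row x) z
   = f x \<otimes> (\<Oplus>y\<in>Ds. g y \<otimes> \<mu> x y z)" by (simp only: free_module_simps)
  show "f x \<otimes> (\<Oplus>y\<in>Ds. g y \<otimes> \<mu> x y z) \<in> carrier R"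
   by (intro R.m_closed fc R.finsum_closed) (auto simp: gc mu_in_R)
 qed
 also have "... = (\<Oplus>x\<in>Ds. \<Oplus>y\<in>Ds. f x \<otimes> g y \<otimes> \<mu> x y z)"
  by (rule R.finsum_cong'[OF refl Pi_I])
   (auto simp: R.finsum_rdistr[OF finite_diagrams] Pi_def fc gc mu_in_R R.m_assoc intro!: R.finsum_closed R.finsum_cong')
 finally show ?thesis .
qed

lemma B_closed: "x \<in> Ds ==> B x \<in> carrier (free_module R Ds)"
 by (rule basis_elt_closed[OF R.ring_axioms])

lemma finsum_B_left:
 assumes "x \<in> Ds" "!!u. u \<in> Ds ==> F u \<in> carrier R"
 shows "(\<Oplus>u\<in>Ds. B x u \<otimes> F u) = F x"
 by (subst R.finsum_single[OF finite_diagrams assms(1)]) (auto simp: basis_elt_def assms)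

lemma A_mult_B_right:
 assumes f: "f \<in> carrier (free_module R Ds)" and y: "y \<in> Ds"
 shows "(f \<otimes>\<^bsub>A\<^esub> B y) z = (\<Oplus>x\<in>Ds. f x \<otimes> \<mu> x y z)"
 unfolding A_mult[OF f B_closed[OF y]]
proof (rule R.finsum_cong'[OF refl Pi_I])
 fix x assume "x \<in> Ds"
 have fc: "f u \<in> carrier R" for u using f by (auto simp: A_carrier)
 show "(\<Oplus>v\<in>Ds. f x \<otimes> B y v \<otimes> \<mu> x v z) = f x \<otimes> \<mu> x y z"
  by (subst R.finsum_single[OF finite_diagrams y]) (auto simp: basis_elt_def fc mu_in_R)
 show "f x \<otimes> \<mu> x y z \<in> carrier R" by (simp add: fc mu_in_R)
qed

lemma A_mult_B_left:
 assumes g: "g \<in> carrier (free_module R Ds)" and x: "x \<in> Ds"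
 shows "(B x \<otimes>\<^bsub>A\<^esub> g) z = (\<Oplus>y\<in>Ds. g y \<otimes> \<mu> x y z)"
proof -
 have gc: "g u \<in> carrier R" for u using g by (auto simp: A_carrier)
 show ?thesis unfolding A_mult[OF B_closed[OF x] g]
  by (subst R.finsum_single[OF finite_diagrams x])
   (auto simp: basis_elt_def gc mu_in_R intro!: R.finsum_closed R.finsum_zero')
qed

lemma B_mult_B:
 assumes "x \<in> Ds" "y \<in> Ds"
 shows "B x \<otimes>\<^bsub>A\<^esub> B y = (%z. \<mu> x y z)"
 by (rule ext) (simp add: A_mult_B_left[OF B_closed[OF assms(2)] assms(1)] finsum_B_left[OF assms(2)] mu_in_R)

lemma mu_in_A: "x \<in> Ds ==> y \<in> Ds ==> (%z. \<mu> x y z) \<in> carrier (free_module R Ds)"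
 using A.m_closed[of "B x" "B y"] by (simp add: B_mult_B B_closed)

sublocale structure_constants R Ds \<mu>
proof
 show "finite Ds" by (rule finite_diagrams)
 fix u v y z assume *: "u \<in> Ds" "v \<in> Ds"
 show "\<mu> u v z \<in> carrier R" by (rule mu_in_R)
 show "z \<notin> Ds ==> \<mu> u v z = \<zero>" using mu_in_A[OF *] by (auto simp: A_carrier)
 assume y: "y \<in> Ds"
 have "((B u \<otimes>\<^bsub>A\<^esub> B v) \<otimes>\<^bsub>A\<^esub> B y) z = (B u \<otimes>\<^bsub>A\<^esub> (B v \<otimes>\<^bsub>A\<^esub> B y)) z"
  using * y by (subst A.m_assoc) (simp_all add: B_closed)
 then show "(\<Oplus>w\<in>Ds. \<mu> u v w \<otimes> \<mu> w y z) = (\<Oplus>w\<in>Ds. \<mu> v y w \<otimes> \<mu> u w z)"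
  by (simp add: B_mult_B * y A_mult_B_right A_mult_B_left mu_in_A)
qed

lemma mu_nonzero: "\<mu> x y z ~= \<zero> ==> z = glue x y"
 by (auto simp: tl_coefficient_def split: if_splits)

lemma B_mult_no_loops: "x \<in> Ds ==> y \<in> Ds ==> loops x y = 0 ==> B x \<otimes>\<^bsub>A\<^esub> B y = B (glue x y)"
 by (simp only: B_mult_B) (auto simp: fun_eq_iff tl_coefficient_def basis_elt_def)

subsection \<open>Local units for diagrams with prescribed cups\<close>

definition absorbing :: "nat set => nat set => bool" where
 "absorbing S T \<longleftrightarrow> (\<exists>e\<in>carrier A. (\<forall>x. e x ~= \<zero> --> T \<subseteq> left_cups x) &
   (\<forall>x\<in>Ds. S \<subseteq> left_cups x --> e \<otimes>\<^bsub>A\<^esub> B x = B x))"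

lemma absorbing_empty: "absorbing S {}"
 unfolding absorbing_def using A.one_closed A.l_one B_closed by (auto simp del: A_simps(5) intro!: bexI[of _ "\<one>\<^bsub>A\<^esub>"])

definition cup_places :: "nat set => bool" where
 "cup_places S \<longleftrightarrow> (\<forall>s\<in>S. Suc s < N & Suc s \<notin> S)"

lemma support_left:
 assumes g: "g \<in> carrier (free_module R Ds)" "!!x. g x ~= \<zero> ==> P x" and y: "y \<in> Ds" and "(B y \<otimes>\<^bsub>A\<^esub> g) z ~= \<zero>"
 obtains x where "x \<in> Ds" "P x" "z = glue y x"
proof -
 have "\<not> (\<forall>x\<in>Ds. g x \<otimes> \<mu> y x z = \<zero>)"
  using assms(4) unfolding A_mult_B_left[OF g(1) y] using R.finsum_zero'[of Ds "%x. g x \<otimes> \<mu> y x z"] by blast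
 then obtain x where x: "x \<in> Ds" "g x \<otimes> \<mu> y x z ~= \<zero>" by blast
 have "g x \<in> carrier R" using g(1) by (simp add: A_carrier)
 then have "g x ~= \<zero>" "\<mu> y x z ~= \<zero>" using x(2) by (auto simp: mu_in_R)
 then show ?thesis using that[OF x(1)] g(2) mu_nonzero by blast
qed

lemma support_right:
 assumes g: "g \<in> carrier (free_module R Ds)" "!!x. g x ~= \<zero> ==> P x" and y: "y \<in> Ds" and "(g \<otimes>\<^bsub>A\<^esub> B y) z ~= \<zero>"
 obtains x where "x \<in> Ds" "P x" "z = glue x y"
proof -
 have "\<not> (\<forall>x\<in>Ds. g x \<otimes> \<mu> x y z = \<zero>)"
  using assms(4) unfolding A_mult_B_right[OF g(1) y] using R.finsum_zero'[of Ds "%x. g x \<otimes> \<mu> x y z"] by blast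
 then obtain x where x: "x \<in> Ds" "g x \<otimes> \<mu> x y z ~= \<zero>" by blast
 have "g x \<in> carrier R" using g(1) by (simp add: A_carrier)
 then have "g x ~= \<zero>" "\<mu> x y z ~= \<zero>" using x(2) by (auto simp: mu_in_R)
 then show ?thesis using that[OF x(1)] g(2) mu_nonzero by blast
qed

text \<open>The element is \<open>U\<^sub>s e U\<^sub>t\<close>: the right factor moves the cup from \<open>s\<close> to \<open>t\<close>, where \<open>e\<close> absorbs
  the result, and the left factor moves the cup back.\<close>

lemma absorbing_move:
 assumes S: "cup_places (insert s Q)" "cup_places (insert t Q)" "s \<notin> Q" "t \<notin> Q"
  and st: "s = Suc t \<or> t = Suc s" and T: "T \<subseteq> insert t Q" and good: "absorbing (insert t Q) T"
 shows "absorbing (insert s Q) (insert s (T - {t}))"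
proof -
 have sN: "Suc s < N" and tN: "Suc t < N" using S by (auto simp: cup_places_def)
 obtain e where e: "e \<in> carrier A" "!!x. e x ~= \<zero> ==> T \<subseteq> left_cups x"
  "!!x. x \<in> Ds ==> insert t Q \<subseteq> left_cups x ==> e \<otimes>\<^bsub>A\<^esub> B x = B x"
  using good unfolding absorbing_def by blast
 let ?U = "cup_cap N"
 have U: "?U s \<in> Ds" "?U t \<in> Ds" using sN tN by (auto intro: cup_cap_diagram)
 have BU: "B (?U s) \<in> carrier A" "B (?U t) \<in> carrier A" using B_closed U by simp_all
 define e' where "e' = B (?U s) \<otimes>\<^bsub>A\<^esub> (e \<otimes>\<^bsub>A\<^esub> B (?U t))"
 have eU: "e \<otimes>\<^bsub>A\<^esub> B (?U t) \<in> carrier A" using A.m_closed e(1) BU by blast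
 have e': "e' \<in> carrier A" unfolding e'_def using A.m_closed eU BU by blast
 have supp: "insert s (T - {t}) \<subseteq> left_cups z" if nz: "e' z ~= \<zero>" for z
 proof -
  have eUT: "T \<subseteq> left_cups x"
   if nz: "(e \<otimes>\<^bsub>A\<^esub> B (?U t)) x ~= \<zero>" for x
  proof -
   obtain w where "w \<in> Ds" "T \<subseteq> left_cups w" "x = glue w (?U t)"
    by (rule support_right[of e "%x. T \<subseteq> left_cups x", OF _ e(2) U(2) nz]) (use e(1) in simp_all)
   then show ?thesis using left_cups_compose by blast
  qed
  obtain x where x: "x \<in> Ds" "T \<subseteq> left_cups x" "z = glue (?U s) x"
   by (rule support_left[of "e \<otimes>\<^bsub>A\<^esub> B (?U t)" "%x. T \<subseteq> left_cups x", OF _ eUT U(1)])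
    (use eU nz in \<open>simp_all add: e'_def\<close>)
  have "s \<in> left_cups (?U s)" by (simp add: left_cups_def cup_cap_arcs)
  then have "s \<in> left_cups z" using left_cups_compose x(3) by blast
  moreover have "u \<in> left_cups z" if u: "u \<in> T - {t}" for u
  proof -
   have "u \<in> Q" using u T by blast
   then have "u ~= s" "u ~= Suc s" "Suc u ~= s" using S by (auto simp: cup_places_def)
   then show ?thesis unfolding x(3) using u x(1,2) by (intro left_cups_cup_cap_compose[OF sN]) auto
  qed
  ultimately show ?thesis by blast
 qed
 have "e' \<otimes>\<^bsub>A\<^esub> B x = B x" if x: "x \<in> Ds" "insert s Q \<subseteq> left_cups x" for x
 proof -
  have s: "s \<in> left_cups x" using x by blast
  note move = move_cup[OF x(1) s tN st]
  let ?x = "glue (?U t) x"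
  have x': "?x \<in> Ds" using U x(1) by (intro compose_closed)
  have Bx: "B x \<in> carrier A" "B ?x \<in> carrier A" using B_closed x(1) x' by simp_all
  have "insert t Q \<subseteq> left_cups ?x"
  proof -
   have "u \<in> left_cups ?x" if u: "u \<in> Q" for u
   proof (rule move(5))
    show "u \<in> left_cups x" using u x(2) by blast
    show "u ~= s" "Suc u ~= t" "u ~= Suc t" using u S by (auto simp: cup_places_def)
   qed
   then show ?thesis using move(4) by blast
  qed
  then have "e \<otimes>\<^bsub>A\<^esub> B ?x = B ?x" by (rule e(3)[OF x'])
  moreover have "B (?U t) \<otimes>\<^bsub>A\<^esub> B x = B ?x" using U x(1) move(1) by (simp add: B_mult_no_loops)
  moreover have "B (?U s) \<otimes>\<^bsub>A\<^esub> B ?x = B x" using U x' move(2,3) by (simp add: B_mult_no_loops)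
  ultimately show ?thesis
   unfolding e'_def using A.m_assoc[OF BU(1) eU Bx(1)] A.m_assoc[OF e(1) BU(2) Bx(1)] by simp
 qed
 then show ?thesis unfolding absorbing_def using e' supp by blast
qed

definition free_node :: "nat set => nat => bool" where
 "free_node S f \<longleftrightarrow> f < N & f \<notin> S & (\<forall>s\<in>S. Suc s ~= f)"

text \<open>The cup right above a free node can be moved down by one, which frees a node above it.\<close>

lemma absorbing_above:
 "cup_places S ==> free_node S f ==> absorbing S {s \<in> S. f < s}"
proof (induction "N - f" arbitrary: S f rule: less_induct)
 case less
 note S = less.prems(1) and f = less.prems(2)
 have fN: "f < N" using f by (simp add: free_node_def)
 consider "{s \<in> S. f < s} = {}" | "free_node S (Suc f)" | "Suc f \<in> S"
 proof (cases "Suc f < N")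
  case True
  then show ?thesis using f that(2,3) by (auto simp: free_node_def)
 next
  case False
  then have "{s \<in> S. f < s} = {}" using S by (auto simp: cup_places_def)
  then show ?thesis by (rule that(1))
 qed
 then show ?case
 proof cases
  case 1
  show ?thesis unfolding 1 by (rule absorbing_empty)
 next
  case 2
  have "absorbing S {s \<in> S. Suc f < s}" by (rule less.hyps[OF _ S 2]) (use fN in simp)
  moreover have "{s \<in> S. Suc f < s} = {s \<in> S. f < s}" using 2 by (auto simp: free_node_def intro: Suc_lessI)
  ultimately show ?thesis by simp
 next
  case 3
  let ?Q = "S - {Suc f}" and ?s = "Suc f"
  let ?S = "insert f ?Q" and ?g = "Suc (Suc f)"
  have eq: "insert ?s ?Q = S" using 3 by blast
  have g: "?g < N" "?g \<notin> S" using S 3 by (auto simp: cup_places_def)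
  have S': "cup_places ?S" using S f g by (auto simp: cup_places_def free_node_def)
  have free: "free_node ?S ?g" using g by (auto simp: free_node_def)
  have good: "absorbing ?S {s \<in> ?S. ?g < s}" by (rule less.hyps[OF _ S' free]) (use fN in simp)
  have "absorbing (insert ?s ?Q) (insert ?s ({s \<in> ?S. ?g < s} - {f}))"
   by (rule absorbing_move[OF _ _ _ _ _ _ good]) (use S S' f in \<open>auto simp: eq insert_absorb[OF 3] free_node_def\<close>)
  moreover have "insert ?s ({s \<in> ?S. ?g < s} - {f}) = {s \<in> S. f < s}"
   using 3 g by (auto, metis Suc_lessI)
  ultimately show ?thesis by (simp only: eq)
 qed
qed

lemma absorbing_self:
 "cup_places S ==> free_node S f ==> absorbing S S"
proof (induction f arbitrary: S rule: less_induct)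
 case (less f)
 note S = less.prems(1) and f = less.prems(2)
 have fN: "f < N" using f by (simp add: free_node_def)
 consider "f = 0" | g where "f = Suc g" "free_node S g" | h where "f = Suc (Suc h)" "h \<in> S"
  using f by (cases f) (force simp: free_node_def)+
 then show ?case
 proof cases
  case 1
  have "{s \<in> S. f < s} = S" using f 1 by (auto simp: free_node_def) (metis gr0I)
  then show ?thesis using absorbing_above[OF S f] by simp
 next
  case (2 g)
  then show ?thesis using less.IH[of g S] S by simp
 next
  case (3 h)
  let ?Q = "S - {h}" and ?t = "Suc h"
  let ?S = "insert ?t ?Q"
  have eq: "insert h ?Q = S" using 3 by blast
  have tS: "?t \<notin> S" using S 3 by (auto simp: cup_places_def)
  have S': "cup_places ?S" using S f fN 3 by (auto simp: cup_places_def free_node_def)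
  have free: "free_node ?S h" using S 3 fN by (auto simp: free_node_def cup_places_def)
  have good: "absorbing ?S ?S" by (rule less.IH[OF _ S' free]) (use 3 in simp)
  have "absorbing (insert h ?Q) (insert h (?S - {?t}))"
   by (rule absorbing_move[OF _ _ _ _ _ _ good]) (use S S' tS in \<open>auto simp: eq insert_absorb[OF 3(2)]\<close>)
  moreover have "insert h (?S - {?t}) = S" using 3 tS by blast
  ultimately show ?thesis by (simp only: eq)
 qed
qed

lemma absorbing_few:
 assumes "cup_places S" "finite S" "card S < n"
 shows "absorbing S S"
proof -
 have "card (S \<union> Suc ` S) < card {..<N}"
  using card_Un_le[of S "Suc ` S"] card_image_le[OF assms(2), of Suc] assms(3) by simp
 then have "\<not> {..<N} \<subseteq> S \<union> Suc ` S" using card_mono[of "S \<union> Suc ` S" "{..<N}"] assms(2) by auto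
 then obtain f where "f < N" "f \<notin> S \<union> Suc ` S" by auto
 then show ?thesis by (intro absorbing_self[OF assms(1), of f]) (auto simp: free_node_def)
qed

lemma cup_places_half: "cup_places S ==> inj_on (%s. s div 2) S"
 "cup_places S ==> (%s. s div 2) ` S \<subseteq> {..<n}"
proof -
 assume S: "cup_places S"
 show "inj_on (%s. s div 2) S"
 proof (rule inj_onI)
  fix x y assume *: "x \<in> S" "y \<in> S" "x div 2 = y div 2"
  then have "x = y \<or> x = Suc y \<or> y = Suc x" by presburger
  then show "x = y" using S * by (auto simp: cup_places_def)
 qed
 show "(%s. s div 2) ` S \<subseteq> {..<n}" using S by (auto simp: cup_places_def)
qed

lemma cup_places_card: "cup_places S ==> card S \<le> n"
 using card_inj_on_le[OF cup_places_half] by simp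

definition all_cups :: "nat set" where "all_cups = (%i. 2 * i) ` {..<n}"

lemma cup_places_top:
 assumes S: "cup_places S" and card: "card S = n"
 shows "S = all_cups"
proof -
 have fin: "finite S" by (rule finite_subset[of _ "{..<N}"]) (use S in \<open>auto simp: cup_places_def\<close>)
 have im: "(%s. s div 2) ` S = {..<n}"
  by (rule card_subset_eq) (simp_all add: cup_places_half[OF S] card_image[OF cup_places_half(1)[OF S]] card)
 have even: "2 * (n - Suc k) \<in> S" if "k < n" for k
  using that
 proof (induction k)
  case 0
  have "n - 1 \<in> (%s. s div 2) ` S" unfolding im using 0 by simp
  then obtain s where s: "s \<in> S" "n - 1 = s div 2" by blast
  then have "s = 2 * (n - 1) \<or> s = Suc (2 * (n - 1))" by presburger
  then show ?case using s(1) S 0 by (auto simp: cup_places_def)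
 next
  case (Suc k)
  let ?m = "n - Suc (Suc k)"
  have m: "n - Suc k = Suc ?m" "?m < n" using Suc.prems by simp_all
  have "?m \<in> (%s. s div 2) ` S" unfolding im using m(2) by simp
  then obtain s where s: "s \<in> S" "?m = s div 2" by blast
  then have "s = 2 * ?m \<or> s = Suc (2 * ?m)" by presburger
  moreover have "Suc (Suc (2 * ?m)) \<in> S" using Suc m by simp
  ultimately show ?case using s(1) S by (auto simp: cup_places_def)
 qed
 have "2 * i \<in> S" if "i < n" for i using even[of "n - Suc i"] that by simp
 then have "all_cups \<subseteq> S" by (auto simp: all_cups_def)
 moreover have "card all_cups = n" by (simp add: all_cups_def card_image inj_on_def)
 ultimately show ?thesis using card_subset_eq[OF fin] card by metis
qed

definition I :: "diagram set" where "I = Ds - {identity_diagram N}"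

lemma I_iff: "x \<in> I \<longleftrightarrow> x \<in> Ds & left_cups x ~= {}"
 using identity_if_no_left_cups[of x N] left_cups_identity by (auto simp: I_def)

lemma I_right: "x \<in> I ==> y \<in> Ds ==> glue x y \<in> I"
 using left_cups_compose[of x y] by (auto simp: I_iff compose_closed)

lemma flip_I: "flip x \<in> I \<longleftrightarrow> x \<in> I"
proof -
 have "flip x \<in> Ds \<longleftrightarrow> x \<in> Ds" using flip_diagrams[of x N N] flip_diagrams[of "flip x" N N] by auto
 moreover have "flip x = identity_diagram N \<longleftrightarrow> x = identity_diagram N"
  using flip_flip[of x] flip_identity[of N] by metis
 ultimately show ?thesis by (simp add: I_def)
qed

lemma I_left: "x \<in> Ds ==> y \<in> I ==> glue x y \<in> I"
 using I_right[of "flip y" "flip x"] by (simp add: flip_I flip_diagrams compose_flip)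

lemma cup_places_left_cups: "x \<in> Ds ==> S \<subseteq> left_cups x ==> cup_places S"
 using left_cups_bounded[of x N N] left_cups_nonadjacent[of x N N] unfolding cup_places_def by blast

sublocale cup_algebra R Ds \<mu> I left_cups N n all_cups
proof
 show "n \<ge> 1" by (rule n_pos)
 show "right_stable I" unfolding right_stable_def
 proof (intro conjI ballI allI impI)
  fix x y z assume "x \<in> I" "y \<in> Ds" and nz: "\<mu> x y z ~= \<zero>"
  then show "z \<in> I" using I_right[of x y] mu_nonzero[OF nz] by simp
 qed (auto simp: I_def)
 show "card all_cups = n" by (simp add: all_cups_def card_image inj_on_def)
 fix x assume x: "x \<in> I"
 then have xD: "x \<in> Ds" by (simp add: I_def)
 show "left_cups x \<subseteq> {..<N}" using left_cups_bounded[OF xD] by fastforce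
 show "left_cups x ~= {}" using x by (simp add: I_iff)
 show "left_cups x \<subseteq> left_cups z" if "\<mu> x y z ~= \<zero>" for y z
  using mu_nonzero[OF that] left_cups_compose by simp
 fix S assume S: "S \<subseteq> left_cups x"
 note places = cup_places_left_cups[OF xD S]
 show "card S \<le> n" by (rule cup_places_card[OF places])
 show "card S = n ==> S = all_cups" by (rule cup_places_top[OF places])
 have fin: "finite S" by (rule finite_subset[of _ "{..<N}"]) (use places in \<open>auto simp: cup_places_def\<close>)
 assume "S ~= {}" "card S < n"
 then obtain e where e: "e \<in> carrier A" "!!x. e x ~= \<zero> ==> S \<subseteq> left_cups x"
  "!!x. x \<in> Ds ==> S \<subseteq> left_cups x ==> e \<otimes>\<^bsub>A\<^esub> B x = B x"
  using absorbing_few[OF places fin] unfolding absorbing_def by blast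
 have "e x \<in> carrier R & (e x ~= \<zero> --> x \<in> I & S \<subseteq> left_cups x)" if "x \<in> Ds" for x
  using e(1) e(2)[of x] that \<open>S ~= {}\<close> by (auto simp: A_carrier I_iff)
 moreover have "(\<Oplus>x\<in>Ds. e x \<otimes> \<mu> x y z) = (if z = y then \<one> else \<zero>)" if "y \<in> I" "S \<subseteq> left_cups y" for y z
 proof -
  have y: "y \<in> Ds" using that(1) by (simp add: I_def)
  have "(e \<otimes>\<^bsub>A\<^esub> B y) z = B y z" using e(3)[OF y that(2)] by simp
  then show ?thesis using e(1) by (simp add: A_mult_B_right y) (simp add: basis_elt_def)
 qed
 ultimately show "\<exists>e. (\<forall>x\<in>Ds. e x \<in> carrier R & (e x ~= \<zero> --> x \<in> I & S \<subseteq> left_cups x)) &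
   (\<forall>y\<in>I. S \<subseteq> left_cups y --> (\<forall>z\<in>Ds. (\<Oplus>x\<in>Ds. e x \<otimes> \<mu> x y z) = (if z = y then \<one> else \<zero>)))"
  by blast
qed

end

section \<open>Reflecting chains\<close>

lemma (in abelian_monoid) finsum_lessThan_Suc:
 assumes "!!i. f i \<in> carrier G"
 shows "finsum G f {..<Suc k} = f 0 \<oplus> (\<Oplus>i\<in>{..<k}. f (Suc i))"
proof -
 have "finsum G f (Suc ` {..<k}) = (\<Oplus>i\<in>{..<k}. f (Suc i))"
  by (rule finsum_reindex) (use assms in auto)
 moreover have "finsum G f (insert 0 (Suc ` {..<k})) = f 0 \<oplus> finsum G f (Suc ` {..<k})"
  by (rule finsum_insert) (use assms in auto)
 ultimately show ?thesis by (simp add: lessThan_Suc_eq_insert_0)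
qed

context structure_constants
begin

abbreviation sign :: "nat => 'r" where "sign i \<equiv> (\<ominus> \<one>) [^] i"

lemma sign_closed: "sign i \<in> carrier R" by simp

lemma sign_square: "sign i \<otimes> sign i = \<one>"
proof (induction i)
 case (Suc i)
 have "sign (Suc i) \<otimes> sign (Suc i) = (sign i \<otimes> sign i) \<otimes> (\<ominus> \<one> \<otimes> \<ominus> \<one>)" by (simp add: R.m_ac)
 then show ?case using Suc by (simp add: R.l_minus R.r_minus)
qed simp

lemma sign_reverse: "i \<le> p ==> sign p \<otimes> sign (p - i) = sign i"
proof -
 assume "i \<le> p"
 then have "sign p = sign (p - i) \<otimes> sign i" by (simp add: R.nat_pow_mult)
 then have "sign p \<otimes> sign (p - i) = sign (p - i) \<otimes> sign (p - i) \<otimes> sign i" by (simp add: R.m_ac)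
 then show ?thesis by (simp add: sign_square)
qed

lemma sign_cases: "sign i = \<one> \<or> sign i = \<ominus> \<one>"
 by (induction i) (auto simp: R.l_minus R.r_minus)

lemma sum2_closed': "(!!xs. f xs \<in> carrier R) ==> (\<Oplus>x\<in>\<D>. \<Oplus>y\<in>\<D>. \<mu> x y z \<otimes> f (g x y)) \<in> carrier R"
 by (intro R.finsum_closed Pi_I R.m_closed mu_closed)

lemma neg_alternating:
 assumes g: "!!i. g i \<in> carrier R"
 shows "\<ominus> (\<Oplus>i\<in>{..<k}. sign i \<otimes> g i) = (\<Oplus>i\<in>{..<k}. sign (Suc i) \<otimes> g i)"
proof -
 have "\<ominus> (\<Oplus>i\<in>{..<k}. sign i \<otimes> g i) = \<ominus> \<one> \<otimes> (\<Oplus>i\<in>{..<k}. sign i \<otimes> g i)"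
  using g by (simp add: R.l_minus R.finsum_closed)
 also have "... = (\<Oplus>i\<in>{..<k}. \<ominus> \<one> \<otimes> (sign i \<otimes> g i))"
  by (rule R.finsum_rdistr) (use g in auto)
 also have "... = (\<Oplus>i\<in>{..<k}. sign (Suc i) \<otimes> g i)"
  by (rule R.finsum_cong'[OF refl Pi_I]) (use g in \<open>auto simp: R.m_ac\<close>)
 finally show ?thesis .
qed

lemma merge_index:
 assumes "!!xs. f xs \<in> carrier R"
 shows "merge (regular_module R) f zs = (\<Oplus>i\<in>{..<length zs}. sign i \<otimes>
  (\<Oplus>x\<in>\<D>. \<Oplus>y\<in>\<D>. \<mu> x y (zs ! i) \<otimes> f (take i zs @ [x, y] @ drop (Suc i) zs)))"
 using assms
proof (induction zs arbitrary: f)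
 case (Cons z zs)
 let ?F = "%i. \<Oplus>x\<in>\<D>. \<Oplus>y\<in>\<D>. \<mu> x y ((z # zs) ! i) \<otimes> f (take i (z # zs) @ [x, y] @ drop (Suc i) (z # zs))"
 have F: "?F i \<in> carrier R" for i by (rule sum2_closed') (rule Cons.prems)
 have "merge (regular_module R) (%ws. f (z # ws)) zs = (\<Oplus>i\<in>{..<length zs}. sign i \<otimes> ?F (Suc i))"
  by (subst Cons.IH) (simp_all add: Cons.prems)
 moreover have "\<ominus> (\<Oplus>i\<in>{..<length zs}. sign i \<otimes> ?F (Suc i)) = (\<Oplus>i\<in>{..<length zs}. sign (Suc i) \<otimes> ?F (Suc i))"
  by (rule neg_alternating) (rule F)
 ultimately have "merge (regular_module R) f (z # zs) = ?F 0 \<oplus> (\<Oplus>i\<in>{..<length zs}. sign (Suc i) \<otimes> ?F (Suc i))"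
  by (simp add: a_minus_def)
 also have "... = sign 0 \<otimes> ?F 0 \<oplus> (\<Oplus>i\<in>{..<length zs}. sign (Suc i) \<otimes> ?F (Suc i))"
  using F[of 0] by simp
 also have "... = (\<Oplus>i\<in>{..<Suc (length zs)}. sign i \<otimes> ?F i)"
  by (rule R.finsum_lessThan_Suc[symmetric]) (use F in blast)
 finally show ?case by simp
qed simp

lemma merge_mirror:
 fixes \<tau> :: "'d => 'd"
 assumes f: "!!xs. f xs \<in> carrier R" and \<tau>: "bij_betw \<tau> \<D> \<D>"
  and anti: "!!x y z. x \<in> \<D> ==> y \<in> \<D> ==> \<mu> (\<tau> y) (\<tau> x) (\<tau> z) = \<mu> x y z"
 shows "merge (regular_module R) (%xs. f (rev (map \<tau> xs))) zs =
  sign (length zs - 1) \<otimes> merge (regular_module R) f (rev (map \<tau> zs))"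
proof -
 let ?l = "length zs" and ?m = "%xs. rev (map \<tau> xs)"
 let ?F = "%i. \<Oplus>x\<in>\<D>. \<Oplus>y\<in>\<D>. \<mu> x y (?m zs ! i) \<otimes> f (take i (?m zs) @ [x, y] @ drop (Suc i) (?m zs))"
 have F: "?F i \<in> carrier R" for i by (rule sum2_closed') (rule f)
 have eq: "(\<Oplus>x\<in>\<D>. \<Oplus>y\<in>\<D>. \<mu> x y (zs ! i) \<otimes> f (?m (take i zs @ [x, y] @ drop (Suc i) zs))) = ?F (?l - Suc i)"
  if i: "i < ?l" for i
 proof -
  have nth: "?m zs ! (?l - Suc i) = \<tau> (zs ! i)" using i by (simp add: rev_nth)
  have tk: "take (?l - Suc i) (?m zs) = ?m (drop (Suc i) zs)" using i by (simp add: take_rev drop_map)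
  have dr: "drop (Suc (?l - Suc i)) (?m zs) = ?m (take i zs)" using i by (simp add: drop_rev take_map Suc_diff_Suc)
  let ?G = "%x y. \<mu> x y (\<tau> (zs ! i)) \<otimes> f (?m (drop (Suc i) zs) @ [x, y] @ ?m (take i zs))"
  have G: "?G x y \<in> carrier R" if "x \<in> \<D>" "y \<in> \<D>" for x y using that by (intro R.m_closed f mu_closed)
  have \<tau>D: "\<tau> x \<in> \<D>" if "x \<in> \<D>" for x using \<tau> that by (auto simp: bij_betw_def)
  have re: "(\<Oplus>x\<in>\<D>. H x) = (\<Oplus>x\<in>\<D>. H (\<tau> x))" if "!!x. x \<in> \<D> ==> H x \<in> carrier R" for H
   using R.finsum_reindex[of H \<tau> \<D>] \<tau> that by (auto simp: bij_betw_def Pi_def)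
  have "?F (?l - Suc i) = (\<Oplus>x\<in>\<D>. \<Oplus>y\<in>\<D>. ?G x y)" unfolding nth tk dr ..
  also have "... = (\<Oplus>x\<in>\<D>. \<Oplus>y\<in>\<D>. ?G (\<tau> x) y)"
   by (rule re[of "%x. \<Oplus>y\<in>\<D>. ?G x y"]) (use G in \<open>auto intro!: R.finsum_closed\<close>)
  also have "... = (\<Oplus>x\<in>\<D>. \<Oplus>y\<in>\<D>. ?G (\<tau> x) (\<tau> y))"
  proof (rule R.finsum_cong'[OF refl Pi_I])
   fix x assume "x \<in> \<D>"
   then show "(\<Oplus>y\<in>\<D>. ?G (\<tau> x) y) = (\<Oplus>y\<in>\<D>. ?G (\<tau> x) (\<tau> y))"
    by (intro re[of "?G (\<tau> x)"] G \<tau>D)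
   show "(\<Oplus>y\<in>\<D>. ?G (\<tau> x) (\<tau> y)) \<in> carrier R"
    using \<open>x \<in> \<D>\<close> by (intro R.finsum_closed Pi_I G \<tau>D)
  qed
  also have "... = (\<Oplus>y\<in>\<D>. \<Oplus>x\<in>\<D>. ?G (\<tau> x) (\<tau> y))"
   by (rule R.finsum_swap[OF finite_basis finite_basis]) (intro G \<tau>D)
  also have "... = (\<Oplus>x\<in>\<D>. \<Oplus>y\<in>\<D>. \<mu> x y (zs ! i) \<otimes> f (?m (take i zs @ [x, y] @ drop (Suc i) zs)))"
  proof (rule R.finsum_cong'[OF refl Pi_I])
   fix x assume x: "x \<in> \<D>"
   show "(\<Oplus>y\<in>\<D>. ?G (\<tau> y) (\<tau> x)) = (\<Oplus>y\<in>\<D>. \<mu> x y (zs ! i) \<otimes> f (?m (take i zs @ [x, y] @ drop (Suc i) zs)))"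
   proof (rule R.finsum_cong'[OF refl Pi_I])
    fix y assume y: "y \<in> \<D>"
    show "?G (\<tau> y) (\<tau> x) = \<mu> x y (zs ! i) \<otimes> f (?m (take i zs @ [x, y] @ drop (Suc i) zs))"
     using anti[OF x y] by simp
    show "\<mu> x y (zs ! i) \<otimes> f (?m (take i zs @ [x, y] @ drop (Suc i) zs)) \<in> carrier R"
     by (intro R.m_closed mu_closed x y f)
   qed
   show "(\<Oplus>y\<in>\<D>. \<mu> x y (zs ! i) \<otimes> f (?m (take i zs @ [x, y] @ drop (Suc i) zs))) \<in> carrier R"
    by (intro R.finsum_closed Pi_I R.m_closed mu_closed x f)
  qed
  finally show ?thesis by (rule sym)
 qed
 have "merge (regular_module R) (%xs. f (?m xs)) zs = (\<Oplus>i\<in>{..<?l}. sign i \<otimes>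
  (\<Oplus>x\<in>\<D>. \<Oplus>y\<in>\<D>. \<mu> x y (zs ! i) \<otimes> f (?m (take i zs @ [x, y] @ drop (Suc i) zs))))"
  by (rule merge_index) (rule f)
 also have "... = (\<Oplus>i\<in>{..<?l}. sign (?l - 1) \<otimes> (sign (?l - Suc i) \<otimes> ?F (?l - Suc i)))"
 proof (rule R.finsum_cong'[OF refl Pi_I])
  fix i assume "i \<in> {..<?l}"
  then have i: "i < ?l" by simp
  have "sign (?l - 1) \<otimes> sign (?l - Suc i) = sign i" using sign_reverse[of i "?l - 1"] i by simp
  with R.m_assoc[OF sign_closed[of "?l - 1"] sign_closed[of "?l - Suc i"] F[of "?l - Suc i"]]
  have "sign i \<otimes> ?F (?l - Suc i) = sign (?l - 1) \<otimes> (sign (?l - Suc i) \<otimes> ?F (?l - Suc i))" by (simp only:)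
  then show "sign i \<otimes> (\<Oplus>x\<in>\<D>. \<Oplus>y\<in>\<D>. \<mu> x y (zs ! i) \<otimes> f (?m (take i zs @ [x, y] @ drop (Suc i) zs)))
   = sign (?l - 1) \<otimes> (sign (?l - Suc i) \<otimes> ?F (?l - Suc i))" unfolding eq[OF i] .
  show "sign (?l - 1) \<otimes> (sign (?l - Suc i) \<otimes> ?F (?l - Suc i)) \<in> carrier R" by (intro R.m_closed sign_closed F)
 qed
 also have "... = sign (?l - 1) \<otimes> (\<Oplus>i\<in>{..<?l}. sign (?l - Suc i) \<otimes> ?F (?l - Suc i))"
  by (rule R.finsum_rdistr[symmetric]) (simp, rule sign_closed, intro Pi_I R.m_closed sign_closed F)
 also have "(\<Oplus>i\<in>{..<?l}. sign (?l - Suc i) \<otimes> ?F (?l - Suc i)) = (\<Oplus>i\<in>{..<?l}. sign i \<otimes> ?F i)"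
 proof -
  have inj: "inj_on (%i. ?l - Suc i) {..<?l}" by (rule inj_onI) auto
  have "(%i. ?l - Suc i) ` {..<?l} = {..<?l}"
   by (rule card_subset_eq) (auto simp: card_image[OF inj])
  then show ?thesis using R.finsum_reindex[of "%i. sign i \<otimes> ?F i" "%i. ?l - Suc i" "{..<?l}"] inj F
   by (auto simp: Pi_def)
 qed
 also have "... = merge (regular_module R) f (?m zs)"
  using merge_index[where f = f and zs = "?m zs", OF f] by simp
 finally show ?thesis .
qed

end

context temperley_lieb
begin

definition mirror :: "diagram list => diagram list" where "mirror xs = rev (map flip xs)"

lemma mirror_mirror [simp]: "mirror (mirror xs) = xs"
 by (simp add: mirror_def rev_map[symmetric] comp_def)

lemma flip_Ds: "flip x \<in> Ds \<longleftrightarrow> x \<in> Ds"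
 using flip_diagrams[of x N N] flip_diagrams[of "flip x" N N] by auto

definition J :: "diagram set" where "J = {y \<in> I. all_cups \<subseteq> left_cups (flip y)}"

lemma J_iff: "flip y \<in> J \<longleftrightarrow> y \<in> with_cups all_cups"
 by (auto simp: J_def with_cups_def flip_I)

lemma I_left_stable: "left_stable I"
 unfolding left_stable_def
proof (intro conjI ballI allI impI)
 fix x y z assume "x \<in> Ds" "y \<in> I" and nz: "\<mu> x y z ~= \<zero>"
 then show "z \<in> I" using I_left[of x y] mu_nonzero[OF nz] by simp
qed (auto simp: I_def)

lemma J_left_stable: "left_stable J"
 unfolding left_stable_def
proof (intro conjI ballI allI impI)
 fix x y z assume xy: "x \<in> Ds" "y \<in> J" and nz: "\<mu> x y z ~= \<zero>"
 have "all_cups \<subseteq> left_cups (glue (flip y) (flip x))"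
  using xy left_cups_compose[of "flip y" "flip x"] by (auto simp: J_def)
 then show "z \<in> J" using I_left[of x y] mu_nonzero[OF nz] xy by (simp add: J_def compose_flip)
qed (auto simp: J_def I_def)

lemma mirror_tensor_lists:
 "mirror xs \<in> tensor_lists X Y q \<longleftrightarrow> xs \<in> tensor_lists {x. flip x \<in> Y} {x. flip x \<in> X} q"
proof (cases "xs = []")
 case False
 have "set (mirror xs) \<subseteq> Ds \<longleftrightarrow> set xs \<subseteq> Ds" unfolding mirror_def set_rev set_map image_subset_iff flip_Ds by blast
 then show ?thesis using False
  by (auto simp: tensor_lists_def mirror_def hd_rev last_rev hd_map last_map simp del: set_rev set_map)
qed (simp add: tensor_lists_def mirror_def)

lemma flip_coefficient: "\<mu> (flip y) (flip x) (flip z) = \<mu> x y z"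
 unfolding tl_coefficient_def compose_flip closed_loops_flip using flip_flip by metis

lemma reflected_homology:
 "same_homology R (funs V1) (%q. chains V1 (tensor_lists (with_cups all_cups) I q)) (merge V1) q
  (funs V1) (%q. chains V1 (tensor_lists I J q)) (merge V1) q"
proof -
 let ?C = "%q. chains V1 (tensor_lists (with_cups all_cups) I q)" and ?C' = "%q. chains V1 (tensor_lists I J q)"
 let ?f = "%f xs. f (mirror xs)"
 note F = funs_is_module[OF V1, where 's = "diagram list"]
 have C': "?f f \<in> ?C' q \<longleftrightarrow> f \<in> ?C q" for f q
 proof -
  have *: "mirror xs \<in> tensor_lists (with_cups all_cups) I q \<longleftrightarrow> xs \<in> tensor_lists I J q" for xs
  proof -
   have "flip x \<in> with_cups all_cups \<longleftrightarrow> x \<in> J" for x using J_iff[of "flip x"] by simp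
   then show ?thesis unfolding mirror_tensor_lists by (simp add: flip_I)
  qed
  then show ?thesis unfolding chains_def mem_Collect_eq by (metis mirror_mirror)
 qed
 have onto: "?f ` ?C q = ?C' q" for q
 proof
  show "?f ` ?C q \<subseteq> ?C' q" using C' by blast
  show "?C' q \<subseteq> ?f ` ?C q"
  proof
   fix g assume g: "g \<in> ?C' q"
   have "?f (?f g) = g" by simp
   moreover have "?f g \<in> ?C q" using C'[of "?f g" q] g by simp
   ultimately show "g \<in> ?f ` ?C q" by (intro image_eqI[of g ?f "?f g"]) simp_all
  qed
 qed
 have comm: "merge V1 (?f x) = ?f (merge V1 x) \<or> merge V1 (?f x) = \<ominus>\<^bsub>funs V1\<^esub> ?f (merge V1 x)"
  if x: "x \<in> ?C p" for x p
 proof -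
  have xc: "x xs \<in> carrier R" for xs using x by (auto simp: chains_def)
  have mc: "merge V1 x xs \<in> carrier R" for xs using merge_closed[OF V1, of x xs] xc by simp
  have vanish: "merge V1 x ys = \<zero>" "merge V1 (?f x) ys = \<zero>" if "length ys ~= p" for ys
  proof -
   have "x xs = \<zero>" if "length xs ~= Suc p" for xs using x that by (auto simp: chains_def tensor_lists_def)
   then show "merge V1 x ys = \<zero>" "merge V1 (?f x) ys = \<zero>"
    using merge_vanish[OF V1, of x p ys] merge_vanish[OF V1, of "?f x" p ys] xc that
    by (auto simp: mirror_def)
  qed
  have m: "merge V1 (?f x) ys = sign (p - 1) \<otimes> merge V1 x (mirror ys)" for ys
  proof (cases "length ys = p")
   case True
   then show ?thesis unfolding mirror_def
    using merge_mirror[of x flip ys, OF xc flip_bij flip_coefficient] by simp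
  next
   case False
   then show ?thesis using vanish(1)[of "mirror ys"] vanish(2)[OF False] by (simp add: mirror_def)
  qed
  consider "sign (p - 1) = \<one>" | "sign (p - 1) = \<ominus> \<one>" using sign_cases by blast
  then show ?thesis
  proof cases
   case 1
   then have "merge V1 (?f x) = ?f (merge V1 x)" using m mc by (simp add: fun_eq_iff)
   then show ?thesis ..
  next
   case 2
   then have "merge V1 (?f x) ys = (\<ominus>\<^bsub>funs V1\<^esub> ?f (merge V1 x)) ys" for ys
    using m mc funs_inv[OF V1, of "?f (merge V1 x)" ys] by (simp add: R.l_minus)
   then show ?thesis by blast
  qed
 qed
 show ?thesis
 proof (rule same_homology_injective[OF F F _ _ merge_hom[OF V1] merge_hom[OF V1], where f = ?f])
  show "submodule (?C q) R (funs V1)" "submodule (?C (Suc q)) R (funs V1)"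
   by (rule chains_submodule[OF V1])+
  show "?f \<in> module_hom R (funs V1) (funs V1)" by (auto simp: module_hom_def)
  show "?f ` ?C q = ?C' q" "?f ` ?C (Suc q) = ?C' (Suc q)" by (rule onto)+
  show "merge V1 (?f x) = ?f (merge V1 x) \<or> merge V1 (?f x) = \<ominus>\<^bsub>funs V1\<^esub> ?f (merge V1 x)"
   if "x \<in> ?C q \<union> ?C (Suc q)" for x using that comm by blast
  show "merge V1 x \<in> ?C q" if "x \<in> ?C (Suc q)" for x
   by (rule merge_chains[OF V1 I_left_stable with_cups_right that])
  show "x = \<zero>\<^bsub>funs V1\<^esub>" if "?f x = \<zero>\<^bsub>funs V1\<^esub>" for x
   using that by (simp add: fun_eq_iff) (metis mirror_mirror)
 qed
qed

end

section \<open>Planar loops as chains\<close>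

lemma bij_betw_restrict:
 assumes "bij_betw f X Y" "!!x. x \<in> X ==> P x \<longleftrightarrow> Q (f x)"
 shows "bij_betw f {x \<in> X. P x} {y \<in> Y. Q y}"
 using assms unfolding bij_betw_def inj_on_def by auto

lemma bij_betw_lists:
 fixes q :: nat
 assumes f: "!!i. i \<le> q ==> bij_betw (f i) (X i) (Y i)"
 shows "bij_betw (%xs. map (%i. f i (xs ! i)) [0..<Suc q])
  {xs. length xs = Suc q & (\<forall>i\<le>q. xs ! i \<in> X i)} {ys. length ys = Suc q & (\<forall>i\<le>q. ys ! i \<in> Y i)}"
proof (rule bij_betw_byWitness[where f' = "%ys. map (%i. inv_into (X i) (f i) (ys ! i)) [0..<Suc q]"])
 have le: "i < Suc q ==> i \<le> q" for i by simp
 show "\<forall>xs\<in>{xs. length xs = Suc q & (\<forall>i\<le>q. xs ! i \<in> X i)}.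
   map (%i. inv_into (X i) (f i) (map (%i. f i (xs ! i)) [0..<Suc q] ! i)) [0..<Suc q] = xs"
  using bij_betw_inv_into_left[OF f] by (auto intro!: nth_equalityI simp del: upt_Suc)
 show "\<forall>ys\<in>{ys. length ys = Suc q & (\<forall>i\<le>q. ys ! i \<in> Y i)}.
   map (%i. f i (map (%i. inv_into (X i) (f i) (ys ! i)) [0..<Suc q] ! i)) [0..<Suc q] = ys"
  using bij_betw_inv_into_right[OF f] by (auto intro!: nth_equalityI simp del: upt_Suc)
 show "(%xs. map (%i. f i (xs ! i)) [0..<Suc q]) ` {xs. length xs = Suc q & (\<forall>i\<le>q. xs ! i \<in> X i)}
   \<subseteq> {ys. length ys = Suc q & (\<forall>i\<le>q. ys ! i \<in> Y i)}"
  using bij_betw_apply[OF f] by (auto simp del: upt_Suc)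
 show "(%ys. map (%i. inv_into (X i) (f i) (ys ! i)) [0..<Suc q]) ` {ys. length ys = Suc q & (\<forall>i\<le>q. ys ! i \<in> Y i)}
   \<subseteq> {xs. length xs = Suc q & (\<forall>i\<le>q. xs ! i \<in> X i)}"
  using bij_betw_apply[OF bij_betw_inv_into[OF f]] by (auto simp del: upt_Suc)
qed

lemma caps_disjoint_diagram: "D \<in> diagrams 0 m ==> nested_caps n \<inter> D = {}"
 using diagramsD(1)[of D 0 m] by (auto simp: nested_caps_def nodes_def)

lemma add_caps_bij: "bij_betw (add_caps n) (diagrams 0 m) {D \<in> diagrams (2 * n) m. nested_caps n \<subseteq> D}"
proof (rule bij_betw_byWitness[where f' = "%D. D - nested_caps n"])
 show "\<forall>D\<in>diagrams 0 m. add_caps n D - nested_caps n = D" 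
  using caps_disjoint_diagram by (fastforce simp: add_caps_def)
 show "\<forall>D\<in>{D \<in> diagrams (2 * n) m. nested_caps n \<subseteq> D}. add_caps n (D - nested_caps n) = D"
  by (auto simp: add_caps_def)
 show "add_caps n ` diagrams 0 m \<subseteq> {D \<in> diagrams (2 * n) m. nested_caps n \<subseteq> D}"
  using add_caps_closed by (auto simp: add_caps_def)
 show "(%D. D - nested_caps n) ` {D \<in> diagrams (2 * n) m. nested_caps n \<subseteq> D} \<subseteq> diagrams 0 m"
  using remove_caps_closed(1) by blast
qed

definition close_right :: "nat => diagram => diagram" where
 "close_right n D = flip (add_caps n (flip D))"

lemma flip_add_caps: "flip (add_caps n D) = flip (nested_caps n) \<union> flip D"
 by (simp add: flip_def add_caps_def image_Un)

lemma close_right_bij: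
 "bij_betw (close_right n) (diagrams m 0) {D \<in> diagrams m (2 * n). nested_caps n \<subseteq> flip D}"
proof -
 have "bij_betw flip {D \<in> diagrams (2 * n) m. nested_caps n \<subseteq> D} {D \<in> diagrams m (2 * n). nested_caps n \<subseteq> flip D}"
  by (rule bij_betw_restrict[OF flip_bij]) simp
 with bij_betw_trans[OF flip_bij add_caps_bij]
 have "bij_betw (flip \<circ> (add_caps n \<circ> flip)) (diagrams m 0) {D \<in> diagrams m (2 * n). nested_caps n \<subseteq> flip D}"
  by (rule bij_betw_trans)
 then show ?thesis by (simp add: close_right_def[abs_def] comp_def)
qed

lemma compose_close_right:
 assumes "D \<in> diagrams l m" "E \<in> diagrams m 0"
 shows "glue D (close_right n E) = close_right n (glue D E)"
  and "loops D (close_right n E) = loops D E"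
proof -
 have c: "glue D E = flip (glue (flip E) (flip D))" for D E
  by (metis compose_flip flip_flip)
 show "glue D (close_right n E) = close_right n (glue D E)"
  unfolding close_right_def c[of D] flip_flip
  by (simp add: compose_add_caps[OF flip_diagrams[OF assms(2)] flip_diagrams[OF assms(1)]])
 have l: "loops D E = loops (flip E) (flip D)" for D E by (simp add: closed_loops_flip)
 show "loops D (close_right n E) = loops D E"
  unfolding close_right_def l[of D] flip_flip
  by (rule loops_add_caps[OF flip_diagrams[OF assms(2)] flip_diagrams[OF assms(1)]])
qed

text \<open>Closing the outer bars of a tuple of planar loops, entrywise.\<close>

definition close_entry :: "nat => nat => nat => diagram => diagram" where
 "close_entry n q i D = (if i = 0 then add_caps n else id) ((if i = q then close_right n else id) D)"

definition close_tuple :: "nat => nat => diagram list => diagram list" where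
 "close_tuple n q xs = map (%i. close_entry n q i (xs ! i)) [0..<Suc q]"

lemma close_entry_bij:
 "bij_betw (close_entry n q i) (diagrams (if i = 0 then 0 else 2 * n) (if i = q then 0 else 2 * n))
  {D \<in> diagrams (2 * n) (2 * n). (i = 0 --> nested_caps n \<subseteq> D) & (i = q --> nested_caps n \<subseteq> flip D)}"
proof -
 let ?l = "if i = 0 then 0 else 2 * n" and ?Q = "%D. i = q --> nested_caps n \<subseteq> flip D"
 have right: "bij_betw (if i = q then close_right n else id) (diagrams ?l (if i = q then 0 else 2 * n))
   {D \<in> diagrams ?l (2 * n). ?Q D}"
  using close_right_bij by auto
 have left: "bij_betw (if i = 0 then add_caps n else id) {D \<in> diagrams ?l (2 * n). ?Q D}
  {D \<in> {D \<in> diagrams (2 * n) (2 * n). i = 0 --> nested_caps n \<subseteq> D}. ?Q D}"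
 proof (rule bij_betw_restrict)
  show "bij_betw (if i = 0 then add_caps n else id) (diagrams ?l (2 * n))
    {D \<in> diagrams (2 * n) (2 * n). i = 0 --> nested_caps n \<subseteq> D}"
   using add_caps_bij by auto
  have "nested_caps n \<inter> flip (nested_caps n) = {}" by (auto simp: nested_caps_def flip_def doubleton_eq_iff)
  then show "?Q D \<longleftrightarrow> ?Q ((if i = 0 then add_caps n else id) D)" for D
   by (auto simp: flip_add_caps)
 qed
 show ?thesis
  using bij_betw_trans[OF right left] by (simp add: close_entry_def[abs_def] comp_def conj_ac)
qed

context temperley_lieb
begin

lemma all_cups_iff: "all_cups \<subseteq> left_cups x \<longleftrightarrow> nested_caps n \<subseteq> x"
 by (auto simp: all_cups_def left_cups_def nested_caps_def)

abbreviation K :: "nat => diagram list set" where "K q \<equiv> tensor_lists (with_cups all_cups) J q"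
abbreviation \<theta> :: "nat => diagram list => diagram list" where "\<theta> \<equiv> close_tuple n"

lemma K_iff: "xs \<in> K q \<longleftrightarrow> length xs = Suc q & (\<forall>i\<le>q. xs ! i \<in>
  {D \<in> Ds. (i = 0 --> nested_caps n \<subseteq> D) & (i = q --> nested_caps n \<subseteq> flip D)})"
proof (cases "length xs = Suc q")
 case True
 then have ne: "xs ~= []" by auto
 have ac: "all_cups ~= {}" using n_pos by (auto simp: all_cups_def lessThan_empty_iff)
 have W: "x \<in> with_cups all_cups \<longleftrightarrow> x \<in> Ds & nested_caps n \<subseteq> x" for x
  using ac by (auto simp: with_cups_def I_iff all_cups_iff[symmetric])
 have J: "x \<in> J \<longleftrightarrow> x \<in> Ds & nested_caps n \<subseteq> flip x" for x
  using W[of "flip x"] J_iff[of "flip x"] by (simp add: flip_Ds)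
 have "set xs \<subseteq> Ds \<longleftrightarrow> (\<forall>i\<le>q. xs ! i \<in> Ds)" using True by (auto simp: subset_iff in_set_conv_nth less_Suc_eq_le)
 then show ?thesis unfolding tensor_lists_def mem_Collect_eq hd_conv_nth[OF ne] last_conv_nth[OF ne] W J
  using True by auto
qed (simp add: tensor_lists_def)

lemma \<theta>_bij: "bij_betw (\<theta> q) (loop_tuples N q) (K q)"
proof -
 have "K q = {ys. length ys = Suc q & (\<forall>i\<le>q. ys ! i \<in>
  {D \<in> Ds. (i = 0 --> nested_caps n \<subseteq> D) & (i = q --> nested_caps n \<subseteq> flip D)})}"
  using K_iff by blast
 then show ?thesis
  unfolding close_tuple_def[abs_def] loop_tuples_def
  using bij_betw_lists[of q "close_entry n q", OF close_entry_bij] by (simp only:)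
qed

lemma \<theta>_nth: "i \<le> q ==> \<theta> q xs ! i = close_entry n q i (xs ! i)" "length (\<theta> q xs) = Suc q"
 by (simp_all add: close_tuple_def del: upt_Suc)

lemma compose_\<theta>:
 assumes xs: "xs \<in> loop_tuples N (Suc q)" and i: "i \<le> q"
 shows "glue (\<theta> (Suc q) xs ! i) (\<theta> (Suc q) xs ! Suc i) =
   close_entry n q i (glue (xs ! i) (xs ! Suc i))"
  and "loops (\<theta> (Suc q) xs ! i) (\<theta> (Suc q) xs ! Suc i) = loops (xs ! i) (xs ! Suc i)"
proof -
 let ?x = "xs ! i" and ?y = "xs ! Suc i"
 have D: "xs ! j \<in> diagrams (if j = 0 then 0 else N) (if j = Suc q then 0 else N)" if "j \<le> Suc q" for j
  using xs that by (simp add: loop_tuples_def)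
 have x: "?x \<in> diagrams (if i = 0 then 0 else N) N" and y: "?y \<in> diagrams N (if i = q then 0 else N)"
  using D[of i] D[of "Suc i"] i by auto
 define y' where "y' = (if i = q then close_right n else id) ?y"
 have y': "y' \<in> diagrams N N" using y bij_betw_apply[OF close_right_bij] by (auto simp: y'_def)
 have nth: "\<theta> (Suc q) xs ! i = (if i = 0 then add_caps n else id) ?x" "\<theta> (Suc q) xs ! Suc i = y'"
  using i by (simp_all add: \<theta>_nth close_entry_def y'_def)
 have "glue ?x y' = (if i = q then close_right n else id) (glue ?x ?y)"
  "loops ?x y' = loops ?x ?y"
  using compose_close_right[OF x, of ?y n] y by (auto simp: y'_def)
 moreover have "glue ((if i = 0 then add_caps n else id) ?x) y' =
   (if i = 0 then add_caps n else id) (glue ?x y')"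
  "loops ((if i = 0 then add_caps n else id) ?x) y' = loops ?x y'"
  using compose_add_caps[of ?x N y' N n] loops_add_caps[of ?x N y' N n] x y' by auto
 ultimately show "glue (\<theta> (Suc q) xs ! i) (\<theta> (Suc q) xs ! Suc i) =
   close_entry n q i (glue (xs ! i) (xs ! Suc i))"
  "loops (\<theta> (Suc q) xs ! i) (\<theta> (Suc q) xs ! Suc i) = loops (xs ! i) (xs ! Suc i)"
  by (simp_all add: nth close_entry_def)
qed

definition merge_at :: "nat => diagram list => diagram list" where
 "merge_at i xs = take i xs @ [glue (xs ! i) (xs ! Suc i)] @ drop (i + 2) xs"

lemma merge_at_nth:
 assumes "length xs = Suc (Suc q)" "i \<le> q"
 shows "length (merge_at i xs) = Suc q" "j \<le> q ==> merge_at i xs ! j =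
  (if j < i then xs ! j else if j = i then glue (xs ! i) (xs ! Suc i) else xs ! Suc j)"
 using assms by (auto simp: merge_at_def nth_append nth_Cons')

lemma merge_at_loop_tuples:
 assumes xs: "xs \<in> loop_tuples N (Suc q)" and i: "i \<le> q"
 shows "merge_at i xs \<in> loop_tuples N q"
proof -
 have len: "length xs = Suc (Suc q)" using xs by (simp add: loop_tuples_def)
 have D: "xs ! j \<in> diagrams (if j = 0 then 0 else N) (if j = Suc q then 0 else N)" if "j \<le> Suc q" for j
  using xs that by (simp add: loop_tuples_def)
 have "merge_at i xs ! j \<in> diagrams (if j = 0 then 0 else N) (if j = q then 0 else N)" if j: "j \<le> q" for j
  using D[of j] D[of "Suc j"] i j compose_closed[of "xs ! i" _ N "xs ! Suc i"]
  by (auto simp: merge_at_nth[OF len i])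
 then show ?thesis by (simp add: loop_tuples_def merge_at_nth[OF len i])
qed

lemma merge_at_\<theta>:
 assumes xs: "xs \<in> loop_tuples N (Suc q)" and i: "i \<le> q"
 shows "merge_at i (\<theta> (Suc q) xs) = \<theta> q (merge_at i xs)"
proof (rule nth_equalityI)
 have len: "length xs = Suc (Suc q)" "length (\<theta> (Suc q) xs) = Suc (Suc q)"
  using xs by (simp_all add: loop_tuples_def \<theta>_nth)
 note nth = merge_at_nth[OF len(1) i] merge_at_nth[OF len(2) i]
 show "length (merge_at i (\<theta> (Suc q) xs)) = length (\<theta> q (merge_at i xs))"
  by (simp add: nth \<theta>_nth)
 fix j assume "j < length (merge_at i (\<theta> (Suc q) xs))"
 then have j: "j \<le> q" by (simp add: nth)
 have e: "j < i ==> close_entry n (Suc q) j = close_entry n q j"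
  "i < j ==> close_entry n (Suc q) (Suc j) = close_entry n q j"
  using i j by (auto simp: close_entry_def fun_eq_iff)
 show "merge_at i (\<theta> (Suc q) xs) ! j = \<theta> q (merge_at i xs) ! j"
  using i j e compose_\<theta>(1)[OF xs i] by (auto simp: nth \<theta>_nth)
qed

lemma finite_K: "finite (K q)"
 by (rule finite_subset[OF _ finite_lists_length_eq[OF finite_diagrams[of N N], of "Suc q"]])
  (auto simp: tensor_lists_def)

lemma merge_basis:
 assumes xs: "xs \<in> K (Suc q)" and zs: "length zs = Suc q"
 shows "merge V1 (basis_elt R xs) zs =
  (\<Oplus>i\<in>{..q}. sign i \<otimes> (a [^] loops (xs ! i) (xs ! Suc i) \<otimes> basis_elt R (merge_at i xs) zs))"
proof -
 have xD: "length xs = Suc (Suc q)" "set xs \<subseteq> Ds" using xs by (auto simp: tensor_lists_def)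
 have "merge V1 (basis_elt R xs) zs = (\<Oplus>i\<in>{..<length zs}. sign i \<otimes>
  (\<Oplus>x\<in>Ds. \<Oplus>y\<in>Ds. \<mu> x y (zs ! i) \<otimes> basis_elt R xs (take i zs @ [x, y] @ drop (Suc i) zs)))"
  by (rule merge_index) (simp add: basis_elt_def)
 also have "... = (\<Oplus>i\<in>{..q}. sign i \<otimes> (a [^] loops (xs ! i) (xs ! Suc i) \<otimes> basis_elt R (merge_at i xs) zs))"
  unfolding zs lessThan_Suc_atMost
 proof (rule R.finsum_cong'[OF refl Pi_I])
  fix i assume "i \<in> {..q}"
  then have i: "i \<le> q" by simp
  let ?b = "take i zs = take i xs & drop (Suc i) zs = drop (i + 2) xs"
  have xi: "xs ! i \<in> Ds" "xs ! Suc i \<in> Ds" using xD i by (auto simp: subset_iff)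
  have split: "xs = take i xs @ [xs ! i, xs ! Suc i] @ drop (i + 2) xs"
   using xD(1) i by (simp add: Cons_nth_drop_Suc)
  have split': "zs = take i zs @ [zs ! i] @ drop (Suc i) zs" using zs i by (simp add: Cons_nth_drop_Suc)
  have len: "length (take i zs) = length (take i xs)" using xD(1) zs i by simp
  have iff: "take i zs @ [x, y] @ drop (Suc i) zs = xs \<longleftrightarrow> x = xs ! i & y = xs ! Suc i & ?b" for x y
   by (subst split) (use len in auto)
  have iff': "zs = merge_at i xs \<longleftrightarrow> zs ! i = glue (xs ! i) (xs ! Suc i) & ?b"
   unfolding merge_at_def by (subst split') (use len in auto)
  have "(\<Oplus>x\<in>Ds. \<Oplus>y\<in>Ds. \<mu> x y (zs ! i) \<otimes> basis_elt R xs (take i zs @ [x, y] @ drop (Suc i) zs))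
   = (\<Oplus>y\<in>Ds. \<mu> (xs ! i) y (zs ! i) \<otimes> basis_elt R xs (take i zs @ [xs ! i, y] @ drop (Suc i) zs))"
  proof (rule R.finsum_single[OF finite_diagrams xi(1)])
   fix x assume x: "x \<in> Ds" "x ~= xs ! i"
   then have "take i zs @ [x, y] @ drop (Suc i) zs ~= xs" for y using iff by blast
   then show "(\<Oplus>y\<in>Ds. \<mu> x y (zs ! i) \<otimes> basis_elt R xs (take i zs @ [x, y] @ drop (Suc i) zs)) = \<zero>"
    by (intro R.finsum_zero') (simp add: basis_elt_def mu_in_R)
  qed (intro R.finsum_closed Pi_I R.m_closed mu_in_R, simp add: basis_elt_def)
  also have "... = \<mu> (xs ! i) (xs ! Suc i) (zs ! i) \<otimes> basis_elt R xs (take i zs @ [xs ! i, xs ! Suc i] @ drop (Suc i) zs)"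
  proof (rule R.finsum_single[OF finite_diagrams xi(2)])
   fix y assume y: "y \<in> Ds" "y ~= xs ! Suc i"
   then have "take i zs @ [xs ! i, y] @ drop (Suc i) zs ~= xs" using iff by blast
   then show "\<mu> (xs ! i) y (zs ! i) \<otimes> basis_elt R xs (take i zs @ [xs ! i, y] @ drop (Suc i) zs) = \<zero>"
    by (simp add: basis_elt_def mu_in_R)
  qed (simp add: basis_elt_def mu_in_R)
  also have "... = a [^] loops (xs ! i) (xs ! Suc i) \<otimes> basis_elt R (merge_at i xs) zs"
   unfolding basis_elt_def iff iff' by (auto simp: tl_coefficient_def a_closed)
  finally show "sign i \<otimes> (\<Oplus>x\<in>Ds. \<Oplus>y\<in>Ds. \<mu> x y (zs ! i) \<otimes> basis_elt R xs (take i zs @ [x, y] @ drop (Suc i) zs))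
   = sign i \<otimes> (a [^] loops (xs ! i) (xs ! Suc i) \<otimes> basis_elt R (merge_at i xs) zs)" by simp
  show "sign i \<otimes> (a [^] loops (xs ! i) (xs ! Suc i) \<otimes> basis_elt R (merge_at i xs) zs) \<in> carrier R"
   by (simp add: a_closed basis_elt_def)
 qed
 finally show ?thesis .
qed

abbreviation L :: "nat => ('r, diagram list => 'r) module" where "L \<equiv> planar_loops R N"
abbreviation dL :: "nat => (diagram list => 'r) => diagram list => 'r" where "dL \<equiv> planar_loops_diff R a N"

definition closed_chain :: "nat => (diagram list => 'r) => diagram list => 'r" where
 "closed_chain q g xs = (if xs \<in> K q then g (inv_into (loop_tuples N q) (\<theta> q) xs) else \<zero>)"

lemma L_module: "module R (L q)"
 unfolding planar_loops_def by (rule free_module_is_module) (rule R.is_cring)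

lemma L_carrier: "g \<in> carrier (L q) \<longleftrightarrow> (\<forall>xs. g xs \<in> carrier R) & (\<forall>xs. xs \<notin> loop_tuples N q --> g xs = \<zero>)"
proof -
 have "finite (loop_tuples N q)" using finite_K bij_betw_finite[OF \<theta>_bij] by blast
 then have "finite {xs. g xs ~= \<zero>}" if "\<forall>xs. xs \<notin> loop_tuples N q --> g xs = \<zero>"
  by (rule rev_finite_subset) (use that in auto)
 then show ?thesis by (auto simp: planar_loops_def free_module_carrier)
qed

lemma closed_chain_\<theta>: "xs \<in> loop_tuples N q ==> closed_chain q g (\<theta> q xs) = g xs"
 using bij_betw_apply[OF \<theta>_bij] bij_betw_inv_into_left[OF \<theta>_bij] by (simp add: closed_chain_def)

lemma closed_chain_bij: "bij_betw (closed_chain q) (carrier (L q)) (chains V1 (K q))"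
proof (rule bij_betw_byWitness[where f' = "%f xs. if xs \<in> loop_tuples N q then f (\<theta> q xs) else \<zero>"])
 show "\<forall>g\<in>carrier (L q). (%xs. if xs \<in> loop_tuples N q then closed_chain q g (\<theta> q xs) else \<zero>) = g"
  by (auto simp: closed_chain_\<theta> L_carrier)
 show "\<forall>f\<in>chains V1 (K q). closed_chain q (%xs. if xs \<in> loop_tuples N q then f (\<theta> q xs) else \<zero>) = f"
  using bij_betw_apply[OF bij_betw_inv_into[OF \<theta>_bij[of q]]] bij_betw_inv_into_right[OF \<theta>_bij[of q]]
  by (auto simp: closed_chain_def chains_def fun_eq_iff)
 show "closed_chain q ` carrier (L q) \<subseteq> chains V1 (K q)"
  by (auto simp: closed_chain_def chains_def L_carrier)
 show "(%f xs. if xs \<in> loop_tuples N q then f (\<theta> q xs) else \<zero>) ` chains V1 (K q) \<subseteq> carrier (L q)"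
  by (auto simp: chains_def L_carrier)
qed

lemma closed_chain_hom: "closed_chain q \<in> module_hom R (L q) (funs V1)"
 by (auto simp: module_hom_def closed_chain_def L_carrier planar_loops_def[of R N q] fun_eq_iff)
  (auto simp: planar_loops_def[symmetric] L_carrier)

lemma closed_chain_basis:
 "xs \<in> loop_tuples N q ==> closed_chain q (basis_elt R xs) = basis_elt R (\<theta> q xs)"
proof
 fix ys assume xs: "xs \<in> loop_tuples N q"
 show "closed_chain q (basis_elt R xs) ys = basis_elt R (\<theta> q xs) ys"
 proof (cases "ys \<in> K q")
  case True
  then obtain zs where zs: "zs \<in> loop_tuples N q" "ys = \<theta> q zs" using bij_betw_imp_surj_on[OF \<theta>_bij] by blast
  have "\<theta> q zs = \<theta> q xs \<longleftrightarrow> zs = xs" using bij_betw_imp_inj_on[OF \<theta>_bij] xs zs(1) by (auto simp: inj_on_def)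
  then show ?thesis using zs by (simp add: closed_chain_\<theta> basis_elt_def)
 next
  case False
  then show ?thesis using bij_betw_apply[OF \<theta>_bij xs] by (auto simp: closed_chain_def basis_elt_def)
 qed
qed

lemma planar_term_closed:
 assumes "xs \<in> loop_tuples N (Suc q)" "i \<le> q" "c \<in> carrier R"
 shows "c \<odot>\<^bsub>L q\<^esub> basis_elt R (merge_at i xs) \<in> carrier (L q)"
proof -
 interpret L: module R "L q" by (rule L_module)
 show ?thesis
  by (rule L.smult_closed[OF assms(3)])
   (simp add: planar_loops_def basis_elt_closed[OF R.ring_axioms merge_at_loop_tuples[OF assms(1,2)]])
qed

definition planar_image :: "nat => diagram list => diagram list => 'r" where
 "planar_image q xs = (\<Oplus>\<^bsub>L q\<^esub>i\<in>{..q}. (sign i \<otimes> a [^] loops (xs ! i) (xs ! Suc i)) \<odot>\<^bsub>L q\<^esub> basis_elt R (merge_at i xs))"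

lemma planar_image_closed: "xs \<in> loop_tuples N (Suc q) ==> planar_image q xs \<in> carrier (L q)"
proof -
 assume xs: "xs \<in> loop_tuples N (Suc q)"
 interpret L: module R "L q" by (rule L_module)
 show ?thesis unfolding planar_image_def
  by (intro L.finsum_closed Pi_I planar_term_closed xs) (auto simp: a_closed)
qed

lemma dL_eq: "dL q = linear_extension R (L q) (planar_image q)"
 by (simp add: planar_loops_diff_def planar_image_def[abs_def] merge_at_def)

lemma dL_hom: "dL q \<in> module_hom R (L (Suc q)) (L q)"
 unfolding dL_eq planar_loops_def[of R N "Suc q"]
 by (rule linear_extension_hom[OF L_module planar_image_closed])

lemma closed_chain_dL:
 assumes g: "g \<in> carrier (L (Suc q))"
 shows "merge V1 (closed_chain (Suc q) g) = closed_chain q (dL q g)"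
proof
 fix ys
 note FV = funs_is_module[OF V1, where 's = "diagram list"]
 have comp: "(%x. k (h x)) \<in> module_hom R X Z" if "h \<in> module_hom R X Y" "k \<in> module_hom R Y Z"
  for h k and X :: "('r, 'y1) module" and Y :: "('r, 'y2) module" and Z :: "('r, 'y3) module"
  using that by (auto simp: module_hom_def Pi_def)
 show "merge V1 (closed_chain (Suc q) g) ys = closed_chain q (dL q g) ys"
 proof (rule free_module_hom_eqI[OF R.is_cring V1, of "%g. merge V1 (closed_chain (Suc q) g) ys" "loop_tuples N (Suc q)"
    "%g. closed_chain q (dL q g) ys" g])
  show "(%g. merge V1 (closed_chain (Suc q) g) ys) \<in> module_hom R (free_module R (loop_tuples N (Suc q))) V1"
   unfolding planar_loops_def[symmetric]
   by (rule comp[OF comp[OF closed_chain_hom merge_hom[OF V1]] eval_module_hom])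
  show "(%g. closed_chain q (dL q g) ys) \<in> module_hom R (free_module R (loop_tuples N (Suc q))) V1"
   unfolding planar_loops_def[symmetric]
   by (rule comp[OF comp[OF dL_hom closed_chain_hom] eval_module_hom])
  show "g \<in> carrier (free_module R (loop_tuples N (Suc q)))" using g by (simp add: planar_loops_def)
  fix xs assume xs: "xs \<in> loop_tuples N (Suc q)"
  have basis: "merge V1 (closed_chain (Suc q) (basis_elt R xs)) ys = merge V1 (basis_elt R (\<theta> (Suc q) xs)) ys"
   by (simp add: closed_chain_basis[OF xs])
  have dL_basis: "dL q (basis_elt R xs) = planar_image q xs"
   unfolding dL_eq by (rule linear_extension_basis[OF L_module xs planar_image_closed])
  show "merge V1 (closed_chain (Suc q) (basis_elt R xs)) ys = closed_chain q (dL q (basis_elt R xs)) ys"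
  proof (cases "ys \<in> K q")
   case False
   have "basis_elt R (\<theta> (Suc q) xs) \<in> chains V1 (K (Suc q))"
    using bij_betw_apply[OF \<theta>_bij xs] by (auto simp: chains_def basis_elt_def)
   from merge_chains_vanish[OF V1 J_left_stable with_cups_right this False]
   show ?thesis unfolding basis using False by (simp add: closed_chain_def)
  next
   case True
   then obtain zs where zs: "zs \<in> loop_tuples N q" "ys = \<theta> q zs" using bij_betw_imp_surj_on[OF \<theta>_bij] by blast
   have len: "length (\<theta> q zs) = Suc q" by (simp add: \<theta>_nth)
   have inj: "basis_elt R (merge_at i (\<theta> (Suc q) xs)) (\<theta> q zs) = basis_elt R (merge_at i xs) zs" if i: "i \<le> q" for i
    using bij_betw_imp_inj_on[OF \<theta>_bij] merge_at_loop_tuples[OF xs i] zs(1)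
    unfolding merge_at_\<theta>[OF xs i] by (auto simp: basis_elt_def inj_on_def)
   let ?t = "%i. (sign i \<otimes> a [^] loops (xs ! i) (xs ! Suc i)) \<otimes> basis_elt R (merge_at i xs) zs"
   have tc: "?t i \<in> carrier R" for i by (simp add: a_closed basis_elt_def)
   have "merge V1 (basis_elt R (\<theta> (Suc q) xs)) ys = (\<Oplus>i\<in>{..q}. ?t i)"
    unfolding zs(2) merge_basis[OF bij_betw_apply[OF \<theta>_bij xs] len]
   proof (rule R.finsum_cong'[OF refl Pi_I])
    fix i assume "i \<in> {..q}"
    then have i: "i \<le> q" by simp
    show "sign i \<otimes> (a [^] loops (\<theta> (Suc q) xs ! i) (\<theta> (Suc q) xs ! Suc i) \<otimes>
      basis_elt R (merge_at i (\<theta> (Suc q) xs)) (\<theta> q zs)) = ?t i"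
     unfolding inj[OF i] compose_\<theta>(2)[OF xs i] by (simp add: R.m_assoc a_closed basis_elt_def)
   qed (rule tc)
   also have "... = planar_image q xs zs"
   proof -
    have "planar_image q xs zs = (\<Oplus>i\<in>{..q}. ((sign i \<otimes> a [^] loops (xs ! i) (xs ! Suc i)) \<odot>\<^bsub>L q\<^esub> basis_elt R (merge_at i xs)) zs)"
     unfolding planar_image_def using planar_term_closed[OF xs]
     by (simp only: planar_loops_def, intro free_module_finsum[OF R.is_cring]) (auto simp: planar_loops_def a_closed)
    then show ?thesis by (simp add: planar_loops_def)
   qed
   finally show ?thesis unfolding basis dL_basis unfolding zs(2) closed_chain_\<theta>[OF zs(1)] .
  qed
 qed
qed

lemma planar_complex: "chain_complex R L dL"
proof (rule chain_complex.intro)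
 show "module R (L q)" for q by (rule L_module)
 show "dL q \<in> module_hom R (L (Suc q)) (L q)" for q by (rule dL_hom)
 fix q g assume g: "g \<in> carrier (L (Suc (Suc q)))"
 have g1: "dL (Suc q) g \<in> carrier (L (Suc q))" by (rule module_hom_closed[OF dL_hom g])
 have g2: "dL q (dL (Suc q) g) \<in> carrier (L q)" by (rule module_hom_closed[OF dL_hom g1])
 interpret L: module R "L q" by (rule L_module)
 have "closed_chain q (dL q (dL (Suc q) g)) = merge V1 (merge V1 (closed_chain (Suc (Suc q)) g))"
  by (simp add: closed_chain_dL[OF g] closed_chain_dL[OF g1])
 also have "... = (%_. \<zero>)"
  using merge_merge[OF V1] module_hom_closed[OF closed_chain_hom g] by (simp add: fun_eq_iff)
 also have "... = closed_chain q \<zero>\<^bsub>L q\<^esub>" by (simp add: planar_loops_def closed_chain_def fun_eq_iff)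
 finally show "dL q (dL (Suc q) g) = \<zero>\<^bsub>L q\<^esub>"
  using bij_betw_imp_inj_on[OF closed_chain_bij] g2 L.zero_closed by (auto simp: inj_on_def)
qed

lemma planar_homology:
 "subquot_iso R (funs V1) {f \<in> chains V1 (K q). merge V1 f = \<zero>\<^bsub>funs V1\<^esub>}
  (merge V1 ` chains V1 (K (Suc q))) (L q) (cycles L dL q) (boundaries L dL q)"
proof (rule subquot_iso_sym, rule subquot_iso_map[where f = "closed_chain q"])
 interpret C: chain_complex R L dL by (rule planar_complex)
 interpret L: module R "L q" by (rule L_module)
 note sub = L.submoduleE[OF C.cycles_submodule]
 have zc: "z \<in> cycles L dL q ==> z \<in> carrier (L q)" for z using sub(1) by blast
 have inj: "inj_on (closed_chain q) (carrier (L q))" for q by (rule bij_betw_imp_inj_on[OF closed_chain_bij])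
 have surj: "closed_chain q ` carrier (L q) = chains V1 (K q)" for q by (rule bij_betw_imp_surj_on[OF closed_chain_bij])
 have cyc: "g \<in> cycles L dL q \<longleftrightarrow> merge V1 (closed_chain q g) = \<zero>\<^bsub>funs V1\<^esub>" if g: "g \<in> carrier (L q)" for g
 proof (cases q)
  case 0
  have "closed_chain 0 g \<in> chains V1 (K 0)" using bij_betw_apply[OF closed_chain_bij] g 0 by blast
  from merge_chains_bottom[OF V1 this] show ?thesis using g by (simp add: 0)
 next
  case (Suc p)
  interpret L': module R "L p" by (rule L_module)
  have z: "closed_chain p \<zero>\<^bsub>L p\<^esub> = \<zero>\<^bsub>funs V1\<^esub>" by (simp add: planar_loops_def closed_chain_def fun_eq_iff)
  have "dL p g \<in> carrier (L p)" using module_hom_closed[OF dL_hom] g Suc by blast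
  then have "dL p g = \<zero>\<^bsub>L p\<^esub> \<longleftrightarrow> closed_chain p (dL p g) = closed_chain p \<zero>\<^bsub>L p\<^esub>"
   using inj_on_eq_iff[OF inj, of "dL p g" p "\<zero>\<^bsub>L p\<^esub>"] by simp
  then show ?thesis using g closed_chain_dL[of g p] unfolding z by (simp add: Suc)
 qed
 show "closed_chain q ` cycles L dL q = {f \<in> chains V1 (K q). merge V1 f = \<zero>\<^bsub>funs V1\<^esub>}"
 proof
  show "closed_chain q ` cycles L dL q \<subseteq> {f \<in> chains V1 (K q). merge V1 f = \<zero>\<^bsub>funs V1\<^esub>}"
   using cyc zc surj[of q] by blast
  show "{f \<in> chains V1 (K q). merge V1 f = \<zero>\<^bsub>funs V1\<^esub>} \<subseteq> closed_chain q ` cycles L dL q"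
   using cyc unfolding surj[symmetric] by blast
 qed
 show "x \<oplus>\<^bsub>L q\<^esub> y \<in> cycles L dL q & closed_chain q (x \<oplus>\<^bsub>L q\<^esub> y) = closed_chain q x \<oplus>\<^bsub>funs V1\<^esub> closed_chain q y"
  if "x \<in> cycles L dL q" "y \<in> cycles L dL q" for x y
  using that sub(5) module_hom_add[OF closed_chain_hom zc zc] by blast
 show "r \<odot>\<^bsub>L q\<^esub> x \<in> cycles L dL q & closed_chain q (r \<odot>\<^bsub>L q\<^esub> x) = r \<odot>\<^bsub>funs V1\<^esub> closed_chain q x"
  if "r \<in> carrier R" "x \<in> cycles L dL q" for r x
  using that sub(4) module_hom_smult[OF closed_chain_hom _ zc] by blast
 have im: "merge V1 ` chains V1 (K (Suc q)) = closed_chain q ` boundaries L dL q"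
  unfolding boundaries_def surj[symmetric] image_image by (rule image_cong[OF refl closed_chain_dL])
 show "x \<in> boundaries L dL q \<longleftrightarrow> closed_chain q x \<in> merge V1 ` chains V1 (K (Suc q))" if x: "x \<in> cycles L dL q" for x
 proof -
  have "boundaries L dL q \<subseteq> carrier (L q)" unfolding boundaries_def using module_hom_closed[OF dL_hom] by blast
  then show ?thesis unfolding im using inj_on_image_mem_iff[OF inj zc[OF x]] by blast
 qed
qed

end

section \<open>The bar complex of the trivial module\<close>

context temperley_lieb
begin

abbreviation idd :: diagram where "idd \<equiv> identity_diagram N"
abbreviation F :: "('r, diagram => 'r) module" where "F \<equiv> free_module R Ds"

definition trivial_act :: "'r => diagram => 'r" where
 "trivial_act r x = (if x = idd then r else \<zero>)"

lemma idd_closed: "idd \<in> Ds" by (rule identity_diagram_closed)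

lemma F_module: "module R F" by (rule free_module_is_module) (rule R.is_cring)

interpretation FM: module R F by (rule F_module)

lemma mu_identity:
 assumes "x \<in> Ds" "y \<in> Ds"
 shows "\<mu> x y idd = (if x = idd & y = idd then \<one> else \<zero>)"
proof (cases "x = idd & y = idd")
 case True
 have "(B idd \<otimes>\<^bsub>A\<^esub> B idd) idd = B idd idd" using A.l_one[of "B idd"] B_closed[OF idd_closed] by simp
 then show ?thesis using True by (simp add: B_mult_B idd_closed) (simp add: basis_elt_def)
next
 case False
 then have "x \<in> I \<or> y \<in> I" using assms by (auto simp: I_def)
 then have "glue x y \<in> I" using I_right[of x y] I_left[of x y] assms by blast
 then have "glue x y ~= idd" by (auto simp: I_def)
 then show ?thesis using False by (auto simp: tl_coefficient_def)
qed

lemma mu_unit: "x \<in> Ds ==> \<mu> idd x z = B x z"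
 using A.l_one[of "B x"] B_closed[of x] B_mult_B[OF idd_closed, of x] by (simp add: fun_eq_iff)

lemma rep_trivial: "right_rep V1 trivial_act"
 unfolding right_rep_def
proof (intro conjI ballI)
 show "module R V1" by (rule V1)
 show "(%v. trivial_act v x) \<in> module_hom R V1 V1" if "x \<in> Ds" for x
  by (auto simp: module_hom_def trivial_act_def)
 fix v x y assume v: "v \<in> carrier V1" and xy: "x \<in> Ds" "y \<in> Ds"
 have "(\<Oplus>z\<in>Ds. \<mu> x y z \<otimes> trivial_act v z) = \<mu> x y idd \<otimes> trivial_act v idd"
  by (rule R.finsum_single[OF finite_diagrams idd_closed]) (use v in \<open>auto simp: trivial_act_def mu_in_R\<close>)
 then show "trivial_act (trivial_act v x) y = (\<Oplus>\<^bsub>V1\<^esub>z\<in>Ds. \<mu> x y z \<odot>\<^bsub>V1\<^esub> trivial_act v z)"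
  using v by (simp add: mu_identity[OF xy]) (auto simp: trivial_act_def)
qed

lemma F_coeff: "v \<in> carrier F ==> v x \<in> carrier R" by (simp add: A_carrier)

lemma F_finsum:
 "(!!i. i \<in> X ==> f i \<in> carrier F) ==> finite X ==> finsum F f X z = (\<Oplus>i\<in>X. f i z)"
 by (rule free_module_finsum[OF R.is_cring])

lemma F_smult_closed: "r \<in> carrier R ==> v \<in> carrier F ==> r \<odot>\<^bsub>F\<^esub> v \<in> carrier F"
 by (rule FM.smult_closed)

lemma F_one: "B idd \<in> carrier F" by (rule B_closed[OF idd_closed])

lemma F_sum_basis: "v \<in> carrier F ==> (\<Oplus>\<^bsub>F\<^esub>x\<in>Ds. v x \<odot>\<^bsub>F\<^esub> B x) = v"
proof
 fix z assume v: "v \<in> carrier F"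
 have "(\<Oplus>\<^bsub>F\<^esub>x\<in>Ds. v x \<odot>\<^bsub>F\<^esub> B x) z = (\<Oplus>x\<in>Ds. (v x \<odot>\<^bsub>F\<^esub> B x) z)"
  by (rule F_finsum) (auto intro!: F_smult_closed B_closed F_coeff[OF v] finite_diagrams simp del: free_module_simps)
 also have "... = v z"
 proof (cases "z \<in> Ds")
  case True
  show ?thesis by (subst R.finsum_single[OF finite_diagrams True]) (auto simp: basis_elt_def F_coeff[OF v])
 next
  case False
  then have "(\<Oplus>x\<in>Ds. (v x \<odot>\<^bsub>F\<^esub> B x) z) = \<zero>"
   by (intro R.finsum_zero') (auto simp: basis_elt_def F_coeff[OF v])
  then show ?thesis using False v by (simp add: A_carrier)
 qed
 finally show "(\<Oplus>\<^bsub>F\<^esub>x\<in>Ds. v x \<odot>\<^bsub>F\<^esub> B x) z = v z" .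
qed

definition reduced :: "(diagram list => 'r) => diagram list => 'r" where
 "reduced g xs = (if xs ~= [] & hd xs \<in> I then g xs else \<zero>)"

definition unit_part :: "(diagram list => 'r) => diagram list => 'r" where
 "unit_part k xs = (if xs ~= [] & hd xs = idd then k (tl xs) else \<zero>)"

abbreviation \<beta> :: "(diagram list => 'r) => diagram list => 'r" where "\<beta> \<equiv> bar V1 trivial_act"
abbreviation mrg :: "(diagram list => 'r) => diagram list => 'r" where "mrg \<equiv> merge V1"
abbreviation bars :: "nat => (diagram list => 'r) set" where "bars q \<equiv> chains V1 (bar_lists I q)"
abbreviation ideals :: "nat => (diagram list => 'r) set" where "ideals q \<equiv> chains V1 (tensor_lists I I q)"

lemma tensor_lists_bar: "xs \<in> tensor_lists I I q \<longleftrightarrow> xs \<in> bar_lists I (Suc q) & hd xs \<in> I"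
 by (cases xs) (auto simp: tensor_lists_def bar_lists_def I_def)

lemma reduced_ideals: "g \<in> bars (Suc q) ==> reduced g \<in> ideals q"
 by (auto simp: chains_def reduced_def tensor_lists_bar)

lemma ideals_bars: "g \<in> ideals q ==> g \<in> bars (Suc q)" "g \<in> ideals q ==> reduced g = g"
 by (auto simp: chains_def reduced_def tensor_lists_bar fun_eq_iff bar_lists_def)

lemma unit_part_bars: "k \<in> bars (Suc q) ==> unit_part k \<in> bars (Suc (Suc q))"
proof -
 assume k: "k \<in> bars (Suc q)"
 have "unit_part k xs = \<zero>" if xs: "xs \<notin> bar_lists I (Suc (Suc q))" for xs
 proof (cases xs)
  case (Cons x ws)
  have "ws \<notin> bar_lists I (Suc q)" if "x = idd"
   using xs that idd_closed unfolding Cons by (auto simp: bar_lists_def split: if_splits)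
  then show ?thesis using k Cons by (auto simp: unit_part_def chains_def)
 qed (simp add: unit_part_def)
 then show ?thesis using k by (auto simp: chains_def unit_part_def)
qed

lemma bars_split:
 assumes g: "g \<in> bars (Suc q)"
 shows "g xs = reduced g xs \<oplus> unit_part (%ws. g (idd # ws)) xs"
proof (cases "xs \<in> bar_lists I (Suc q)")
 case True
 then obtain x ws where "xs = x # ws" "x \<in> Ds" by (cases xs) (auto simp: bar_lists_def)
 moreover have "idd \<notin> I" by (simp add: I_def)
 ultimately show ?thesis using g by (cases "x = idd") (auto simp: reduced_def unit_part_def chains_def I_def)
next
 case False
 then have "g xs = \<zero>" using g by (simp add: chains_def)
 then show ?thesis by (cases xs) (auto simp: reduced_def unit_part_def)
qed

lemma beta_eq: "(!!xs. g xs \<in> carrier R) ==> \<beta> g ys = g (idd # ys) \<ominus> mrg g ys"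
proof -
 assume g: "!!xs. g xs \<in> carrier R"
 have "(\<Oplus>x\<in>Ds. trivial_act (g (x # ys)) x) = trivial_act (g (idd # ys)) idd"
  by (rule R.finsum_single[OF finite_diagrams idd_closed]) (use g in \<open>auto simp: trivial_act_def\<close>)
 then show ?thesis by (simp add: bar_def trivial_act_def)
qed

lemma merge_unit_part:
 assumes k: "!!xs. k xs \<in> carrier R" and y: "y \<in> Ds"
 shows "mrg (unit_part k) (y # ys) = k (y # ys) \<ominus> (if y = idd then mrg k ys else \<zero>)"
proof -
 have "(\<Oplus>u\<in>Ds. \<Oplus>v\<in>Ds. \<mu> u v y \<otimes> unit_part k (u # v # ys)) = (\<Oplus>v\<in>Ds. \<mu> idd v y \<otimes> k (v # ys))"
  using k by (subst R.finsum_single[OF finite_diagrams idd_closed])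
   (auto simp: unit_part_def mu_in_R intro!: R.finsum_zero' R.finsum_closed)
 also have "... = \<mu> idd y y \<otimes> k (y # ys)"
  by (rule R.finsum_single[OF finite_diagrams y]) (auto simp: mu_unit basis_elt_def k y)
 also have "... = k (y # ys)" using k y by (simp add: mu_unit basis_elt_def)
 finally have s: "(\<Oplus>u\<in>Ds. \<Oplus>v\<in>Ds. \<mu> u v y \<otimes> unit_part k (u # v # ys)) = k (y # ys)" .
 have "(%ws. unit_part k (y # ws)) = (if y = idd then k else (%_. \<zero>))" by (auto simp: unit_part_def)
 then have "mrg (%ws. unit_part k (y # ws)) ys = (if y = idd then mrg k ys else \<zero>)"
  using merge_zero[OF V1] by (simp add: fun_eq_iff)
 with s show ?thesis by simp
qed

text \<open>The chains whose first entry lies in the ideal form a quotient of the bar complex, with differential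
  \<open>- merge\<close>: in degree \<open>q + 1\<close>, the action of the identity cancels against the term that merges it with the
  next entry. The chains that start with the identity are contractible.\<close>

lemma beta_reduced:
 assumes g: "g \<in> bars (Suc q)" and y: "y \<in> I"
 shows "\<beta> g (y # ys) = \<ominus> mrg (reduced g) (y # ys)"
proof -
 let ?k = "%ws. g (idd # ws)"
 have gc: "g xs \<in> carrier R" for xs using g by (simp add: chains_def)
 have c: "reduced g xs \<in> carrier R" "unit_part ?k xs \<in> carrier R" for xs using gc by (simp_all add: reduced_def unit_part_def)
 have mc: "mrg (reduced g) xs \<in> carrier R" for xs using merge_closed[OF V1, of "reduced g"] c by simp
 have yD: "y \<in> Ds" "y ~= idd" using y by (auto simp: I_def)
 have "g = (%xs. reduced g xs \<oplus> unit_part ?k xs)" by (rule ext) (rule bars_split[OF g])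
 then have "mrg g (y # ys) = mrg (%xs. reduced g xs \<oplus> unit_part ?k xs) (y # ys)" by (rule arg_cong[where f = "%g. mrg g (y # ys)"])
 also have "... = mrg (reduced g) (y # ys) \<oplus> g (idd # y # ys)"
  using merge_add[OF V1, of "reduced g" "unit_part ?k" "y # ys"] merge_unit_part[of ?k y ys] c gc yD
  by (simp add: R.minus_zero_right del: merge.simps)
 finally show ?thesis
  using gc mc by (simp add: beta_eq a_minus_def R.minus_add R.a_ac R.r_neg R.r_neg1 R.r_neg2 del: merge.simps)
qed

lemma merge_ideals:
 assumes "h \<in> ideals q" "zs = [] \<or> hd zs \<notin> I"
 shows "mrg h zs = \<zero>"
proof (cases q)
 case 0
 then show ?thesis using merge_chains_bottom[OF V1, of h I I] assms(1) by simp
next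
 case (Suc p)
 have "zs \<notin> tensor_lists I I p" using assms(2) by (auto simp: tensor_lists_def)
 then show ?thesis using merge_chains_vanish[OF V1 I_left_stable _ _ , of I h p zs] assms(1) Suc cup_algebra.I_right[OF cup_algebra_axioms] by simp
qed

lemma reduced_beta:
 assumes g: "g \<in> bars (Suc q)"
 shows "reduced (\<beta> g) = (%xs. \<ominus> mrg (reduced g) xs)"
proof
 fix xs
 show "reduced (\<beta> g) xs = \<ominus> mrg (reduced g) xs"
 proof (cases "xs ~= [] & hd xs \<in> I")
  case True
  then show ?thesis using beta_reduced[OF g, of "hd xs" "tl xs"] by (simp add: reduced_def del: merge.simps)
 next
  case False
  then show ?thesis using merge_ideals[OF reduced_ideals[OF g], of xs] by (auto simp: reduced_def)
 qed
qed

lemma unit_part_boundary: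
 assumes k: "!!xs. k xs \<in> carrier R" and u: "unit_part k \<in> bars (Suc q)"
  and cyc: "!!ys. \<beta> (unit_part k) ys = \<zero>"
 shows "unit_part k = \<beta> (unit_part (unit_part k))"
proof
 fix ys
 let ?u = "unit_part k"
 have uc: "?u xs \<in> carrier R" "unit_part ?u xs \<in> carrier R" for xs using k by (simp_all add: unit_part_def)
 have mc: "mrg ?u xs \<in> carrier R" for xs using merge_closed[OF V1, of ?u] uc by simp
 have ku: "k zs = mrg ?u zs" for zs
  using cyc[of zs] beta_eq[of ?u zs, OF uc(1)] R.minus_eq_zero_iff[OF k mc] by (simp add: unit_part_def)
 show "?u ys = \<beta> (unit_part ?u) ys"
 proof (cases ys)
  case Nil
  then show ?thesis by (simp add: beta_eq[of "unit_part ?u" "[]", OF uc(2)]) (simp add: unit_part_def R.minus_zero_right)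
 next
  case (Cons y zs)
  show ?thesis
  proof (cases "y \<in> Ds")
   case True
   have "unit_part ?u (idd # ys) = ?u ys" by (simp add: unit_part_def[of ?u])
   then have "\<beta> (unit_part ?u) ys = ?u ys \<ominus> mrg (unit_part ?u) ys"
    using beta_eq[of "unit_part ?u" ys, OF uc(2)] by simp
   also have "mrg (unit_part ?u) ys = ?u ys \<ominus> (if y = idd then mrg ?u zs else \<zero>)"
    unfolding Cons by (rule merge_unit_part[OF uc(1) True])
   also have "?u ys \<ominus> (?u ys \<ominus> (if y = idd then mrg ?u zs else \<zero>)) = (if y = idd then mrg ?u zs else \<zero>)"
    using uc(1)[of ys] mc[of zs] by (simp add: a_minus_def R.minus_add R.r_neg R.r_neg1 R.r_neg2 R.a_ac)
   also have "... = ?u ys" using ku[of zs] by (simp add: Cons unit_part_def)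
   finally show ?thesis by simp
  next
   case False
   then have "ys \<notin> bar_lists I (Suc q)" by (simp add: Cons bar_lists_def)
   moreover have "\<beta> (unit_part ?u) \<in> bars (Suc q)"
    by (rule bar_chains[OF rep_trivial I_left_stable unit_part_bars[OF u]])
   ultimately show ?thesis using u by (simp add: chains_def)
  qed
 qed
qed

theorem trivial_bar_homology:
 "subquot_iso R (funs V1) {g \<in> bars (Suc q). \<beta> g = \<zero>\<^bsub>funs V1\<^esub>} (\<beta> ` bars (Suc (Suc q)))
  (funs V1) {h \<in> ideals q. mrg h = \<zero>\<^bsub>funs V1\<^esub>} (mrg ` ideals (Suc q))"
proof (rule subquot_iso_map[where f = reduced])
 interpret FV: module R "funs V1 :: ('r, diagram list => 'r) module" by (rule funs_is_module[OF V1])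
 note ag = FV.M.abelian_group_axioms FV.M.abelian_group_axioms
 note bh = bar_hom[OF rep_trivial]
 let ?Z = "{g \<in> bars (Suc q). \<beta> g = \<zero>\<^bsub>funs V1\<^esub>}"
 note E = FV.submoduleE[OF chains_submodule[OF V1]]
 have fc: "g \<in> carrier (funs V1)" if "g \<in> bars p \<or> g \<in> ideals p" for g :: "diagram list => 'r" and p
  using that by (auto simp: chains_def)
 have neg: "mrg h = \<zero>\<^bsub>funs V1\<^esub> \<longleftrightarrow> (%xs. \<ominus> mrg h xs) = (%_. \<zero>)" if "h \<in> ideals p" for h p
 proof -
  have "mrg h xs \<in> carrier R" for xs using merge_closed[OF V1, of h xs] that by (simp add: chains_def)
  then show ?thesis by (auto simp: fun_eq_iff R.a_inv_eq_zero_iff)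
 qed
 have beta_ideals: "\<beta> h = (%xs. \<ominus> mrg h xs)" if h: "h \<in> ideals p" for h p
 proof
  fix xs
  have "h (idd # xs) = \<zero>" using h by (auto simp: chains_def tensor_lists_def I_def)
  moreover have "h ys \<in> carrier R" "mrg h xs \<in> carrier R" for ys using merge_closed[OF V1, of h xs] h by (simp_all add: chains_def)
  ultimately show "\<beta> h xs = \<ominus> mrg h xs" by (simp add: beta_eq a_minus_def)
 qed
 show "reduced ` ?Z = {h \<in> ideals q. mrg h = \<zero>\<^bsub>funs V1\<^esub>}"
 proof
  show "reduced ` ?Z \<subseteq> {h \<in> ideals q. mrg h = \<zero>\<^bsub>funs V1\<^esub>}"
  proof (rule image_subsetI)
   fix g assume "g \<in> ?Z"
   then have g: "g \<in> bars (Suc q)" "\<beta> g = (%_. \<zero>)" by simp_all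
   have "(%xs. \<ominus> mrg (reduced g) xs) = (%_. \<zero>)"
    unfolding reduced_beta[OF g(1), symmetric] g(2) by (simp add: reduced_def fun_eq_iff)
   then show "reduced g \<in> {h \<in> ideals q. mrg h = \<zero>\<^bsub>funs V1\<^esub>}"
    using reduced_ideals[OF g(1)] neg[OF reduced_ideals[OF g(1)]] by simp
  qed
  show "{h \<in> ideals q. mrg h = \<zero>\<^bsub>funs V1\<^esub>} \<subseteq> reduced ` ?Z"
  proof
   fix h assume "h \<in> {h \<in> ideals q. mrg h = \<zero>\<^bsub>funs V1\<^esub>}"
   then have h: "h \<in> ideals q" "mrg h = \<zero>\<^bsub>funs V1\<^esub>" by simp_all
   then have "h \<in> ?Z" using ideals_bars(1)[OF h(1)] beta_ideals[OF h(1)] by simp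
   then show "h \<in> reduced ` ?Z" by (intro image_eqI[of h reduced h]) (simp_all only: ideals_bars(2)[OF h(1)])
  qed
 qed
 show "x \<oplus>\<^bsub>funs V1\<^esub> y \<in> ?Z & reduced (x \<oplus>\<^bsub>funs V1\<^esub> y) = reduced x \<oplus>\<^bsub>funs V1\<^esub> reduced y"
  if "x \<in> ?Z" "y \<in> ?Z" for x y
  using that E(5)[of x "bar_lists I (Suc q)" y] module_hom_add[OF bh fc fc, of x "Suc q" y "Suc q"] FV.M.l_zero[OF FV.M.zero_closed]
  by (simp add: reduced_def fun_eq_iff)
 show "r \<odot>\<^bsub>funs V1\<^esub> x \<in> ?Z & reduced (r \<odot>\<^bsub>funs V1\<^esub> x) = r \<odot>\<^bsub>funs V1\<^esub> reduced x"
  if "r \<in> carrier R" "x \<in> ?Z" for r x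
  using that E(4)[of r x "bar_lists I (Suc q)"] module_hom_smult[OF bh _ fc, of r x "Suc q"] FV.smult_r_null[of r]
  by (simp add: reduced_def fun_eq_iff)
 fix g assume "g \<in> ?Z"
 then have g: "g \<in> bars (Suc q)" "\<beta> g = \<zero>\<^bsub>funs V1\<^esub>" by simp_all
 show "g \<in> \<beta> ` bars (Suc (Suc q)) \<longleftrightarrow> reduced g \<in> mrg ` ideals (Suc q)"
 proof
  assume "g \<in> \<beta> ` bars (Suc (Suc q))"
  then obtain w where w: "w \<in> bars (Suc (Suc q))" "g = \<beta> w" by blast
  note rw = reduced_ideals[OF w(1)]
  let ?w = "\<ominus>\<^bsub>funs V1\<^esub> reduced w"
  have "mrg ?w = \<ominus>\<^bsub>funs V1\<^esub> mrg (reduced w)" by (rule module_hom_inv[OF ag merge_hom[OF V1] fc]) (use rw in blast)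
  also have "... = reduced g"
   unfolding w(2) reduced_beta[OF w(1)] using merge_closed[OF V1, of "reduced w"] rw
   by (intro ext) (simp add: funs_inv[OF V1] chains_def)
  finally show "reduced g \<in> mrg ` ideals (Suc q)" by (intro image_eqI[OF _ E(3)[OF rw]]) (rule sym)
 next
  assume "reduced g \<in> mrg ` ideals (Suc q)"
  then obtain h where h: "h \<in> ideals (Suc q)" "reduced g = mrg h" by blast
  let ?k = "%ws. g (idd # ws)"
  note hb = ideals_bars(1)[OF h(1)]
  have gc: "g xs \<in> carrier R" for xs using g by (simp add: chains_def)
  have hc: "h xs \<in> carrier R" "mrg h xs \<in> carrier R" for xs using h(1) merge_closed[OF V1, of h] by (simp_all add: chains_def)
  have uc: "unit_part ?k \<in> carrier (funs V1)" using gc by (simp add: unit_part_def)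
  have bc: "\<beta> h \<in> carrier (funs V1)" by (rule module_hom_closed[OF bh fc]) (use hb in blast)
  have split: "unit_part ?k = g \<oplus>\<^bsub>funs V1\<^esub> \<beta> h"
  proof
   fix xs
   have "unit_part ?k xs \<in> carrier R" using uc by simp
   then show "unit_part ?k xs = (g \<oplus>\<^bsub>funs V1\<^esub> \<beta> h) xs"
    using bars_split[OF g(1), of xs] hc(2)[of xs] unfolding h(2) beta_ideals[OF h(1)]
    by (simp add: R.a_ac R.r_neg R.r_neg1)
  qed
  have ub: "unit_part ?k \<in> bars (Suc q)"
   unfolding split by (rule E(5)[OF g(1) bar_chains[OF rep_trivial I_left_stable hb]])
  have "\<beta> (unit_part ?k) = \<beta> g \<oplus>\<^bsub>funs V1\<^esub> \<beta> (\<beta> h)"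
   unfolding split by (rule module_hom_add[OF bh fc bc]) (use g in blast)
  then have cyc: "\<beta> (unit_part ?k) ys = \<zero>" for ys
   using g(2) bar_bar[OF rep_trivial, of h ys] hc by simp
  let ?w = "unit_part (unit_part ?k)"
  have w: "?w \<in> bars (Suc (Suc q))" by (rule unit_part_bars[OF ub])
  have "\<beta> (?w \<ominus>\<^bsub>funs V1\<^esub> h) = \<beta> ?w \<ominus>\<^bsub>funs V1\<^esub> \<beta> h"
   by (rule module_hom_diff[OF ag bh fc fc]) (use w hb in blast)+
  also have "\<beta> ?w = g \<oplus>\<^bsub>funs V1\<^esub> \<beta> h"
   using unit_part_boundary[OF gc ub cyc] split by simp
  also have "(g \<oplus>\<^bsub>funs V1\<^esub> \<beta> h) \<ominus>\<^bsub>funs V1\<^esub> \<beta> h = g"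
   using fc[of g "Suc q"] g(1) bc FV.M.r_neg[OF bc] by (simp add: a_minus_def FV.M.a_assoc del: funs_simps)
  finally have "g = \<beta> (?w \<ominus>\<^bsub>funs V1\<^esub> h)" by (rule sym)
  moreover have "?w \<ominus>\<^bsub>funs V1\<^esub> h \<in> bars (Suc (Suc q))"
   unfolding a_minus_def by (rule E(5)[OF w E(3)[OF hb]])
  ultimately show "g \<in> \<beta> ` bars (Suc (Suc q))" by blast
 qed
qed

end

section \<open>Restriction of scalars\<close>

context temperley_lieb
begin

interpretation FM: module R F by (rule F_module)

abbreviation op :: "('r, diagram => 'r) module" where "op \<equiv> opposite A"

lemma op_simps [simp]:
 "carrier op = carrier F" "\<zero>\<^bsub>op\<^esub> = (%_. \<zero>)" "f \<oplus>\<^bsub>op\<^esub> g = (%x. f x \<oplus> g x)"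
 "\<one>\<^bsub>op\<^esub> = B idd" "f \<otimes>\<^bsub>op\<^esub> g = g \<otimes>\<^bsub>A\<^esub> f"
 using A_simps by (simp_all add: opposite_def del: A_simps)

definition scalar :: "'r => diagram => 'r" where "scalar r = (%x. r \<otimes> B idd x)"

lemma scalar_closed: "r \<in> carrier R ==> scalar r \<in> carrier F"
 using F_smult_closed[OF _ F_one] by (simp add: scalar_def)

lemma scalar_add: "r \<in> carrier R ==> s \<in> carrier R ==> scalar (r \<oplus> s) = scalar r \<oplus>\<^bsub>op\<^esub> scalar s"
 using F_coeff[OF F_one] by (simp add: scalar_def R.l_distr)

lemma scalar_one: "scalar \<one> = B idd"
 using F_coeff[OF F_one] by (simp add: scalar_def)

lemma scalar_zero: "scalar \<zero> = (%_. \<zero>)"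
 using F_coeff[OF F_one] by (simp add: scalar_def)

lemma scalar_idd: "r \<in> carrier R ==> scalar r idd = r"
 by (simp add: scalar_def basis_elt_def)

lemma mult_scalar:
 assumes f: "f \<in> carrier F" and r: "r \<in> carrier R"
 shows "f \<otimes>\<^bsub>A\<^esub> scalar r = (%x. r \<otimes> f x)" "scalar r \<otimes>\<^bsub>A\<^esub> f = (%x. r \<otimes> f x)"
proof -
 note fc = F_coeff[OF f]
 have "(f \<otimes>\<^bsub>A\<^esub> scalar r) z = r \<otimes> f z & (scalar r \<otimes>\<^bsub>A\<^esub> f) z = r \<otimes> f z" for z
 proof
  have "(f \<otimes>\<^bsub>A\<^esub> scalar r) z = (\<Oplus>x\<in>Ds. r \<otimes> (f x \<otimes> \<mu> x idd z))"
   unfolding A_mult[OF f scalar_closed[OF r]]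
  proof (rule R.finsum_cong'[OF refl Pi_I])
   fix x
   show "(\<Oplus>y\<in>Ds. f x \<otimes> scalar r y \<otimes> \<mu> x y z) = r \<otimes> (f x \<otimes> \<mu> x idd z)"
    by (subst R.finsum_single[OF finite_diagrams idd_closed])
     (auto simp: scalar_def basis_elt_def fc r mu_in_R R.m_ac)
  qed (simp add: fc r mu_in_R)
  also have "... = r \<otimes> (\<Oplus>x\<in>Ds. f x \<otimes> \<mu> x idd z)"
   by (rule R.finsum_rdistr[symmetric]) (auto simp: fc r mu_in_R finite_diagrams)
  also have "(\<Oplus>x\<in>Ds. f x \<otimes> \<mu> x idd z) = (f \<otimes>\<^bsub>A\<^esub> \<one>\<^bsub>A\<^esub>) z"
   by (simp add: A_mult_B_right[OF f idd_closed])
  also have "f \<otimes>\<^bsub>A\<^esub> \<one>\<^bsub>A\<^esub> = f" by (rule A.r_one) (simp add: f)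
  finally show "(f \<otimes>\<^bsub>A\<^esub> scalar r) z = r \<otimes> f z" .
  have "(scalar r \<otimes>\<^bsub>A\<^esub> f) z = (\<Oplus>y\<in>Ds. r \<otimes> (f y \<otimes> \<mu> idd y z))"
   unfolding A_mult[OF scalar_closed[OF r] f]
   by (subst R.finsum_single[OF finite_diagrams idd_closed])
    (auto simp: scalar_def basis_elt_def fc r mu_in_R R.m_assoc intro!: R.finsum_closed R.finsum_zero')
  also have "... = r \<otimes> (\<Oplus>y\<in>Ds. f y \<otimes> \<mu> idd y z)"
   by (rule R.finsum_rdistr[symmetric]) (auto simp: fc r mu_in_R finite_diagrams)
  also have "(\<Oplus>y\<in>Ds. f y \<otimes> \<mu> idd y z) = (\<one>\<^bsub>A\<^esub> \<otimes>\<^bsub>A\<^esub> f) z"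
   by (simp add: A_mult_B_left[OF f idd_closed])
  also have "\<one>\<^bsub>A\<^esub> \<otimes>\<^bsub>A\<^esub> f = f" by (rule A.l_one) (simp add: f)
  finally show "(scalar r \<otimes>\<^bsub>A\<^esub> f) z = r \<otimes> f z" .
 qed
 then show "f \<otimes>\<^bsub>A\<^esub> scalar r = (%x. r \<otimes> f x)" "scalar r \<otimes>\<^bsub>A\<^esub> f = (%x. r \<otimes> f x)" by blast+
qed

definition over_R :: "(diagram => 'r, 'm) module => ('r, 'm) module" where
 "over_R M = \<lparr>carrier = carrier M, mult = undefined, one = undefined, zero = \<zero>\<^bsub>M\<^esub>,
   add = add M, smult = (%r. smult M (scalar r))\<rparr>"

definition basis_act :: "(diagram => 'r, 'm) module => 'm => diagram => 'm" where
 "basis_act M p x = B x \<odot>\<^bsub>M\<^esub> p"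

lemma restricted_simps [simp]:
 "carrier (over_R M) = carrier M" "\<zero>\<^bsub>over_R M\<^esub> = \<zero>\<^bsub>M\<^esub>"
 "p \<oplus>\<^bsub>over_R M\<^esub> q = p \<oplus>\<^bsub>M\<^esub> q" "r \<odot>\<^bsub>over_R M\<^esub> p = scalar r \<odot>\<^bsub>M\<^esub> p"
 by (simp_all add: over_R_def)

context
 fixes M :: "(diagram => 'r, 'm) module"
 assumes M: "left_module op M"
begin

interpretation M: left_module op M by (rule M)

lemma restricted_module: "module R (over_R M)"
proof (intro moduleI abelian_groupI)
 show "cring R" by (rule R.is_cring)
 fix p assume p: "p \<in> carrier (over_R M)"
 show "\<exists>q\<in>carrier (over_R M). q \<oplus>\<^bsub>over_R M\<^esub> p = \<zero>\<^bsub>over_R M\<^esub>"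
  using p M.M.l_neg by (intro bexI[of _ "\<ominus>\<^bsub>M\<^esub> p"]) simp_all
 show "(r \<otimes> s) \<odot>\<^bsub>over_R M\<^esub> p = r \<odot>\<^bsub>over_R M\<^esub> (s \<odot>\<^bsub>over_R M\<^esub> p)"
  if r: "r \<in> carrier R" and s: "s \<in> carrier R" for r s
 proof -
  have "scalar (r \<otimes> s) = scalar r \<otimes>\<^bsub>op\<^esub> scalar s"
   using mult_scalar(1)[OF scalar_closed[OF s] r] r s F_coeff[OF F_one] by (simp add: scalar_def R.m_assoc)
  then show ?thesis using M.smult_assoc[of "scalar r" "scalar s" p] p r s by (simp add: scalar_closed)
 qed
 show "(r \<oplus> s) \<odot>\<^bsub>over_R M\<^esub> p = r \<odot>\<^bsub>over_R M\<^esub> p \<oplus>\<^bsub>over_R M\<^esub> s \<odot>\<^bsub>over_R M\<^esub> p"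
  if "r \<in> carrier R" "s \<in> carrier R" for r s
  unfolding restricted_simps scalar_add[OF that] using M.smult_l_distr p that by (simp add: scalar_closed del: op_simps(3))
 show "\<one> \<odot>\<^bsub>over_R M\<^esub> p = p" using M.smult_one p by (simp add: scalar_one)
qed (auto simp: M.M.a_ac scalar_closed intro: M.smult_closed M.smult_r_distr)

lemma smult_hom: "p \<in> carrier M ==> (%f. f \<odot>\<^bsub>M\<^esub> p) \<in> module_hom R F (over_R M)"
proof (rule module_homI)
 fix f assume p: "p \<in> carrier M" and f: "f \<in> carrier F"
 show "f \<odot>\<^bsub>M\<^esub> p \<in> carrier (over_R M)" using M.smult_closed f p by simp
 show "(f \<oplus>\<^bsub>F\<^esub> g) \<odot>\<^bsub>M\<^esub> p = f \<odot>\<^bsub>M\<^esub> p \<oplus>\<^bsub>over_R M\<^esub> g \<odot>\<^bsub>M\<^esub> p" if "g \<in> carrier F" for g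
  using M.smult_l_distr[of f g p] f that p by simp
 show "(r \<odot>\<^bsub>F\<^esub> f) \<odot>\<^bsub>M\<^esub> p = r \<odot>\<^bsub>over_R M\<^esub> (f \<odot>\<^bsub>M\<^esub> p)" if "r \<in> carrier R" for r
  using M.smult_assoc[of "scalar r" f p] f that p by (simp add: scalar_closed mult_scalar)
qed

interpretation RM: module R "over_R M" by (rule restricted_module)

lemma smult_expand:
 assumes f: "f \<in> carrier F" and p: "p \<in> carrier M"
 shows "f \<odot>\<^bsub>M\<^esub> p = (\<Oplus>\<^bsub>over_R M\<^esub>x\<in>Ds. f x \<odot>\<^bsub>over_R M\<^esub> basis_act M p x)"
proof -
 note h = smult_hom[OF p] and ag = FM.M.abelian_group_axioms RM.M.abelian_group_axioms
 have "f \<odot>\<^bsub>M\<^esub> p = (\<Oplus>\<^bsub>F\<^esub>x\<in>Ds. f x \<odot>\<^bsub>F\<^esub> B x) \<odot>\<^bsub>M\<^esub> p" by (simp only: F_sum_basis[OF f])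
 also have "... = (\<Oplus>\<^bsub>over_R M\<^esub>x\<in>Ds. (f x \<odot>\<^bsub>F\<^esub> B x) \<odot>\<^bsub>M\<^esub> p)"
  by (rule module_hom_finsum[OF ag h finite_diagrams]) (rule F_smult_closed[OF F_coeff[OF f] B_closed])
 also have "... = (\<Oplus>\<^bsub>over_R M\<^esub>x\<in>Ds. f x \<odot>\<^bsub>over_R M\<^esub> basis_act M p x)"
 proof (rule RM.M.finsum_cong'[OF refl Pi_I])
  fix x assume x: "x \<in> Ds"
  show "(f x \<odot>\<^bsub>F\<^esub> B x) \<odot>\<^bsub>M\<^esub> p = f x \<odot>\<^bsub>over_R M\<^esub> basis_act M p x"
   using module_hom_smult[OF h F_coeff[OF f] B_closed[OF x]] by (simp only: basis_act_def)
  show "f x \<odot>\<^bsub>over_R M\<^esub> basis_act M p x \<in> carrier (over_R M)"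
   by (intro RM.smult_closed F_coeff[OF f])
    (use M.smult_closed[of "B x" p] B_closed[OF x] p in \<open>simp add: basis_act_def\<close>)
 qed
 finally show ?thesis .
qed

lemma basis_act_closed: "p \<in> carrier M ==> x \<in> Ds ==> basis_act M p x \<in> carrier M"
 using M.smult_closed[of "B x" p] B_closed by (simp add: basis_act_def)

lemma rep_restricted: "right_rep (over_R M) (basis_act M)"
 unfolding right_rep_def
proof (intro conjI ballI)
 show "module R (over_R M)" by (rule restricted_module)
 show "(%p. basis_act M p x) \<in> module_hom R (over_R M) (over_R M)" if x: "x \<in> Ds" for x
 proof (rule module_homI)
  fix p assume p: "p \<in> carrier (over_R M)"
  show "basis_act M p x \<in> carrier (over_R M)" using basis_act_closed p x by simp
  show "basis_act M (p \<oplus>\<^bsub>over_R M\<^esub> q) x = basis_act M p x \<oplus>\<^bsub>over_R M\<^esub> basis_act M q x"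
   if "q \<in> carrier (over_R M)" for q
   using M.smult_r_distr[of "B x" p q] B_closed[OF x] p that by (simp add: basis_act_def)
  show "basis_act M (r \<odot>\<^bsub>over_R M\<^esub> p) x = r \<odot>\<^bsub>over_R M\<^esub> basis_act M p x" if r: "r \<in> carrier R" for r
   using M.smult_assoc[of "B x" "scalar r" p] M.smult_assoc[of "scalar r" "B x" p] B_closed[OF x] p r
   by (simp add: basis_act_def scalar_closed mult_scalar)
 qed
 fix p x y assume p: "p \<in> carrier (over_R M)" and x: "x \<in> Ds" and y: "y \<in> Ds"
 have "basis_act M (basis_act M p x) y = (B x \<otimes>\<^bsub>A\<^esub> B y) \<odot>\<^bsub>M\<^esub> p"
  using M.smult_assoc[of "B y" "B x" p] B_closed x y p by (simp add: basis_act_def)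
 also have "B x \<otimes>\<^bsub>A\<^esub> B y = (%z. \<mu> x y z)" by (rule B_mult_B[OF x y])
 finally show "basis_act M (basis_act M p x) y =
   (\<Oplus>\<^bsub>over_R M\<^esub>z\<in>Ds. \<mu> x y z \<odot>\<^bsub>over_R M\<^esub> basis_act M p z)"
  using smult_expand[OF mu_in_A[OF x y], of p] p by simp
qed

end

lemma op_hom_equivariant:
 assumes M: "left_module op M" and M': "left_module op M'" and h: "h \<in> module_hom op M M'"
 shows "equivariant (over_R M) (basis_act M) (over_R M') (basis_act M') h"
 using module_hom_closed[OF h] module_hom_add[OF h] module_hom_smult[OF h] scalar_closed B_closed
 by (auto simp: equivariant_def module_hom_def basis_act_def)

text \<open>A free module is a sum of copies of the regular one, and its coordinates split the action.\<close>

definition coordinate :: "diagram => ('s => diagram => 'r) => 's => diagram => 'r" where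
 "coordinate x g = (%t. scalar (g t x))"

context
 fixes S :: "'s set"
begin

abbreviation G :: "(diagram => 'r, 's => diagram => 'r) module" where "G \<equiv> free_module op S"

lemma G_left: "left_module op G" by (rule free_module_left_module[OF opposite_ring])

interpretation RG: module R "over_R G" by (rule restricted_module[OF G_left])

lemma G_carrier: "g \<in> carrier G \<longleftrightarrow> (\<forall>t. g t \<in> carrier F) & finite {t. g t ~= (%_. \<zero>)} & (\<forall>t. t \<notin> S --> g t = (%_. \<zero>))"
 by (simp add: free_module_carrier)

lemma G_coeff: "g \<in> carrier G ==> g t x \<in> carrier R"
 by (rule F_coeff) (simp add: G_carrier)

lemma G_smult: "r \<in> carrier R ==> g \<in> carrier G ==> (r \<odot>\<^bsub>over_R G\<^esub> g) t x = r \<otimes> g t x"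
 using mult_scalar(1)[of "g t" r] by (simp add: G_carrier)

lemma G_eval: "(%g. g t x) \<in> module_hom R (over_R G) V1"
proof (rule module_homI)
 fix r g assume "r \<in> carrier R" "g \<in> carrier (over_R G)"
 then show "(r \<odot>\<^bsub>over_R G\<^esub> g) t x = r \<odot>\<^bsub>V1\<^esub> g t x" using G_smult[of r g] by simp
qed (simp_all add: G_coeff)

lemma G_finsum:
 "finite X ==> (!!i. i \<in> X ==> f i \<in> carrier G) ==> finsum (over_R G) f X t x = (\<Oplus>i\<in>X. f i t x)"
 using module_hom_finsum[OF RG.M.abelian_group_axioms module_ab[OF V1] G_eval, of X f t x] by simp

lemma coordinate_closed: "g \<in> carrier G ==> coordinate x g \<in> carrier G"
proof -
 assume g: "g \<in> carrier G"
 have "{t. coordinate x g t ~= (%_. \<zero>)} \<subseteq> {t. g t ~= (%_. \<zero>)}" by (auto simp: coordinate_def scalar_zero)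
 then have "finite {t. coordinate x g t ~= (%_. \<zero>)}" using g finite_subset by (auto simp: G_carrier)
 then show ?thesis using g scalar_closed[OF G_coeff[OF g]] by (auto simp: G_carrier coordinate_def scalar_zero)
qed

lemma coordinate_hom: "coordinate x \<in> module_hom R (over_R G) (over_R G)"
proof (rule module_homI)
 fix g assume g: "g \<in> carrier (over_R G)"
 show "coordinate x g \<in> carrier (over_R G)" using coordinate_closed g by simp
 show "coordinate x (g \<oplus>\<^bsub>over_R G\<^esub> h) = coordinate x g \<oplus>\<^bsub>over_R G\<^esub> coordinate x h"
  if "h \<in> carrier (over_R G)" for h
  using scalar_add G_coeff g that by (simp add: coordinate_def)
 show "coordinate x (r \<odot>\<^bsub>over_R G\<^esub> g) = r \<odot>\<^bsub>over_R G\<^esub> coordinate x g" if r: "r \<in> carrier R" for r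
 proof (intro ext)
  fix t w
  show "coordinate x (r \<odot>\<^bsub>over_R G\<^esub> g) t w = (r \<odot>\<^bsub>over_R G\<^esub> coordinate x g) t w"
   using g r G_coeff[of g] F_coeff[OF F_one]
   by (simp add: G_smult coordinate_closed del: restricted_simps(4))
    (simp add: coordinate_def scalar_def G_smult R.m_assoc del: restricted_simps(4))
 qed
qed

lemma coordinate_sum: "g \<in> carrier G ==> (\<Oplus>\<^bsub>over_R G\<^esub>x\<in>Ds. basis_act G (coordinate x g) x) = g"
proof (intro ext)
 fix t w assume g: "g \<in> carrier G"
 have gt: "g t \<in> carrier F" using g by (simp add: G_carrier)
 have "(\<Oplus>\<^bsub>over_R G\<^esub>x\<in>Ds. basis_act G (coordinate x g) x) t w = (\<Oplus>x\<in>Ds. basis_act G (coordinate x g) x t w)"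
  by (rule G_finsum) (simp_all add: finite_diagrams basis_act_closed[OF G_left] coordinate_closed g)
 also have "... = (\<Oplus>x\<in>Ds. (g t x \<odot>\<^bsub>F\<^esub> B x) w)"
  by (rule R.finsum_cong'[OF refl Pi_I])
   (simp_all add: basis_act_def coordinate_def mult_scalar B_closed G_coeff[OF g] F_coeff[OF B_closed])
 also have "... = (\<Oplus>\<^bsub>F\<^esub>x\<in>Ds. g t x \<odot>\<^bsub>F\<^esub> B x) w"
  by (rule F_finsum[symmetric]) (intro F_smult_closed B_closed G_coeff[OF g], simp_all add: finite_diagrams)
 finally show "(\<Oplus>\<^bsub>over_R G\<^esub>x\<in>Ds. basis_act G (coordinate x g) x) t w = g t w"
  by (simp only: F_sum_basis[OF gt])
qed

lemma coordinate_act: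
 assumes g: "g \<in> carrier G" and y: "y \<in> Ds"
 shows "coordinate z (basis_act G g y) = (\<Oplus>\<^bsub>over_R G\<^esub>x\<in>Ds. \<mu> x y z \<odot>\<^bsub>over_R G\<^esub> coordinate x g)"
proof (intro ext)
 fix t w
 have gt: "g t \<in> carrier F" using g by (simp add: G_carrier)
 have "coordinate z (basis_act G g y) t w = (\<Oplus>x\<in>Ds. g t x \<otimes> \<mu> x y z) \<otimes> B idd w"
  by (simp add: coordinate_def basis_act_def scalar_def A_mult_B_right[OF gt y])
 also have "... = (\<Oplus>x\<in>Ds. g t x \<otimes> \<mu> x y z \<otimes> B idd w)"
  by (rule R.finsum_ldistr) (auto simp: finite_diagrams G_coeff[OF g] mu_in_R F_coeff[OF F_one])
 also have "... = (\<Oplus>x\<in>Ds. (\<mu> x y z \<odot>\<^bsub>over_R G\<^esub> coordinate x g) t w)"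
  by (rule R.finsum_cong'[OF refl Pi_I])
   (simp_all add: G_smult mu_in_R coordinate_closed g F_coeff[OF F_one] G_coeff[OF g] del: restricted_simps(4),
    simp_all add: coordinate_def scalar_def mu_in_R G_coeff[OF g] F_coeff[OF F_one] R.m_ac)
 also have "... = (\<Oplus>\<^bsub>over_R G\<^esub>x\<in>Ds. \<mu> x y z \<odot>\<^bsub>over_R G\<^esub> coordinate x g) t w"
 proof (rule G_finsum[symmetric])
  show "\<mu> x y z \<odot>\<^bsub>over_R G\<^esub> coordinate x g \<in> carrier G" for x
   using RG.smult_closed[of "\<mu> x y z" "coordinate x g"] coordinate_closed[OF g] mu_in_R by (simp del: restricted_simps(4))
 qed (simp add: finite_diagrams)
 finally show "coordinate z (basis_act G g y) t w =
  (\<Oplus>\<^bsub>over_R G\<^esub>x\<in>Ds. \<mu> x y z \<odot>\<^bsub>over_R G\<^esub> coordinate x g) t w" .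
qed

end

lemma projective_bar_exact:
 fixes M :: "(diagram => 'r, 'm) module"
 assumes P: "projective_module op M"
 shows "exact_at (funs (over_R M)) (%q. chains (over_R M) (bar_lists Y q))
  (bar (over_R M) (basis_act M)) (Suc q)"
proof -
 have M: "left_module op M" using P by (simp add: projective_module_def)
 obtain S :: "'m set" and s r where s: "s \<in> module_hom op M (free_module op S)"
  and r: "r \<in> module_hom op (free_module op S) M" and rs: "!!p. p \<in> carrier M ==> r (s p) = p"
  using P unfolding projective_module_def by blast
 let ?G = "free_module op S"
 note GL = G_left[of S]
 note se = op_hom_equivariant[OF M GL s] and re = op_hom_equivariant[OF GL M r]
 interpret RM: module R "over_R M" by (rule restricted_module[OF M])
 interpret RG: module R "over_R ?G" by (rule restricted_module[OF GL])
 note ag = RG.M.abelian_group_axioms RM.M.abelian_group_axioms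
 note sh = equivariant_hom[OF se] and rh = equivariant_hom[OF re]
 have sc: "p \<in> carrier M ==> s p \<in> carrier ?G" for p using module_hom_closed[OF s] .
 let ?\<sigma> = "%x p. if x \<in> Ds then r (coordinate x (s p)) else \<zero>\<^bsub>over_R M\<^esub>"
 show ?thesis
 proof (rule bar_exact[OF rep_restricted[OF M], where \<sigma> = ?\<sigma>])
  show "?\<sigma> x \<in> module_hom R (over_R M) (over_R M)" for x
  proof (cases "x \<in> Ds")
   case True
   note c = coordinate_hom[of x S]
   have "(%p. r (coordinate x (s p))) \<in> module_hom R (over_R M) (over_R M)"
   proof (rule module_homI)
    fix p assume p: "p \<in> carrier (over_R M)"
    note sp = module_hom_closed[OF sh p]
    show "r (coordinate x (s p)) \<in> carrier (over_R M)"
     by (intro module_hom_closed[OF rh] module_hom_closed[OF c] sp)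
    show "r (coordinate x (s (p \<oplus>\<^bsub>over_R M\<^esub> q))) = r (coordinate x (s p)) \<oplus>\<^bsub>over_R M\<^esub> r (coordinate x (s q))"
     if q: "q \<in> carrier (over_R M)" for q
     using module_hom_add[OF sh p q] module_hom_add[OF c sp module_hom_closed[OF sh q]]
      module_hom_add[OF rh module_hom_closed[OF c sp] module_hom_closed[OF c module_hom_closed[OF sh q]]] by (simp only:)
    show "r (coordinate x (s (k \<odot>\<^bsub>over_R M\<^esub> p))) = k \<odot>\<^bsub>over_R M\<^esub> r (coordinate x (s p))"
     if k: "k \<in> carrier R" for k
     using module_hom_smult[OF sh k p] module_hom_smult[OF c k sp]
      module_hom_smult[OF rh k module_hom_closed[OF c sp]] by (simp only:)
   qed
   then show ?thesis using True by simp
  next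
   case False
   have "(%p. \<zero>\<^bsub>over_R M\<^esub>) \<in> module_hom R (over_R M) (over_R M)"
    using RM.smult_r_null RM.M.zero_closed RM.M.l_zero by (intro module_homI) (simp_all del: restricted_simps(3,4))
   then show ?thesis using False by simp
  qed
  show "?\<sigma> x p = \<zero>\<^bsub>over_R M\<^esub>" if "x \<notin> Ds" for x p using that by simp
  show "(\<Oplus>\<^bsub>over_R M\<^esub>x\<in>Ds. basis_act M (?\<sigma> x p) x) = p" if "p \<in> carrier (over_R M)" for p
  proof -
   have p: "s p \<in> carrier ?G" "p \<in> carrier M" using that sc by simp_all
   have "(\<Oplus>\<^bsub>over_R M\<^esub>x\<in>Ds. basis_act M (?\<sigma> x p) x) =
    (\<Oplus>\<^bsub>over_R M\<^esub>x\<in>Ds. r (basis_act ?G (coordinate x (s p)) x))"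
   proof (rule RM.M.finsum_cong'[OF refl Pi_I])
    fix x assume x: "x \<in> Ds"
    show "basis_act M (?\<sigma> x p) x = r (basis_act ?G (coordinate x (s p)) x)"
     using equivariant_act[OF re _ x, of "coordinate x (s p)"] x coordinate_closed[OF p(1)] by simp
    show "r (basis_act ?G (coordinate x (s p)) x) \<in> carrier (over_R M)"
     using module_hom_closed[OF r basis_act_closed[OF GL coordinate_closed[OF p(1)] x]] by simp
   qed
   also have "... = r (\<Oplus>\<^bsub>over_R ?G\<^esub>x\<in>Ds. basis_act ?G (coordinate x (s p)) x)"
    by (rule module_hom_finsum[OF ag rh finite_diagrams, symmetric])
     (simp add: basis_act_closed[OF GL coordinate_closed[OF p(1)]])
   also have "... = p" by (simp only: coordinate_sum[OF p(1)] rs[OF p(2)])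
   finally show ?thesis .
  qed
  fix p y z assume "p \<in> carrier (over_R M)" and y: "y \<in> Ds" and z: "z \<in> Ds"
  then have p: "s p \<in> carrier ?G" "p \<in> carrier M" using sc by simp_all
  have c: "\<mu> x y z \<odot>\<^bsub>over_R ?G\<^esub> coordinate x (s p) \<in> carrier (over_R ?G)" for x
   by (intro RG.smult_closed mu_in_R) (simp add: coordinate_closed[OF p(1)])
  have "?\<sigma> z (basis_act M p y) = r (coordinate z (basis_act ?G (s p) y))"
   using z equivariant_act[OF se _ y, of p] p(2) by simp
  also have "... = r (\<Oplus>\<^bsub>over_R ?G\<^esub>x\<in>Ds. \<mu> x y z \<odot>\<^bsub>over_R ?G\<^esub> coordinate x (s p))"
   by (simp only: coordinate_act[OF p(1) y])
  also have "... = (\<Oplus>\<^bsub>over_R M\<^esub>x\<in>Ds. r (\<mu> x y z \<odot>\<^bsub>over_R ?G\<^esub> coordinate x (s p)))"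
   by (rule module_hom_finsum[OF ag rh finite_diagrams c])
  also have "... = (\<Oplus>\<^bsub>over_R M\<^esub>x\<in>Ds. \<mu> x y z \<odot>\<^bsub>over_R M\<^esub> ?\<sigma> x p)"
  proof (rule RM.M.finsum_cong'[OF refl Pi_I])
   fix x assume x: "x \<in> Ds"
   have "r (\<mu> x y z \<odot>\<^bsub>over_R ?G\<^esub> coordinate x (s p)) = \<mu> x y z \<odot>\<^bsub>over_R M\<^esub> r (coordinate x (s p))"
    by (rule module_hom_smult[OF rh mu_in_R]) (simp add: coordinate_closed[OF p(1)])
   then show *: "r (\<mu> x y z \<odot>\<^bsub>over_R ?G\<^esub> coordinate x (s p)) = \<mu> x y z \<odot>\<^bsub>over_R M\<^esub> ?\<sigma> x p"
    by (simp only: x if_True)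
   show "\<mu> x y z \<odot>\<^bsub>over_R M\<^esub> ?\<sigma> x p \<in> carrier (over_R M)"
    unfolding *[symmetric] by (rule module_hom_closed[OF rh c])
  qed
  finally show "?\<sigma> z (basis_act M p y) = (\<Oplus>\<^bsub>over_R M\<^esub>x\<in>Ds. \<mu> x y z \<odot>\<^bsub>over_R M\<^esub> ?\<sigma> x p)" .
 qed
qed

end

section \<open>Tensoring with the trivial module\<close>

lemma submodule_generated_superset: "X \<subseteq> submodule_generated R V X"
 by (auto simp: submodule_generated_def)

lemma submodule_generated_least: "submodule H R V ==> X \<subseteq> H ==> submodule_generated R V X \<subseteq> H"
 by (auto simp: submodule_generated_def)

lemma submodule_generated_submodule:
 assumes V: "module R V" and X: "X \<subseteq> carrier V"
 shows "submodule (submodule_generated R V X) R V"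
proof -
 interpret V: module R V by fact
 have top: "submodule (carrier V) R V" by (rule V.carrier_is_submodule)
 note E = V.submoduleE
 show ?thesis
 proof (rule V.submoduleI)
  show "submodule_generated R V X \<subseteq> carrier V" by (rule submodule_generated_least[OF top X])
  show "\<zero>\<^bsub>V\<^esub> \<in> submodule_generated R V X"
   unfolding submodule_generated_def
   by (auto simp: submodule_def dest: subgroup.one_closed)
  show "\<ominus>\<^bsub>V\<^esub> x \<in> submodule_generated R V X" if "x \<in> submodule_generated R V X" for x
   using that E(3) unfolding submodule_generated_def by blast
  show "x \<oplus>\<^bsub>V\<^esub> y \<in> submodule_generated R V X" if "x \<in> submodule_generated R V X" "y \<in> submodule_generated R V X" for x y
   using that E(5) unfolding submodule_generated_def by blast
  show "r \<odot>\<^bsub>V\<^esub> x \<in> submodule_generated R V X" if "r \<in> carrier R" "x \<in> submodule_generated R V X" for r x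
   using that E(4) unfolding submodule_generated_def by blast
 qed
qed

context temperley_lieb
begin

abbreviation triv :: "(diagram => 'r, 'r) module" where "triv \<equiv> trivial_module R N"

lemma triv_simps [simp]: "carrier triv = carrier R" "\<zero>\<^bsub>triv\<^esub> = \<zero>" "r \<oplus>\<^bsub>triv\<^esub> s = r \<oplus> s" "f \<odot>\<^bsub>triv\<^esub> r = f idd \<otimes> r"
 by (simp_all add: trivial_module_def)

definition coinv_ker :: "(diagram => 'r, 'm) module => 'm set" where
 "coinv_ker M = product_with (over_R M) (basis_act M) I"

definition pure :: "(diagram => 'r, 'm) module => 'm => ('m \<times> 'r => 'r) set" where
 "pure M p = tensor_relations R A M triv +>\<^bsub>free_module R (carrier M \<times> carrier R)\<^esub> basis_elt R (p, \<one>)"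

context
 fixes M :: "(diagram => 'r, 'm) module"
 assumes M: "left_module op M"
begin

interpretation M: left_module op M by (rule M)
interpretation RM: module R "over_R M" by (rule restricted_module[OF M])

abbreviation FR :: "('r, 'm \<times> 'r => 'r) module" where "FR \<equiv> free_module R (carrier M \<times> carrier R)"
abbreviation TR :: "('m \<times> 'r => 'r) set" where "TR \<equiv> tensor_relations R A M triv"
abbreviation T :: "('r, ('m \<times> 'r => 'r) set) module" where "T \<equiv> tensor_module R A M triv"
abbreviation tn :: "'m => 'r => 'm \<times> 'r => 'r" where "tn p x \<equiv> basis_elt R (p, x)"

interpretation FR: module R FR by (rule free_module_is_module) (rule R.is_cring)

lemma tn_closed: "p \<in> carrier M ==> x \<in> carrier R ==> tn p x \<in> carrier FR"
 by (rule basis_elt_closed[OF R.ring_axioms]) simp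

definition relations :: "('m \<times> 'r => 'r) set" where
 "relations = {tn (p \<oplus>\<^bsub>M\<^esub> p') x \<ominus>\<^bsub>FR\<^esub> (tn p x \<oplus>\<^bsub>FR\<^esub> tn p' x) | p p' x.
      p \<in> carrier M & p' \<in> carrier M & x \<in> carrier R} \<union>
    {tn p (x \<oplus> x') \<ominus>\<^bsub>FR\<^esub> (tn p x \<oplus>\<^bsub>FR\<^esub> tn p x') | p x x'.
      p \<in> carrier M & x \<in> carrier R & x' \<in> carrier R} \<union>
    {tn (f \<odot>\<^bsub>M\<^esub> p) x \<ominus>\<^bsub>FR\<^esub> tn p (f idd \<otimes> x) | f p x.
      f \<in> carrier F & p \<in> carrier M & x \<in> carrier R} \<union>
    {tn (scalar r \<odot>\<^bsub>M\<^esub> p) x \<ominus>\<^bsub>FR\<^esub> (r \<odot>\<^bsub>FR\<^esub> tn p x) | r p x.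
      r \<in> carrier R & p \<in> carrier M & x \<in> carrier R}"

lemma TR_eq: "TR = submodule_generated R FR relations"
proof -
 have "r \<odot>\<^bsub>A\<^esub> \<one>\<^bsub>A\<^esub> = scalar r" for r by (simp add: scalar_def)
 then show ?thesis
  unfolding tensor_relations_def relations_def Let_def triv_simps A_simps(1) by (simp only:)
qed

lemma relation_cases:
 assumes "u \<in> relations"
 obtains p p' x where "u = tn (p \<oplus>\<^bsub>M\<^esub> p') x \<ominus>\<^bsub>FR\<^esub> (tn p x \<oplus>\<^bsub>FR\<^esub> tn p' x)" "p \<in> carrier M" "p' \<in> carrier M" "x \<in> carrier R"
 | p x x' where "u = tn p (x \<oplus> x') \<ominus>\<^bsub>FR\<^esub> (tn p x \<oplus>\<^bsub>FR\<^esub> tn p x')" "p \<in> carrier M" "x \<in> carrier R" "x' \<in> carrier R"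
 | f p x where "u = tn (f \<odot>\<^bsub>M\<^esub> p) x \<ominus>\<^bsub>FR\<^esub> tn p (f idd \<otimes> x)" "f \<in> carrier F" "p \<in> carrier M" "x \<in> carrier R"
 | r p x where "u = tn (scalar r \<odot>\<^bsub>M\<^esub> p) x \<ominus>\<^bsub>FR\<^esub> (r \<odot>\<^bsub>FR\<^esub> tn p x)" "r \<in> carrier R" "p \<in> carrier M" "x \<in> carrier R"
 using assms unfolding relations_def Un_iff mem_Collect_eq
 by (elim disjE exE conjE) ((rule that(1); assumption) | (rule that(2); assumption) | (rule that(3); assumption) | (rule that(4); assumption))+

lemma smult_M: "f \<in> carrier F ==> p \<in> carrier M ==> f \<odot>\<^bsub>M\<^esub> p \<in> carrier M"
 using M.smult_closed by simp

lemma relations_closed: "relations \<subseteq> carrier FR"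
proof
 fix u assume "u \<in> relations"
 then show "u \<in> carrier FR"
  by (cases rule: relation_cases)
   (simp_all only: FR.M.minus_closed FR.M.add.m_closed FR.smult_closed tn_closed smult_M scalar_closed M.M.add.m_closed
    R.add.m_closed R.m_closed F_coeff)
qed

lemma TR_submodule: "submodule TR R FR"
 unfolding TR_eq by (rule submodule_generated_submodule[OF FR.module_axioms relations_closed])

lemma T_eq: "T = quotient_module FR TR"
 by (simp add: tensor_module_def)

lemma T_module: "module R T"
 unfolding T_eq by (rule quotient_module_is_module[OF FR.module_axioms TR_submodule])

interpretation T: module R T by (rule T_module)

abbreviation cls :: "('m \<times> 'r => 'r) => ('m \<times> 'r => 'r) set" where "cls u \<equiv> TR +>\<^bsub>FR\<^esub> u"

lemmas T_simps = quotient_module_simps[OF FR.module_axioms TR_submodule, folded T_eq]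

lemma cls_hom: "(%u. cls u) \<in> module_hom R FR T"
 by (rule module_homI) (simp_all only: T_simps image_eqI)

lemma cls_eq: "u \<ominus>\<^bsub>FR\<^esub> v \<in> relations ==> u \<in> carrier FR ==> v \<in> carrier FR ==> cls u = cls v"
 using submodule_generated_superset[of relations R FR] FR.submodule_coset_eq_iff[OF TR_submodule] unfolding TR_eq[symmetric] by blast

lemma pure_eq: "pure M p = cls (tn p \<one>)"
 by (simp add: pure_def)

lemma pure_hom: "pure M \<in> module_hom R (over_R M) T"
proof (rule module_homI)
 fix p assume "p \<in> carrier (over_R M)"
 then have p: "p \<in> carrier M" by simp
 note tp = tn_closed[OF p R.one_closed]
 show "pure M p \<in> carrier T" unfolding pure_eq by (rule module_hom_closed[OF cls_hom tp])
 show "pure M (p \<oplus>\<^bsub>over_R M\<^esub> q) = pure M p \<oplus>\<^bsub>T\<^esub> pure M q" if "q \<in> carrier (over_R M)" for q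
 proof -
  have q: "q \<in> carrier M" using that by simp
  note tq = tn_closed[OF q R.one_closed]
  have "cls (tn (p \<oplus>\<^bsub>M\<^esub> q) \<one>) = cls (tn p \<one> \<oplus>\<^bsub>FR\<^esub> tn q \<one>)"
   by (rule cls_eq[OF _ tn_closed[OF M.M.add.m_closed[OF p q] R.one_closed] FR.M.add.m_closed[OF tp tq]])
    (use p q R.one_closed in \<open>unfold relations_def, blast\<close>)
  then show ?thesis unfolding pure_eq restricted_simps using T_simps(3)[OF tp tq] by (simp only:)
 qed
 show "pure M (r \<odot>\<^bsub>over_R M\<^esub> p) = r \<odot>\<^bsub>T\<^esub> pure M p" if r: "r \<in> carrier R" for r
 proof -
  have "cls (tn (scalar r \<odot>\<^bsub>M\<^esub> p) \<one>) = cls (r \<odot>\<^bsub>FR\<^esub> tn p \<one>)"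
   by (rule cls_eq[OF _ tn_closed[OF smult_M[OF scalar_closed[OF r] p] R.one_closed] FR.smult_closed[OF r tp]])
    (use p r R.one_closed in \<open>unfold relations_def, blast\<close>)
  then show ?thesis unfolding pure_eq restricted_simps using T_simps(4)[OF r tp] by (simp only:)
 qed
qed

lemma pure_smult:
 assumes f: "f \<in> carrier F" and p: "p \<in> carrier M"
 shows "pure M (f \<odot>\<^bsub>M\<^esub> p) = cls (tn p (f idd))"
proof -
 have "cls (tn (f \<odot>\<^bsub>M\<^esub> p) \<one>) = cls (tn p (f idd \<otimes> \<one>))"
  by (rule cls_eq[OF _ tn_closed[OF smult_M[OF f p] R.one_closed] tn_closed[OF p R.m_closed[OF F_coeff[OF f] R.one_closed]]])
   (use f p R.one_closed in \<open>unfold relations_def, blast\<close>)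
 then show ?thesis by (simp add: pure_eq F_coeff[OF f])
qed

lemma cls_tn: "p \<in> carrier M ==> x \<in> carrier R ==> cls (tn p x) = pure M (scalar x \<odot>\<^bsub>M\<^esub> p)"
 using pure_smult[OF scalar_closed, of x p] by (simp only: scalar_idd)

definition representative :: "('m \<times> 'r => 'r) => 'm" where
 "representative = linear_extension R (over_R M) (%(p, x). scalar x \<odot>\<^bsub>M\<^esub> p)"

lemma rep_term: "px \<in> carrier M \<times> carrier R ==> (%(p, x). scalar x \<odot>\<^bsub>M\<^esub> p) px \<in> carrier (over_R M)"
 using smult_M scalar_closed by auto

lemma representative_hom: "representative \<in> module_hom R FR (over_R M)"
 unfolding representative_def by (rule linear_extension_hom[OF RM.module_axioms rep_term])

lemma representative_tn: "p \<in> carrier M ==> x \<in> carrier R ==> representative (tn p x) = scalar x \<odot>\<^bsub>M\<^esub> p"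
 unfolding representative_def
 by (subst linear_extension_basis[where S = "carrier M \<times> carrier R", OF RM.module_axioms]) (use rep_term in auto)

lemma cls_representative:
 assumes "u \<in> carrier FR"
 shows "cls u = pure M (representative u)"
proof (rule free_module_hom_eqI[OF R.is_cring T_module cls_hom _ _ assms])
 show "(%u. pure M (representative u)) \<in> module_hom R FR T"
  by (rule module_hom_comp[OF representative_hom pure_hom])
 show "cls (basis_elt R s) = pure M (representative (basis_elt R s))" if "s \<in> carrier M \<times> carrier R" for s
  using that cls_tn representative_tn by (cases s) simp
qed

lemma pure_onto: "pure M ` carrier M = carrier T"
proof
 show "pure M ` carrier M \<subseteq> carrier T" using module_hom_closed[OF pure_hom] by auto
 show "carrier T \<subseteq> pure M ` carrier M"
  unfolding T_simps(1) using cls_representative module_hom_closed[OF representative_hom] by auto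
qed

lemma kernel_submodule: "submodule (coinv_ker M) R (over_R M)"
 unfolding coinv_ker_def by (rule product_with_submodule[OF rep_restricted[OF M]])

lemmas kernel_E = RM.submoduleE[OF kernel_submodule]

lemma kernel_zero: "\<zero>\<^bsub>over_R M\<^esub> \<in> coinv_ker M"
 using kernel_submodule by (auto simp: submodule_def simp del: restricted_simps dest: subgroup.one_closed)

lemma kernel_carrier: "p \<in> coinv_ker M ==> p \<in> carrier M"
 using kernel_E(1) by auto

lemma smult_in_kernel:
 assumes f: "f \<in> carrier F" "f idd = \<zero>" and p: "p \<in> carrier M"
 shows "f \<odot>\<^bsub>M\<^esub> p \<in> coinv_ker M"
proof -
 define g where "g xs = (if xs \<in> bar_lists I (Suc 0) then f (hd xs) \<odot>\<^bsub>over_R M\<^esub> p else \<zero>\<^bsub>over_R M\<^esub>)" for xs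
 have pc: "p \<in> carrier (over_R M)" using p by simp
 have gc: "g xs \<in> carrier (over_R M)" for xs
  using RM.smult_closed[OF F_coeff[OF f(1)] pc] RM.M.zero_closed
  by (cases "xs \<in> bar_lists I (Suc 0)") (simp_all only: g_def if_True if_False)
 have g: "g \<in> chains (over_R M) (bar_lists I (Suc 0))" using gc by (simp add: chains_def g_def del: restricted_simps)
 note act = module_hom_smult[OF act_hom[OF rep_restricted[OF M]]] and act0 = module_hom_zero[OF RM.M.abelian_group_axioms RM.M.abelian_group_axioms act_hom[OF rep_restricted[OF M]]]
 have "bar (over_R M) (basis_act M) g [] = (\<Oplus>\<^bsub>over_R M\<^esub>x\<in>Ds. basis_act M (g [x]) x)"
  unfolding bar_def merge.simps
  by (intro RM.M.minus_zero_right RM.M.finsum_closed Pi_I act_closed[OF rep_restricted[OF M]] gc)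
 also have "... = (\<Oplus>\<^bsub>over_R M\<^esub>x\<in>Ds. f x \<odot>\<^bsub>over_R M\<^esub> basis_act M p x)"
 proof (rule RM.M.finsum_cong'[OF refl Pi_I])
  fix x assume x: "x \<in> Ds"
  have bc: "basis_act M p x \<in> carrier (over_R M)" using basis_act_closed[OF M p x] by simp
  show "f x \<odot>\<^bsub>over_R M\<^esub> basis_act M p x \<in> carrier (over_R M)"
   by (rule RM.smult_closed[OF F_coeff[OF f(1)] bc])
  show "basis_act M (g [x]) x = f x \<odot>\<^bsub>over_R M\<^esub> basis_act M p x"
  proof (cases "x \<in> I")
   case True
   then have "[x] \<in> bar_lists I (Suc 0)" using x by (simp add: bar_lists_def)
   then have "g [x] = f x \<odot>\<^bsub>over_R M\<^esub> p" by (simp only: g_def list.sel if_True)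
   then show ?thesis using act[OF x F_coeff[OF f(1)] pc] by (simp only:)
  next
   case False
   then have "[x] \<notin> bar_lists I (Suc 0)" "f x = \<zero>" using x f(2) by (auto simp: bar_lists_def I_def)
   then show ?thesis using act0[OF x] RM.smult_l_null[OF bc] by (simp only: g_def if_False)
  qed
 qed
 also have "... = f \<odot>\<^bsub>M\<^esub> p" by (rule smult_expand[OF M f(1) p, symmetric])
 finally have "f \<odot>\<^bsub>M\<^esub> p = bar (over_R M) (basis_act M) g []" by (rule sym)
 then show ?thesis unfolding coinv_ker_def product_with_def using g by blast
qed

lemma pure_kernel: "p \<in> coinv_ker M ==> pure M p = \<zero>\<^bsub>T\<^esub>"
proof -
 assume "p \<in> coinv_ker M"
 then obtain g where g: "g \<in> chains (over_R M) (bar_lists I (Suc 0))" and p: "p = bar (over_R M) (basis_act M) g []"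
  unfolding coinv_ker_def product_with_def by blast
 have gc: "g xs \<in> carrier (over_R M)" for xs using g by (simp add: chains_def)
 have ac: "basis_act M (g [x]) x \<in> carrier (over_R M)" if "x \<in> Ds" for x
  by (rule act_closed[OF rep_restricted[OF M] that gc])
 have pure0: "pure M \<zero>\<^bsub>over_R M\<^esub> = \<zero>\<^bsub>T\<^esub>"
  by (rule module_hom_zero[OF RM.M.abelian_group_axioms T.M.abelian_group_axioms pure_hom])
 have "p = (\<Oplus>\<^bsub>over_R M\<^esub>x\<in>Ds. basis_act M (g [x]) x)"
  unfolding p bar_def merge.simps by (intro RM.M.minus_zero_right RM.M.finsum_closed Pi_I ac)
 then have "pure M p = (\<Oplus>\<^bsub>T\<^esub>x\<in>Ds. pure M (basis_act M (g [x]) x))"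
  using module_hom_finsum[OF RM.M.abelian_group_axioms T.M.abelian_group_axioms pure_hom finite_diagrams ac] by (simp only:)
 also have "... = \<zero>\<^bsub>T\<^esub>"
 proof (rule T.M.finsum_zero')
  fix x assume x: "x \<in> Ds"
  have gx: "g [x] \<in> carrier M" using gc by simp
  have "pure M (basis_act M (g [x]) x) = pure M (scalar (B x idd) \<odot>\<^bsub>M\<^esub> g [x])"
   unfolding basis_act_def using pure_smult[OF B_closed[OF x] gx] cls_tn[OF gx F_coeff[OF B_closed[OF x]]] by (simp only:)
  also have "scalar (B x idd) \<odot>\<^bsub>M\<^esub> g [x] = B x idd \<odot>\<^bsub>over_R M\<^esub> g [x]" by simp
  also have "... = \<zero>\<^bsub>over_R M\<^esub>"
  proof (cases "x = idd")
   case True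
   have "[idd] \<notin> bar_lists I (Suc 0)" by (simp add: bar_lists_def I_def)
   then have "g [x] = \<zero>\<^bsub>over_R M\<^esub>" using g True by (simp add: chains_def)
   then show ?thesis using RM.smult_r_null[OF F_coeff[OF B_closed[OF x]]] by (simp only:)
  next
   case False
   then have "B x idd = \<zero>" by (simp add: basis_elt_def)
   then show ?thesis using RM.smult_l_null[OF gc] by (simp only:)
  qed
  finally show "pure M (basis_act M (g [x]) x) = \<zero>\<^bsub>T\<^esub>" by (simp only: pure0)
 qed
 finally show ?thesis .
qed

lemma representative_relation: "u \<in> relations ==> representative u \<in> coinv_ker M"
proof -
 note ag = FR.M.abelian_group_axioms RM.M.abelian_group_axioms
 note rd = module_hom_diff[OF ag representative_hom] and ra = module_hom_add[OF representative_hom]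
  and rm = module_hom_smult[OF representative_hom]
 have zero: "p \<ominus>\<^bsub>over_R M\<^esub> p \<in> coinv_ker M" if "p \<in> carrier M" for p
  using RM.M.minus_eq_zero_iff[of p p] that kernel_zero by (simp only: restricted_simps simp_thms)
 assume "u \<in> relations"
 then show ?thesis
 proof (cases rule: relation_cases)
  case (1 p p' x)
  have "representative u = scalar x \<odot>\<^bsub>M\<^esub> (p \<oplus>\<^bsub>M\<^esub> p') \<ominus>\<^bsub>over_R M\<^esub> (scalar x \<odot>\<^bsub>M\<^esub> p \<oplus>\<^bsub>M\<^esub> scalar x \<odot>\<^bsub>M\<^esub> p')"
   using 1 by (simp only: rd ra tn_closed FR.M.add.m_closed M.M.add.m_closed representative_tn restricted_simps)
  also have "scalar x \<odot>\<^bsub>M\<^esub> p \<oplus>\<^bsub>M\<^esub> scalar x \<odot>\<^bsub>M\<^esub> p' = scalar x \<odot>\<^bsub>M\<^esub> (p \<oplus>\<^bsub>M\<^esub> p')"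
   using M.smult_r_distr[of "scalar x" p p'] 1 scalar_closed by (simp only: op_simps)
  finally show ?thesis using zero[OF smult_M[OF scalar_closed M.M.add.m_closed]] 1 by (simp only:)
 next
  case (2 p x x')
  have "representative u = scalar (x \<oplus> x') \<odot>\<^bsub>M\<^esub> p \<ominus>\<^bsub>over_R M\<^esub> (scalar x \<odot>\<^bsub>M\<^esub> p \<oplus>\<^bsub>M\<^esub> scalar x' \<odot>\<^bsub>M\<^esub> p)"
   using 2 by (simp only: rd ra tn_closed FR.M.add.m_closed R.add.m_closed representative_tn restricted_simps)
  also have "scalar x \<odot>\<^bsub>M\<^esub> p \<oplus>\<^bsub>M\<^esub> scalar x' \<odot>\<^bsub>M\<^esub> p = scalar (x \<oplus> x') \<odot>\<^bsub>M\<^esub> p"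
   unfolding scalar_add[OF 2(3,4)] by (rule M.smult_l_distr[symmetric]) (simp_all add: scalar_closed 2)
  finally show ?thesis using zero[OF smult_M[OF scalar_closed[OF R.add.m_closed[OF 2(3,4)]] 2(2)]] by (simp only:)
 next
  case (3 f p x)
  have fx: "f idd \<otimes> x \<in> carrier R" using 3 F_coeff by simp
  note h = smult_hom[OF M 3(3)]
  let ?g = "%z. x \<otimes> f z"
  have g: "?g \<in> carrier F" using F_smult_closed[OF 3(4,2)] by simp
  have "representative u = scalar x \<odot>\<^bsub>M\<^esub> (f \<odot>\<^bsub>M\<^esub> p) \<ominus>\<^bsub>over_R M\<^esub> scalar (f idd \<otimes> x) \<odot>\<^bsub>M\<^esub> p"
   using 3 fx smult_M by (simp only: rd tn_closed representative_tn)
  also have "scalar x \<odot>\<^bsub>M\<^esub> (f \<odot>\<^bsub>M\<^esub> p) = ?g \<odot>\<^bsub>M\<^esub> p"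
   using M.smult_assoc[of "scalar x" f p] 3 by (simp add: scalar_closed mult_scalar)
  also have "?g \<odot>\<^bsub>M\<^esub> p \<ominus>\<^bsub>over_R M\<^esub> scalar (f idd \<otimes> x) \<odot>\<^bsub>M\<^esub> p = (?g \<ominus>\<^bsub>F\<^esub> scalar (f idd \<otimes> x)) \<odot>\<^bsub>M\<^esub> p"
   using module_hom_diff[OF module_ab[OF F_module] RM.M.abelian_group_axioms h g scalar_closed[OF fx]] by (rule sym)
  also have "... \<in> coinv_ker M"
  proof (rule smult_in_kernel[OF _ _ 3(3)])
   interpret FM: module R F by (rule F_module)
   show "?g \<ominus>\<^bsub>F\<^esub> scalar (f idd \<otimes> x) \<in> carrier F" by (rule FM.M.minus_closed[OF g scalar_closed[OF fx]])
   have "(?g \<ominus>\<^bsub>F\<^esub> scalar (f idd \<otimes> x)) idd = ?g idd \<ominus> scalar (f idd \<otimes> x) idd"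
    using module_hom_diff[OF module_ab module_ab eval_free_module_hom, OF F_module V1 g scalar_closed[OF fx]] by simp
   then show "(?g \<ominus>\<^bsub>F\<^esub> scalar (f idd \<otimes> x)) idd = \<zero>"
    using fx 3 F_coeff[OF 3(2), of idd] by (simp add: scalar_idd R.m_comm R.minus_eq_zero_iff)
  qed
  finally show ?thesis .
 next
  case (4 r p x)
  have "representative u = scalar x \<odot>\<^bsub>M\<^esub> (scalar r \<odot>\<^bsub>M\<^esub> p) \<ominus>\<^bsub>over_R M\<^esub> scalar r \<odot>\<^bsub>M\<^esub> (scalar x \<odot>\<^bsub>M\<^esub> p)"
   using 4 by (simp only: rd rm tn_closed FR.smult_closed smult_M scalar_closed representative_tn restricted_simps)
  also have "scalar r \<odot>\<^bsub>M\<^esub> (scalar x \<odot>\<^bsub>M\<^esub> p) = scalar x \<odot>\<^bsub>M\<^esub> (scalar r \<odot>\<^bsub>M\<^esub> p)"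
   using RM.smult_assoc1[of r x p] RM.smult_assoc1[of x r p] 4 by (simp add: R.m_comm)
  finally show ?thesis using zero[OF smult_M[OF scalar_closed smult_M[OF scalar_closed]]] 4 by (simp only:)
 qed
qed

lemma pure_zero_iff: "p \<in> carrier M ==> pure M p = \<zero>\<^bsub>T\<^esub> \<longleftrightarrow> p \<in> coinv_ker M"
proof
 assume p: "p \<in> carrier M" and "pure M p = \<zero>\<^bsub>T\<^esub>"
 then have "cls (tn p \<one>) = cls \<zero>\<^bsub>FR\<^esub>" by (simp only: pure_eq T_simps)
 then have "tn p \<one> \<ominus>\<^bsub>FR\<^esub> \<zero>\<^bsub>FR\<^esub> \<in> TR"
  using FR.submodule_coset_eq_iff[OF TR_submodule tn_closed[OF p R.one_closed] FR.M.zero_closed] by blast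
 then have "tn p \<one> \<in> TR" using FR.M.minus_zero_right[OF tn_closed[OF p R.one_closed]] by (simp only:)
 moreover have "TR \<subseteq> {u \<in> carrier FR. representative u \<in> coinv_ker M}"
  unfolding TR_eq using representative_relation relations_closed
  by (intro submodule_generated_least submodule_preimage[OF FR.module_axioms RM.module_axioms representative_hom kernel_submodule]) auto
 ultimately have "representative (tn p \<one>) \<in> coinv_ker M" by blast
 then show "p \<in> coinv_ker M"
  using representative_tn[OF p R.one_closed] M.smult_one[of p] p by (simp add: scalar_one)
qed (rule pure_kernel)

lemma pure_eq_iff:
 assumes "p \<in> carrier M" "q \<in> carrier M"
 shows "pure M p = pure M q \<longleftrightarrow> p \<ominus>\<^bsub>over_R M\<^esub> q \<in> coinv_ker M"
proof -
 have pq: "p \<in> carrier (over_R M)" "q \<in> carrier (over_R M)" using assms by simp_all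
 have "pure M p = pure M q \<longleftrightarrow> pure M p \<ominus>\<^bsub>T\<^esub> pure M q = \<zero>\<^bsub>T\<^esub>"
  using T.M.minus_eq_zero_iff[OF module_hom_closed[OF pure_hom pq(1)] module_hom_closed[OF pure_hom pq(2)]] by (rule sym)
 also have "pure M p \<ominus>\<^bsub>T\<^esub> pure M q = pure M (p \<ominus>\<^bsub>over_R M\<^esub> q)"
  by (rule module_hom_diff[OF RM.M.abelian_group_axioms T.M.abelian_group_axioms pure_hom pq, symmetric])
 finally show ?thesis using pure_zero_iff RM.M.minus_closed[OF pq] by simp
qed

end

text \<open>On pure tensors the induced map is what it should be.\<close>

lemma tensor_map_pure:
 fixes M M' :: "(diagram => 'r, 'm) module"
 assumes M: "left_module op M" and M': "left_module op M'" and h: "h \<in> module_hom op M M'" and p: "p \<in> carrier M"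
 shows "tensor_map R A M' triv h (pure M p) = pure M' (h p)"
proof -
 let ?F = "free_module R (carrier M \<times> carrier R)" and ?F' = "free_module R (carrier M' \<times> carrier R)"
 let ?T = "tensor_relations R A M triv" and ?T' = "tensor_relations R A M' triv"
 let ?g = "%(p, x). basis_elt R (h p, x)"
 interpret F: module R ?F by (rule free_module_is_module) (rule R.is_cring)
 interpret F': module R ?F' by (rule free_module_is_module) (rule R.is_cring)
 interpret RM: module R "over_R M" by (rule restricted_module[OF M])
 interpret RM': module R "over_R M'" by (rule restricted_module[OF M'])
 note he = op_hom_equivariant[OF M M' h]
 note hh = equivariant_hom[OF he]
 have hc: "q \<in> carrier M ==> h q \<in> carrier M'" for q by (rule module_hom_closed[OF h])
 have gc: "?g s \<in> carrier ?F'" if "s \<in> carrier M \<times> carrier R" for s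
  using that hc tn_closed[OF M'] by auto
 have lin: "linear_extension R ?F' ?g \<in> module_hom R ?F ?F'"
  by (rule linear_extension_hom[OF F'.module_axioms gc])
 have rep: "representative M' (linear_extension R ?F' ?g u) = h (representative M u)" if u: "u \<in> carrier ?F" for u
 proof (rule free_module_hom_eqI[OF R.is_cring RM'.module_axioms _ _ _ u])
  show "(%u. representative M' (linear_extension R ?F' ?g u)) \<in> module_hom R ?F (over_R M')"
   by (rule module_hom_comp[OF lin representative_hom[OF M']])
  show "(%u. h (representative M u)) \<in> module_hom R ?F (over_R M')"
   by (rule module_hom_comp[OF representative_hom[OF M] hh])
  fix s assume s: "s \<in> carrier M \<times> carrier R"
  then obtain q x where qx: "s = (q, x)" "q \<in> carrier M" "x \<in> carrier R" by auto
  have "linear_extension R ?F' ?g (basis_elt R s) = basis_elt R (h q, x)"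
   by (subst linear_extension_basis[where S = "carrier M \<times> carrier R", OF F'.module_axioms s])
    (use gc qx in auto)
  then show "representative M' (linear_extension R ?F' ?g (basis_elt R s)) = h (representative M (basis_elt R s))"
   using representative_tn[OF M' hc[OF qx(2)] qx(3)] representative_tn[OF M qx(2,3)]
    module_hom_smult[OF h _ qx(2), of "scalar x"] scalar_closed[OF qx(3)] by (simp add: qx(1))
 qed
 have step: "?T' +>\<^bsub>?F'\<^esub> linear_extension R ?F' ?g u = pure M' (h p)" if u: "u \<in> pure M p" for u
 proof -
  interpret T: abelian_subgroup ?T ?F by (rule F.submodule_abelian_subgroup[OF TR_submodule[OF M]])
  have tp: "basis_elt R (p, \<one>) \<in> carrier ?F" by (rule tn_closed[OF M p R.one_closed])
  have uc: "u \<in> carrier ?F" using u T.a_elemrcos_carrier[OF tp] by (simp add: pure_eq[OF M])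
  have "pure M p = ?T +>\<^bsub>?F\<^esub> u" using T.a_repr_independence'[OF _ tp] u by (simp add: pure_eq[OF M])
  also have "... = pure M (representative M u)" by (rule cls_representative[OF M uc])
  finally have eq: "pure M (representative M u) = pure M p" by (rule sym)
  have rc: "representative M u \<in> carrier M" using module_hom_closed[OF representative_hom[OF M] uc] by simp
  have k: "representative M u \<ominus>\<^bsub>over_R M\<^esub> p \<in> coinv_ker M" using eq pure_eq_iff[OF M rc p] by blast
  have h_kernel: "h k \<in> coinv_ker M'" if kernel: "k \<in> coinv_ker M" for k
  proof -
   obtain g where g: "g \<in> chains (over_R M) (bar_lists I (Suc 0))" "k = bar (over_R M) (basis_act M) g []"
    using kernel unfolding coinv_ker_def product_with_def by blast
   have gc: "g xs \<in> carrier (over_R M)" for xs using g(1) by (simp add: chains_def)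
   have "h k = bar (over_R M') (basis_act M') (%xs. h (g xs)) []"
    unfolding g(2) by (rule bar_equivariant[OF rep_restricted[OF M] rep_restricted[OF M'] he gc])
   moreover have "(%xs. h (g xs)) \<in> chains (over_R M') (bar_lists I (Suc 0))"
    using g(1) module_hom_closed[OF hh gc] module_hom_zero[OF RM.M.abelian_group_axioms RM'.M.abelian_group_axioms hh]
    by (simp add: chains_def)
   ultimately show ?thesis unfolding coinv_ker_def product_with_def by blast
  qed
  from h_kernel[OF k] have "h (representative M u) \<ominus>\<^bsub>over_R M'\<^esub> h p \<in> coinv_ker M'"
   using module_hom_diff[OF RM.M.abelian_group_axioms RM'.M.abelian_group_axioms hh, of "representative M u" p] rc p by simp
  then have "pure M' (h (representative M u)) = pure M' (h p)" using pure_eq_iff[OF M' hc[OF rc] hc[OF p]] by blast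
  then show ?thesis
   using cls_representative[OF M' module_hom_closed[OF lin uc]] rep[OF uc] by (simp only:)
 qed
 have "basis_elt R (p, \<one>) \<in> pure M p"
 proof -
  interpret T: abelian_subgroup ?T ?F by (rule F.submodule_abelian_subgroup[OF TR_submodule[OF M]])
  show ?thesis unfolding pure_eq[OF M] by (rule T.a_rcos_self[OF tn_closed[OF M p R.one_closed]])
 qed
 then show ?thesis unfolding tensor_map_def Let_def triv_simps using step by blast
qed

end

section \<open>Tor of the trivial module\<close>

lemma (in abelian_group) add_diff_inverse:
 assumes "x \<in> carrier G" "y \<in> carrier G"
 shows "y \<oplus> (x \<ominus> y) = x" "(x \<oplus> y) \<ominus> x = y"
 using assms a_lcomm[of x y "\<ominus> x"] a_lcomm[of y x "\<ominus> y"] by (simp_all add: a_minus_def r_neg a_assoc)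

context temperley_lieb
begin

context
 fixes P :: "nat => (diagram => 'r, 'p) module" and d :: "nat => 'p => 'p" and e :: "'p => 'r"
 assumes res: "projective_resolution op triv P d e"
begin

lemma P_left: "left_module op (P i)"
 using res by (simp add: projective_resolution_def projective_module_def)

lemma d_hom: "d i \<in> module_hom op (P (Suc i)) (P i)"
 using res by (simp add: projective_resolution_def)

lemma d_equivariant: "equivariant (over_R (P (Suc i))) (basis_act (P (Suc i))) (over_R (P i)) (basis_act (P i)) (d i)"
 by (rule op_hom_equivariant[OF P_left P_left d_hom])

lemma e_hom: "e \<in> module_hom op (P 0) triv"
 using res by (simp add: projective_resolution_def)

lemma e_equivariant: "equivariant (over_R (P 0)) (basis_act (P 0)) V1 trivial_act e"
 unfolding equivariant_def
proof (intro conjI ballI)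
 show "e \<in> module_hom R (over_R (P 0)) V1"
  using module_hom_closed[OF e_hom] module_hom_add[OF e_hom] module_hom_smult[OF e_hom] scalar_closed
  by (intro module_homI) (simp_all add: scalar_idd)
 show "e (basis_act (P 0) p x) = trivial_act (e p) x" if "p \<in> carrier (over_R (P 0))" "x \<in> Ds" for p x
  using module_hom_smult[OF e_hom, of "B x" p] module_hom_closed[OF e_hom, of p] B_closed that
  by (simp add: basis_act_def trivial_act_def) (simp add: basis_elt_def)
qed

lemma e_onto: "e ` carrier (over_R (P 0)) = carrier V1"
 using res by (simp add: projective_resolution_def)

lemma exact_first: "d 0 ` carrier (over_R (P (Suc 0))) = {p \<in> carrier (over_R (P 0)). e p = \<zero>\<^bsub>V1\<^esub>}"
 using res by (simp add: projective_resolution_def)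

lemma exact_next: "d (Suc i) ` carrier (over_R (P (Suc (Suc i)))) =
  {p \<in> carrier (over_R (P (Suc i))). d i p = \<zero>\<^bsub>over_R (P i)\<^esub>}"
 using res unfolding projective_resolution_def restricted_simps by blast

lemma resolved_homology:
 "subquot_iso R (over_R (P (Suc i))) {z \<in> carrier (P (Suc i)). d i z \<in> coinv_ker (P i)}
  {u \<oplus>\<^bsub>P (Suc i)\<^esub> m | u m. u \<in> carrier (P (Suc i)) & d i u = \<zero>\<^bsub>P i\<^esub> & m \<in> coinv_ker (P (Suc i))}
  (funs V1) {f \<in> chains V1 (tensor_lists I I i). merge V1 f = \<zero>\<^bsub>funs V1\<^esub>}
   (merge V1 ` chains V1 (tensor_lists I I (Suc i)))"
proof -
 have proj: "projective_module op (P j)" for j using res by (simp add: projective_resolution_def)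
 note * = resolution_homology[where V = "%j. over_R (P j)" and act = "%j. basis_act (P j)" and b = d and i = i,
   OF rep_restricted[OF P_left] rep_trivial I_left_stable d_equivariant e_equivariant e_onto exact_first exact_next
    projective_bar_exact[OF proj]]
 show ?thesis
  using subquot_iso_trans[OF * trivial_bar_homology[of i]]
  unfolding restricted_simps coinv_ker_def by (simp only:)
qed

abbreviation tors :: "nat => ('r, ('p \<times> 'r => 'r) set) module" where "tors i \<equiv> tensor_module R A (P i) triv"
abbreviation dt :: "nat => ('p \<times> 'r => 'r) set => ('p \<times> 'r => 'r) set" where "dt i \<equiv> tensor_map R A (P i) triv (d i)"

lemma dt_pure: "p \<in> carrier (P (Suc i)) ==> dt i (pure (P (Suc i)) p) = pure (P i) (d i p)"
 by (rule tensor_map_pure[OF P_left P_left d_hom])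

lemma tors_pure: "X \<in> carrier (tors i) ==> \<exists>p\<in>carrier (P i). X = pure (P i) p"
 using pure_onto[OF P_left, of i] by blast

lemma d_closed: "p \<in> carrier (P (Suc i)) ==> d i p \<in> carrier (P i)"
 by (rule module_hom_closed[OF d_hom])

lemma d_d: "p \<in> carrier (P (Suc (Suc i))) ==> d i (d (Suc i) p) = \<zero>\<^bsub>P i\<^esub>"
 using exact_next[of i] by auto

lemma pure_0: "pure (P i) \<zero>\<^bsub>P i\<^esub> = \<zero>\<^bsub>tors i\<^esub>"
 using module_hom_zero[OF module_ab[OF restricted_module[OF P_left]] module_ab[OF T_module[OF P_left]] pure_hom[OF P_left]]
 by simp

lemma tors_complex: "chain_complex R tors dt"
proof (rule chain_complex.intro)
 show T: "module R (tors i)" for i by (rule T_module[OF P_left])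
 show "dt i \<in> module_hom R (tors (Suc i)) (tors i)" for i
 proof (rule module_homI)
  interpret RP: module R "over_R (P (Suc i))" by (rule restricted_module[OF P_left])
  note ph = pure_hom[OF P_left] and dh = equivariant_hom[OF d_equivariant]
  fix X assume "X \<in> carrier (tors (Suc i))"
  then obtain p where p: "p \<in> carrier (over_R (P (Suc i)))" "X = pure (P (Suc i)) p" using tors_pure by auto
  note dp = module_hom_closed[OF dh p(1)]
  have dt: "dt i (pure (P (Suc i)) u) = pure (P i) (d i u)" if "u \<in> carrier (over_R (P (Suc i)))" for u
   using dt_pure that by simp
  show "dt i X \<in> carrier (tors i)" unfolding p(2) dt[OF p(1)] by (rule module_hom_closed[OF ph dp])
  show "dt i (r \<odot>\<^bsub>tors (Suc i)\<^esub> X) = r \<odot>\<^bsub>tors i\<^esub> dt i X" if r: "r \<in> carrier R" for r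
   using module_hom_smult[OF ph r p(1)] module_hom_smult[OF dh r p(1)] module_hom_smult[OF ph r dp]
    dt[OF RP.smult_closed[OF r p(1)]] dt[OF p(1)] unfolding p(2) by metis
  show "dt i (X \<oplus>\<^bsub>tors (Suc i)\<^esub> Y) = dt i X \<oplus>\<^bsub>tors i\<^esub> dt i Y" if Y: "Y \<in> carrier (tors (Suc i))" for Y
  proof -
   obtain q where q: "q \<in> carrier (over_R (P (Suc i)))" "Y = pure (P (Suc i)) q" using tors_pure[OF Y] by auto
   note dq = module_hom_closed[OF dh q(1)]
   show ?thesis
    using module_hom_add[OF ph p(1) q(1)] module_hom_add[OF dh p(1) q(1)] module_hom_add[OF ph dp dq]
     dt[OF RP.M.add.m_closed[OF p(1) q(1)]] dt[OF p(1)] dt[OF q(1)] unfolding p(2) q(2) by metis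
  qed
 qed
 fix i X assume "X \<in> carrier (tors (Suc (Suc i)))"
 then obtain p where p: "p \<in> carrier (P (Suc (Suc i)))" "X = pure (P (Suc (Suc i))) p" using tors_pure by blast
 show "dt i (dt (Suc i) X) = \<zero>\<^bsub>tors i\<^esub>"
  unfolding p(2) dt_pure[OF p(1)] dt_pure[OF d_closed[OF p(1)]] d_d[OF p(1)] by (rule pure_0)
qed

lemma boundary_iff:
 assumes z: "z \<in> carrier (P i)"
 shows "pure (P i) z \<in> boundaries tors dt i \<longleftrightarrow>
  (\<exists>w\<in>carrier (P (Suc i)). z \<ominus>\<^bsub>over_R (P i)\<^esub> d i w \<in> coinv_ker (P i))"
proof -
 have "boundaries tors dt i = (%w. pure (P i) (d i w)) ` carrier (P (Suc i))"
  unfolding boundaries_def pure_onto[OF P_left, symmetric] image_image by (rule image_cong[OF refl dt_pure])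
 then show ?thesis using pure_eq_iff[OF P_left z d_closed] unfolding image_iff by blast
qed

lemma positive_tor:
 "subquot_iso R (over_R (P (Suc i))) {z \<in> carrier (P (Suc i)). d i z \<in> coinv_ker (P i)}
  {u \<oplus>\<^bsub>P (Suc i)\<^esub> m | u m. u \<in> carrier (P (Suc i)) & d i u = \<zero>\<^bsub>P i\<^esub> & m \<in> coinv_ker (P (Suc i))}
  (tors (Suc i)) (cycles tors dt (Suc i)) (boundaries tors dt (Suc i))"
proof (rule subquot_iso_map[where f = "pure (P (Suc i))"])
 interpret RP: module R "over_R (P (Suc i))" by (rule restricted_module[OF P_left])
 interpret RP': module R "over_R (P i)" by (rule restricted_module[OF P_left])
 note dh = equivariant_hom[OF d_equivariant[of i]] and ph = pure_hom[OF P_left, of "Suc i"]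
 let ?B = "{u \<oplus>\<^bsub>P (Suc i)\<^esub> m | u m. u \<in> carrier (P (Suc i)) & d i u = \<zero>\<^bsub>P i\<^esub> & m \<in> coinv_ker (P (Suc i))}" and ?P = "over_R (P (Suc i))"
 let ?Z = "{z \<in> carrier (P (Suc i)). d i z \<in> coinv_ker (P i)}"
 have sub: "submodule {z \<in> carrier (over_R (P (Suc i))). d i z \<in> coinv_ker (P i)} R (over_R (P (Suc i)))"
  by (rule submodule_preimage[OF RP.module_axioms RP'.module_axioms dh kernel_submodule[OF P_left]])
 note ZE = RP.submoduleE[OF sub, unfolded restricted_simps]
 show "pure (P (Suc i)) ` ?Z = cycles tors dt (Suc i)"
 proof -
  have "pure (P (Suc i)) z \<in> cycles tors dt (Suc i) \<longleftrightarrow> z \<in> ?Z" if z: "z \<in> carrier (P (Suc i))" for z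
   using dt_pure[OF z] pure_zero_iff[OF P_left d_closed[OF z]] z module_hom_closed[OF ph] by simp
  moreover have "cycles tors dt (Suc i) \<subseteq> pure (P (Suc i)) ` carrier (P (Suc i))"
   unfolding pure_onto[OF P_left] by auto
  ultimately show ?thesis by blast
 qed
 show "x \<oplus>\<^bsub>?P\<^esub> y \<in> ?Z & pure (P (Suc i)) (x \<oplus>\<^bsub>?P\<^esub> y) = pure (P (Suc i)) x \<oplus>\<^bsub>tors (Suc i)\<^esub> pure (P (Suc i)) y"
  if "x \<in> ?Z" "y \<in> ?Z" for x y
  using ZE(5)[OF that] module_hom_add[OF ph, of x y] that by simp
 show "r \<odot>\<^bsub>?P\<^esub> x \<in> ?Z & pure (P (Suc i)) (r \<odot>\<^bsub>?P\<^esub> x) = r \<odot>\<^bsub>tors (Suc i)\<^esub> pure (P (Suc i)) x"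
  if "r \<in> carrier R" "x \<in> ?Z" for r x
  using ZE(4)[OF that] module_hom_smult[OF ph that(1), of x] that by simp
 fix z assume "z \<in> ?Z"
 then have z: "z \<in> carrier (P (Suc i))" by simp
 note zr = z[folded restricted_simps(1)]
 show "z \<in> ?B \<longleftrightarrow>
  pure (P (Suc i)) z \<in> boundaries tors dt (Suc i)"
  unfolding boundary_iff[OF z]
 proof
  assume "z \<in> ?B"
  then obtain u m where um: "z = u \<oplus>\<^bsub>P (Suc i)\<^esub> m" "u \<in> carrier (P (Suc i))" "d i u = \<zero>\<^bsub>P i\<^esub>" "m \<in> coinv_ker (P (Suc i))" by blast
  have m: "m \<in> carrier (P (Suc i))" by (rule kernel_carrier[OF P_left um(4)])
  obtain w where w: "w \<in> carrier (P (Suc (Suc i)))" "u = d (Suc i) w" using exact_next[of i] um(2,3) by auto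
  have "z \<ominus>\<^bsub>?P\<^esub> u = m"
   using RP.M.add_diff_inverse(2)[of u m] um(2) m unfolding um(1) by simp
  then show "\<exists>w\<in>carrier (P (Suc (Suc i))). z \<ominus>\<^bsub>?P\<^esub> d (Suc i) w \<in> coinv_ker (P (Suc i))"
   using w um(4) by blast
 next
  assume "\<exists>w\<in>carrier (P (Suc (Suc i))). z \<ominus>\<^bsub>?P\<^esub> d (Suc i) w \<in> coinv_ker (P (Suc i))"
  then obtain w where w: "w \<in> carrier (P (Suc (Suc i)))" and k: "z \<ominus>\<^bsub>?P\<^esub> d (Suc i) w \<in> coinv_ker (P (Suc i))" by blast
  have dw: "d (Suc i) w \<in> carrier (over_R (P (Suc i)))" using d_closed[OF w] by simp
  have "z = d (Suc i) w \<oplus>\<^bsub>?P\<^esub> (z \<ominus>\<^bsub>?P\<^esub> d (Suc i) w)"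
   by (rule RP.M.add_diff_inverse(1)[OF zr dw, symmetric])
  then have "z = d (Suc i) w \<oplus>\<^bsub>P (Suc i)\<^esub> (z \<ominus>\<^bsub>?P\<^esub> d (Suc i) w)" by (simp only: restricted_simps)
  then show "z \<in> ?B"
   using k d_d[OF w] d_closed[OF w] by blast
 qed
qed

lemma tor_chains:
 "subquot_iso R (funs V1) {f \<in> chains V1 (tensor_lists I I i). merge V1 f = \<zero>\<^bsub>funs V1\<^esub>}
   (merge V1 ` chains V1 (tensor_lists I I (Suc i)))
  (tors (Suc i)) (cycles tors dt (Suc i)) (boundaries tors dt (Suc i))"
 by (rule subquot_iso_trans[OF subquot_iso_sym[OF resolved_homology] positive_tor])

lemma Tor_eq: "Tor R A P d triv i = homology tors dt i"
 by (simp add: Tor_def)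

theorem tor_zero: "module_isomorphic R (Tor R A P d triv 0) V1"
 unfolding Tor_eq
proof (rule homology_isomorphic_module[OF tors_complex V1])
 interpret RP: module R "over_R (P 0)" by (rule restricted_module[OF P_left])
 note eh = equivariant_hom[OF e_equivariant] and ph = pure_hom[OF P_left, of 0]
 have "subquot_iso R (over_R (P 0)) (carrier (over_R (P 0))) {p \<in> carrier (over_R (P 0)). e p = \<zero>\<^bsub>V1\<^esub>}
   V1 (carrier V1) {\<zero>\<^bsub>V1\<^esub>}"
  by (rule subquot_iso_map[where f = e])
   (use e_onto RP.M.add.m_closed RP.smult_closed module_hom_add[OF eh] module_hom_smult[OF eh] in \<open>simp_all del: restricted_simps\<close>)
 moreover have "subquot_iso R (over_R (P 0)) (carrier (over_R (P 0))) {p \<in> carrier (over_R (P 0)). e p = \<zero>\<^bsub>V1\<^esub>}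
   (tors 0) (cycles tors dt 0) (boundaries tors dt 0)"
 proof (rule subquot_iso_map[where f = "pure (P 0)"])
  show "pure (P 0) ` carrier (over_R (P 0)) = cycles tors dt 0" using pure_onto[OF P_left, of 0] by simp
  show "x \<oplus>\<^bsub>over_R (P 0)\<^esub> y \<in> carrier (over_R (P 0)) & pure (P 0) (x \<oplus>\<^bsub>over_R (P 0)\<^esub> y) = pure (P 0) x \<oplus>\<^bsub>tors 0\<^esub> pure (P 0) y"
   if "x \<in> carrier (over_R (P 0))" "y \<in> carrier (over_R (P 0))" for x y
   using RP.M.add.m_closed[OF that] module_hom_add[OF ph that] by blast
  show "r \<odot>\<^bsub>over_R (P 0)\<^esub> x \<in> carrier (over_R (P 0)) & pure (P 0) (r \<odot>\<^bsub>over_R (P 0)\<^esub> x) = r \<odot>\<^bsub>tors 0\<^esub> pure (P 0) x"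
   if "r \<in> carrier R" "x \<in> carrier (over_R (P 0))" for r x
   using RP.smult_closed[OF that] module_hom_smult[OF ph that] by blast
  fix z assume zr: "z \<in> carrier (over_R (P 0))"
  then have z: "z \<in> carrier (P 0)" by simp
  have e_kernel: "e k = \<zero>" if kernel: "k \<in> coinv_ker (P 0)" for k
  proof -
   obtain g where g: "g \<in> chains (over_R (P 0)) (bar_lists I (Suc 0))" "k = bar (over_R (P 0)) (basis_act (P 0)) g []"
    using kernel unfolding coinv_ker_def product_with_def by blast
   have gc: "g xs \<in> carrier (over_R (P 0))" for xs using g(1) by (simp add: chains_def)
   have ec: "e (g xs) \<in> carrier R" for xs using module_hom_closed[OF eh gc] by simp
   have "e k = bar V1 trivial_act (%xs. e (g xs)) []"
    unfolding g(2) by (rule bar_equivariant[OF rep_restricted[OF P_left] rep_trivial e_equivariant gc])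
   also have "... = (\<Oplus>x\<in>Ds. trivial_act (e (g [x])) x)"
    unfolding bar_def merge.simps using ec
    by (simp add: trivial_act_def R.minus_zero_right R.finsum_closed)
   also have "... = \<zero>"
   proof (rule R.finsum_zero')
    fix x assume "x \<in> Ds"
    have "[idd] \<notin> bar_lists I (Suc 0)" by (simp add: bar_lists_def I_def)
    then have "g [idd] = \<zero>\<^bsub>over_R (P 0)\<^esub>" using g(1) by (simp add: chains_def)
    then have "e (g [idd]) = \<zero>" using module_hom_zero[OF RP.M.abelian_group_axioms module_ab[OF V1] eh] by simp
    then show "trivial_act (e (g [x])) x = \<zero>" by (simp add: trivial_act_def)
   qed
   finally show ?thesis .
  qed
  have ed: "e (d 0 w) = \<zero>" if "w \<in> carrier (P (Suc 0))" for w using exact_first that by auto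
  show "z \<in> {p \<in> carrier (over_R (P 0)). e p = \<zero>\<^bsub>V1\<^esub>} \<longleftrightarrow> pure (P 0) z \<in> boundaries tors dt 0"
   unfolding boundary_iff[OF z]
  proof
   assume "z \<in> {p \<in> carrier (over_R (P 0)). e p = \<zero>\<^bsub>V1\<^esub>}"
   then obtain w where w: "w \<in> carrier (P (Suc 0))" "z = d 0 w" using exact_first by auto
   have "z \<ominus>\<^bsub>over_R (P 0)\<^esub> d 0 w = \<zero>\<^bsub>over_R (P 0)\<^esub>" using RP.M.minus_eq_zero_iff[OF zr zr] w(2) by simp
   moreover have "\<zero>\<^bsub>over_R (P 0)\<^esub> \<in> coinv_ker (P 0)"
    by (rule kernel_zero[OF P_left])
   ultimately show "\<exists>w\<in>carrier (P (Suc 0)). z \<ominus>\<^bsub>over_R (P 0)\<^esub> d 0 w \<in> coinv_ker (P 0)"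
    by (intro bexI[OF _ w(1)]) (simp only:)
  next
   assume "\<exists>w\<in>carrier (P (Suc 0)). z \<ominus>\<^bsub>over_R (P 0)\<^esub> d 0 w \<in> coinv_ker (P 0)"
   then obtain w where w: "w \<in> carrier (P (Suc 0))" "z \<ominus>\<^bsub>over_R (P 0)\<^esub> d 0 w \<in> coinv_ker (P 0)" by blast
   have dw: "d 0 w \<in> carrier (over_R (P 0))" using d_closed[OF w(1)] by simp
   have "e z \<ominus> e (d 0 w) = \<zero>"
    using e_kernel[OF w(2)] module_hom_diff[OF RP.M.abelian_group_axioms module_ab[OF V1] eh zr dw] by simp
   then have "e z = \<zero>" using ed[OF w(1)] module_hom_closed[OF eh zr] by (simp add: R.minus_zero_right)
   then show "z \<in> {p \<in> carrier (over_R (P 0)). e p = \<zero>\<^bsub>V1\<^esub>}" using zr by simp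
  qed
 qed
 ultimately show "subquot_iso R (tors 0) (cycles tors dt 0) (boundaries tors dt 0) V1 (carrier V1) {\<zero>\<^bsub>V1\<^esub>}"
  using subquot_iso_trans subquot_iso_sym by blast
qed

lemma tor_shift:
 "same_homology R (funs V1) (%q. chains V1 (tensor_lists I I q)) (merge V1) (q + (n - 1))
  (funs V1) (%q. chains V1 (tensor_lists I J q)) (merge V1) q"
 by (rule same_homology_trans[OF ideal_shift[OF I_left_stable] reflected_homology])

theorem tor_vanishes:
 assumes "i < 2 * n - 2"
 shows "carrier (Tor R A P d triv (Suc i)) = {\<zero>\<^bsub>Tor R A P d triv (Suc i)\<^esub>}"
proof -
 have "exact_at (funs V1) (%q. chains V1 (tensor_lists I I q)) (merge V1) i"
 proof (cases "i < n - 1")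
  case True
  then show ?thesis by (rule ideal_exact[OF I_left_stable])
 next
  case False
  then have i: "i = (i - (n - 1)) + (n - 1)" "i - (n - 1) < n - 1" using assms by simp_all
  show ?thesis
   using same_homology_exact[OF same_homology_sym[OF tor_shift[of "i - (n - 1)"]] ideal_exact[OF J_left_stable i(2)]] i(1) by simp
 qed
 then have "cycles tors dt (Suc i) \<subseteq> boundaries tors dt (Suc i)"
  unfolding exact_at_def by (rule subquot_iso_zero[OF tor_chains])
 then show ?thesis unfolding Tor_eq by (rule homology_trivial[OF tors_complex])
qed

theorem tor_planar_loops:
 "module_isomorphic R (Tor R A P d triv (Suc (q + (n - 1) + (n - 1)))) (planar_loops_homology R a N q)"
proof -
 have "same_homology R (funs V1) (%q. chains V1 (tensor_lists I I q)) (merge V1) (q + (n - 1) + (n - 1))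
  (funs V1) (%q. chains V1 (K q)) (merge V1) q"
  by (rule same_homology_trans[OF tor_shift ideal_shift[OF J_left_stable]])
 from subquot_iso_trans[OF this[unfolded same_homology_def] planar_homology]
 have "subquot_iso R (tors (Suc (q + (n - 1) + (n - 1))))
   (cycles tors dt (Suc (q + (n - 1) + (n - 1)))) (boundaries tors dt (Suc (q + (n - 1) + (n - 1))))
   (L q) (cycles L dL q) (boundaries L dL q)"
  by (rule subquot_iso_trans[OF subquot_iso_sym[OF tor_chains]])
 then show ?thesis
  unfolding Tor_eq planar_loops_homology_def by (rule homology_isomorphic[OF tors_complex planar_complex])
qed

end
end

theorem theorem1p3:
  fixes R :: "('r, 'x) ring_scheme" and a :: 'r and n :: nat
    and P :: "nat \<Rightarrow> (diagram \<Rightarrow> 'r, 'p) module" and d :: "nat \<Rightarrow> 'p \<Rightarrow> 'p" and e :: "'p \<Rightarrow> 'r"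
  assumes "cring R" and "a \<in> carrier R" and "n \<ge> 1"
    and "projective_resolution (opposite (TL_algebra R a (2 * n))) (trivial_module R (2 * n)) P d e"
  defines "T \<equiv> Tor R (TL_algebra R a (2 * n)) P d (trivial_module R (2 * n))"
  shows "module_isomorphic R (T 0) (regular_module R)
    \<and> (\<forall>i. 0 < i \<and> i < 2 * n - 1 \<longrightarrow> carrier (T i) = {\<zero>\<^bsub>T i\<^esub>})
    \<and> (\<forall>i \<ge> 2 * n - 1. module_isomorphic R (T i)
          (planar_loops_homology R a (2 * n) (i - (2 * n - 1))))"
proof -
 have "left_module (opposite (TL_algebra R a (2 * n))) (P 0)"
  using assms(4) by (simp add: projective_resolution_def projective_module_def)
 then have "ring (opposite (TL_algebra R a (2 * n)))" by (rule left_module.axioms)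
 then interpret temperley_lieb R a n
  using assms(1-3) by (intro temperley_lieb.intro temperley_lieb_axioms.intro)
 show ?thesis
  unfolding T_def
 proof (intro conjI allI impI)
  show "module_isomorphic R (Tor R A P d triv 0) V1" by (rule tor_zero[OF assms(4)])
  fix i
  show "carrier (Tor R A P d triv i) = {\<zero>\<^bsub>Tor R A P d triv i\<^esub>}" if "0 < i & i < 2 * n - 1"
  proof -
   have "i - 1 < 2 * n - 2" "Suc (i - 1) = i" using that by linarith+
   then show ?thesis using tor_vanishes[OF assms(4), of "i - 1"] by simp
  qed
  show "module_isomorphic R (Tor R A P d triv i) (planar_loops_homology R a N (i - (2 * n - 1)))" if "2 * n - 1 \<le> i"
  proof -
   have "Suc (i - (2 * n - 1) + (n - 1) + (n - 1)) = i" using that assms(3) by simp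
   then show ?thesis using tor_planar_loops[OF assms(4), of "i - (2 * n - 1)"] by simp
  qed
 qed
qed

end
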